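(* Let $k_0,k\in\mathcal{S}(\mathbb{R}^n)$, let $S\ge-1$ be an integer and $\varepsilon>0$, and suppose that $$|\mathcal{F}k_0(\xi)|>0\ \text{ for } |\xi|<2\varepsilon,\qquad |\mathcal{F}k(\xi)|>0\ \text{ for } \tfrac{\varepsilon}{2}<|\xi|<2\varepsilon,$$ $$\int_{\mathbb{R}^n}x^{\beta}k(x)\,dx=0\ \text{ for every multi-index } \beta \text{ with } |\beta|\le S.$$ Let $\alpha\in C^{\log}_{\mathrm{loc}}(\mathbb{R}^n)$ and $p\in\mathcal{P}^{\log}(\mathbb{R}^n)$, let $q\in\mathcal{P}(\mathbb{R})$ be log-Hölder continuous at the origin, let $a>\frac{n}{p^-}$ and $\alpha^+<S+1$, where $p^-:=\operatorname{ess\,inf}_{\mathbb{R}^n}p$ and $\alpha^+:=\operatorname{ess\,sup}_{\mathbb{R}^n}\alpha$. Then $$\|f\|'_{\boldsymbol{B}^{\alpha(\cdot)}_{p(\cdot),q(\cdot)}}:=\|k_0^{*,a}f\|_{p(\cdot)}+\Big\|\,\|k_t^{*,a}t^{-\alpha(\cdot)}f\|_{p(\cdot)}\Big\|_{L^{q(\cdot)}((0,1],\frac{dt}{t})}$$ and $$\|f\|''_{\boldsymbol{B}^{\alpha(\cdot)}_{p(\cdot),q(\cdot)}}:=\|k_0*f\|_{p(\cdot)}+\Big\|\,\|t^{-\alpha(\cdot)}(k_t*f)\|_{p(\cdot)}\Big\|_{L^{q(\cdot)}((0,1],\frac{dt}{t})}$$ are equivalent norms on $\boldsymbol{B}^{\alpha(\cdot)}_{p(\cdot),q(\cdot)}$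 (i.e. each is bounded above and below by positive constant multiples of $\|f\|_{\boldsymbol{B}^{\alpha(\cdot)}_{p(\cdot),q(\cdot)}}$, with constants independent of $f\in\boldsymbol{B}^{\alpha(\cdot)}_{p(\cdot),q(\cdot)}$).
   Context: Exponents. $\mathcal{P}(\mathbb{R}^d)$ is the set of measurable functions $\mathbb{R}^d\to[1,\infty)$. For $p\in\mathcal{P}(\mathbb{R}^n)$, $\|f\|_{p(\cdot)}:=\inf\{\lambda>0:\int_{\mathbb{R}^n}|f(x)/\lambda|^{p(x)}dx\le1\}$. For $q\in\mathcal{P}(\mathbb{R})$ and measurable $g$ on an interval $I\subset(0,1]$, $\|g(t)\|_{L^{q(\cdot)}(I,dt/t)}:=\inf\{\lambda>0:\int_I|g(t)/\lambda|^{q(t)}\frac{dt}{t}\le1\}$. Log-Hölder conditions. $g\in C^{\log}_{\mathrm{loc}}(\mathbb{R}^n)$ means $g:\mathbb{R}^n\to\mathbb{R}$ and there is $c_{\log}(g)>0$ with $|g(x)-g(y)|\le\frac{c_{\log}(g)}{\log(e+1/|x-y|)}$ for all $x,y\in\mathbb{R}^n$. $g$ is log-Hölder continuous at the origin if there is $c>0$ with $|g(x)-g(0)|\le\frac{c}{\log(e+1/|x|)}$ for all $x$. $g\in C^{\log}(\mathbb{R}^n)$ if $g\in C^{\log}_{\mathrm{loc}}(\mathbb{R}^n)$ and there are $g_\infty\in\mathbb{R}$, $c>0$ with $|g(x)-g_\infty|\le\frac{c}{\log(e+|x|)}$ for all $x$. $\mathcal{P}^{\log}(\mathbb{R}^n):=\{p\in\mathcal{P}(\mathbb{R}^n):1/p\in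 C^{\log}(\mathbb{R}^n)\}$. Resolution of unity. $\mathcal{F}$ is the Fourier transform, normalised so that $\mathcal{F}(f*g)=\mathcal{F}f\,\mathcal{F}g$. A pair $\{\mathcal{F}\Phi,\mathcal{F}\varphi\}$ with $\Phi,\varphi\in\mathcal{S}(\mathbb{R}^n)$ is a resolution of unity if $\operatorname{supp}\mathcal{F}\Phi\subset\{|x|<2\}$, $\operatorname{supp}\mathcal{F}\varphi\subset\{\frac12<|x|<2\}$ and $\mathcal{F}\Phi(\xi)+\int_0^1\mathcal{F}\varphi(t\xi)\frac{dt}{t}=1$ for all $\xi\in\mathbb{R}^n$. Put $\varphi_t:=t^{-n}\varphi(\cdot/t)$. Besov space. Fix a resolution of unity $\{\mathcal{F}\Phi,\mathcal{F}\varphi\}$. $\boldsymbol{B}^{\alpha(\cdot)}_{p(\cdot),q(\cdot)}$ is the set of $f\in\mathcal{S}'(\mathbb{R}^n)$ with $$\|f\|_{\boldsymbol{B}^{\alpha(\cdot)}_{p(\cdot),q(\cdot)}}:=\|\Phi*f\|_{p(\cdot)}+\Big\|\,\|t^{-\alpha(\cdot)}(\varphi_t*f)\|_{p(\cdot)}\Big\|_{L^{q(\cdot)}((0,1],\frac{dt}{t})}<\infty.$$ Local means and maximal functions. $k_t(x):=t^{-n}k(t^{-1}x)$ for $t>0$, and for $a>0$, $f\in\mathcal{S}'(\mathbb{R}^n)$, $x\in\mathbb{R}^n$: $$k_t^{*,a}t^{-\alpha(\cdot)}f(x):=\sup_{y\in\mathbb{R}^n}\frac{t^{-\alpha(y)}|k_t*f(y)|}{(1+t^{-1}|x-y|)^a},\qquad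 k_0^{*,a}f(x):=\sup_{y\in\mathbb{R}^n}\frac{|k_0*f(y)|}{(1+|x-y|)^a}.$$ *)

theory Defs
  imports "HOL-Analysis.Analysis" "HOL-Probability.Essential_Supremum"
begin

definition partial_deriv :: "'n::finite \<Rightarrow> (real^'n \<Rightarrow> complex) \<Rightarrow> real^'n \<Rightarrow> complex" where
  "partial_deriv i f x = frechet_derivative f (at x) (axis i 1)"

text \<open>The list enumerates the coordinate directions of an iterated partial derivative,
  so its length is the order.\<close>

primrec partial_derivs :: "'n::finite list \<Rightarrow> (real^'n \<Rightarrow> complex) \<Rightarrow> real^'n \<Rightarrow> complex" where
  "partial_derivs [] f = f"
| "partial_derivs (i # is) f = partial_deriv i (partial_derivs is f)"

text \<open>Differentiability of every iterated partial derivative makes them all continuous,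
  so it amounts to smoothness.\<close>

definition schwartz :: "(real^'n::finite \<Rightarrow> complex) set" where
  "schwartz = {f. \<forall>is. partial_derivs is f differentiable_on UNIV \<and>
     (\<forall>N::nat. bounded (range (\<lambda>x. (1 + norm x) ^ N *\<^sub>R partial_derivs is f x)))}"

definition schwartz_seminorm :: "nat \<Rightarrow> (real^'n::finite \<Rightarrow> complex) \<Rightarrow> real" where
  "schwartz_seminorm N f =
     (SUP (is, x) \<in> {is. length is \<le> N} \<times> UNIV. (1 + norm x) ^ N * norm (partial_derivs is f x))"

text \<open>The seminorms increase with \<open>N\<close>, so continuity of a linear functional means domination
  by a multiple of a single one. Extensionality makes equality of distributions agree with
  equality on Schwartz functions.\<close>

definition tempered :: "((real^'n::finite \<Rightarrow> complex) \<Rightarrow> complex) set" where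
  "tempered = {f \<in> extensional schwartz.
     (\<forall>u\<in>schwartz. \<forall>v\<in>schwartz. f (\<lambda>x. u x + v x) = f u + f v) \<and>
     (\<forall>c. \<forall>u\<in>schwartz. f (\<lambda>x. c * u x) = c * f u) \<and>
     (\<exists>N C. \<forall>u\<in>schwartz. norm (f u) \<le> C * schwartz_seminorm N u)}"

text \<open>The convolution \<open>g * f\<close> of a Schwartz function with a tempered distribution.\<close>

definition conv :: "(real^'n::finite \<Rightarrow> complex) \<Rightarrow> ((real^'n \<Rightarrow> complex) \<Rightarrow> complex)
    \<Rightarrow> real^'n \<Rightarrow> complex" where
  "conv g f x = f (\<lambda>y. g (x - y))"

definition fourier :: "(real^'n::finite \<Rightarrow> complex) \<Rightarrow> real^'n \<Rightarrow> complex" where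
  "fourier g \<xi> = (LINT x|lborel. exp (- \<i> * complex_of_real (x \<bullet> \<xi>)) * g x)"

definition dilate :: "real \<Rightarrow> (real^'n::finite \<Rightarrow> complex) \<Rightarrow> real^'n \<Rightarrow> complex" where
  "dilate t g x = (1 / t ^ CARD('n)) *\<^sub>R g (x /\<^sub>R t)"

definition moment :: "('n::finite \<Rightarrow> nat) \<Rightarrow> (real^'n \<Rightarrow> complex) \<Rightarrow> complex" where
  "moment \<beta> g = (LINT x|lborel. (\<Prod>i\<in>UNIV. (x $ i) ^ \<beta> i) *\<^sub>R g x)"

definition resolution_of_unity ::
    "(real^'n::finite \<Rightarrow> complex) \<Rightarrow> (real^'n \<Rightarrow> complex) \<Rightarrow> bool" where
  "resolution_of_unity \<Phi> \<phi> \<longleftrightarrow>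
     \<Phi> \<in> schwartz \<and> \<phi> \<in> schwartz \<and>
     closure {\<xi>. fourier \<Phi> \<xi> \<noteq> 0} \<subseteq> {\<xi>. norm \<xi> < 2} \<and>
     closure {\<xi>. fourier \<phi> \<xi> \<noteq> 0} \<subseteq> {\<xi>. 1/2 < norm \<xi> \<and> norm \<xi> < 2} \<and>
     (\<forall>\<xi>. fourier \<Phi> \<xi> + (LINT t:{0<..1}|lborel. (1 / t) *\<^sub>R fourier \<phi> (t *\<^sub>R \<xi>)) = 1)"

definition exponents :: "('a::euclidean_space \<Rightarrow> real) set" where
  "exponents = {p \<in> borel_measurable lebesgue. \<forall>x. 1 \<le> p x}"

definition log_holder_loc :: "('a::real_normed_vector \<Rightarrow> real) \<Rightarrow> bool" where
  "log_holder_loc g \<longleftrightarrow> (\<exists>c>0. \<forall>x y. \<bar>g x - g y\<bar> \<le> c / ln (exp 1 + 1 / norm (x - y)))"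

definition log_holder_origin :: "('a::real_normed_vector \<Rightarrow> real) \<Rightarrow> bool" where
  "log_holder_origin g \<longleftrightarrow> (\<exists>c>0. \<forall>x. \<bar>g x - g 0\<bar> \<le> c / ln (exp 1 + 1 / norm x))"

definition log_holder :: "('a::real_normed_vector \<Rightarrow> real) \<Rightarrow> bool" where
  "log_holder g \<longleftrightarrow> log_holder_loc g \<and>
     (\<exists>g_inf. \<exists>c>0. \<forall>x. \<bar>g x - g_inf\<bar> \<le> c / ln (exp 1 + norm x))"

definition log_exponents :: "('a::euclidean_space \<Rightarrow> real) set" where
  "log_exponents = {p \<in> exponents. log_holder (\<lambda>x. 1 / p x)}"

definition ess_sup :: "('a::euclidean_space \<Rightarrow> real) \<Rightarrow> ereal" where
  "ess_sup g = esssup lebesgue (\<lambda>x. ereal (g x))"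

definition ess_inf :: "('a::euclidean_space \<Rightarrow> real) \<Rightarrow> ereal" where
  "ess_inf g = - esssup lebesgue (\<lambda>x. - ereal (g x))"

text \<open>The functions to be measured take values in \<^typ>\<open>ennreal\<close>, because the maximal functions and
  the inner norms below may be infinite. Only exponents \<open>r \<ge> 1\<close> matter.\<close>

definition epowr :: "ennreal \<Rightarrow> real \<Rightarrow> ennreal" where
  "epowr u r = (if u = \<infinity> then \<infinity> else ennreal (enn2real u powr r))"

definition lux_norm :: "('a::euclidean_space \<Rightarrow> real) \<Rightarrow> ('a \<Rightarrow> ennreal) \<Rightarrow> ennreal" where
  "lux_norm p g = Inf {ennreal \<mu> | \<mu>. 0 < \<mu> \<and>
     (\<integral>\<^sup>+x. epowr (g x / ennreal \<mu>) (p x) \<partial>lebesgue) \<le> 1}"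

definition lux_norm_dt :: "(real \<Rightarrow> real) \<Rightarrow> real set \<Rightarrow> (real \<Rightarrow> ennreal) \<Rightarrow> ennreal" where
  "lux_norm_dt q I g = Inf {ennreal \<mu> | \<mu>. 0 < \<mu> \<and>
     (\<integral>\<^sup>+t\<in>I. epowr (g t / ennreal \<mu>) (q t) * ennreal (1 / t) \<partial>lebesgue) \<le> 1}"

definition local_means_norm ::
    "(real^'n::finite \<Rightarrow> complex) \<Rightarrow> (real^'n \<Rightarrow> complex) \<Rightarrow> (real^'n \<Rightarrow> real) \<Rightarrow> (real^'n \<Rightarrow> real)
      \<Rightarrow> (real \<Rightarrow> real) \<Rightarrow> ((real^'n \<Rightarrow> complex) \<Rightarrow> complex) \<Rightarrow> ennreal" where
  "local_means_norm k0 k \<alpha> p q f =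
     lux_norm p (\<lambda>x. ennreal (norm (conv k0 f x))) +
     lux_norm_dt q {0<..1}
       (\<lambda>t. lux_norm p (\<lambda>x. ennreal (t powr (- \<alpha> x) * norm (conv (dilate t k) f x))))"

text \<open>The pair \<open>\<Phi>, \<phi>\<close> is meant to be a resolution of unity.\<close>

definition besov_norm ::
    "(real^'n::finite \<Rightarrow> complex) \<Rightarrow> (real^'n \<Rightarrow> complex) \<Rightarrow> (real^'n \<Rightarrow> real) \<Rightarrow> (real^'n \<Rightarrow> real)
      \<Rightarrow> (real \<Rightarrow> real) \<Rightarrow> ((real^'n \<Rightarrow> complex) \<Rightarrow> complex) \<Rightarrow> ennreal" where
  "besov_norm \<Phi> \<phi> \<alpha> p q f = local_means_norm \<Phi> \<phi> \<alpha> p q f"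

definition besov ::
    "(real^'n::finite \<Rightarrow> complex) \<Rightarrow> (real^'n \<Rightarrow> complex) \<Rightarrow> (real^'n \<Rightarrow> real) \<Rightarrow> (real^'n \<Rightarrow> real)
      \<Rightarrow> (real \<Rightarrow> real) \<Rightarrow> ((real^'n \<Rightarrow> complex) \<Rightarrow> complex) set" where
  "besov \<Phi> \<phi> \<alpha> p q = {f \<in> tempered. besov_norm \<Phi> \<phi> \<alpha> p q f < \<infinity>}"

definition maximal ::
    "(real^'n::finite \<Rightarrow> complex) \<Rightarrow> real \<Rightarrow> real \<Rightarrow> (real^'n \<Rightarrow> real)
      \<Rightarrow> ((real^'n \<Rightarrow> complex) \<Rightarrow> complex) \<Rightarrow> real^'n \<Rightarrow> ennreal" where
  "maximal k a t \<alpha> f x =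
     (SUP y. ennreal (t powr (- \<alpha> y) * norm (conv (dilate t k) f y) / (1 + norm (x - y) / t) powr a))"

definition maximal0 ::
    "(real^'n::finite \<Rightarrow> complex) \<Rightarrow> real \<Rightarrow> ((real^'n \<Rightarrow> complex) \<Rightarrow> complex) \<Rightarrow> real^'n \<Rightarrow> ennreal" where
  "maximal0 k0 a f x = (SUP y. ennreal (norm (conv k0 f y) / (1 + norm (x - y)) powr a))"

definition maximal_norm ::
    "(real^'n::finite \<Rightarrow> complex) \<Rightarrow> (real^'n \<Rightarrow> complex) \<Rightarrow> real \<Rightarrow> (real^'n \<Rightarrow> real) \<Rightarrow> (real^'n \<Rightarrow> real)
      \<Rightarrow> (real \<Rightarrow> real) \<Rightarrow> ((real^'n \<Rightarrow> complex) \<Rightarrow> complex) \<Rightarrow> ennreal" where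
  "maximal_norm k0 k a \<alpha> p q f =
     lux_norm p (maximal0 k0 a f) + lux_norm_dt q {0<..1} (\<lambda>t. lux_norm p (maximal k a t \<alpha> f))"

definition equivalent_on :: "'f set \<Rightarrow> ('f \<Rightarrow> ennreal) \<Rightarrow> ('f \<Rightarrow> ennreal) \<Rightarrow> bool" where
  "equivalent_on B N1 N2 \<longleftrightarrow> (\<exists>c C :: real. 0 < c \<and> 0 < C \<and>
     (\<forall>f\<in>B. ennreal c * N2 f \<le> N1 f \<and> N1 f \<le> ennreal C * N2 f))"

end

theory Submission
  imports Defs "HOL-Probability.Probability" "HOL-Real_Asymp.Real_Asymp"
begin

text \<open>Let \<open>(h\<^sub>0, h)\<close> be one of the pairs \<open>(\<Phi>, \<phi>)\<close>, \<open>(k0, k)\<close>. Dividing on the Fourier side gives Schwartz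
  functions \<open>L\<^sub>0, L\<close>, with \<open>\<F> L\<close> vanishing near the origin, such that every tempered \<open>f\<close> equals
  \<open>L\<^sub>0 * h\<^sub>0 * f + \<integral>\<^sub>0\<^sup>1 L\<^sub>s * h\<^sub>s * f ds / s\<close>. Convolve this with \<open>u\<^sub>t\<close>, where \<open>(u\<^sub>0, u)\<close> is the other pair.
  Since \<open>u\<close> has vanishing moments of order less than \<open>S + 1\<close> and \<open>L\<close> of all orders, the kernel
  \<open>t\<^bsup>-\<alpha>\<^esup> u\<^sub>t * L\<^sub>s\<close> is bounded by \<open>s\<^bsup>-\<alpha>\<^esup> min (s / t) (t / s)\<^sup>\<delta>\<close> times a bump of width \<open>max s t\<close>; moving the
  weight from \<open>y\<close> to \<open>z\<close> costs a power of \<open>1 + |y - z| / max s t\<close> by log-Hoelder continuity of \<open>\<alpha>\<close>.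
  With \<open>r = p\<^sup>-\<close> and \<open>a r > n\<close>, Jensen's inequality bounds the Peetre maximal function by averages
  \<open>(\<eta> * |h\<^sub>s * f|\<^sup>r)\<^bsup>1/r\<^esup>\<close>, which are bounded on \<open>L\<^bsup>p(\<cdot>)\<^esup>\<close>, and a Hardy inequality in \<open>L\<^bsup>q(\<cdot>)\<^esup>(dt / t)\<close>
  handles the integral over \<open>s\<close>. So the maximal norm of either pair is bounded by the norm of the
  local means of the other.\<close>

text \<open>The exponent \<open>p\<close> may be unbounded, so a modular cannot be rescaled with a
  uniform factor \<open>c powr p\<close>. The operator estimates are therefore proved for functions
  of modular at most 1 and transferred by homogeneity. With \<open>r = p\<^sup>-\<close> the
  exponent \<open>p / r\<close> has infimum 1, where the Hardy-Littlewood maximal operator is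
  unbounded; averages over balls of one fixed radius remain bounded there, uniformly in the radius,
  and so the range \<open>a > n / p\<^sup>-\<close> is reached without loss. As \<open>r\<close> is
  at least 1, Jensen's inequality takes the place of the sub-mean-value arguments typical of
  exponents below 1. To apply a distribution to the reproducing formula is to apply it to an
  integral of Schwartz functions; finite Riemann sums, accurate in one seminorm, achieve this
  without integration in a Frechet space. In the variable \<open>- ln t\<close> the Hardy inequality
  is an averaging on a half-line with the origin moved to infinity, so it and the ball averages are
  instances of one modular estimate. The bound of one pair by the other holds for every tempered
  \<open>f\<close>, with values in \<open>[0, \<infinity>]\<close>, and using it in both directions
  gives all four inequalities.\<close>

section \<open>Luxemburg norms\<close>

lemma ennreal_inverse_antimono: "a \<le> b \<Longrightarrow> inverse b \<le> inverse (a::ennreal)"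
  by (cases a; cases b; cases "a = 0") (auto simp: inverse_ennreal top_unique le_imp_inverse_le intro!: ennreal_leI)

lemma ennreal_divide_mult:
  assumes "0 < a" "0 < b"
  shows "c / ennreal (a * b) = c / ennreal a / ennreal b"
  using assms by (simp add: divide_ennreal_def inverse_ennreal ennreal_mult'[symmetric] mult.assoc)

lemma epowr_mono: "u \<le> v \<Longrightarrow> 0 \<le> r \<Longrightarrow> epowr u r \<le> epowr v r"
  by (auto simp: epowr_def top_unique intro!: ennreal_leI powr_mono2 enn2real_mono simp: less_top)

lemma epowr_ennreal: "0 \<le> x \<Longrightarrow> epowr (ennreal x) r = ennreal (x powr r)"
  by (simp add: epowr_def)

lemma epowr_top [simp]: "epowr top r = top"
  by (simp add: epowr_def)

lemma epowr_0 [simp]: "epowr 0 r = 0"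
  by (simp add: epowr_def)

lemma epowr_1 [simp]: "epowr u 1 = u"
  by (cases u) (auto simp: epowr_ennreal)

lemma epowr_mult: "0 < r \<Longrightarrow> epowr (u * v) r = epowr u r * epowr v r"
proof (cases u; cases v)
  fix x y assume "0 < r" "u = ennreal x" "v = ennreal y" "0 \<le> x" "0 \<le> y"
  then show ?thesis by (simp add: epowr_ennreal ennreal_mult[symmetric] powr_mult)
next
  fix x assume "0 < r" "u = ennreal x" "0 \<le> x" "v = top"
  then show ?thesis by (cases "x = 0") (auto simp: epowr_ennreal ennreal_mult_top)
next
  fix x assume "0 < r" "v = ennreal x" "0 \<le> x" "u = top"
  then show ?thesis by (cases "x = 0") (auto simp: epowr_ennreal ennreal_top_mult)
qed auto

lemma epowr_epowr: "epowr (epowr u a) b = epowr u (a * b)"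
  by (cases u) (auto simp: epowr_ennreal powr_powr)

lemma epowr_antimono_exp:
  assumes "u \<le> 1" "a \<le> b" shows "epowr u b \<le> epowr u a"
proof (cases u)
  case (real x)
  then show ?thesis using assms by (auto simp: epowr_ennreal intro!: ennreal_leI powr_mono')
qed (use assms in auto)

lemma epowr_mono_exp:
  assumes "1 \<le> u" "a \<le> b" shows "epowr u a \<le> epowr u b"
proof (cases u)
  case (real x)
  then show ?thesis using assms by (auto simp: epowr_ennreal intro!: ennreal_leI powr_mono)
qed auto

lemma epowr_le_iff: "0 < r \<Longrightarrow> epowr u r \<le> epowr v r \<longleftrightarrow> u \<le> v"
  using epowr_mono[of u v r] epowr_mono[of "epowr u r" "epowr v r" "1 / r"]
  by (auto simp: epowr_epowr)

lemma borel_measurable_epowr [measurable]: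
  assumes [measurable]: "f \<in> borel_measurable M" "p \<in> borel_measurable M"
  shows "(\<lambda>x. epowr (f x) (p x)) \<in> borel_measurable M"
  unfolding epowr_def by measurable

text \<open>Convexity: \<open>u powr r\<close> lies above its tangent at \<open>x\<close>. In this
  arrangement all terms are nonnegative, so the inequality carries over to extended nonnegative
  reals. It is a case of Young's inequality.\<close>

lemma powr_tangent:
  fixes u x r :: real
  assumes "0 \<le> u" "0 \<le> x" "1 \<le> r"
  shows "r * x powr (r - 1) * u \<le> u powr r + (r - 1) * x powr r"
proof (cases "r = 1")
  case False
  then have r: "1 < r" using assms by simp
  have "u * x powr (r - 1) \<le> u powr r / r + (x powr (r - 1)) powr (r / (r - 1)) / (r / (r - 1))"
    by (rule Youngs_inequality) (use r assms in \<open>auto simp: field_simps\<close>)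
  then have "r * (u * x powr (r - 1)) \<le> r * (u powr r / r + (x powr (r - 1)) powr (r / (r - 1)) / (r / (r - 1)))"
    using r by (intro mult_left_mono) auto
  also have "\<dots> = u powr r + (r - 1) * x powr r"
    using r by (simp add: powr_powr) (simp add: field_simps)
  finally show ?thesis by (simp add: mult_ac)
qed (use assms in auto)

text \<open>Integrate the tangent inequality taken at the mean \<open>?v\<close> itself. A kernel of
  mass below 1 is admissible because the term \<open>(r - 1) * x powr r\<close> enters with a factor
  at most 1.\<close>

lemma epowr_Jensen:
  assumes [measurable]: "K \<in> borel_measurable M" "g \<in> borel_measurable M"
    and K: "(\<integral>\<^sup>+y. K y \<partial>M) \<le> 1" and r: "1 \<le> r"
  shows "epowr (\<integral>\<^sup>+y. K y * g y \<partial>M) r \<le> (\<integral>\<^sup>+y. K y * epowr (g y) r \<partial>M)" (is "epowr ?v r \<le> ?A")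
proof (cases "?A = top")
  case False
  \<comment> \<open>This makes the mean finite, so that a real tangent point exists and the
    subtraction at the end is legitimate.\<close>
  have g: "g y \<le> 1 + epowr (g y) r" for y
  proof (cases "g y \<le> 1")
    case False
    then have "epowr (g y) 1 \<le> epowr (g y) r" using r by (intro epowr_mono_exp) auto
    then show ?thesis by (simp add: add_increasing)
  qed (auto intro: add_increasing2)
  have "?v \<le> (\<integral>\<^sup>+y. K y + K y * epowr (g y) r \<partial>M)"
    using g by (intro nn_integral_mono) (metis distrib_left mult.right_neutral mult_left_mono zero_le)
  also have "\<dots> \<le> 1 + ?A" using K by (subst nn_integral_add) (auto intro: add_right_mono)
  finally have "?v < top" using False by (metis ennreal_add_eq_top ennreal_one_neq_top infinity_ennreal_def neq_top_trans order.not_eq_order_implies_strict top.not_eq_extremum)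
  then obtain x where x: "?v = ennreal x" "0 \<le> x" by (metis less_top_ennreal)
  have tan: "ennreal (r * x powr (r - 1)) * u \<le> epowr u r + ennreal ((r - 1) * x powr r)" for u
  proof (cases u)
    case (real z)
    then show ?thesis using powr_tangent[of z x r] r x
      by (simp add: epowr_ennreal ennreal_mult[symmetric] ennreal_plus[symmetric] del: ennreal_plus)
  qed simp
  have "ennreal (r * x powr r) = ennreal (r * x powr (r - 1)) * ?v"
    using x r by (cases "x = 0") (auto simp: ennreal_mult[symmetric] powr_diff)
  also have "\<dots> = (\<integral>\<^sup>+y. K y * (ennreal (r * x powr (r - 1)) * g y) \<partial>M)"
    by (subst nn_integral_cmult[symmetric]) (auto simp: mult_ac)
  also have "\<dots> \<le> (\<integral>\<^sup>+y. K y * (epowr (g y) r + ennreal ((r - 1) * x powr r)) \<partial>M)"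
    by (intro nn_integral_mono mult_left_mono tan) auto
  also have "\<dots> = ?A + (\<integral>\<^sup>+y. K y \<partial>M) * ennreal ((r - 1) * x powr r)"
    by (simp add: distrib_left nn_integral_add nn_integral_multc)
  also have "\<dots> \<le> ?A + 1 * ennreal ((r - 1) * x powr r)"
    using K by (intro add_left_mono mult_right_mono) auto
  finally have *: "ennreal (r * x powr r) \<le> ?A + ennreal ((r - 1) * x powr r)" by simp
  obtain A where A: "?A = ennreal A" "0 \<le> A" using False by (cases ?A) auto
  have "r * x powr r \<le> A + (r - 1) * x powr r"
    using * A r x by (simp add: ennreal_plus[symmetric] del: ennreal_plus)
  then show ?thesis using A x by (simp add: epowr_ennreal ennreal_leI algebra_simps)
qed simp

text \<open>A common frame for \<open>lux_norm\<close> and \<open>lux_norm_dt\<close>. With an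
  arbitrary measure, counting measures are included, so finite sums and scalar functionals become
  instances.\<close>

definition modular :: "'a measure \<Rightarrow> ('a \<Rightarrow> real) \<Rightarrow> ('a \<Rightarrow> ennreal) \<Rightarrow> ennreal" where
  "modular M p g = (\<integral>\<^sup>+x. epowr (g x) (p x) \<partial>M)"

definition lux :: "'a measure \<Rightarrow> ('a \<Rightarrow> real) \<Rightarrow> ('a \<Rightarrow> ennreal) \<Rightarrow> ennreal" where
  "lux M p g = Inf {ennreal \<mu> | \<mu>. 0 < \<mu> \<and> modular M p (\<lambda>x. g x / ennreal \<mu>) \<le> 1}"

lemma lux_le:
  assumes "modular M p (\<lambda>x. g x / ennreal \<mu>) \<le> 1" "0 < \<mu>"
  shows "lux M p g \<le> ennreal \<mu>"
  unfolding lux_def using assms by (intro Inf_lower) auto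

lemma modular_mono:
  assumes "\<And>x. x \<in> space M \<Longrightarrow> f x \<le> g x" "\<And>x. 0 \<le> p x"
  shows "modular M p f \<le> modular M p g"
  unfolding modular_def using assms by (intro nn_integral_mono epowr_mono) auto

lemma modular_mono_AE:
  assumes "AE x in M. f x \<le> g x" "\<And>x. 0 \<le> p x"
  shows "modular M p f \<le> modular M p g"
  unfolding modular_def using assms by (intro nn_integral_mono_AE) (auto intro: epowr_mono)

text \<open>With a strict bound some admissible \<open>\<mu>\<close> lies below \<open>c\<close>;
  whether the infimum is attained does not matter.\<close>

lemma lux_less:
  assumes "lux M p g < c" "\<And>x. 0 \<le> p x"
  shows "modular M p (\<lambda>x. g x / c) \<le> 1"
proof -
  obtain \<mu> where \<mu>: "ennreal \<mu> < c" "0 < \<mu>" "modular M p (\<lambda>x. g x / ennreal \<mu>) \<le> 1"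
    using assms(1) unfolding lux_def Inf_less_iff by auto
  have "modular M p (\<lambda>x. g x / c) \<le> modular M p (\<lambda>x. g x / ennreal \<mu>)"
    using \<mu> assms by (intro modular_mono) (auto simp: divide_ennreal_def intro!: mult_left_mono ennreal_inverse_antimono)
  then show ?thesis using \<mu> by auto
qed

lemma lux_mono:
  assumes "\<And>x. x \<in> space M \<Longrightarrow> f x \<le> g x" "\<And>x. 0 \<le> p x"
  shows "lux M p f \<le> lux M p g"
  unfolding lux_def
proof (rule Inf_superset_mono, clarify)
  fix \<mu> :: real assume "0 < \<mu>" "modular M p (\<lambda>x. g x / ennreal \<mu>) \<le> 1"
  moreover have "modular M p (\<lambda>x. f x / ennreal \<mu>) \<le> modular M p (\<lambda>x. g x / ennreal \<mu>)"
    using assms by (intro modular_mono) (auto intro: divide_right_mono_ennreal)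
  ultimately show "\<exists>\<mu>'. ennreal \<mu> = ennreal \<mu>' \<and> 0 < \<mu>' \<and> modular M p (\<lambda>x. f x / ennreal \<mu>') \<le> 1"
    by (auto intro: order_trans)
qed

text \<open>The operator \<open>T\<close> need not be additive; homogeneity is what turns a modular bound into a
  norm bound.\<close>
lemma lux_le_of_modular:
  fixes T :: "('a \<Rightarrow> ennreal) \<Rightarrow> 'b \<Rightarrow> ennreal"
  assumes T: "\<And>g'. g' \<in> borel_measurable M \<Longrightarrow> modular M p g' \<le> 1 \<Longrightarrow> modular N q (\<lambda>x. T g' x / ennreal D) \<le> 1"
    and hom: "\<And>c x. T (\<lambda>y. c * g y) x = c * T g x"
    and g [measurable]: "g \<in> borel_measurable M" and D: "0 < D" and p: "\<And>x. 0 \<le> p x" and q: "\<And>x. 0 \<le> q x"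
  shows "lux N q (T g) \<le> ennreal D * lux M p g"
proof -
  have *: "lux N q (T g) \<le> ennreal D * ennreal \<mu>" if \<mu>: "lux M p g < ennreal \<mu>" for \<mu>
  proof -
    have \<mu>0: "0 < \<mu>" using that by (metis ennreal_0 ennreal_less_zero_iff not_less_zero leI ennreal_neg le_less_trans)
    have "modular N q (\<lambda>x. T (\<lambda>y. g y / ennreal \<mu>) x / ennreal D) \<le> 1"
      using lux_less[OF \<mu> p] by (intro T) auto
    moreover have "T (\<lambda>y. g y / ennreal \<mu>) x / ennreal D = T g x / ennreal (D * \<mu>)" for x
      using hom[of "inverse (ennreal \<mu>)" x] ennreal_divide_mult[OF \<mu>0 D, of "T g x"]
      by (simp add: divide_ennreal_def mult.commute)
    ultimately have "lux N q (T g) \<le> ennreal (D * \<mu>)"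
      using D \<mu>0 by (intro lux_le) auto
    then show ?thesis using D \<mu>0 by (simp add: ennreal_mult')
  qed
  show ?thesis
  proof (cases "lux M p g")
    case (real l)
    show ?thesis
    proof (rule ennreal_le_epsilon)
      fix e :: real assume e: "0 < e"
      have "lux N q (T g) \<le> ennreal D * ennreal (l + e / D)"
        using real e D by (intro *) (auto intro!: ennreal_lessI)
      also have "\<dots> = ennreal D * lux M p g + ennreal e"
        using real e D by (simp add: distrib_left ennreal_mult[symmetric])
      finally show "lux N q (T g) \<le> ennreal D * lux M p g + ennreal e" .
    qed
  qed (use D in \<open>auto simp: ennreal_mult_top\<close>)
qed

lemma lux_cmult_le:
  assumes "g \<in> borel_measurable M" "0 < D" "\<And>x. 0 \<le> p x"
  shows "lux M p (\<lambda>x. ennreal D * g x) \<le> ennreal D * lux M p g"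
proof (rule lux_le_of_modular)
  show "modular M p (\<lambda>x. ennreal D * g' x / ennreal D) \<le> 1" if "modular M p g' \<le> 1" for g'
    using that \<open>0 < D\<close> by (simp add: ennreal_mult_divide_eq mult.commute[of "ennreal D"])
qed (use assms in \<open>auto simp: mult_ac\<close>)

text \<open>The modular decreases when \<open>\<mu>\<close> grows, so the infimum may be taken over
  rational \<open>\<mu>\<close>, and the sublevel sets become countable unions.\<close>

lemma borel_measurable_lux [measurable]:
  assumes "sigma_finite_measure M"
    and [measurable]: "(\<lambda>(s, x). h s x) \<in> borel_measurable (N \<Otimes>\<^sub>M M)" "p \<in> borel_measurable M"
    and p: "\<And>x. 0 \<le> p x"
  shows "(\<lambda>s. lux M p (h s)) \<in> borel_measurable N"
proof -
  interpret sigma_finite_measure M by fact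
  have eq: "{s \<in> space N. lux M p (h s) < c} =
      {s \<in> space N. \<exists>\<mu>::rat. 0 < \<mu> \<and> ennreal (of_rat \<mu>) < c \<and> modular M p (\<lambda>x. h s x / ennreal (of_rat \<mu>)) \<le> 1}" for c
  proof (intro Collect_cong conj_cong refl iffI)
    fix s assume "lux M p (h s) < c"
    then obtain \<mu> where \<mu>: "ennreal \<mu> < c" "0 < \<mu>" "modular M p (\<lambda>x. h s x / ennreal \<mu>) \<le> 1"
      unfolding lux_def Inf_less_iff by auto
    obtain d where d: "ennreal \<mu> < ennreal d" "ennreal d < c" "0 < d"
      using dense[OF \<mu>(1)] \<mu>(2) by (metis ennreal_cases ennreal_less_zero_iff less_top_ennreal not_less_zero order_less_imp_not_less top.not_eq_extremum zero_less_iff_neq_zero)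
    obtain r where r: "\<mu> < of_rat r" "of_rat r < d"
      using of_rat_dense[of \<mu> d] d \<mu> by (auto simp: ennreal_less_iff)
    have "modular M p (\<lambda>x. h s x / ennreal (of_rat r)) \<le> modular M p (\<lambda>x. h s x / ennreal \<mu>)"
      using r p by (intro modular_mono)
        (auto simp: divide_ennreal_def intro!: mult_left_mono ennreal_inverse_antimono ennreal_leI)
    moreover have "ennreal (of_rat r) < c"
      using r d(2) by (meson ennreal_leI le_less_trans less_imp_le)
    moreover have "0 < r" using r \<mu>(2) by (metis less_trans zero_less_of_rat_iff)
    ultimately show "\<exists>\<mu>::rat. 0 < \<mu> \<and> ennreal (of_rat \<mu>) < c \<and> modular M p (\<lambda>x. h s x / ennreal (of_rat \<mu>)) \<le> 1"
      using \<mu>(3) by (intro exI[of _ r]) auto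
  next
    fix s assume "\<exists>\<mu>::rat. 0 < \<mu> \<and> ennreal (of_rat \<mu>) < c \<and> modular M p (\<lambda>x. h s x / ennreal (of_rat \<mu>)) \<le> 1"
    then show "lux M p (h s) < c" by (auto intro: le_less_trans[OF lux_le])
  qed
  show ?thesis
  proof (rule borel_measurableI_less)
    fix c
    show "{x \<in> space N. lux M p (h x) < c} \<in> sets N"
      unfolding eq modular_def by measurable
  qed
qed

text \<open>Minkowski's inequality for integrals. Dividing each \<open>h s\<close> by slightly more
  than its norm gives modular at most 1; the mean of these quotients with weights \<open>K s\<close>
  is handled by Jensen's inequality and Fubini's theorem.\<close>

lemma lux_nn_integral_le:
  assumes "sigma_finite_measure M" "sigma_finite_measure N"
    and h [measurable]: "(\<lambda>(s, x). h s x) \<in> borel_measurable (N \<Otimes>\<^sub>M M)"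
    and [measurable]: "w \<in> borel_measurable N" "p \<in> borel_measurable M"
    and w: "(\<integral>\<^sup>+s. w s \<partial>N) < \<infinity>" and p: "\<And>x. 1 \<le> p x"
  shows "lux M p (\<lambda>x. \<integral>\<^sup>+s. w s * h s x \<partial>N) \<le> (\<integral>\<^sup>+s. w s * lux M p (h s) \<partial>N)" (is "?L \<le> ?A")
proof (cases "?A = top")
  case False
  interpret M: sigma_finite_measure M by fact
  interpret N: sigma_finite_measure N by fact
  interpret P: pair_sigma_finite N M ..
  have p0: "0 \<le> p x" for x using p[of x] by simp
  define g where "g s = lux M p (h s)" for s
  have [measurable]: "g \<in> borel_measurable N"
    unfolding g_def using p0 by (intro borel_measurable_lux \<open>sigma_finite_measure M\<close>) auto
  obtain W where W: "(\<integral>\<^sup>+s. w s \<partial>N) = ennreal W" "0 \<le> W"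
    using w by (cases "\<integral>\<^sup>+s. w s \<partial>N") auto
  obtain A where A: "?A = ennreal A" "0 \<le> A" using False by (cases ?A) auto
  show ?thesis
  proof (rule ennreal_le_epsilon)
    fix e :: real assume e: "0 < e"
    define e' where "e' = e / (W + 1)"
    have e': "0 < e'" "e' * W \<le> e" using e W by (auto simp: e'_def field_simps)
    \<comment> \<open>The summand \<open>e'\<close> makes \<open>ge s\<close> positive and, where
      the norm is finite, strictly larger than it; the total that it adds is at most
      \<open>e\<close>.\<close>
    define ge where "ge s = g s + ennreal e'" for s
    have [measurable]: "ge \<in> borel_measurable N" unfolding ge_def by measurable
    have ge0: "ge s \<noteq> 0" for s using e' by (simp add: ge_def)
    have mod: "modular M p (\<lambda>x. h s x / ge s) \<le> 1" for s
    proof (cases "g s = top")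
      case True
      then show ?thesis by (simp add: ge_def modular_def ennreal_divide_top)
    next
      case False
      then have "lux M p (h s) < ge s" using e' unfolding ge_def g_def[symmetric]
        by (cases "g s") (auto simp: ennreal_plus[symmetric] ennreal_less_iff simp del: ennreal_plus)
      then show ?thesis using p0 by (intro lux_less)
    qed
    define B where "B = A + e"
    have B: "0 < B" using A e by (simp add: B_def)
    have "(\<integral>\<^sup>+s. w s * ge s \<partial>N) = ?A + ennreal W * ennreal e'"
      unfolding ge_def by (simp add: distrib_left nn_integral_add nn_integral_multc W g_def[symmetric])
    also have "\<dots> = ennreal (A + W * e')"
      using A W e' by (simp add: ennreal_mult[symmetric])
    also have "\<dots> \<le> ennreal B" using e' by (auto simp: B_def mult.commute intro!: ennreal_leI)
    finally have wge: "(\<integral>\<^sup>+s. w s * ge s \<partial>N) \<le> ennreal B" .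
    define K where "K s = w s * ge s / ennreal B" for s
    have [measurable]: "K \<in> borel_measurable N" unfolding K_def by measurable
    have K1: "(\<integral>\<^sup>+s. K s \<partial>N) \<le> 1"
      unfolding K_def using wge B by (simp add: nn_integral_divide divide_le_posI_ennreal)
    have "AE s in N. w s * ge s \<noteq> \<infinity>"
      using wge by (intro nn_integral_noteq_infinite) (auto simp: top_unique)
    then have fin: "AE s in N. w s = 0 \<or> ge s < top"
      by eventually_elim (auto simp: ennreal_mult_eq_top_iff less_top)
    have le: "(\<integral>\<^sup>+s. w s * h s x \<partial>N) / ennreal B \<le> (\<integral>\<^sup>+s. K s * (h s x / ge s) \<partial>N)" if "x \<in> space M" for x
    proof -
      have [measurable]: "(\<lambda>s. h s x) \<in> borel_measurable N" using that by measurable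
      have "(\<integral>\<^sup>+s. w s * h s x \<partial>N) / ennreal B = (\<integral>\<^sup>+s. w s * h s x / ennreal B \<partial>N)"
        by (rule nn_integral_divide[symmetric]) measurable
      also have "\<dots> \<le> (\<integral>\<^sup>+s. K s * (h s x / ge s) \<partial>N)"
      proof (rule nn_integral_mono_AE)
        show "AE s in N. w s * h s x / ennreal B \<le> K s * (h s x / ge s)"
          using fin
        proof eventually_elim
          case (elim s)
          then show ?case
          proof
            assume "ge s < top"
            then have "ge s * inverse (ge s) = 1"
              using ge0[of s] by (metis divide_ennreal_def ennreal_divide_self less_top)
            then have "K s * (h s x / ge s) = w s * h s x / ennreal B"
              unfolding K_def divide_ennreal_def by (metis (no_types, lifting) mult.assoc mult.commute mult.right_neutral)
            then show ?thesis by simp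
          qed simp
        qed
      qed
      finally show ?thesis .
    qed
    have "modular M p (\<lambda>x. (\<integral>\<^sup>+s. w s * h s x \<partial>N) / ennreal B)
        \<le> (\<integral>\<^sup>+x. (\<integral>\<^sup>+s. K s * epowr (h s x / ge s) (p x) \<partial>N) \<partial>M)"
      unfolding modular_def
    proof (rule nn_integral_mono)
      fix x assume x: "x \<in> space M"
      then have [measurable]: "(\<lambda>s. h s x) \<in> borel_measurable N" by measurable
      show "epowr ((\<integral>\<^sup>+s. w s * h s x \<partial>N) / ennreal B) (p x) \<le> (\<integral>\<^sup>+s. K s * epowr (h s x / ge s) (p x) \<partial>N)"
        by (rule order_trans[OF epowr_mono[OF le[OF x] p0] epowr_Jensen[OF _ _ K1 p]]) measurable
    qed
    also have "\<dots> = (\<integral>\<^sup>+s. (\<integral>\<^sup>+x. K s * epowr (h s x / ge s) (p x) \<partial>M) \<partial>N)"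
      by (rule P.Fubini') measurable
    also have "\<dots> = (\<integral>\<^sup>+s. K s * modular M p (\<lambda>x. h s x / ge s) \<partial>N)"
      unfolding modular_def by (intro nn_integral_cong nn_integral_cmult) measurable
    also have "\<dots> \<le> (\<integral>\<^sup>+s. K s * 1 \<partial>N)"
      using mod by (intro nn_integral_mono mult_left_mono) auto
    also have "\<dots> \<le> 1" using K1 by simp
    finally have "?L \<le> ennreal B" using B by (intro lux_le)
    then show "?L \<le> ?A + ennreal e" using A e by (simp add: B_def)
  qed
qed simp

text \<open>The triangle inequality is Minkowski's inequality for the counting measure on two
  points.\<close>

lemma lux_add_le:
  assumes "sigma_finite_measure M"
    and [measurable]: "f \<in> borel_measurable M" "g \<in> borel_measurable M" "p \<in> borel_measurable M"
    and p: "\<And>x. 1 \<le> p x"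
  shows "lux M p (\<lambda>x. f x + g x) \<le> lux M p f + lux M p g"
proof -
  have "lux M p (\<lambda>x. \<integral>\<^sup>+b. 1 * (if b then f x else g x) \<partial>count_space UNIV)
      \<le> (\<integral>\<^sup>+b. 1 * lux M p (\<lambda>x. if b then f x else g x) \<partial>count_space UNIV)"
  proof (rule lux_nn_integral_le[OF assms(1)])
    show "sigma_finite_measure (count_space (UNIV :: bool set))"
      by (intro sigma_finite_measure_count_space_countable) auto
  qed (use p in \<open>auto simp: nn_integral_count_space_finite UNIV_bool intro!: measurable_pair_measure_countable1\<close>)
  then show ?thesis by (simp add: nn_integral_count_space_finite UNIV_bool add.commute)
qed

lemma epowr_divide_le:
  assumes "1 \<le> D" "1 \<le> r"
  shows "epowr (u / ennreal D) r \<le> epowr u r / ennreal D"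
proof -
  have "epowr (inverse (ennreal D)) r \<le> epowr (inverse (ennreal D)) 1"
    using assms by (intro epowr_antimono_exp) (auto simp: inverse_ennreal intro!: inverse_le_1_iff[THEN iffD2])
  then show ?thesis using assms
    by (auto simp: divide_ennreal_def epowr_mult intro!: mult_left_mono)
qed

text \<open>Since \<open>D\<close> and the exponent are at least 1, dividing by \<open>D\<close>
  lowers the modular at least by the factor \<open>D\<close>, however large the exponent.\<close>

lemma modular_divide_le:
  assumes [measurable]: "g \<in> borel_measurable M" "p \<in> borel_measurable M"
    and p: "\<And>x. 1 \<le> p x" and D: "1 \<le> D" "modular M p g \<le> ennreal D"
  shows "modular M p (\<lambda>x. g x / ennreal D) \<le> 1"
proof -
  have "modular M p (\<lambda>x. g x / ennreal D) \<le> (\<integral>\<^sup>+x. epowr (g x) (p x) / ennreal D \<partial>M)"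
    unfolding modular_def using epowr_divide_le[OF D(1) p] by (intro nn_integral_mono)
  also have "\<dots> = modular M p g / ennreal D"
    unfolding modular_def by (intro nn_integral_divide) measurable
  also have "\<dots> \<le> 1" using D by (intro divide_le_posI_ennreal) auto
  finally show ?thesis .
qed

text \<open>The larger of \<open>\<gamma>\<close> and \<open>g powr (py / s)\<close> decides, where
  \<open>1 / s = 1 / px - 1 / py\<close>: replacing the smaller by the larger turns the left side
  into one of the two summands.\<close>

lemma powr_Young_variable:
  fixes g \<gamma> px py :: real
  assumes "0 \<le> g" "0 < \<gamma>" "0 < px" "px < py"
  shows "(\<gamma> * g) powr px \<le> g powr py + \<gamma> powr (1 / (1 / px - 1 / py))"
proof -
  define s where "s = 1 / (1 / px - 1 / py)"
  have s: "0 < s" "1 / s = 1 / px - 1 / py" using assms by (auto simp: s_def frac_less2)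
  have s1: "px * (1 + py / s) = py" "px * (1 + s / py) = s"
    using assms s unfolding s_def by (simp_all add: divide_simps)
  show ?thesis
  proof (cases "\<gamma> \<le> g powr (py / s)")
    case True
    have "(\<gamma> * g) powr px \<le> (g powr (py / s) * g powr 1) powr px"
      using True assms by (intro powr_mono2 mult_mono) auto
    also have "\<dots> = g powr py"
      unfolding powr_add[symmetric] powr_powr using s1 by (simp add: mult_ac add_ac)
    finally show ?thesis by (simp add: add_increasing2)
  next
    case False
    have "g \<le> (g powr (py / s)) powr (s / py)"
      using assms s by (simp add: powr_powr)
    also have "\<dots> \<le> \<gamma> powr (s / py)" using False assms s by (intro powr_mono2) auto
    finally have "(\<gamma> * g) powr px \<le> (\<gamma> powr 1 * \<gamma> powr (s / py)) powr px"
      using assms by (intro powr_mono2 mult_mono) auto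
    also have "\<dots> = \<gamma> powr s"
      unfolding powr_add[symmetric] powr_powr using s1 by (simp add: mult_ac)
    finally show ?thesis by (simp add: s_def add_increasing)
  qed
qed

text \<open>Dividing by 3 before taking the power lets the largest summand bound the mean, so no
  factor depending on \<open>r\<close> appears; this matters for unbounded exponents.\<close>

lemma epowr_third_le:
  assumes "0 \<le> r"
  shows "epowr ((a + b + c) / 3) r \<le> epowr a r + epowr b r + epowr c r"
proof -
  define m where "m = max a (max b c)"
  have "a + b + c \<le> m + m + m" unfolding m_def by (intro add_mono) (auto simp: le_max_iff_disj)
  also have "\<dots> = m * 3" by (metis distrib_left mult.right_neutral numeral_Bit1 numeral_One one_add_one)
  finally have "(a + b + c) / 3 \<le> m" by (intro divide_le_posI_ennreal) (auto simp: mult.commute)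
  then have "epowr ((a + b + c) / 3) r \<le> epowr m r" using assms by (intro epowr_mono)
  also have "\<dots> \<le> epowr a r + epowr b r + epowr c r"
    by (auto simp: m_def max_def add_increasing add_increasing2)
  finally show ?thesis .
qed

text \<open>The argument \<open>g\<close> is split into the part above 1, which is the subject of the assumption
  \<open>big\<close>, and two parts below 1, according to the order of \<open>p x\<close> and \<open>p y\<close>: for
  \<open>p y \<le> p x\<close> raising the exponent is harmless, for \<open>p x < p y\<close> Young's inequality applies.\<close>
lemma modular_kernel_bound:
  fixes p :: "'a \<Rightarrow> real" and K :: "'a \<Rightarrow> 'a \<Rightarrow> ennreal"
  assumes "sigma_finite_measure M"
    and [measurable]: "p \<in> borel_measurable M" "(\<lambda>(x, y). K x y) \<in> borel_measurable (M \<Otimes>\<^sub>M M)"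
      "h \<in> borel_measurable M"
    and p: "\<And>x. 1 \<le> p x"
    and K1: "\<And>x. x \<in> space M \<Longrightarrow> (\<integral>\<^sup>+y. K x y \<partial>M) \<le> 1"
    and K2: "\<And>y. y \<in> space M \<Longrightarrow> (\<integral>\<^sup>+x. K x y \<partial>M) \<le> 1"
    and h: "(\<integral>\<^sup>+x. h x \<partial>M) \<le> ennreal H" "0 \<le> H"
    and \<gamma>: "0 < \<gamma>" "\<gamma> \<le> 1"
    and young: "\<And>x y. x \<in> space M \<Longrightarrow> y \<in> space M \<Longrightarrow> p x < p y \<Longrightarrow>
        ennreal (\<gamma> powr (1 / (1 / p x - 1 / p y))) \<le> h x + h y"
    and B: "1 \<le> B"
    and big: "\<And>g x. g \<in> borel_measurable M \<Longrightarrow> modular M p g \<le> 1 \<Longrightarrow> x \<in> space M \<Longrightarrow>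
        epowr ((\<integral>\<^sup>+y. K x y * (if 1 < g y then g y else 0) \<partial>M) / ennreal B) (p x)
          \<le> (\<integral>\<^sup>+y. K x y * epowr (g y) (p y) \<partial>M)"
    and g [measurable]: "g \<in> borel_measurable M" and gmod: "modular M p g \<le> 1"
  shows "modular M p (\<lambda>x. (\<integral>\<^sup>+y. K x y * g y \<partial>M) / ennreal (3 * B / \<gamma> * (3 + 2 * H))) \<le> 1"
proof -
  interpret M: sigma_finite_measure M by fact
  interpret P: pair_sigma_finite M M ..
  have p0: "0 \<le> p x" for x using p[of x] by simp
  have [measurable]: "(\<lambda>y. K x y) \<in> borel_measurable M" if "x \<in> space M" for x
    using that by measurable
  define E where "E y = epowr (g y) (p y)" for y
  have [measurable]: "E \<in> borel_measurable M" unfolding E_def by measurable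
  have E1: "(\<integral>\<^sup>+y. E y \<partial>M) \<le> 1" using gmod by (simp add: E_def modular_def)
  \<comment> \<open>\<open>\<beta>\<close> is below each of 1, \<open>\<gamma>\<close> and
    \<open>1 / B\<close>, the factors required by the three parts of \<open>g\<close>.\<close>
  define \<beta> where "\<beta> = ennreal (\<gamma> / B)"
  have \<beta>: "\<beta> \<le> ennreal \<gamma>" "\<beta> \<le> 1" "\<beta> = ennreal \<gamma> / ennreal B" "\<beta> \<le> inverse (ennreal B)"
  proof -
    have "\<gamma> / B \<le> \<gamma> / 1" using B \<gamma> by (intro divide_left_mono) auto
    then show "\<beta> \<le> ennreal \<gamma>" by (simp add: \<beta>_def ennreal_leI)
    also have "\<dots> \<le> 1" using \<gamma> by simp
    finally show "\<beta> \<le> 1" .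
    show "\<beta> = ennreal \<gamma> / ennreal B" using B \<gamma> by (simp add: \<beta>_def divide_ennreal)
    show "\<beta> \<le> inverse (ennreal B)"
      using B \<gamma> by (simp add: \<beta>_def inverse_ennreal divide_inverse mult_left_le_one_le ennreal_leI)
  qed
  have point: "epowr ((\<integral>\<^sup>+y. K x y * g y \<partial>M) * \<beta> / 3) (p x)
      \<le> 3 * (\<integral>\<^sup>+y. K x y * E y \<partial>M) + h x + (\<integral>\<^sup>+y. K x y * h y \<partial>M)" (is "_ \<le> ?R")
    if x: "x \<in> space M" for x
  proof -
    define g1 where "g1 y = (if 1 < g y then g y else 0)" for y
    define g2 where "g2 y = (if g y \<le> 1 \<and> p y \<le> p x then g y else 0)" for y
    define g3 where "g3 y = (if g y \<le> 1 \<and> p x < p y then g y else 0)" for y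
    have [measurable]: "g1 \<in> borel_measurable M" "g2 \<in> borel_measurable M" "g3 \<in> borel_measurable M"
      unfolding g1_def g2_def g3_def by measurable
    note [measurable] = \<open>\<And>x. x \<in> space M \<Longrightarrow> (\<lambda>y. K x y) \<in> borel_measurable M\<close>[OF x]
    define I where "I u = (\<integral>\<^sup>+y. K x y * u y \<partial>M)" for u
    have split: "I g = I g1 + I g2 + I g3"
    proof -
      have "K x y * g y = K x y * g1 y + K x y * g2 y + K x y * g3 y" for y
        by (auto simp: g1_def g2_def g3_def)
      then show ?thesis unfolding I_def
        by (simp add: nn_integral_add)
    qed
    have "epowr (I g * \<beta> / 3) (p x) = epowr ((I g1 * \<beta> + I g2 * \<beta> + I g3 * \<beta>) / 3) (p x)"
      by (simp add: split distrib_right)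
    also have "\<dots> \<le> epowr (I g1 * \<beta>) (p x) + epowr (I g2 * \<beta>) (p x) + epowr (I g3 * \<beta>) (p x)"
      using p0 by (rule epowr_third_le)
    also have "epowr (I g1 * \<beta>) (p x) \<le> I E"
    proof -
      have "epowr (I g1 * \<beta>) (p x) \<le> epowr (I g1 / ennreal B) (p x)"
        using \<beta> p0 by (intro epowr_mono) (auto simp: divide_ennreal_def intro: mult_left_mono)
      also have "\<dots> \<le> I E" unfolding I_def g1_def E_def by (rule big[OF g gmod x])
      finally show ?thesis .
    qed
    also have "epowr (I g2 * \<beta>) (p x) \<le> I E"
    proof -
      have "epowr (I g2 * \<beta>) (p x) \<le> epowr (I g2 * 1) (p x)"
        using \<beta> p0 by (intro epowr_mono mult_left_mono) auto
      also have "\<dots> \<le> (\<integral>\<^sup>+y. K x y * epowr (g2 y) (p x) \<partial>M)"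
        using epowr_Jensen[OF _ _ K1[OF x] p, of g2] by (simp add: I_def)
      also have "\<dots> \<le> I E" unfolding I_def
        by (intro nn_integral_mono mult_left_mono) (auto simp: g2_def E_def intro: epowr_antimono_exp)
      finally show ?thesis .
    qed
    also have "epowr (I g3 * \<beta>) (p x) \<le> I E + h x + I h"
    proof -
      have "epowr (I g3 * \<beta>) (p x) \<le> epowr (I (\<lambda>y. ennreal \<gamma> * g3 y)) (p x)"
      proof (intro epowr_mono p0)
        have "I g3 * \<beta> \<le> ennreal \<gamma> * I g3" using \<beta> by (metis mult.commute mult_left_mono zero_le)
        also have "\<dots> = I (\<lambda>y. ennreal \<gamma> * g3 y)"
          unfolding I_def by (subst nn_integral_cmult[symmetric]) (auto simp: mult_ac)
        finally show "I g3 * \<beta> \<le> I (\<lambda>y. ennreal \<gamma> * g3 y)" .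
      qed
      also have "\<dots> \<le> (\<integral>\<^sup>+y. K x y * epowr (ennreal \<gamma> * g3 y) (p x) \<partial>M)"
        unfolding I_def by (rule epowr_Jensen[OF _ _ K1[OF x] p]) measurable
      also have "\<dots> \<le> (\<integral>\<^sup>+y. K x y * (E y + (h x + h y)) \<partial>M)"
      proof (intro nn_integral_mono mult_left_mono)
        fix y assume y: "y \<in> space M"
        show "epowr (ennreal \<gamma> * g3 y) (p x) \<le> E y + (h x + h y)"
        proof (cases "g y \<le> 1 \<and> p x < p y")
          case True
          then obtain z where z: "g y = ennreal z" "0 \<le> z" by (cases "g y") (auto simp: top_unique)
          have "epowr (ennreal \<gamma> * g3 y) (p x) = ennreal ((\<gamma> * z) powr p x)"
            using True z \<gamma> by (simp add: g3_def ennreal_mult[symmetric] epowr_ennreal)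
          also have "\<dots> \<le> ennreal (z powr p y + \<gamma> powr (1 / (1 / p x - 1 / p y)))"
            using z \<gamma> True p[of x] by (intro ennreal_leI powr_Young_variable) auto
          also have "\<dots> \<le> E y + (h x + h y)"
            using z young[OF x y] True by (auto simp: E_def epowr_ennreal intro!: add_left_mono)
          finally show ?thesis .
        qed (auto simp: g3_def)
      qed auto
      also have "\<dots> = I E + ((\<integral>\<^sup>+y. K x y \<partial>M) * h x + I h)"
        unfolding I_def distrib_left by (simp add: nn_integral_add nn_integral_multc)
      also have "\<dots> \<le> I E + (1 * h x + I h)"
        using K1[OF x] by (intro add_mono mult_right_mono) auto
      finally show ?thesis by (simp add: add_ac)
    qed
    also have "I E + I E + (I E + h x + I h) = 3 * I E + h x + I h"
    proof -
      have "3 * I E = I E + I E + I E" by (metis distrib_right mult_1 numeral_Bit1 numeral_One one_add_one)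
      then show ?thesis by (simp add: add_ac)
    qed
    finally show ?thesis by (simp add: I_def add_mono)
  qed
  \<comment> \<open>Here the bound on the column integrals of \<open>K\<close> enters: averaging
    does not increase the total mass.\<close>
  have Kint: "(\<integral>\<^sup>+x. (\<integral>\<^sup>+y. K x y * u y \<partial>M) \<partial>M) \<le> (\<integral>\<^sup>+y. u y \<partial>M)"
    if [measurable]: "u \<in> borel_measurable M" for u
  proof -
    have "(\<integral>\<^sup>+x. (\<integral>\<^sup>+y. K x y * u y \<partial>M) \<partial>M) = (\<integral>\<^sup>+y. (\<integral>\<^sup>+x. K x y * u y \<partial>M) \<partial>M)"
      by (rule P.Fubini'[symmetric]) measurable
    also have "\<dots> = (\<integral>\<^sup>+y. (\<integral>\<^sup>+x. K x y \<partial>M) * u y \<partial>M)"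
      by (intro nn_integral_cong nn_integral_multc) measurable
    also have "\<dots> \<le> (\<integral>\<^sup>+y. 1 * u y \<partial>M)"
      by (intro nn_integral_mono mult_right_mono K2) auto
    finally show ?thesis by simp
  qed
  have "modular M p (\<lambda>x. (\<integral>\<^sup>+y. K x y * g y \<partial>M) * \<beta> / 3)
      \<le> (\<integral>\<^sup>+x. 3 * (\<integral>\<^sup>+y. K x y * E y \<partial>M) + h x + (\<integral>\<^sup>+y. K x y * h y \<partial>M) \<partial>M)"
    unfolding modular_def by (intro nn_integral_mono point)
  also have "\<dots> = 3 * (\<integral>\<^sup>+x. (\<integral>\<^sup>+y. K x y * E y \<partial>M) \<partial>M) + (\<integral>\<^sup>+x. h x \<partial>M) + (\<integral>\<^sup>+x. (\<integral>\<^sup>+y. K x y * h y \<partial>M) \<partial>M)"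
    by (simp add: nn_integral_add nn_integral_cmult)
  also have "\<dots> \<le> 3 * 1 + ennreal H + ennreal H"
    using order_trans[OF Kint[of E] E1] order_trans[OF Kint[of h] h(1)] h
    by (intro add_mono mult_left_mono) auto
  also have "\<dots> = ennreal (3 + 2 * H)"
  proof -
    have "ennreal (2 * H) = ennreal H + ennreal H"
      unfolding mult_2 by (rule ennreal_plus[OF h(2) h(2)])
    then show ?thesis using h(2) by (simp add: add.assoc)
  qed
  \<comment> \<open>The constant collects \<open>B / \<gamma>\<close> from \<open>\<beta>\<close>, 3
    from the splitting into three parts, and the bound \<open>3 + 2 * H\<close> of the
    modular.\<close>
  finally have "modular M p (\<lambda>x. (\<integral>\<^sup>+y. K x y * g y \<partial>M) * \<beta> / 3 / ennreal (3 + 2 * H)) \<le> 1"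
    using h(2) p by (intro modular_divide_le) auto
  moreover have "u * \<beta> / 3 / ennreal (3 + 2 * H) = u / ennreal (3 * B / \<gamma> * (3 + 2 * H))" for u
  proof -
    have eq: "u * \<beta> / 3 = u / ennreal (3 * B / \<gamma>)"
      using B \<gamma> by (simp add: divide_ennreal_def \<beta>_def inverse_ennreal mult.assoc ennreal_mult[symmetric] ennreal_numeral[symmetric] mult.commute[of B] del: ennreal_numeral)
    show ?thesis unfolding eq by (rule ennreal_divide_mult[symmetric]) (use B \<gamma> h in auto)
  qed
  ultimately show ?thesis by simp
qed

section \<open>Averaging operators on variable exponent spaces\<close>

lemma log_holder_loc_continuous:
  assumes "log_holder_loc g"
  shows "continuous_on UNIV g"
proof -
  obtain c where c: "c > 0" "\<And>x y. \<bar>g x - g y\<bar> \<le> c / ln (exp 1 + 1 / norm (x - y))"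
    using assms by (auto simp: log_holder_loc_def)
  show ?thesis unfolding continuous_on_iff
  proof (intro ballI allI impI)
    fix x and e :: real assume e: "0 < e"
    \<comment> \<open>Chosen so that \<open>ln (1 / d) = 2 * c / e\<close>, which gives oscillation
      at most \<open>e / 2\<close>.\<close>
    define d where "d = exp (- (2 * c / e))"
    show "\<exists>d>0. \<forall>x'\<in>UNIV. dist x' x < d \<longrightarrow> dist (g x') (g x) < e"
    proof (intro exI[of _ d] conjI ballI impI)
      show "0 < d" by (simp add: d_def)
      fix y assume y: "dist y x < d"
      show "dist (g y) (g x) < e"
      proof (cases "y = x")
        case False
        then have n: "0 < norm (y - x)" "norm (y - x) < d" using y by (auto simp: dist_norm)
        have "exp (2 * c / e) \<le> 1 / norm (y - x)"
          using n by (simp add: d_def exp_minus field_simps)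
        then have "exp (2 * c / e) \<le> exp 1 + 1 / norm (y - x)" by (simp add: add_increasing)
        then have "2 * c / e \<le> ln (exp 1 + 1 / norm (y - x))"
          by (metis exp_gt_zero ln_exp ln_le_cancel_iff order_less_le_trans)
        then have "c / ln (exp 1 + 1 / norm (y - x)) \<le> c / (2 * c / e)"
          by (intro frac_le) (use c e in auto)
        also have "\<dots> < e" using c e by simp
        finally show ?thesis using c(2)[of y x] by (simp add: dist_real_def)
      qed (use e in simp)
    qed
  qed
qed

definition ball_avg :: "real \<Rightarrow> ('a::euclidean_space \<Rightarrow> ennreal) \<Rightarrow> 'a \<Rightarrow> ennreal" where
  "ball_avg r g x = (\<integral>\<^sup>+y. indicator (ball x r) y / emeasure lborel (ball (0::'a) r) * g y \<partial>lborel)"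

text \<open>A bump of width \<open>t\<close> whose mass does not depend on \<open>t\<close>;
  \<open>m\<close> is its rate of decay.\<close>

definition eta :: "real \<Rightarrow> real \<Rightarrow> 'a::euclidean_space \<Rightarrow> ennreal" where
  "eta t m x = ennreal (t powr (- real DIM('a)) * (1 + norm x / t) powr (- m))"

lemma borel_measurable_eta [measurable]: "eta t m \<in> borel_measurable borel"
  unfolding eta_def by measurable

text \<open>Coefficient of the average over the ball of radius \<open>2 ^ j * t\<close>: the decay
  \<open>2 powr (- m * j)\<close> of the bump times the volume of that ball in units of
  \<open>t\<close>. The factor \<open>2 powr m\<close> is lost because the decay is measured at the
  inner radius of the annulus.\<close>

definition eta_weight :: "'a::euclidean_space itself \<Rightarrow> real \<Rightarrow> nat \<Rightarrow> real" where
  "eta_weight _ m j = 2 powr m * unit_ball_vol (real DIM('a)) * (2 powr (real DIM('a) - m)) ^ j"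

lemma eta_weight_nonneg: "0 \<le> eta_weight T m j"
  by (simp add: eta_weight_def)

lemma eta_weight_summable:
  assumes "real DIM('a::euclidean_space) < m"
  shows "(\<Sum>j. ennreal (eta_weight TYPE('a) m j)) < top"
proof -
  have "summable (eta_weight TYPE('a) m)"
    unfolding eta_weight_def using assms
    by (intro summable_mult summable_geometric) (simp add: powr_less_one)
  then show ?thesis
    using eta_weight_nonneg by (subst suminf_ennreal_eq[OF _ summable_sums]) auto
qed

lemma emeasure_ball_powr:
  fixes x :: "'a::euclidean_space"
  assumes "0 < r"
  shows "emeasure lborel (ball x r) = ennreal (unit_ball_vol (real DIM('a)) * r powr (real DIM('a)))"
  using assms by (simp add: emeasure_ball powr_realpow)

text \<open>Dyadic decomposition into balls of radius \<open>2 ^ j * t\<close>.\<close>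
lemma eta_le_suminf:
  fixes x :: "'a::euclidean_space"
  assumes t: "0 < t" and m: "0 \<le> m"
  shows "eta t m x \<le> (\<Sum>j. ennreal (eta_weight TYPE('a) m j) *
    (indicator (ball 0 (2 ^ j * t)) x / emeasure lborel (ball (0::'a) (2 ^ j * t))))"
proof -
  obtain k where k: "norm x / t < 2 ^ k" using real_arch_pow[of 2 "norm x / t"] by auto
  \<comment> \<open>Only the term of the smallest ball of the family that contains \<open>x\<close>
    is used; the other terms of the series are nonnegative.\<close>
  define j where "j = (LEAST j. norm x / t < 2 ^ j)"
  have j: "norm x / t < 2 ^ j" unfolding j_def using k by (rule LeastI)
  have b: "(1 + norm x / t) powr (- m) \<le> 2 powr m * 2 powr (- m * j)"
  proof (cases j)
    case 0
    have "(1 + norm x / t) powr (- m) \<le> 1" using t m powr_mono2'[of "- m" 1 "1 + norm x / t"] by simp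
    also have "\<dots> \<le> 2 powr m" using m by (simp add: ge_one_powr_ge_zero)
    finally show ?thesis using 0 by simp
  next
    case (Suc i)
    then have "\<not> norm x / t < 2 ^ i" using not_less_Least[of i "\<lambda>j. norm x / t < 2 ^ j"] by (simp add: j_def)
    then have "2 powr i \<le> 1 + norm x / t" by (simp add: powr_realpow)
    then have "(1 + norm x / t) powr (- m) \<le> (2 powr i) powr (- m)"
      using m by (intro powr_mono2') auto
    also have "\<dots> = 2 powr m * 2 powr (- m * j)"
      by (simp add: powr_powr powr_add[symmetric] Suc algebra_simps)
    finally show ?thesis .
  qed
  let ?n = "real DIM('a)"
  have V: "emeasure lborel (ball (0::'a) (2 ^ j * t)) = ennreal (unit_ball_vol ?n * (2 ^ j * t) powr ?n)"
    using t by (intro emeasure_ball_powr) auto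
  have "eta t m x \<le> ennreal (t powr (- ?n) * (2 powr m * 2 powr (- m * j)))"
    unfolding eta_def using b by (intro ennreal_leI mult_left_mono) auto
  also have "t powr (- ?n) * (2 powr m * 2 powr (- m * j)) = eta_weight TYPE('a) m j / (unit_ball_vol ?n * (2 ^ j * t) powr ?n)"
  proof -
    have "(2::real) ^ j = 2 powr j" by (simp add: powr_realpow)
    then show ?thesis using t less_imp_neq[OF unit_ball_vol_pos[of ?n]]
      unfolding eta_weight_def
      by (simp add: powr_mult powr_powr powr_minus powr_power powr_diff divide_simps mult_ac powr_add[symmetric] algebra_simps)
  qed
  also have "ennreal (eta_weight TYPE('a) m j / (unit_ball_vol ?n * (2 ^ j * t) powr ?n)) =
      ennreal (eta_weight TYPE('a) m j) * (indicator (ball 0 (2 ^ j * t)) x / emeasure lborel (ball (0::'a) (2 ^ j * t)))"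
  proof -
    have "0 < unit_ball_vol ?n * (2 ^ j * t) powr ?n" using t by simp
    moreover have "x \<in> ball 0 (2 ^ j * t)" using j t by (simp add: field_simps)
    ultimately show ?thesis unfolding V
      by (simp add: divide_ennreal[OF eta_weight_nonneg, symmetric] ennreal_times_divide del: mem_ball_0)
  qed
  also have "\<dots> \<le> (\<Sum>j. ennreal (eta_weight TYPE('a) m j) *
    (indicator (ball 0 (2 ^ j * t)) x / emeasure lborel (ball (0::'a) (2 ^ j * t))))"
    by (rule order_trans[OF _ sum_le_suminf[where I="{j}"]]) auto
  finally show ?thesis .
qed

lemma eta_conv_le:
  fixes g :: "'a::euclidean_space \<Rightarrow> ennreal"
  assumes [measurable]: "g \<in> borel_measurable borel" and "0 < t" "0 \<le> m"
  shows "(\<integral>\<^sup>+y. eta t m (x - y) * g y \<partial>lborel)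
    \<le> (\<integral>\<^sup>+j. ennreal (eta_weight TYPE('a) m j) * ball_avg (2 ^ j * t) g x \<partial>count_space UNIV)"
proof -
  have ind: "indicator (ball 0 r) (x - y) = (indicator (ball x r) y :: ennreal)" for r y
    by (auto simp: indicator_def dist_norm norm_minus_commute)
  have [measurable]: "(\<lambda>y. indicator (ball x r) y :: ennreal) \<in> borel_measurable borel" for r
    by (intro borel_measurable_indicator) auto
  have "(\<integral>\<^sup>+y. eta t m (x - y) * g y \<partial>lborel) \<le> (\<integral>\<^sup>+y. (\<Sum>j. ennreal (eta_weight TYPE('a) m j) *
      (indicator (ball x (2 ^ j * t)) y / emeasure lborel (ball (0::'a) (2 ^ j * t)) * g y)) \<partial>lborel)"
  proof (rule nn_integral_mono)
    fix y
    have "eta t m (x - y) * g y \<le> (\<Sum>j. ennreal (eta_weight TYPE('a) m j) *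
      (indicator (ball x (2 ^ j * t)) y / emeasure lborel (ball (0::'a) (2 ^ j * t)))) * g y"
      using eta_le_suminf[OF assms(2,3), of "x - y"] unfolding ind by (rule mult_right_mono) auto
    also have "\<dots> = (\<Sum>j. ennreal (eta_weight TYPE('a) m j) *
      (indicator (ball x (2 ^ j * t)) y / emeasure lborel (ball (0::'a) (2 ^ j * t)) * g y))"
      by (simp add: ennreal_suminf_multc[symmetric] mult.assoc)
    finally show "eta t m (x - y) * g y \<le> \<dots>" .
  qed
  also have "\<dots> = (\<Sum>j. ennreal (eta_weight TYPE('a) m j) * ball_avg (2 ^ j * t) g x)"
    unfolding ball_avg_def by (simp add: nn_integral_suminf nn_integral_cmult)
  finally show ?thesis by (simp add: nn_integral_count_space_nat)
qed

lemma nn_integral_eta: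
  assumes "real DIM('a::euclidean_space) < m"
  obtains W where "0 \<le> W" "\<And>t. 0 < t \<Longrightarrow> (\<integral>\<^sup>+x. eta t m (x::'a) \<partial>lborel) \<le> ennreal W"
proof
  let ?W = "\<Sum>j. ennreal (eta_weight TYPE('a) m j)"
  show "0 \<le> enn2real ?W" by simp
  fix t :: real assume t: "0 < t"
  have "(\<integral>\<^sup>+x. eta t m (x::'a) \<partial>lborel) \<le> (\<integral>\<^sup>+x. (\<Sum>j. ennreal (eta_weight TYPE('a) m j) *
    (indicator (ball 0 (2 ^ j * t)) (x::'a) / emeasure lborel (ball (0::'a) (2 ^ j * t)))) \<partial>lborel)"
    using assms t by (intro nn_integral_mono eta_le_suminf) auto
  also
  have [measurable]: "(\<lambda>x. indicator (ball 0 r) x :: ennreal) \<in> borel_measurable (borel :: 'a measure)" for r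
    by (intro borel_measurable_indicator) auto
  have "(\<integral>\<^sup>+x. (\<Sum>j. ennreal (eta_weight TYPE('a) m j) *
    (indicator (ball 0 (2 ^ j * t)) (x::'a) / emeasure lborel (ball (0::'a) (2 ^ j * t)))) \<partial>lborel) = (\<Sum>j. ennreal (eta_weight TYPE('a) m j) *
      (emeasure lborel (ball (0::'a) (2 ^ j * t)) / emeasure lborel (ball (0::'a) (2 ^ j * t))))"
    by (subst nn_integral_suminf) (simp_all add: nn_integral_cmult nn_integral_divide)
  also have "\<dots> \<le> ?W"
  proof (intro suminf_le allI)
    fix j
    have "0 < unit_ball_vol (real DIM('a)) * (2 ^ j * t) powr (real DIM('a))" using t by simp
    then show "ennreal (eta_weight TYPE('a) m j) * (emeasure lborel (ball (0::'a) (2 ^ j * t)) / emeasure lborel (ball (0::'a) (2 ^ j * t)))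
        \<le> ennreal (eta_weight TYPE('a) m j)"
      using t by (simp add: emeasure_ball_powr divide_ennreal del: zero_less_mult_iff)
  qed auto
  also have "\<dots> = ennreal (enn2real ?W)" using eta_weight_summable[OF assms] by simp
  finally show "(\<integral>\<^sup>+x. eta t m (x::'a) \<partial>lborel) \<le> ennreal (enn2real ?W)" .
qed

text \<open>Raising the exponent from \<open>P\<close> to \<open>px\<close> produces the factor
  \<open>f powr (px / P - 1)\<close>, and the bound \<open>v\<close> on \<open>f\<close> lets
  \<open>B powr px\<close> absorb it.\<close>

lemma powr_exponent_transfer:
  fixes a f v B P px :: real
  assumes "0 \<le> a" "1 \<le> P" "P \<le> px" "a powr P \<le> f" "f \<le> v" "1 \<le> v" "v powr (1 / P - 1 / px) \<le> B"
  shows "(a / B) powr px \<le> f"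
proof -
  have B: "0 < B" using assms by (smt (verit) powr_gt_zero)
  have f: "0 \<le> f" using assms by (smt (verit) powr_ge_zero)
  have "a powr px = (a powr P) powr (px / P)" using assms by (simp add: powr_powr)
  also have "\<dots> \<le> f powr (px / P)" using assms by (intro powr_mono2) auto
  also have "\<dots> = f * f powr (px / P - 1)" using f by (cases "f = 0") (auto simp: powr_diff)
  also have "\<dots> \<le> f * v powr (px / P - 1)" using assms f by (intro mult_left_mono powr_mono2) auto
  also have "v powr (px / P - 1) = (v powr (1 / P - 1 / px)) powr px"
  proof -
    have "(1 / P - 1 / px) * px = px / P - 1" using assms by (simp add: left_diff_distrib)
    then show ?thesis by (simp add: powr_powr)
  qed
  also have "\<dots> \<le> B powr px" using assms by (intro powr_mono2) auto
  finally have "a powr px \<le> f * B powr px" using f by (simp add: mult_left_mono)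
  then show ?thesis using B assms by (simp add: powr_divide divide_le_eq)
qed

text \<open>The constant is uniform in the radius. For values above 1, Jensen's inequality is
  applied with a constant exponent \<open>P\<close> below \<open>p\<close> on the ball, and local
  log-Hoelder continuity pays for the return to \<open>p x\<close>. For values below 1, the decay of
  \<open>1 / p\<close> towards its limit supplies the integrable error \<open>h\<close>.\<close>

lemma ball_avg_modular:
  fixes p :: "'a::euclidean_space \<Rightarrow> real"
  assumes p: "\<And>x. 1 \<le> p x" and lh: "log_holder (\<lambda>x. 1 / p x)"
  obtains D where "0 < D" "\<And>r g. 0 < r \<Longrightarrow> g \<in> borel_measurable borel \<Longrightarrow> modular lborel p g \<le> 1 \<Longrightarrow>
      modular lborel p (\<lambda>x. ball_avg r g x / ennreal D) \<le> 1"
proof -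
  let ?n = "real DIM('a)"
  obtain c1 where c1: "c1 > 0" "\<And>x y. \<bar>1 / p x - 1 / p y\<bar> \<le> c1 / ln (exp 1 + 1 / norm (x - y))"
    using lh by (auto simp: log_holder_def log_holder_loc_def)
  obtain ginf c2 where c2: "c2 > 0" "\<And>x. \<bar>1 / p x - ginf\<bar> \<le> c2 / ln (exp 1 + norm x)"
    using lh by (auto simp: log_holder_def)
  have "continuous_on UNIV (\<lambda>x. 1 / p x)"
    using lh by (auto simp: log_holder_def intro: log_holder_loc_continuous)
  moreover have "1 / p x \<noteq> 0" for x using p[of x] by simp
  ultimately have "continuous_on UNIV (\<lambda>x. 1 / (1 / p x))"
    using continuous_on_divide[OF continuous_on_const[of UNIV 1], of "\<lambda>x. 1 / p x"] by simp
  then have "continuous_on UNIV p" by simp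
  then have [measurable]: "p \<in> borel_measurable borel" by (rule borel_measurable_continuous_onI)
  define h :: "'a \<Rightarrow> ennreal" where "h = eta 1 (?n + 1)"
  have [measurable]: "h \<in> borel_measurable borel" unfolding h_def by measurable
  obtain H where H: "0 \<le> H" "(\<integral>\<^sup>+x. h x \<partial>lborel) \<le> ennreal H"
    using nn_integral_eta[of "?n + 1", where 'a='a] unfolding h_def by (metis less_add_one zero_less_one)
  \<comment> \<open>Calibrated to the decay: if \<open>z\<close> is the point closer to the origin,
    \<open>1 / p x - 1 / p y\<close> is at most \<open>2 * c2 / ln (exp 1 + norm z)\<close>, and
    then \<open>\<gamma>\<close> raised to the reciprocal of this difference is at most
    \<open>(exp 1 + norm z) powr (- (?n + 1))\<close>.\<close>
  define \<gamma> where "\<gamma> = exp (- (2 * c2 * (?n + 1)))"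
  have \<gamma>: "0 < \<gamma>" "\<gamma> \<le> 1" using c2 by (auto simp: \<gamma>_def)
  have young: "ennreal (\<gamma> powr (1 / (1 / p x - 1 / p y))) \<le> h x + h y" if xy: "p x < p y" for x y
  proof -
    define \<delta> where "\<delta> = 1 / p x - 1 / p y"
    have \<delta>: "0 < \<delta>" using xy p[of x] p[of y] by (simp add: \<delta>_def frac_less2)
    have key: "ennreal (\<gamma> powr (1 / \<delta>)) \<le> h z" if z: "norm z \<le> norm x" "norm z \<le> norm y" for z
    proof -
      have ln1: "1 \<le> ln (exp 1 + norm u)" for u :: 'a
        by (metis add_increasing2 exp_gt_zero ln_exp ln_ge_iff norm_ge_zero order.refl add_pos_nonneg)
      have "\<delta> \<le> c2 / ln (exp 1 + norm x) + c2 / ln (exp 1 + norm y)"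
        using c2(2)[of x] c2(2)[of y] unfolding \<delta>_def by (simp add: abs_le_iff)
      also have "\<dots> \<le> c2 / ln (exp 1 + norm z) + c2 / ln (exp 1 + norm z)"
        using ln1[of z] z c2(1) by (intro add_mono frac_le) (auto intro!: ln_mono add_pos_nonneg)
      finally have "\<delta> * ln (exp 1 + norm z) \<le> 2 * c2"
        using ln1[of z] by (simp add: field_simps)
      then have "ln (exp 1 + norm z) * (?n + 1) \<le> (2 * c2 / \<delta>) * (?n + 1)"
        using \<delta> by (intro mult_right_mono) (auto simp: field_simps)
      moreover have "\<gamma> powr (1 / \<delta>) = exp (- ((2 * c2 / \<delta>) * (?n + 1)))"
        by (simp add: \<gamma>_def powr_def)
      moreover have "exp 1 + norm z \<noteq> 0" by (smt (verit) exp_gt_zero norm_ge_zero)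
      then have "(exp 1 + norm z) powr (- (?n + 1)) = exp (- (ln (exp 1 + norm z) * (?n + 1)))"
        unfolding powr_def by (metis minus_mult_left mult.commute)
      ultimately have "\<gamma> powr (1 / \<delta>) \<le> (exp 1 + norm z) powr (- (?n + 1))" by simp
      also have "\<dots> \<le> (1 + norm z) powr (- (?n + 1))"
        by (intro powr_mono2') (auto simp: add_pos_nonneg)
      finally show ?thesis by (auto simp: h_def eta_def intro!: ennreal_leI)
    qed
    show ?thesis
    proof (cases "norm x \<le> norm y")
      case True
      then show ?thesis using key[of x] unfolding \<delta>_def by (auto intro: order_trans)
    next
      case False
      then show ?thesis using key[of y] unfolding \<delta>_def by (auto intro: order_trans)
    qed
  qed
  define \<omega> where "\<omega> = unit_ball_vol ?n"
  have \<omega>: "0 < \<omega>" by (simp add: \<omega>_def)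
  \<comment> \<open>The first factor accounts for the volume of the unit ball. The second is the
    value of \<open>(exp 1 + 1 / r) powr (?n * \<theta>)\<close>, which no longer depends on the
    radius \<open>r\<close>.\<close>
  define B where "B = max 1 (1 / \<omega>) powr c1 * exp (?n * c1)"
  have "1 * 1 \<le> B" unfolding B_def using c1 by (intro mult_mono ge_one_powr_ge_zero) auto
  then have B: "1 \<le> B" by simp
  show thesis
  proof
    show "0 < 3 * B / \<gamma> * (3 + 2 * H)" using B \<gamma> H by (intro mult_pos_pos divide_pos_pos) auto
    fix r :: real and g :: "'a \<Rightarrow> ennreal"
    assume r: "0 < r" and gm: "g \<in> borel_measurable borel" and g1: "modular lborel p g \<le> 1"
    define V where "V = \<omega> * r powr ?n"
    have V: "0 < V" "emeasure lborel (ball z r) = ennreal V" for z :: 'a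
      using r \<omega> by (auto simp: V_def \<omega>_def emeasure_ball_powr)
    define K :: "'a \<Rightarrow> 'a \<Rightarrow> ennreal" where "K x y = indicator (ball x r) y / emeasure lborel (ball (0::'a) r)" for x y
    have K: "K x y = indicator {z. norm z < r} (x - y) / ennreal V" for x y
      by (auto simp: K_def V indicator_def dist_norm)
    have sym: "K x y = K y x" for x y
      by (auto simp: K indicator_def norm_minus_commute)
    have [measurable]: "{z::'a. norm z < r} \<in> sets borel" by measurable
    have [measurable]: "(\<lambda>(x, y). K x y) \<in> borel_measurable (lborel \<Otimes>\<^sub>M lborel)"
      unfolding K by measurable
    have K1: "(\<integral>\<^sup>+y. K x y \<partial>lborel) = 1" for x
    proof -
    have "(\<integral>\<^sup>+y. K x y \<partial>lborel) = (\<integral>\<^sup>+y. indicator (ball x r) y \<partial>lborel) / ennreal V"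
      unfolding K_def V by (intro nn_integral_divide borel_measurable_indicator) auto
    then show ?thesis using V by (simp add: divide_ennreal)
  qed
    have big: "epowr ((\<integral>\<^sup>+y. K x y * (if 1 < g y then g y else 0) \<partial>lborel) / ennreal B) (p x)
          \<le> (\<integral>\<^sup>+y. K x y * epowr (g y) (p y) \<partial>lborel)"
      if [measurable]: "g \<in> borel_measurable lborel" and g1: "modular lborel p g \<le> 1" for g :: "'a \<Rightarrow> ennreal" and x
    proof -
      have [measurable]: "(\<lambda>y. K x y) \<in> borel_measurable borel" unfolding K by measurable
      define A where "A = (\<integral>\<^sup>+y. K x y * (if 1 < g y then g y else 0) \<partial>lborel)"
      define F where "F = (\<integral>\<^sup>+y. K x y * epowr (g y) (p y) \<partial>lborel)"
      define \<theta> where "\<theta> = c1 / ln (exp 1 + 1 / r)"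
      have lnr: "1 \<le> ln (exp 1 + 1 / r)"
        using r by (subst ln_ge_iff) (auto intro!: add_pos_nonneg)
      have \<theta>: "0 < \<theta>" "\<theta> \<le> c1" using c1 lnr by (auto simp: \<theta>_def field_simps)
      \<comment> \<open>On the reciprocal scale this is the largest value that log-Hoelder
        continuity allows \<open>1 / p\<close> on the ball, truncated at 1 so that \<open>P\<close>
        is at least 1.\<close>
      define P where "P = 1 / min 1 (1 / p x + \<theta>)"
      have px: "0 < 1 / p x" "1 / p x \<le> 1" using p[of x] by auto
      have "0 < 1 / p x + \<theta>" by (rule add_pos_pos[OF px(1) \<theta>(1)])
      then have "0 < min 1 (1 / p x + \<theta>)" "min 1 (1 / p x + \<theta>) \<le> 1" by simp_all
      then have P: "1 \<le> P" "1 / P = min 1 (1 / p x + \<theta>)" by (simp_all add: P_def)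
      have Ple: "P \<le> p y" if "1 / p y \<le> 1 / p x + \<theta>" for y
      proof -
        have "1 / p y \<le> 1 / P" using that p[of y] by (simp add: P)
        then have "inverse (p y) \<le> inverse P" unfolding inverse_eq_divide .
        then show ?thesis using p[of y] by (intro inverse_le_imp_le[of "p y" P]) auto
      qed
      have Py: "P \<le> p y" if y: "y \<in> ball x r" for y
      proof (cases "y = x")
        case False
        then have "0 < norm (y - x)" "norm (y - x) < r" using y by (auto simp: dist_norm norm_minus_commute)
        then have "1 / r \<le> 1 / norm (y - x)" by (intro frac_le) auto
        then have "c1 / ln (exp 1 + 1 / norm (y - x)) \<le> \<theta>"
          unfolding \<theta>_def using c1 lnr r by (intro frac_le ln_mono) (auto intro!: add_pos_nonneg)
        then show ?thesis using c1(2)[of y x] by (intro Ple) (auto simp: abs_le_iff)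
      qed (use Ple[of x] \<theta> in auto)
      have "F \<le> (\<integral>\<^sup>+y. epowr (g y) (p y) / ennreal V \<partial>lborel)"
        unfolding F_def K by (intro nn_integral_mono) (auto simp: indicator_def divide_ennreal_def mult.commute)
      also have "\<dots> = modular lborel p g / ennreal V"
        unfolding modular_def by (intro nn_integral_divide) measurable
      also have "\<dots> \<le> 1 / ennreal V" using g1 by (intro divide_right_mono_ennreal)
      also have "\<dots> = ennreal (1 / V)" using V by (simp add: divide_ennreal[symmetric])
      finally have FV: "F \<le> ennreal (1 / V)" .
      then obtain f where f: "F = ennreal f" "0 \<le> f" "f \<le> 1 / V"
        using V by (cases F) (auto simp: top_unique)
      have "epowr A P \<le> (\<integral>\<^sup>+y. K x y * epowr (if 1 < g y then g y else 0) P \<partial>lborel)"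
        unfolding A_def using K1[of x] P by (intro epowr_Jensen) auto
      also have "\<dots> \<le> F" unfolding F_def
      proof (intro nn_integral_mono)
        fix y
        show "K x y * epowr (if 1 < g y then g y else 0) P \<le> K x y * epowr (g y) (p y)"
          using Py[of y] by (cases "y \<in> ball x r") (auto simp: K_def intro!: mult_left_mono epowr_mono_exp)
      qed
      finally have AP: "epowr A P \<le> ennreal f" using f by simp
      then obtain a' where a': "A = ennreal a'" "0 \<le> a'" by (cases A) (auto simp: top_unique)
      have vB: "max 1 (1 / V) powr (1 / P - 1 / p x) \<le> B"
      proof -
        have "1 / V = (1 / \<omega>) * (1 / r) powr ?n" using r by (simp add: V_def powr_divide)
        also have "\<dots> \<le> max 1 (1 / \<omega>) * (exp 1 + 1 / r) powr ?n"
          using r \<omega> by (intro mult_mono powr_mono2) auto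
        finally have 1: "1 / V \<le> max 1 (1 / \<omega>) * (exp 1 + 1 / r) powr ?n" .
        have "1 \<le> exp 1 + 1 / r" using r by (simp add: add_increasing2)
        then have "1 * 1 \<le> max 1 (1 / \<omega>) * (exp 1 + 1 / r) powr ?n"
          by (intro mult_mono ge_one_powr_ge_zero) auto
        with 1 have "max 1 (1 / V) \<le> max 1 (1 / \<omega>) * (exp 1 + 1 / r) powr ?n" by simp
        moreover have d: "1 / P - 1 / p x \<le> \<theta>" "0 \<le> 1 / P - 1 / p x" using P px \<theta> by (auto simp: min_def)
        ultimately have "max 1 (1 / V) powr (1 / P - 1 / p x) \<le> (max 1 (1 / \<omega>) * (exp 1 + 1 / r) powr ?n) powr \<theta>"
          by (intro order_trans[OF powr_mono powr_mono2]) (use \<theta> in auto)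
        also have "\<dots> = max 1 (1 / \<omega>) powr \<theta> * (exp 1 + 1 / r) powr (?n * \<theta>)"
          using r by (simp add: powr_mult powr_powr)
        also have "(exp 1 + 1 / r) powr (?n * \<theta>) = exp (?n * c1)"
        proof -
          have "\<theta> * ln (exp 1 + 1 / r) = c1" using lnr by (simp add: \<theta>_def)
          moreover have "exp 1 + 1 / r \<noteq> 0" using r by (smt (verit) divide_pos_pos exp_gt_zero)
          ultimately show ?thesis by (simp add: powr_def mult.assoc)
        qed
        also have "max 1 (1 / \<omega>) powr \<theta> * exp (?n * c1) \<le> B"
          unfolding B_def using \<theta> by (intro mult_right_mono powr_mono) auto
        finally show ?thesis .
      qed
      have "epowr (A / ennreal B) (p x) = ennreal ((a' / B) powr p x)"
        using a' B by (simp add: divide_ennreal epowr_ennreal)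
      also have "\<dots> \<le> ennreal f"
      proof (intro ennreal_leI powr_exponent_transfer)
        show "a' powr P \<le> f" using AP a' f by (simp add: epowr_ennreal)
        show "f \<le> max 1 (1 / V)" using f by auto
      qed (use a' P vB Ple[of x] \<theta> in auto)
      finally show ?thesis using f by (simp add: A_def F_def)
    qed
    show "modular lborel p (\<lambda>x. ball_avg r g x / ennreal (3 * B / \<gamma> * (3 + 2 * H))) \<le> 1"
      unfolding ball_avg_def K_def[symmetric]
    proof (rule modular_kernel_bound[where h=h])
      show "(\<integral>\<^sup>+x. K x y \<partial>lborel) \<le> 1" for y using K1[of y] by (simp add: sym[of _ y])
    qed (use p gm g1 \<gamma> B H young big K1 in \<open>auto simp: sigma_finite_lborel\<close>)
  qed
qed

lemma borel_measurable_ball_avg [measurable]: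
  assumes [measurable]: "g \<in> borel_measurable borel"
  shows "ball_avg r g \<in> borel_measurable borel"
proof -
  have [measurable]: "{z::'a. norm z < r} \<in> sets borel" by measurable
  have "ball_avg r g = (\<lambda>x. \<integral>\<^sup>+y. indicator {z. norm z < r} (x - y) / emeasure lborel (ball (0::'a) r) * g y \<partial>lborel)"
    by (auto simp: ball_avg_def fun_eq_iff indicator_def dist_norm intro!: nn_integral_cong)
  then show ?thesis by simp
qed

lemma log_holder_cmult:
  assumes "log_holder g" "0 < c"
  shows "log_holder (\<lambda>x. c * g x)"
proof -
  obtain c1 where c1: "c1 > 0" "\<And>x y. \<bar>g x - g y\<bar> \<le> c1 / ln (exp 1 + 1 / norm (x - y))"
    using assms by (auto simp: log_holder_def log_holder_loc_def)
  obtain ginf c2 where c2: "c2 > 0" "\<And>x. \<bar>g x - ginf\<bar> \<le> c2 / ln (exp 1 + norm x)"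
    using assms by (auto simp: log_holder_def)
  have "\<bar>c * g x - c * g y\<bar> \<le> c * c1 / ln (exp 1 + 1 / norm (x - y))" for x y
    using mult_left_mono[OF c1(2)[of x y], of c] \<open>0 < c\<close> by (simp add: abs_mult right_diff_distrib[symmetric])
  moreover have "\<bar>c * g x - c * ginf\<bar> \<le> c * c2 / ln (exp 1 + norm x)" for x
    using mult_left_mono[OF c2(2)[of x], of c] \<open>0 < c\<close> by (simp add: abs_mult right_diff_distrib[symmetric])
  moreover have "0 < c * c1" "0 < c * c2" using c1 c2 \<open>0 < c\<close> by auto
  ultimately show ?thesis unfolding log_holder_def log_holder_loc_def by blast
qed

lemma log_holder_exponent_measurable:
  fixes p :: "'a::euclidean_space \<Rightarrow> real"
  assumes p: "\<And>x. 1 \<le> p x" and lh: "log_holder (\<lambda>x. 1 / p x)"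
  shows "continuous_on UNIV p" "p \<in> borel_measurable borel"
proof -
  have "continuous_on UNIV (\<lambda>x. 1 / p x)"
    using lh by (auto simp: log_holder_def intro: log_holder_loc_continuous)
  moreover have "1 / p x \<noteq> 0" for x using p[of x] by simp
  ultimately have "continuous_on UNIV (\<lambda>x. 1 / (1 / p x))"
    using continuous_on_divide[OF continuous_on_const[of UNIV 1], of "\<lambda>x. 1 / p x"] by simp
  then show "continuous_on UNIV p" by simp
  then show "p \<in> borel_measurable borel" by (rule borel_measurable_continuous_onI)
qed

text \<open>Minkowski's inequality over the dyadic balls: the averages have a common bound, and the
  weights are summable because \<open>m\<close> exceeds the dimension.\<close>

lemma eta_lux:
  fixes p :: "'a::euclidean_space \<Rightarrow> real"
  assumes p: "\<And>x. 1 \<le> p x" and lh: "log_holder (\<lambda>x. 1 / p x)" and m: "real DIM('a) < m"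
  obtains D where "0 < D" "\<And>t g. 0 < t \<Longrightarrow> g \<in> borel_measurable borel \<Longrightarrow>
      lux lborel p (\<lambda>x. \<integral>\<^sup>+y. eta t m (x - y) * g y \<partial>lborel) \<le> ennreal D * lux lborel p g"
proof -
  note [measurable] = log_holder_exponent_measurable(2)[OF p lh]
  have p0: "0 \<le> p x" for x using p[of x] by simp
  obtain D0 where D0: "0 < D0" "\<And>r g. 0 < r \<Longrightarrow> g \<in> borel_measurable borel \<Longrightarrow> modular lborel p g \<le> 1 \<Longrightarrow>
      modular lborel p (\<lambda>x. ball_avg r g x / ennreal D0) \<le> 1"
    using ball_avg_modular[OF p lh] by blast
  define W where "W = enn2real (\<Sum>j. ennreal (eta_weight TYPE('a) m j))"
  have W: "0 \<le> W" "(\<Sum>j. ennreal (eta_weight TYPE('a) m j)) = ennreal W"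
    using eta_weight_summable[OF m] by (auto simp: W_def)
  have avg: "lux lborel p (ball_avg r g) \<le> ennreal D0 * lux lborel p g"
    if "0 < r" and [measurable]: "g \<in> borel_measurable borel" for r and g :: "'a \<Rightarrow> ennreal"
  proof (rule lux_le_of_modular)
    show "ball_avg r (\<lambda>y. c * g y) x = c * ball_avg r g x" for c x
    proof -
      have "(\<lambda>y. indicator (ball x r) y :: ennreal) \<in> borel_measurable borel"
        by (intro borel_measurable_indicator) auto
      then show ?thesis
        unfolding ball_avg_def by (subst nn_integral_cmult[symmetric]) (auto simp: mult_ac)
    qed
  qed (use D0 that p0 in auto)
  show thesis
  proof
    show "0 < (W + 1) * D0" using W D0 by simp
    fix t :: real and g :: "'a \<Rightarrow> ennreal"
    assume t: "0 < t" and [measurable]: "g \<in> borel_measurable borel"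
    have "lux lborel p (\<lambda>x. \<integral>\<^sup>+y. eta t m (x - y) * g y \<partial>lborel)
        \<le> lux lborel p (\<lambda>x. \<integral>\<^sup>+j. ennreal (eta_weight TYPE('a) m j) * ball_avg (2 ^ j * t) g x \<partial>count_space UNIV)"
      using t m p0 by (intro lux_mono eta_conv_le) auto
    also have "\<dots> \<le> (\<integral>\<^sup>+j. ennreal (eta_weight TYPE('a) m j) * lux lborel p (ball_avg (2 ^ j * t) g) \<partial>count_space UNIV)"
    proof (rule lux_nn_integral_le)
      show "sigma_finite_measure (count_space (UNIV :: nat set))"
        by (intro sigma_finite_measure_count_space_countable) auto
      show "(\<lambda>(j, x). ball_avg (2 ^ j * t) g x) \<in> borel_measurable (count_space UNIV \<Otimes>\<^sub>M lborel)"
        by (intro measurable_pair_measure_countable1) auto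
      show "(\<integral>\<^sup>+j. ennreal (eta_weight TYPE('a) m j) \<partial>count_space UNIV) < \<infinity>"
        using eta_weight_summable[OF m] by (simp add: nn_integral_count_space_nat)
    qed (use p sigma_finite_lborel in auto)
    also have "\<dots> \<le> (\<integral>\<^sup>+j. ennreal (eta_weight TYPE('a) m j) * (ennreal D0 * lux lborel p g) \<partial>count_space UNIV)"
      using t by (intro nn_integral_mono mult_left_mono avg) auto
    also have "\<dots> = ennreal W * (ennreal D0 * lux lborel p g)"
      by (simp add: nn_integral_multc nn_integral_count_space_nat W)
    also have "\<dots> \<le> ennreal (W + 1) * (ennreal D0 * lux lborel p g)"
      by (intro mult_right_mono ennreal_leI) auto
    also have "\<dots> = ennreal ((W + 1) * D0) * lux lborel p g"
      using W D0 by (simp add: ennreal_mult mult.assoc)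
    finally show "lux lborel p (\<lambda>x. \<integral>\<^sup>+y. eta t m (x - y) * g y \<partial>lborel) \<le> ennreal ((W + 1) * D0) * lux lborel p g" .
  qed
qed

lemma epowr_divide:
  assumes "0 < E" "0 < s"
  shows "epowr (u / ennreal E) s = epowr u s / ennreal (E powr s)"
  using assms by (simp add: divide_ennreal_def epowr_mult inverse_ennreal epowr_ennreal inverse_powr)

text \<open>The \<open>r\<close>-th powers live in the space with exponent
  \<open>p / r \<ge> 1\<close>, so the case of first powers applies to them; taking the root turns
  its modular bound into one for \<open>p\<close>.\<close>

lemma eta_lux_root:
  fixes p :: "'a::euclidean_space \<Rightarrow> real"
  assumes r: "1 \<le> r" "\<And>x. r \<le> p x" and lh: "log_holder (\<lambda>x. 1 / p x)" and m: "real DIM('a) < m"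
  obtains D where "0 < D" "\<And>t g. 0 < t \<Longrightarrow> g \<in> borel_measurable borel \<Longrightarrow>
      lux lborel p (\<lambda>x. epowr (\<integral>\<^sup>+y. eta t m (x - y) * epowr (g y) r \<partial>lborel) (1 / r)) \<le> ennreal D * lux lborel p g"
proof -
  have p: "1 \<le> p x" for x using r(1) r(2)[of x] by linarith
  have p0: "0 \<le> p x" for x using p[of x] by simp
  have pr: "1 \<le> p x / r" for x using r(1) r(2)[of x] by (simp add: divide_simps)
  have pr0: "0 \<le> p x / r" for x using pr[of x] by simp
  have "log_holder (\<lambda>x. 1 / (p x / r))"
    using log_holder_cmult[OF lh, of r] r by simp
  from eta_lux[OF pr this m] obtain D0 where D0: "0 < D0" "\<And>t g. 0 < t \<Longrightarrow> g \<in> borel_measurable borel \<Longrightarrow>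
      lux lborel (\<lambda>x. p x / r) (\<lambda>x. \<integral>\<^sup>+y. eta t m (x - y) * g y \<partial>lborel) \<le> ennreal D0 * lux lborel (\<lambda>x. p x / r) g"
    by blast
  show thesis
  proof
    show "0 < (D0 + 1) powr (1 / r)" using D0 by simp
    fix t :: real and g :: "'a \<Rightarrow> ennreal"
    assume t: "0 < t" and g [measurable]: "g \<in> borel_measurable borel"
    show "lux lborel p (\<lambda>x. epowr (\<integral>\<^sup>+y. eta t m (x - y) * epowr (g y) r \<partial>lborel) (1 / r))
        \<le> ennreal ((D0 + 1) powr (1 / r)) * lux lborel p g"
    proof (rule lux_le_of_modular[where T="\<lambda>g x. epowr (\<integral>\<^sup>+y. eta t m (x - y) * epowr (g y) r \<partial>lborel) (1 / r)"])
      fix g' :: "'a \<Rightarrow> ennreal"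
      assume "g' \<in> borel_measurable lborel" and g': "modular lborel p g' \<le> 1"
      then have [measurable]: "g' \<in> borel_measurable borel" by simp
      have "modular lborel (\<lambda>x. p x / r) (\<lambda>y. epowr (g' y) r / ennreal 1) \<le> 1"
        using g' r by (simp add: modular_def epowr_epowr divide_ennreal_def)
      then have "lux lborel (\<lambda>x. p x / r) (\<lambda>y. epowr (g' y) r) \<le> ennreal 1"
        by (rule lux_le) simp
      then have "ennreal D0 * lux lborel (\<lambda>x. p x / r) (\<lambda>y. epowr (g' y) r) \<le> ennreal D0 * 1"
        by (intro mult_left_mono) auto
      with D0(2)[OF t, of "\<lambda>y. epowr (g' y) r"]
      have "lux lborel (\<lambda>x. p x / r) (\<lambda>x. \<integral>\<^sup>+y. eta t m (x - y) * epowr (g' y) r \<partial>lborel) \<le> ennreal D0"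
        by simp
      \<comment> \<open>The extra 1 makes the bound strict, as \<open>lux_less\<close>
        requires.\<close>
      also have "ennreal D0 < ennreal (D0 + 1)" using D0 by (simp add: ennreal_less_iff)
      finally have "modular lborel (\<lambda>x. p x / r) (\<lambda>x. (\<integral>\<^sup>+y. eta t m (x - y) * epowr (g' y) r \<partial>lborel) / ennreal (D0 + 1)) \<le> 1"
        by (rule lux_less[OF _ pr0])
      moreover have "epowr (u / ennreal (D0 + 1)) (p x / r) = epowr (epowr u (1 / r) / ennreal ((D0 + 1) powr (1 / r))) (p x)" for u x
      proof -
        have "epowr u (1 / r) / ennreal ((D0 + 1) powr (1 / r)) = epowr (u / ennreal (D0 + 1)) (1 / r)"
          using D0 r by (intro epowr_divide[symmetric]) auto
        then show ?thesis by (simp add: epowr_epowr)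
      qed
      ultimately show "modular lborel p (\<lambda>x. epowr (\<integral>\<^sup>+y. eta t m (x - y) * epowr (g' y) r \<partial>lborel) (1 / r) / ennreal ((D0 + 1) powr (1 / r))) \<le> 1"
        by (simp add: modular_def)
    next
      fix c x
      have "(\<integral>\<^sup>+y. eta t m (x - y) * epowr (c * g y) r \<partial>lborel) = epowr c r * (\<integral>\<^sup>+y. eta t m (x - y) * epowr (g y) r \<partial>lborel)"
        using r by (subst nn_integral_cmult[symmetric]) (auto simp: epowr_mult mult_ac)
      then show "epowr (\<integral>\<^sup>+y. eta t m (x - y) * epowr (c * g y) r \<partial>lborel) (1 / r) = c * epowr (\<integral>\<^sup>+y. eta t m (x - y) * epowr (g y) r \<partial>lborel) (1 / r)"
        using r by (simp add: epowr_mult epowr_epowr)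
    qed (use D0 p0 in auto)
  qed
qed

section \<open>The measure dt / t on the unit interval and Hardy's inequality\<close>

definition dtt :: "real measure" where
  "dtt = density lebesgue (\<lambda>t. indicator {0<..1} t * ennreal (1 / t))"

lemma sets_dtt [measurable_cong]: "sets dtt = sets lebesgue"
  and space_dtt [simp]: "space dtt = UNIV"
  by (auto simp: dtt_def)

lemma sigma_finite_lebesgue: "sigma_finite_measure (lebesgue :: 'a::euclidean_space measure)"
proof
  show "\<exists>A::'a set set. countable A \<and> A \<subseteq> sets lebesgue \<and> \<Union> A = space lebesgue \<and> (\<forall>a\<in>A. emeasure lebesgue a \<noteq> \<infinity>)"
    by (rule exI[of _ "range (\<lambda>n::nat. cball 0 (real n))"])
      (auto simp: emeasure_cball intro: real_arch_simple)
qed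

lemma sigma_finite_dtt: "sigma_finite_measure dtt"
proof -
  interpret sigma_finite_measure "lebesgue :: real measure" by (rule sigma_finite_lebesgue)
  have "(\<lambda>t::real. indicator {0<..1} t * ennreal (1 / t)) \<in> borel_measurable borel" by measurable
  then have "(\<lambda>t::real. indicator {0<..1} t * ennreal (1 / t)) \<in> borel_measurable lebesgue"
    by (simp add: measurable_completion)
  then show ?thesis
    unfolding dtt_def by (subst sigma_finite_iff_density_finite) (auto simp: indicator_def)
qed

lemma nn_integral_dtt:
  assumes "f \<in> borel_measurable lebesgue"
  shows "(\<integral>\<^sup>+t. f t \<partial>dtt) = (\<integral>\<^sup>+t\<in>{0<..1}. f t * ennreal (1 / t) \<partial>lebesgue)"
proof -
  have "(\<lambda>t::real. indicator {0<..1} t * ennreal (1 / t)) \<in> borel_measurable borel" by measurable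
  then have "(\<lambda>t::real. indicator {0<..1} t * ennreal (1 / t)) \<in> borel_measurable lebesgue"
    by (simp add: measurable_completion)
  then show ?thesis using assms
    unfolding dtt_def by (subst nn_integral_density) (auto simp: mult_ac)
qed

lemma lux_norm_dt_eq:
  assumes "g \<in> borel_measurable lebesgue" "q \<in> borel_measurable lebesgue"
  shows "lux_norm_dt q {0<..1} g = lux dtt q g"
proof -
  note [measurable] = assms
  show ?thesis
    unfolding lux_norm_dt_def lux_def modular_def by (subst nn_integral_dtt) auto
qed

lemma lux_norm_eq: "lux_norm p g = lux lborel p g"
  by (simp add: lux_norm_def lux_def modular_def nn_integral_completion)

text \<open>Proved from the integrals themselves and hence valid for functions not known to be
  measurable; the norm of \<open>maximal\<close> as a function of \<open>t\<close> is such a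
  function.\<close>

lemma lux_norm_dt_mono:
  assumes "\<And>t. t \<in> I \<Longrightarrow> f t \<le> g t" "\<And>t. 0 \<le> q t"
  shows "lux_norm_dt q I f \<le> lux_norm_dt q I g"
  unfolding lux_norm_dt_def
proof (rule Inf_superset_mono, clarify)
  fix \<mu> :: real assume \<mu>: "0 < \<mu>" "(\<integral>\<^sup>+t\<in>I. epowr (g t / ennreal \<mu>) (q t) * ennreal (1 / t) \<partial>lebesgue) \<le> 1"
  have "(\<integral>\<^sup>+t\<in>I. epowr (f t / ennreal \<mu>) (q t) * ennreal (1 / t) \<partial>lebesgue)
      \<le> (\<integral>\<^sup>+t\<in>I. epowr (g t / ennreal \<mu>) (q t) * ennreal (1 / t) \<partial>lebesgue)"
    using assms by (intro nn_integral_mono)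
      (auto simp: indicator_def intro!: mult_right_mono epowr_mono divide_right_mono_ennreal)
  then show "\<exists>\<mu>'. ennreal \<mu> = ennreal \<mu>' \<and> 0 < \<mu>' \<and> (\<integral>\<^sup>+t\<in>I. epowr (f t / ennreal \<mu>') (q t) * ennreal (1 / t) \<partial>lebesgue) \<le> 1"
    using \<mu> by (auto intro: order_trans)
qed

text \<open>Split at \<open>s = t\<close>: either half contributes at most
  \<open>1 / \<delta>\<close>, whatever \<open>t\<close> is.\<close>

lemma nn_integral_min_kernel:
  assumes t: "0 < (t::real)" and \<delta>: "0 < \<delta>"
  shows "(\<integral>\<^sup>+s\<in>{0<..1}. ennreal (min (s / t) (t / s) powr \<delta>) * ennreal (1 / s) \<partial>lborel) \<le> ennreal (2 / \<delta>)"
proof -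
  define f1 where "f1 s = t powr (- \<delta>) * s powr (\<delta> - 1)" for s
  define f2 where "f2 s = t powr \<delta> * s powr (- \<delta> - 1)" for s
  have [measurable]: "f1 \<in> borel_measurable borel" "f2 \<in> borel_measurable borel"
    unfolding f1_def f2_def by measurable
  have "(f1 has_integral (t powr (- \<delta>) * (t powr (\<delta> - 1 + 1) / (\<delta> - 1 + 1)))) {0..t}"
    unfolding f1_def using t \<delta> by (intro has_integral_mult_right has_integral_powr_from_0) auto
  also have "t powr (- \<delta>) * (t powr (\<delta> - 1 + 1) / (\<delta> - 1 + 1)) = 1 / \<delta>"
    using t \<delta> by (simp add: powr_minus field_simps)
  finally have I1: "(\<integral>\<^sup>+s. ennreal (indicator {0..t} s * f1 s) \<partial>lborel) = ennreal (1 / \<delta>)"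
    by (intro nn_integral_has_integral_lebesgue) (auto simp: f1_def)
  have "(f2 has_integral (t powr \<delta> * (- (t powr (- \<delta> - 1 + 1)) / (- \<delta> - 1 + 1)))) {t..}"
    unfolding f2_def using t \<delta> by (intro has_integral_mult_right has_integral_powr_to_inf) auto
  also have "t powr \<delta> * (- (t powr (- \<delta> - 1 + 1)) / (- \<delta> - 1 + 1)) = 1 / \<delta>"
    using t \<delta> by (simp add: powr_minus field_simps)
  finally have I2: "(\<integral>\<^sup>+s. ennreal (indicator {t..} s * f2 s) \<partial>lborel) = ennreal (1 / \<delta>)"
    by (intro nn_integral_has_integral_lebesgue) (auto simp: f2_def)
  have "(\<integral>\<^sup>+s\<in>{0<..1}. ennreal (min (s / t) (t / s) powr \<delta>) * ennreal (1 / s) \<partial>lborel)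
      \<le> (\<integral>\<^sup>+s. ennreal (indicator {0..t} s * f1 s) + ennreal (indicator {t..} s * f2 s) \<partial>lborel)"
  proof (rule nn_integral_mono)
    fix s :: real
    show "ennreal (min (s / t) (t / s) powr \<delta>) * ennreal (1 / s) * indicator {0<..1} s
        \<le> ennreal (indicator {0..t} s * f1 s) + ennreal (indicator {t..} s * f2 s)"
    proof (cases "0 < s \<and> s \<le> 1")
      case True
      then have s: "0 < s" by simp
      show ?thesis
      proof (cases "s \<le> t")
        case le: True
        have "min (s / t) (t / s) powr \<delta> * (1 / s) \<le> (s / t) powr \<delta> * (1 / s)"
          using s t \<delta> by (intro mult_right_mono powr_mono2) auto
        also have "\<dots> = f1 s"
          using s t by (simp add: f1_def powr_divide powr_minus powr_diff field_simps)
        finally have "ennreal (min (s / t) (t / s) powr \<delta> * (1 / s)) \<le> ennreal (f1 s)" by (rule ennreal_leI)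
        then show ?thesis using True le by (simp add: ennreal_mult[symmetric] add_increasing2)
      next
        case False
        have "min (s / t) (t / s) powr \<delta> * (1 / s) \<le> (t / s) powr \<delta> * (1 / s)"
          using s t \<delta> by (intro mult_right_mono powr_mono2) auto
        also have "\<dots> = f2 s"
          using s t by (simp add: f2_def powr_divide powr_minus powr_diff field_simps)
        finally have "ennreal (min (s / t) (t / s) powr \<delta> * (1 / s)) \<le> ennreal (f2 s)" by (rule ennreal_leI)
        then show ?thesis using True False by (simp add: ennreal_mult[symmetric] add_increasing)
      qed
    qed auto
  qed
  also have "\<dots> = ennreal (1 / \<delta>) + ennreal (1 / \<delta>)"
    by (subst nn_integral_add) (auto simp: I1 I2)
  also have "\<dots> = ennreal (2 / \<delta>)" using \<delta> by (simp flip: ennreal_plus add: field_simps)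
  finally show ?thesis .
qed

text \<open>Both Hardy operators in one: the range \<open>s \<le> t\<close> collects finer scales,
  the range \<open>s \<ge> t\<close> coarser ones, with decay \<open>\<delta>\<close> in the
  ratio.\<close>

definition hardy :: "real \<Rightarrow> (real \<Rightarrow> ennreal) \<Rightarrow> real \<Rightarrow> ennreal" where
  "hardy \<delta> g t = (\<integral>\<^sup>+s\<in>{0<..1}. ennreal (min (s / t) (t / s) powr \<delta>) * g s * ennreal (1 / s) \<partial>lborel)"

lemma borel_measurable_hardy [measurable]:
  assumes [measurable]: "g \<in> borel_measurable borel"
  shows "hardy \<delta> g \<in> borel_measurable borel"
  unfolding hardy_def by measurable

text \<open>A scalar is a function on a one-point space; this lets bounds on functionals be proved
  through \<open>lux_le_of_modular\<close>.\<close>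

lemma lux_unit: "f () \<le> lux (count_space UNIV) (\<lambda>_. 1) f"
  unfolding lux_def
proof (rule Inf_greatest, clarsimp simp: modular_def nn_integral_count_space_finite UNIV_unit)
  fix \<mu> :: real assume "0 < \<mu>" "f () / ennreal \<mu> \<le> 1"
  then show "f () \<le> ennreal \<mu>"
    by (cases "f ()") (auto simp: divide_ennreal ennreal_top_divide top_unique)
qed

lemma nn_integral_powr_unit:
  assumes "0 < (\<delta>::real)"
  shows "(\<integral>\<^sup>+s\<in>{0<..1}. ennreal (s powr \<delta>) * ennreal (1 / s) \<partial>lborel) \<le> ennreal (1 / \<delta>)"
proof -
  have "((\<lambda>s. s powr (\<delta> - 1)) has_integral (1 powr (\<delta> - 1 + 1) / (\<delta> - 1 + 1))) {0..1}"
    using assms by (intro has_integral_powr_from_0) auto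
  then have I: "(\<integral>\<^sup>+s. ennreal (indicator {0..1} s * s powr (\<delta> - 1)) \<partial>lborel) = ennreal (1 / \<delta>)"
    by (intro nn_integral_has_integral_lebesgue) auto
  have "(\<integral>\<^sup>+s\<in>{0<..1}. ennreal (s powr \<delta>) * ennreal (1 / s) \<partial>lborel)
      \<le> (\<integral>\<^sup>+s. ennreal (indicator {0..1} s * s powr (\<delta> - 1)) \<partial>lborel)"
    by (intro nn_integral_mono) (auto simp: indicator_def ennreal_mult[symmetric] powr_diff)
  then show ?thesis using I by simp
qed

text \<open>A weak form of Hoelder's inequality. The weight is at most 1 on \<open>{0<..1}\<close>,
  so \<open>s powr \<delta> * g s\<close> is at most
  \<open>s powr \<delta> + epowr (g s) (q s)\<close>, and both summands have bounded integrals once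
  the modular is at most 1.\<close>

lemma powr_functional_le:
  fixes q :: "real \<Rightarrow> real"
  assumes q: "\<And>t. 1 \<le> q t" "q \<in> borel_measurable lebesgue" and \<delta>: "0 < \<delta>"
    and g: "g \<in> borel_measurable borel"
  shows "(\<integral>\<^sup>+s\<in>{0<..1}. ennreal (s powr \<delta>) * g s * ennreal (1 / s) \<partial>lborel)
      \<le> ennreal (1 / \<delta> + 1) * lux_norm_dt q {0<..1} g"
proof -
  note [measurable] = q(2)
  have q0: "0 \<le> q t" for t using q(1)[of t] by simp
  have gl: "g \<in> borel_measurable lebesgue" using g by (simp add: measurable_completion)
  have pl: "(\<lambda>s. ennreal (s powr \<delta>)) \<in> borel_measurable lebesgue"
    by (intro measurable_completion) measurable
  have eq: "(\<integral>\<^sup>+s\<in>{0<..1}. ennreal (s powr \<delta>) * g s * ennreal (1 / s) \<partial>lborel) = (\<integral>\<^sup>+s. ennreal (s powr \<delta>) * g s \<partial>dtt)"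
    using pl gl by (subst nn_integral_dtt) (auto simp: nn_integral_completion)
  have p1: "(\<integral>\<^sup>+s. ennreal (s powr \<delta>) \<partial>dtt) \<le> ennreal (1 / \<delta>)"
    using pl nn_integral_powr_unit[OF \<delta>] by (subst nn_integral_dtt) (auto simp: nn_integral_completion)
  have "lux (count_space UNIV) (\<lambda>_::unit. 1) (\<lambda>_. \<integral>\<^sup>+s. ennreal (s powr \<delta>) * g s \<partial>dtt) \<le> ennreal (1 / \<delta> + 1) * lux dtt q g"
  proof (rule lux_le_of_modular[where T="\<lambda>g _. \<integral>\<^sup>+s. ennreal (s powr \<delta>) * g s \<partial>dtt"])
    fix g' assume [measurable]: "g' \<in> borel_measurable dtt" and g': "modular dtt q g' \<le> 1"
    note [measurable] = pl
    have "AE s in dtt. s \<in> {0<..1}"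
      unfolding dtt_def by (subst AE_density) (auto simp: indicator_def intro!: measurable_completion)
    then have "(\<integral>\<^sup>+s. ennreal (s powr \<delta>) * g' s \<partial>dtt) \<le> (\<integral>\<^sup>+s. ennreal (s powr \<delta>) + epowr (g' s) (q s) \<partial>dtt)"
    proof (intro nn_integral_mono_AE, elim eventually_mono)
      fix s :: real assume s: "s \<in> {0<..1}"
      then have s1: "ennreal (s powr \<delta>) \<le> 1" using \<delta> by (simp add: powr_le1)
      show "ennreal (s powr \<delta>) * g' s \<le> ennreal (s powr \<delta>) + epowr (g' s) (q s)"
      proof (cases "g' s \<le> 1")
        case True
        then have "ennreal (s powr \<delta>) * g' s \<le> ennreal (s powr \<delta>) * 1" by (intro mult_left_mono) auto
        then show ?thesis by (simp add: add_increasing2)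
      next
        case False
        then have "epowr (g' s) 1 \<le> epowr (g' s) (q s)" using q(1) by (intro epowr_mono_exp) auto
        moreover have "ennreal (s powr \<delta>) * g' s \<le> 1 * g' s" using s1 by (intro mult_right_mono) auto
        ultimately have "ennreal (s powr \<delta>) * g' s \<le> epowr (g' s) (q s)" by simp
        then show ?thesis by (intro add_increasing) auto
      qed
    qed
    also have "\<dots> = (\<integral>\<^sup>+s. ennreal (s powr \<delta>) \<partial>dtt) + modular dtt q g'"
      unfolding modular_def by (intro nn_integral_add) measurable
    also have "\<dots> \<le> ennreal (1 / \<delta>) + 1" using p1 g' by (intro add_mono)
    also have "\<dots> = ennreal (1 / \<delta> + 1)" using \<delta> by simp
    finally show "modular (count_space UNIV) (\<lambda>_. 1) (\<lambda>x::unit. (\<integral>\<^sup>+s. ennreal (s powr \<delta>) * g' s \<partial>dtt) / ennreal (1 / \<delta> + 1)) \<le> 1"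
      using \<delta> by (auto simp: modular_def nn_integral_count_space_finite UNIV_unit intro!: divide_le_posI_ennreal add_pos_pos)
  next
    fix c
    note [measurable] = pl gl
    show "(\<integral>\<^sup>+s. ennreal (s powr \<delta>) * (c * g s) \<partial>dtt) = c * (\<integral>\<^sup>+s. ennreal (s powr \<delta>) * g s \<partial>dtt)"
      by (subst nn_integral_cmult[symmetric]) (auto simp: mult_ac)
  qed (use \<delta> gl q0 in \<open>auto intro!: add_pos_pos\<close>)
  then show ?thesis
    using lux_unit[of "\<lambda>_. \<integral>\<^sup>+s. ennreal (s powr \<delta>) * g s \<partial>dtt"] gl q(2)
    by (simp add: eq lux_norm_dt_eq)
qed

text \<open>Division by \<open>max 1 (1 / \<delta>)\<close> makes the values at most 1, where a
  power \<open>q \<ge> 1\<close> only lowers them, and makes the integral at most 1.\<close>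

lemma lux_powr_le:
  fixes q :: "real \<Rightarrow> real"
  assumes q: "\<And>t. 1 \<le> q t" "q \<in> borel_measurable lebesgue" and \<delta>: "0 < \<delta>"
  shows "lux dtt q (\<lambda>t. ennreal (t powr \<delta>)) \<le> ennreal (max 1 (1 / \<delta>))"
proof (rule lux_le)
  have pl [measurable]: "(\<lambda>s. ennreal (s powr \<delta>)) \<in> borel_measurable lebesgue"
    by (intro measurable_completion) measurable
  have p1: "(\<integral>\<^sup>+s. ennreal (s powr \<delta>) \<partial>dtt) \<le> ennreal (1 / \<delta>)"
    using pl nn_integral_powr_unit[OF \<delta>] by (subst nn_integral_dtt) (auto simp: nn_integral_completion)
  let ?\<mu> = "max 1 (1 / \<delta>)"
  have "AE s in dtt. s \<in> {0<..1}"
    unfolding dtt_def by (subst AE_density) (auto simp: indicator_def intro!: measurable_completion)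
  then have "modular dtt q (\<lambda>t. ennreal (t powr \<delta>) / ennreal ?\<mu>) \<le> (\<integral>\<^sup>+t. ennreal (t powr \<delta>) / ennreal ?\<mu> \<partial>dtt)"
    unfolding modular_def
  proof (intro nn_integral_mono_AE, elim eventually_mono)
    fix s :: real assume s: "s \<in> {0<..1}"
    have "s powr \<delta> \<le> ?\<mu>" using s \<delta> powr_le1[of \<delta> s] by (auto intro: order_trans)
    then have "ennreal (s powr \<delta>) / ennreal ?\<mu> \<le> 1"
      by (simp add: divide_ennreal del: max_less_iff_conj)
    then have "epowr (ennreal (s powr \<delta>) / ennreal ?\<mu>) (q s) \<le> epowr (ennreal (s powr \<delta>) / ennreal ?\<mu>) 1"
      using q(1) by (rule epowr_antimono_exp)
    then show "epowr (ennreal (s powr \<delta>) / ennreal ?\<mu>) (q s) \<le> ennreal (s powr \<delta>) / ennreal ?\<mu>" by simp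
  qed
  also have "\<dots> = (\<integral>\<^sup>+t. ennreal (t powr \<delta>) \<partial>dtt) / ennreal ?\<mu>"
    by (rule nn_integral_divide) measurable
  also have "\<dots> \<le> 1"
    using p1 by (intro divide_le_posI_ennreal) (auto intro: order_trans ennreal_leI)
  finally show "modular dtt q (\<lambda>t. ennreal (t powr \<delta>) / ennreal ?\<mu>) \<le> 1" .
qed simp

text \<open>In the variable \<open>- ln t\<close> the measure becomes Lebesgue measure on a
  half-line, the kernel an exponentially decaying convolution kernel, and log-Hoelder continuity at
  the origin a decay condition at infinity. So \<open>modular_kernel_bound\<close> applies as it
  does to ball averages.\<close>

lemma hardy_lux:
  fixes q :: "real \<Rightarrow> real"
  assumes q: "\<And>t. 1 \<le> q t" "q \<in> borel_measurable lebesgue" "log_holder_origin q"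
    and \<delta>: "0 < \<delta>" "\<delta> \<le> 1"
  obtains D where "0 < D" "\<And>g. g \<in> borel_measurable borel \<Longrightarrow> lux dtt q (hardy \<delta> g) \<le> ennreal D * lux dtt q g"
proof -
  note [measurable] = q(2)
  have q0: "0 \<le> q t" for t using q(1)[of t] by simp
  obtain c where c: "0 < c" "\<And>t. \<bar>q t - q 0\<bar> \<le> c / ln (exp 1 + 1 / norm t)"
    using q(3) by (auto simp: log_holder_origin_def)
  \<comment> \<open>The function \<open>t\<close> has integral 1 against \<open>dt / t\<close>. Off
    the unit interval, a null set for \<open>dtt\<close>, the value infinity makes the Young
    condition trivial.\<close>
  define h :: "real \<Rightarrow> ennreal" where "h t = (if 0 < t \<and> t \<le> 1 then ennreal t else \<infinity>)" for t
  \<comment> \<open>The factor \<open>\<delta> / 2\<close> normalises the mass; the indicator in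
    \<open>t\<close> makes the kernel symmetric, so the row bound is also the column bound.\<close>
  define K :: "real \<Rightarrow> real \<Rightarrow> ennreal" where
    "K t s = indicator {0<..1} t * (indicator {0<..1} s * (ennreal (\<delta> / 2) * ennreal (min (s / t) (t / s) powr \<delta>)))" for t s
  have hb: "h \<in> borel_measurable borel" unfolding h_def by measurable
  have Kb: "(\<lambda>(t, s). K t s) \<in> borel_measurable (borel \<Otimes>\<^sub>M borel)" unfolding K_def by measurable
  have id: "(\<lambda>x::real. x) \<in> measurable dtt borel"
    using measurable_completion[of "\<lambda>x::real. x" lborel borel] by (simp cong: measurable_cong_sets)
  have [measurable]: "h \<in> borel_measurable dtt" using measurable_compose[OF id hb] by simp
  have "(\<lambda>(t, s). (t, s)) \<in> measurable (dtt \<Otimes>\<^sub>M dtt) (borel \<Otimes>\<^sub>M borel)"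
    unfolding split_beta' by (intro measurable_Pair measurable_compose[OF measurable_fst id] measurable_compose[OF measurable_snd id])
  from measurable_compose[OF this Kb] have [measurable]: "(\<lambda>(t, s). K t s) \<in> borel_measurable (dtt \<Otimes>\<^sub>M dtt)"
    by (simp add: split_beta')
  have Ks: "(\<lambda>s. K t s) \<in> borel_measurable borel" for t unfolding K_def by measurable
  have K1: "(\<integral>\<^sup>+s. K t s \<partial>dtt) \<le> 1" for t
  proof (cases "0 < t \<and> t \<le> 1")
    case True
    have "(\<integral>\<^sup>+s. K t s \<partial>dtt) = (\<integral>\<^sup>+s\<in>{0<..1}. K t s * ennreal (1 / s) \<partial>lborel)"
      using measurable_completion[OF Ks] by (subst nn_integral_dtt) (auto simp: nn_integral_completion)
    also have "\<dots> = ennreal (\<delta> / 2) * (\<integral>\<^sup>+s\<in>{0<..1}. ennreal (min (s / t) (t / s) powr \<delta>) * ennreal (1 / s) \<partial>lborel)"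
      using True \<delta> by (subst nn_integral_cmult[symmetric])
        (auto simp: K_def indicator_def mult_ac intro!: nn_integral_cong)
    also have "\<dots> \<le> ennreal (\<delta> / 2) * ennreal (2 / \<delta>)"
      using True \<delta> by (intro mult_left_mono nn_integral_min_kernel) auto
    also have "\<dots> = 1" using \<delta> by (simp flip: ennreal_mult)
    finally show ?thesis .
  qed (auto simp: K_def)
  have sym: "K t s = K s t" for s t by (auto simp: K_def mult_ac min.commute)
  have Kle: "K t s \<le> 1" for t s
  proof (cases "0 < t \<and> 0 < s")
    case True
    then have "min (s / t) (t / s) \<le> 1" by (auto simp: min_le_iff_disj)
    moreover have "0 \<le> min (s / t) (t / s)" using True by auto
    ultimately have "min (s / t) (t / s) powr \<delta> \<le> 1" using \<delta> by (intro powr_le1) auto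
    then have "ennreal (\<delta> / 2) * ennreal (min (s / t) (t / s) powr \<delta>) \<le> 1 * 1" using \<delta> by (intro mult_mono) auto
    then show ?thesis by (auto simp: K_def indicator_def)
  qed (auto simp: K_def)
  \<comment> \<open>As \<open>q\<close> is at least 1, the difference \<open>d\<close> of
    reciprocals is at most \<open>q s - q t\<close>, hence at most
    \<open>2 * c / ln (exp 1 + 1 / M)\<close> with \<open>M\<close> the larger of \<open>t\<close>
    and \<open>s\<close>. This \<open>\<gamma>\<close> then satisfies
    \<open>\<gamma> powr (1 / d) \<le> M\<close>.\<close>
  define \<gamma> where "\<gamma> = exp (- (2 * c))"
  have \<gamma>: "0 < \<gamma>" "\<gamma> \<le> 1" using c by (auto simp: \<gamma>_def)
  have young: "ennreal (\<gamma> powr (1 / (1 / q t - 1 / q s))) \<le> h t + h s" if ts: "q t < q s" for t s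
  proof (cases "0 < t \<and> t \<le> 1 \<and> 0 < s \<and> s \<le> 1")
    case True
    define d where "d = 1 / q t - 1 / q s"
    have d: "0 < d" using ts q(1)[of t] q(1)[of s] by (simp add: d_def frac_less2)
    define M where "M = max t s"
    have M: "0 < M" "t \<le> M" "s \<le> M" "M \<le> t + s" using True by (auto simp: M_def)
    have lnM: "1 \<le> ln (exp 1 + 1 / M)"
      using M by (subst ln_ge_iff) (auto intro!: add_pos_nonneg)
    have "d = (q s - q t) / (q t * q s)" using q(1)[of t] q(1)[of s] by (simp add: d_def field_simps)
    also have "\<dots> \<le> (q s - q t) / 1"
      using ts q(1)[of t] q(1)[of s] mult_mono[of 1 "q t" 1 "q s"] by (intro divide_left_mono) auto
    also have "\<dots> \<le> c / ln (exp 1 + 1 / norm s) + c / ln (exp 1 + 1 / norm t)"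
      using c(2)[of s] c(2)[of t] by (simp add: abs_le_iff)
    also have "\<dots> \<le> c / ln (exp 1 + 1 / M) + c / ln (exp 1 + 1 / M)"
      using True M c(1) lnM by (intro add_mono frac_le ln_mono) (auto intro!: add_pos_nonneg frac_le)
    finally have "d * ln (exp 1 + 1 / M) \<le> 2 * c" using lnM by (simp add: field_simps)
    then have "ln (exp 1 + 1 / M) \<le> 2 * c / d" using d by (simp add: field_simps)
    then have "exp (- (2 * c / d)) \<le> exp (- ln (exp 1 + 1 / M))" by simp
    also have "\<dots> = 1 / (exp 1 + 1 / M)" using M by (simp add: exp_minus add_pos_pos inverse_eq_divide)
    also have "\<dots> \<le> 1 / (1 / M)" using M by (intro frac_le) auto
    also have "\<dots> \<le> t + s" using M by simp
    finally have "\<gamma> powr (1 / d) \<le> t + s" by (simp add: \<gamma>_def powr_def)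
    then show ?thesis using True by (simp add: h_def d_def flip: ennreal_plus)
  qed (auto simp: h_def)
  have hint: "(\<integral>\<^sup>+t. h t \<partial>dtt) \<le> ennreal 1"
  proof -
    have "(\<integral>\<^sup>+t. h t \<partial>dtt) = (\<integral>\<^sup>+t\<in>{0<..1}. h t * ennreal (1 / t) \<partial>lborel)"
      using measurable_completion[OF hb] by (subst nn_integral_dtt) (auto simp: nn_integral_completion)
    also have "\<dots> = (\<integral>\<^sup>+t\<in>{0<..1}. ennreal (t powr 1) * ennreal (1 / t) \<partial>lborel)"
      by (intro nn_integral_cong) (auto simp: h_def indicator_def)
    also have "\<dots> \<le> ennreal (1 / 1)" by (rule nn_integral_powr_unit) simp
    finally show ?thesis by simp
  qed
  \<comment> \<open>\<open>K\<close> is at most 1, so \<open>?F\<close> is at most the modular and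
    hence at most 1; the power \<open>q t\<close> then only lowers it. This gives the constant
    1.\<close>
  have big: "epowr ((\<integral>\<^sup>+s. K t s * (if 1 < g s then g s else 0) \<partial>dtt) / ennreal 1) (q t)
      \<le> (\<integral>\<^sup>+s. K t s * epowr (g s) (q s) \<partial>dtt)" if g: "modular dtt q g \<le> 1" for g t
  proof -
    let ?F = "\<integral>\<^sup>+s. K t s * epowr (g s) (q s) \<partial>dtt"
    have "?F \<le> (\<integral>\<^sup>+s. 1 * epowr (g s) (q s) \<partial>dtt)"
      using Kle by (intro nn_integral_mono mult_right_mono) auto
    also have "\<dots> \<le> 1" using g by (simp add: modular_def)
    finally have F1: "?F \<le> 1" .
    have "g s \<le> epowr (g s) (q s)" if "1 < g s" for s
      using epowr_mono_exp[of "g s" 1 "q s"] q(1)[of s] that by simp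
    then have "(\<integral>\<^sup>+s. K t s * (if 1 < g s then g s else 0) \<partial>dtt) \<le> ?F"
      by (intro nn_integral_mono mult_left_mono) auto
    then have "epowr (\<integral>\<^sup>+s. K t s * (if 1 < g s then g s else 0) \<partial>dtt) (q t) \<le> epowr ?F (q t)"
      using q0 by (intro epowr_mono)
    also have "\<dots> \<le> epowr ?F 1" using F1 q(1) by (rule epowr_antimono_exp)
    finally show ?thesis by (simp add: divide_ennreal_def)
  qed
  let ?D = "3 * 1 / \<gamma> * (3 + 2 * 1)"
  have mod: "modular dtt q (\<lambda>t. (\<integral>\<^sup>+s. K t s * g s \<partial>dtt) / ennreal ?D) \<le> 1"
    if "g \<in> borel_measurable dtt" "modular dtt q g \<le> 1" for g
  proof (rule modular_kernel_bound[where h=h])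
    show "(\<integral>\<^sup>+t. K t s \<partial>dtt) \<le> 1" for s using K1[of s] by (simp add: sym[of _ s])
    show "q \<in> borel_measurable dtt" using q(2) by (simp cong: measurable_cong_sets add: sets_dtt)
  qed (use q(1) that \<gamma> K1 hint young big sigma_finite_dtt in auto)
  show thesis
  proof
    show "0 < 2 / \<delta> * ?D" using \<delta> \<gamma> by simp
    fix g :: "real \<Rightarrow> ennreal" assume g [measurable]: "g \<in> borel_measurable borel"
    have gl: "g \<in> borel_measurable lebesgue" by (intro measurable_completion) simp
    then have gd: "g \<in> borel_measurable dtt" by (simp cong: measurable_cong_sets add: sets_dtt)
    have Kd: "(\<lambda>s. K t s) \<in> borel_measurable dtt" for t
      using measurable_completion[OF Ks[of t]] by (simp cong: measurable_cong_sets add: sets_dtt)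
    have "lux dtt q (hardy \<delta> g) \<le> lux dtt q (\<lambda>t. ennreal (2 / \<delta>) * (\<integral>\<^sup>+s. K t s * g s \<partial>dtt))"
    proof -
      have AE1: "AE t in dtt. t \<in> {0<..1}"
        unfolding dtt_def by (subst AE_density) (auto simp: indicator_def intro!: measurable_completion)
      have "hardy \<delta> g t = ennreal (2 / \<delta>) * (\<integral>\<^sup>+s. K t s * g s \<partial>dtt)" if "t \<in> {0<..1}" for t
      proof -
        have "(\<integral>\<^sup>+s. K t s * g s \<partial>dtt) = (\<integral>\<^sup>+s\<in>{0<..1}. K t s * g s * ennreal (1 / s) \<partial>lborel)"
          using gl measurable_completion[OF Ks[of t]] by (subst nn_integral_dtt) (auto simp: nn_integral_completion)
        then have "ennreal (2 / \<delta>) * (\<integral>\<^sup>+s. K t s * g s \<partial>dtt) = (\<integral>\<^sup>+s. ennreal (2 / \<delta>) * (K t s * g s * ennreal (1 / s) * indicator {0<..1} s) \<partial>lborel)"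
          using Ks by (simp add: nn_integral_cmult)
        also have "\<dots> = hardy \<delta> g t"
          unfolding hardy_def
        proof (intro nn_integral_cong)
          fix s
          have "ennreal (2 / \<delta>) * ennreal (\<delta> / 2) = 1"
            using \<delta> by (simp flip: ennreal_mult)
          then show "ennreal (2 / \<delta>) * (K t s * g s * ennreal (1 / s) * indicator {0<..1} s) =
              ennreal (min (s / t) (t / s) powr \<delta>) * g s * ennreal (1 / s) * indicator {0<..1} s"
            using that by (simp add: K_def indicator_def mult.assoc[symmetric])
        qed
        finally show ?thesis ..
      qed
      then have "AE t in dtt. hardy \<delta> g t / ennreal \<mu> \<le> ennreal (2 / \<delta>) * (\<integral>\<^sup>+s. K t s * g s \<partial>dtt) / ennreal \<mu>" for \<mu>
        using AE1 by (rule_tac eventually_mono[OF AE1]) simp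
      then have "modular dtt q (\<lambda>t. hardy \<delta> g t / ennreal \<mu>) \<le> modular dtt q (\<lambda>t. ennreal (2 / \<delta>) * (\<integral>\<^sup>+s. K t s * g s \<partial>dtt) / ennreal \<mu>)" for \<mu>
        using q0 by (rule modular_mono_AE)
      then show ?thesis unfolding lux_def by (intro Inf_superset_mono) (auto intro: order_trans)
    qed
    also have "\<dots> \<le> ennreal (2 / \<delta>) * lux dtt q (\<lambda>t. \<integral>\<^sup>+s. K t s * g s \<partial>dtt)"
    proof (rule lux_cmult_le)
      interpret sigma_finite_measure dtt by (rule sigma_finite_dtt)
      note [measurable] = gd
      show "(\<lambda>t. \<integral>\<^sup>+s. K t s * g s \<partial>dtt) \<in> borel_measurable dtt" by measurable
    qed (use \<delta> q0 in auto)
    also have "\<dots> \<le> ennreal (2 / \<delta>) * (ennreal ?D * lux dtt q g)"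
    proof (intro mult_left_mono lux_le_of_modular[where T="\<lambda>g t. \<integral>\<^sup>+s. K t s * g s \<partial>dtt"] mod)
      show "(\<integral>\<^sup>+s. K t s * (c * g s) \<partial>dtt) = c * (\<integral>\<^sup>+s. K t s * g s \<partial>dtt)" for c t
        using Kd gd by (subst nn_integral_cmult[symmetric]) (auto simp: mult_ac)
    qed (use \<gamma> gd q0 in auto)
    also have "\<dots> = ennreal (2 / \<delta> * ?D) * lux dtt q g"
      using \<delta> \<gamma> by (subst ennreal_mult) (auto simp: mult.assoc)
    finally show "lux dtt q (hardy \<delta> g) \<le> ennreal (2 / \<delta> * ?D) * lux dtt q g" .
  qed
qed

section \<open>Smooth functions and Schwartz functions\<close>

lemma partial_deriv_eqI: "(f has_derivative F) (at x) \<Longrightarrow> partial_deriv i f x = F (axis i 1)"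
  by (simp add: partial_deriv_def frechet_derivative_at[symmetric])

lemma partial_derivs_append: "partial_derivs (is @ js) f = partial_derivs is (partial_derivs js f)"
  by (induction "is") auto

lemma partial_deriv_cong:
  assumes "open U" "\<And>x. x \<in> U \<Longrightarrow> f x = g x" "x \<in> U"
  shows "partial_deriv i f x = partial_deriv i g x"
proof -
  have "(f has_derivative F) (at x) \<longleftrightarrow> (g has_derivative F) (at x)" for F
    using has_derivative_transform_within_open[of f F x UNIV U g] has_derivative_transform_within_open[of g F x UNIV U f] assms by auto
  then show ?thesis by (simp add: partial_deriv_def frechet_derivative_def)
qed

lemma partial_derivs_cong:
  assumes "open U" "\<And>x. x \<in> U \<Longrightarrow> f x = g x"
  shows "x \<in> U \<Longrightarrow> partial_derivs is f x = partial_derivs is g x"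
  by (induction "is" arbitrary: x) (auto simp: assms(2) intro: partial_deriv_cong[OF assms(1)])

definition smooth_on :: "(real^'n::finite) set \<Rightarrow> (real^'n \<Rightarrow> complex) \<Rightarrow> bool" where
  "smooth_on U f \<longleftrightarrow> (\<forall>is. \<forall>x\<in>U. partial_derivs is f differentiable (at x))"

lemma smooth_on_D: "smooth_on U f \<Longrightarrow> x \<in> U \<Longrightarrow> partial_derivs is f differentiable (at x)"
  by (simp add: smooth_on_def)

lemma smooth_on_partial_derivs: "smooth_on U f \<Longrightarrow> smooth_on U (partial_derivs is f)"
  by (auto simp: smooth_on_def partial_derivs_append[symmetric])

lemma smooth_on_partial_deriv: "smooth_on U f \<Longrightarrow> smooth_on U (partial_deriv i f)"
  using smooth_on_partial_derivs[of U f "[i]"] by simp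

lemma smooth_on_has_derivative:
  "smooth_on U f \<Longrightarrow> x \<in> U \<Longrightarrow> (f has_derivative frechet_derivative f (at x)) (at x)"
  using smooth_on_D[of U f x "[]"] by (simp add: frechet_derivative_works)

lemma smooth_on_cong:
  assumes "open U" "\<And>x. x \<in> U \<Longrightarrow> f x = g x" "smooth_on U f"
  shows "smooth_on U g"
  unfolding smooth_on_def
proof (intro allI ballI)
  fix "is" x assume x: "x \<in> U"
  obtain F where F: "(partial_derivs is f has_derivative F) (at x)"
    using smooth_on_D[OF assms(3) x] by (auto simp: differentiable_def)
  have "(partial_derivs is g has_derivative F) (at x)"
    by (rule has_derivative_transform_within_open[OF F assms(1) x])
      (use partial_derivs_cong[OF assms(1,2)] in auto)
  then show "partial_derivs is g differentiable (at x)" by (auto simp: differentiable_def)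
qed

lemma smooth_on_Un: "smooth_on U f \<Longrightarrow> smooth_on V f \<Longrightarrow> smooth_on (U \<union> V) f"
  by (auto simp: smooth_on_def)

lemma smooth_on_subset: "smooth_on U f \<Longrightarrow> V \<subseteq> U \<Longrightarrow> smooth_on V f"
  by (auto simp: smooth_on_def)

text \<open>Coinduction replaces Leibniz formulas of higher order: it suffices to exhibit a class
  whose derivatives fall back into it. Equality is required on \<open>U\<close> only, since
  elsewhere \<open>frechet_derivative\<close> may be an arbitrary value.\<close>

lemma smooth_on_coinduct:
  assumes U: "open U" and f: "P f"
    and diff: "\<And>f x. P f \<Longrightarrow> x \<in> U \<Longrightarrow> f differentiable (at x)"
    and step: "\<And>f i. P f \<Longrightarrow> \<exists>g. P g \<and> (\<forall>x\<in>U. partial_deriv i f x = g x)"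
  shows "smooth_on U f"
proof -
  have "\<forall>x\<in>U. partial_derivs is f differentiable (at x)" if "P f" for "is" f
    using that
  \<comment> \<open>The last element of the list is the derivative taken first, which is the one
    that \<open>step\<close> describes.\<close>
  proof (induction "is" arbitrary: f rule: rev_induct)
    case (snoc i "is")
    obtain g where g: "P g" "\<forall>x\<in>U. partial_deriv i f x = g x" using step[OF snoc.prems] by blast
    show ?case
    proof
      fix x assume x: "x \<in> U"
      obtain F where F: "(partial_derivs is g has_derivative F) (at x)"
        using snoc.IH[OF g(1)] x by (auto simp: differentiable_def)
      have "(partial_derivs is (partial_deriv i f) has_derivative F) (at x)"
        by (rule has_derivative_transform_within_open[OF F U x])
          (use partial_derivs_cong[OF U, of g "partial_deriv i f"] g(2) in auto)
      then show "partial_derivs (is @ [i]) f differentiable (at x)"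
        by (auto simp: differentiable_def partial_derivs_append)
    qed
  qed (use diff in auto)
  with f show ?thesis by (auto simp: smooth_on_def)
qed

lemma partial_deriv_const: "partial_deriv i (\<lambda>x. c) = (\<lambda>x. 0)"
  by (rule ext, subst partial_deriv_eqI[OF has_derivative_const]) simp

lemma smooth_on_const:
  assumes "open U" shows "smooth_on U (\<lambda>x. c)"
proof (rule smooth_on_coinduct[where P="\<lambda>f. \<exists>c. f = (\<lambda>x. c)"])
  show "\<exists>g. (\<exists>c. g = (\<lambda>x. c)) \<and> (\<forall>x\<in>U. partial_deriv i f x = g x)" if "\<exists>c. f = (\<lambda>x. c)" for f i
    using that by (auto simp: partial_deriv_const)
qed (use assms in auto)

text \<open>The invariant class consists of finite sums of products of smooth functions, listed as
  pairs; the product rule replaces each pair by two.\<close>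

lemma smooth_on_mult:
  assumes U: "open U" and f: "smooth_on U f" and g: "smooth_on U g"
  shows "smooth_on U (\<lambda>x. f x * g x)"
proof (rule smooth_on_coinduct[OF U, where P="\<lambda>F. \<exists>L. (\<forall>(u, v)\<in>set L. smooth_on U u \<and> smooth_on U v) \<and>
    F = (\<lambda>x. \<Sum>(u, v)\<leftarrow>L. u x * v x)"])
  have der: "((\<lambda>x. \<Sum>(u, v)\<leftarrow>L. u x * v x) has_derivative
      (\<lambda>h. \<Sum>(u, v)\<leftarrow>L. u x * frechet_derivative v (at x) h + frechet_derivative u (at x) h * v x)) (at x)"
    if "\<forall>(u, v)\<in>set L. smooth_on U u \<and> smooth_on U v" "x \<in> U" for L x
    using that
  proof (induction L)
    case (Cons a L)
    then show ?case
      by (cases a) (auto intro!: has_derivative_add has_derivative_mult smooth_on_has_derivative)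
  qed simp
  show "\<exists>L. (\<forall>(u, v)\<in>set L. smooth_on U u \<and> smooth_on U v) \<and> (\<lambda>x. f x * g x) = (\<lambda>x. \<Sum>(u, v)\<leftarrow>L. u x * v x)"
    by (rule exI[of _ "[(f, g)]"]) (use f g in auto)
  fix F assume "\<exists>L. (\<forall>(u, v)\<in>set L. smooth_on U u \<and> smooth_on U v) \<and> F = (\<lambda>x. \<Sum>(u, v)\<leftarrow>L. u x * v x)"
  then obtain L where L: "\<forall>(u, v)\<in>set L. smooth_on U u \<and> smooth_on U v" and F: "F = (\<lambda>x. \<Sum>(u, v)\<leftarrow>L. u x * v x)"
    by blast
  show "F differentiable (at x)" if "x \<in> U" for x
    using der[OF L that] unfolding F differentiable_def by blast
  fix i
  define L' where "L' = concat (map (\<lambda>(u, v). [(u, partial_deriv i v), (partial_deriv i u, v)]) L)"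
  have "\<forall>(u, v)\<in>set L'. smooth_on U u \<and> smooth_on U v"
    using L by (auto simp: L'_def intro: smooth_on_partial_deriv)
  moreover have "\<forall>x\<in>U. partial_deriv i F x = (\<Sum>(u, v)\<leftarrow>L'. u x * v x)"
  proof
    fix x assume x: "x \<in> U"
    have "partial_deriv i F x = (\<Sum>(u, v)\<leftarrow>L. u x * partial_deriv i v x + partial_deriv i u x * v x)"
      unfolding F partial_deriv_eqI[OF der[OF L x]] by (simp add: partial_deriv_def)
    also have "\<dots> = (\<Sum>(u, v)\<leftarrow>L'. u x * v x)"
      unfolding L'_def by (induction L) (auto simp: add.assoc)
    finally show "partial_deriv i F x = (\<Sum>(u, v)\<leftarrow>L'. u x * v x)" .
  qed
  ultimately show "\<exists>g. (\<exists>L. (\<forall>(u, v)\<in>set L. smooth_on U u \<and> smooth_on U v) \<and> g = (\<lambda>x. \<Sum>(u, v)\<leftarrow>L. u x * v x)) \<and>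
      (\<forall>x\<in>U. partial_deriv i F x = g x)"
    by blast
qed

lemma smooth_on_add:
  assumes U: "open U" and f: "smooth_on U f" and g: "smooth_on U g"
  shows "smooth_on U (\<lambda>x. f x + g x)"
proof (rule smooth_on_coinduct[OF U, where P="\<lambda>F. \<exists>u v. smooth_on U u \<and> smooth_on U v \<and> F = (\<lambda>x. u x + v x)"])
  show "\<exists>u v. smooth_on U u \<and> smooth_on U v \<and> (\<lambda>x. f x + g x) = (\<lambda>x. u x + v x)" using f g by blast
  fix F assume "\<exists>u v. smooth_on U u \<and> smooth_on U v \<and> F = (\<lambda>x. u x + v x)"
  then obtain u v where uv: "smooth_on U u" "smooth_on U v" and F: "F = (\<lambda>x. u x + v x)" by blast
  have der: "(F has_derivative (\<lambda>h. frechet_derivative u (at x) h + frechet_derivative v (at x) h)) (at x)" if "x \<in> U" for x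
    unfolding F using uv that by (intro has_derivative_add smooth_on_has_derivative)
  show "F differentiable (at x)" if "x \<in> U" for x using der[OF that] unfolding differentiable_def by blast
  fix i
  have "\<forall>x\<in>U. partial_deriv i F x = partial_deriv i u x + partial_deriv i v x"
    by (auto simp: partial_deriv_eqI[OF der]) (simp add: partial_deriv_def)
  then show "\<exists>g. (\<exists>u v. smooth_on U u \<and> smooth_on U v \<and> g = (\<lambda>x. u x + v x)) \<and> (\<forall>x\<in>U. partial_deriv i F x = g x)"
    using uv smooth_on_partial_deriv by blast
qed

text \<open>The invariant class consists of quotients by positive powers of the fixed
  \<open>g\<close>: differentiation changes the numerator and raises the power by one.\<close>

lemma smooth_on_divide:
  assumes U: "open U" and f: "smooth_on U f" and g: "smooth_on U g" and nz: "\<And>x. x \<in> U \<Longrightarrow> g x \<noteq> 0"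
  shows "smooth_on U (\<lambda>x. f x / g x)"
proof (rule smooth_on_coinduct[OF U, where P="\<lambda>F. \<exists>u k. smooth_on U u \<and> F = (\<lambda>x. u x / g x ^ Suc k)"])
  show "\<exists>u k. smooth_on U u \<and> (\<lambda>x. f x / g x) = (\<lambda>x. u x / g x ^ Suc k)" using f by (intro exI[of _ f] exI[of _ 0]) auto
  fix F assume "\<exists>u k. smooth_on U u \<and> F = (\<lambda>x. u x / g x ^ Suc k)"
  then obtain u k where u: "smooth_on U u" and F: "F = (\<lambda>x. u x / g x ^ Suc k)" by blast
  have der: "(F has_derivative (\<lambda>h. (frechet_derivative u (at x) h * g x ^ Suc k -
        u x * (of_nat (Suc k) * frechet_derivative g (at x) h * g x ^ k)) / (g x ^ Suc k * g x ^ Suc k))) (at x)" if x: "x \<in> U" for x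
    unfolding F using has_derivative_divide'[OF smooth_on_has_derivative[OF u x] has_derivative_power[OF smooth_on_has_derivative[OF g x], of "Suc k"]]
      nz[OF x] by simp
  show "F differentiable (at x)" if "x \<in> U" for x using der[OF that] unfolding differentiable_def by blast
  fix i
  define w where "w x = partial_deriv i u x * g x + (- of_nat (Suc k)) * (u x * partial_deriv i g x)" for x
  have "smooth_on U w" unfolding w_def
    by (intro smooth_on_add smooth_on_mult smooth_on_const U smooth_on_partial_deriv u g)
  moreover have "\<forall>x\<in>U. partial_deriv i F x = w x / g x ^ Suc (Suc k)"
  proof
    fix x assume x: "x \<in> U"
    have "partial_deriv i F x = (partial_deriv i u x * g x ^ Suc k -
        u x * (of_nat (Suc k) * partial_deriv i g x * g x ^ k)) / (g x ^ Suc k * g x ^ Suc k)"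
      unfolding partial_deriv_eqI[OF der[OF x]] by (simp add: partial_deriv_def)
    also have "\<dots> = (w x * g x ^ k) / (g x ^ Suc (Suc k) * g x ^ k)"
      by (simp add: w_def algebra_simps)
    also have "\<dots> = w x / g x ^ Suc (Suc k)" using nz[OF x] by simp
    finally show "partial_deriv i F x = w x / g x ^ Suc (Suc k)" .
  qed
  ultimately show "\<exists>G. (\<exists>u k. smooth_on U u \<and> G = (\<lambda>x. u x / g x ^ Suc k)) \<and> (\<forall>x\<in>U. partial_deriv i F x = G x)"
    by blast
qed

lemma partial_derivs_lincomb:
  assumes "smooth_on UNIV u" "smooth_on UNIV v"
  shows "partial_derivs is (\<lambda>x. a * u x + b * v x) = (\<lambda>x. a * partial_derivs is u x + b * partial_derivs is v x)"
proof (induction "is")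
  case (Cons i "is")
  have "(\<lambda>x. a * partial_derivs is u x + b * partial_derivs is v x) = partial_derivs is (\<lambda>x. a * u x + b * v x)"
    using Cons by simp
  moreover have der: "((\<lambda>x. a * partial_derivs is u x + b * partial_derivs is v x) has_derivative
      (\<lambda>h. a * frechet_derivative (partial_derivs is u) (at x) h + b * frechet_derivative (partial_derivs is v) (at x) h)) (at x)" for x
    using assms by (intro has_derivative_add has_derivative_mult_right smooth_on_has_derivative[of UNIV] smooth_on_partial_derivs) auto
  ultimately have "partial_deriv i (partial_derivs is (\<lambda>x. a * u x + b * v x)) x = a * partial_deriv i (partial_derivs is u) x + b * partial_deriv i (partial_derivs is v) x" for x
    using partial_deriv_eqI[OF der, of i x] by (simp add: partial_deriv_def)
  then show ?case by auto
qed auto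

lemma partial_derivs_affine:
  assumes u: "smooth_on UNIV u"
  shows "partial_derivs is (\<lambda>x. u (c *\<^sub>R x + a)) = (\<lambda>x. c ^ length is *\<^sub>R partial_derivs is u (c *\<^sub>R x + a))"
    and "smooth_on UNIV (\<lambda>x. u (c *\<^sub>R x + a))"
proof -
  have der: "((\<lambda>x. k *\<^sub>R partial_derivs is u (c *\<^sub>R x + a)) has_derivative
      (\<lambda>h. k *\<^sub>R frechet_derivative (partial_derivs is u) (at (c *\<^sub>R x + a)) (c *\<^sub>R h))) (at x)" for k "is" x
  proof -
    have "(partial_derivs is u has_derivative frechet_derivative (partial_derivs is u) (at (c *\<^sub>R x + a))) (at (c *\<^sub>R x + a))"
      using u by (intro smooth_on_has_derivative[of UNIV] smooth_on_partial_derivs) auto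
    moreover have "((\<lambda>x. c *\<^sub>R x + a) has_derivative (\<lambda>h. c *\<^sub>R h)) (at x)"
      by (auto intro!: derivative_eq_intros)
    ultimately have "((partial_derivs is u \<circ> (\<lambda>x. c *\<^sub>R x + a)) has_derivative
        (frechet_derivative (partial_derivs is u) (at (c *\<^sub>R x + a)) \<circ> (\<lambda>h. c *\<^sub>R h))) (at x)"
      by (rule diff_chain_at[rotated])
    then show ?thesis by (auto simp: o_def intro: has_derivative_scaleR_right)
  qed
  have eq: "partial_derivs is (\<lambda>x. u (c *\<^sub>R x + a)) = (\<lambda>x. c ^ length is *\<^sub>R partial_derivs is u (c *\<^sub>R x + a))" for "is"
  proof (induction "is")
    case (Cons i "is")
    show ?case
    proof
      fix x
      have lin: "linear (frechet_derivative (partial_derivs is u) (at (c *\<^sub>R x + a)))"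
        using u by (intro has_derivative_linear[OF smooth_on_has_derivative[of UNIV]] smooth_on_partial_derivs) auto
      show "partial_derivs (i # is) (\<lambda>x. u (c *\<^sub>R x + a)) x = c ^ length (i # is) *\<^sub>R partial_derivs (i # is) u (c *\<^sub>R x + a)"
        unfolding partial_derivs.simps Cons.IH partial_deriv_eqI[OF der]
        by (simp add: linear_cmul[OF lin] partial_deriv_def mult.commute)
    qed
  qed auto
  then show "partial_derivs is (\<lambda>x. u (c *\<^sub>R x + a)) = (\<lambda>x. c ^ length is *\<^sub>R partial_derivs is u (c *\<^sub>R x + a))" .
  show "smooth_on UNIV (\<lambda>x. u (c *\<^sub>R x + a))"
    unfolding smooth_on_def eq using der by (auto simp: differentiable_def)
qed

lemma smooth_on_UNIV_continuous: "smooth_on UNIV u \<Longrightarrow> continuous_on UNIV (partial_derivs is u)"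
  by (intro continuous_at_imp_continuous_on ballI differentiable_imp_continuous_within) (auto intro: smooth_on_D)

lemma schwartz_iff:
  "u \<in> schwartz \<longleftrightarrow> smooth_on UNIV u \<and> (\<forall>is N. \<exists>C. \<forall>x. (1 + norm x) ^ N * norm (partial_derivs is u x) \<le> C)"
  unfolding schwartz_def smooth_on_def differentiable_on_def bounded_iff by (auto simp: abs_mult)

lemma schwartz_smooth: "u \<in> schwartz \<Longrightarrow> smooth_on UNIV u"
  by (simp add: schwartz_iff)

lemma schwartz_bound:
  assumes "u \<in> schwartz"
  obtains C where "0 \<le> C" "\<And>x. (1 + norm x) ^ N * norm (partial_derivs is u x) \<le> C"
proof -
  obtain C where C: "\<And>x. (1 + norm x) ^ N * norm (partial_derivs is u x) \<le> C"
    using assms unfolding schwartz_iff by meson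
  moreover have "0 \<le> C" using C[of 0] by (auto intro: order_trans[OF norm_ge_zero])
  ultimately show thesis using that by blast
qed

lemma schwartz_partial_derivs: "u \<in> schwartz \<Longrightarrow> partial_derivs is u \<in> schwartz"
  by (auto simp: schwartz_iff smooth_on_partial_derivs partial_derivs_append[symmetric])

lemma schwartz_partial_deriv: "u \<in> schwartz \<Longrightarrow> partial_deriv i u \<in> schwartz"
  using schwartz_partial_derivs[of u "[i]"] by simp

lemma schwartz_lincomb:
  assumes u: "u \<in> schwartz" and v: "v \<in> schwartz"
  shows "(\<lambda>x. a * u x + b * v x) \<in> schwartz"
  unfolding schwartz_iff
proof (intro conjI allI)
  show "smooth_on UNIV (\<lambda>x. a * u x + b * v x)"
    using u v by (intro smooth_on_add smooth_on_mult smooth_on_const) (auto simp: schwartz_smooth)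
  fix "is" N
  obtain C where C: "0 \<le> C" "\<And>x. (1 + norm x) ^ N * norm (partial_derivs is u x) \<le> C" using schwartz_bound[OF u] by blast
  obtain D where D: "0 \<le> D" "\<And>x. (1 + norm x) ^ N * norm (partial_derivs is v x) \<le> D" using schwartz_bound[OF v] by blast
  show "\<exists>C. \<forall>x. (1 + norm x) ^ N * norm (partial_derivs is (\<lambda>x. a * u x + b * v x) x) \<le> C"
  proof (intro exI allI)
    fix x
    have "(1 + norm x) ^ N * norm (partial_derivs is (\<lambda>x. a * u x + b * v x) x)
        \<le> (1 + norm x) ^ N * (norm a * norm (partial_derivs is u x) + norm b * norm (partial_derivs is v x))"
      unfolding partial_derivs_lincomb[OF schwartz_smooth[OF u] schwartz_smooth[OF v]]
      by (intro mult_left_mono) (auto intro: norm_triangle_le simp: norm_mult)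
    also have "\<dots> = norm a * ((1 + norm x) ^ N * norm (partial_derivs is u x)) + norm b * ((1 + norm x) ^ N * norm (partial_derivs is v x))"
      by (simp add: algebra_simps)
    also have "\<dots> \<le> norm a * C + norm b * D" using C D by (intro add_mono mult_left_mono) auto
    finally show "(1 + norm x) ^ N * norm (partial_derivs is (\<lambda>x. a * u x + b * v x) x) \<le> norm a * C + norm b * D" .
  qed
qed

lemma schwartz_cmult: "u \<in> schwartz \<Longrightarrow> (\<lambda>x. a * u x) \<in> schwartz"
  using schwartz_lincomb[of u u a 0] by simp

lemma schwartz_affine:
  assumes u: "u \<in> schwartz" and c: "c \<noteq> 0"
  shows "(\<lambda>x. u (c *\<^sub>R x + a)) \<in> schwartz"
  unfolding schwartz_iff
proof (intro conjI allI)
  show "smooth_on UNIV (\<lambda>x. u (c *\<^sub>R x + a))" using u by (intro partial_derivs_affine schwartz_smooth)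
  fix "is" N
  obtain C where C: "0 \<le> C" "\<And>x. (1 + norm x) ^ N * norm (partial_derivs is u x) \<le> C" using schwartz_bound[OF u] by blast
  \<comment> \<open>Chosen so that \<open>1 + norm x\<close> is at most \<open>B\<close> times the
    weight at the image point \<open>c *\<^sub>R x + a\<close>.\<close>
  define B where "B = 1 + (1 + norm a) / \<bar>c\<bar>"
  have B: "1 \<le> B" using c by (simp add: B_def)
  have le: "1 + norm x \<le> B * (1 + norm (c *\<^sub>R x + a))" for x
  proof -
    have "\<bar>c\<bar> * norm x \<le> norm (c *\<^sub>R x + a) + norm a"
      using norm_triangle_ineq4[of "c *\<^sub>R x + a" a] by simp
    also have "\<dots> \<le> (1 + norm a) * (1 + norm (c *\<^sub>R x + a))" by (simp add: algebra_simps)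
    finally have "norm x \<le> (1 + norm a) / \<bar>c\<bar> * (1 + norm (c *\<^sub>R x + a))" using c by (simp add: field_simps)
    moreover have "1 \<le> 1 * (1 + norm (c *\<^sub>R x + a))" by simp
    ultimately show ?thesis unfolding B_def distrib_right by linarith
  qed
  show "\<exists>C. \<forall>x. (1 + norm x) ^ N * norm (partial_derivs is (\<lambda>x. u (c *\<^sub>R x + a)) x) \<le> C"
  proof (intro exI allI)
    fix x
    have "(1 + norm x) ^ N * norm (partial_derivs is (\<lambda>x. u (c *\<^sub>R x + a)) x)
        \<le> (B * (1 + norm (c *\<^sub>R x + a))) ^ N * (\<bar>c\<bar> ^ length is * norm (partial_derivs is u (c *\<^sub>R x + a)))"
      unfolding partial_derivs_affine(1)[OF schwartz_smooth[OF u]]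
      using le[of x] B by (intro mult_mono power_mono zero_le_power mult_nonneg_nonneg) (auto simp: power_abs)
    also have "\<dots> = B ^ N * \<bar>c\<bar> ^ length is * ((1 + norm (c *\<^sub>R x + a)) ^ N * norm (partial_derivs is u (c *\<^sub>R x + a)))"
      by (simp add: power_mult_distrib)
    also have "\<dots> \<le> B ^ N * \<bar>c\<bar> ^ length is * C" using B C by (intro mult_left_mono) auto
    finally show "(1 + norm x) ^ N * norm (partial_derivs is (\<lambda>x. u (c *\<^sub>R x + a)) x) \<le> B ^ N * \<bar>c\<bar> ^ length is * C" .
  qed
qed

text \<open>A derivative of the product is the coordinate times the derivative of \<open>u\<close>
  plus some Schwartz function; only the existence of this remainder \<open>w\<close> is carried
  through the induction.\<close>

lemma schwartz_coord_mult:
  fixes u :: "real^'n::finite \<Rightarrow> complex"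
  assumes u: "u \<in> schwartz"
  shows "(\<lambda>x. complex_of_real (x $ i) * u x) \<in> schwartz"
proof -
  have der: "((\<lambda>x. of_real (x $ i) * v x + w x) has_derivative
      (\<lambda>h. of_real (x $ i) * frechet_derivative v (at x) h + of_real (h $ i) * v x + frechet_derivative w (at x) h)) (at x)"
    if "smooth_on UNIV v" "smooth_on UNIV w" for v w :: "real^'n \<Rightarrow> complex" and x
  proof -
    have "((\<lambda>x. complex_of_real (x $ i)) has_derivative (\<lambda>h. complex_of_real (h $ i))) (at x)"
      by (intro bounded_linear_imp_has_derivative bounded_linear_compose[OF bounded_linear_of_real bounded_linear_vec_nth])
    from has_derivative_mult[OF this smooth_on_has_derivative[OF that(1)]] smooth_on_has_derivative[OF that(2), of x]
    show ?thesis by (intro has_derivative_add) auto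
  qed
  have eq: "\<exists>w\<in>schwartz. partial_derivs is (\<lambda>x. complex_of_real (x $ i) * u x) = (\<lambda>x. of_real (x $ i) * partial_derivs is u x + w x)" for "is"
  proof (induction "is")
    case Nil
    have "(\<lambda>x. 0 * u x) \<in> schwartz" using u by (rule schwartz_cmult)
    then show ?case by (intro bexI[of _ "\<lambda>x. 0"]) auto
  next
    case (Cons j "is")
    then obtain w where w: "w \<in> schwartz"
      "partial_derivs is (\<lambda>x. complex_of_real (x $ i) * u x) = (\<lambda>x. of_real (x $ i) * partial_derivs is u x + w x)" by blast
    define w' where "w' x = (if i = j then 1 else 0) * partial_derivs is u x + 1 * partial_deriv j w x" for x
    have "w' \<in> schwartz" unfolding w'_def
      using u w by (intro schwartz_lincomb schwartz_partial_derivs schwartz_partial_deriv)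
    moreover have "partial_derivs (j # is) (\<lambda>x. complex_of_real (x $ i) * u x) x = of_real (x $ i) * partial_derivs (j # is) u x + w' x" for x
      unfolding partial_derivs.simps w(2)
        partial_deriv_eqI[OF der[OF smooth_on_partial_derivs[OF schwartz_smooth[OF u]] schwartz_smooth[OF w(1)]]]
      by (simp add: w'_def partial_deriv_def axis_def)
    ultimately show ?case by (intro bexI[of _ w']) auto
  qed
  show ?thesis unfolding schwartz_iff
  proof (intro conjI allI)
    show "smooth_on UNIV (\<lambda>x. complex_of_real (x $ i) * u x)"
      unfolding smooth_on_def
    proof (intro allI ballI)
      fix "is" x
      obtain w where w: "w \<in> schwartz"
        "partial_derivs is (\<lambda>x. complex_of_real (x $ i) * u x) = (\<lambda>x. of_real (x $ i) * partial_derivs is u x + w x)"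
        using eq by blast
      show "partial_derivs is (\<lambda>x. complex_of_real (x $ i) * u x) differentiable (at x)"
        unfolding w(2) using der[OF smooth_on_partial_derivs[OF schwartz_smooth[OF u]] schwartz_smooth[OF w(1)]]
        by (auto simp: differentiable_def)
    qed
    fix "is" N
    obtain w where w: "w \<in> schwartz"
      "partial_derivs is (\<lambda>x. complex_of_real (x $ i) * u x) = (\<lambda>x. of_real (x $ i) * partial_derivs is u x + w x)"
      using eq by blast
    obtain C where C: "0 \<le> C" "\<And>x. (1 + norm x) ^ Suc N * norm (partial_derivs is u x) \<le> C" using schwartz_bound[OF u] by blast
    obtain D where D: "0 \<le> D" "\<And>x. (1 + norm x) ^ N * norm (partial_derivs [] w x) \<le> D" using schwartz_bound[OF w(1)] by blast
    show "\<exists>C. \<forall>x. (1 + norm x) ^ N * norm (partial_derivs is (\<lambda>x. complex_of_real (x $ i) * u x) x) \<le> C"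
    proof (intro exI allI)
      fix x :: "real^'n"
      have "\<bar>x $ i\<bar> \<le> 1 + norm x" using component_le_norm_cart[of x i] by simp
      then have "norm (partial_derivs is (\<lambda>x. complex_of_real (x $ i) * u x) x) \<le> (1 + norm x) * norm (partial_derivs is u x) + norm (w x)"
        unfolding w(2) by (intro norm_triangle_le add_mono) (auto simp: norm_mult intro: mult_right_mono)
      then have "(1 + norm x) ^ N * norm (partial_derivs is (\<lambda>x. complex_of_real (x $ i) * u x) x)
          \<le> (1 + norm x) ^ N * ((1 + norm x) * norm (partial_derivs is u x) + norm (w x))"
        by (intro mult_left_mono) auto
      also have "\<dots> \<le> C + D" using C(2)[of x] D(2)[of x] by (simp add: algebra_simps)
      finally show "(1 + norm x) ^ N * norm (partial_derivs is (\<lambda>x. complex_of_real (x $ i) * u x) x) \<le> C + D" .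
    qed
  qed
qed

lemma compact_support_schwartz:
  assumes u: "smooth_on UNIV u" and R: "\<And>x. R < norm x \<Longrightarrow> u x = 0"
  shows "u \<in> schwartz"
  unfolding schwartz_iff
proof (intro conjI allI u)
  fix "is" N
  have zero: "partial_derivs is u x = 0" if "R < norm x" for x
  proof -
    have "partial_derivs is u x = partial_derivs is (\<lambda>x. 0) x"
      by (rule partial_derivs_cong[of "{x. R < norm x}"]) (use R that in \<open>auto intro!: open_Collect_less continuous_intros\<close>)
    also have "\<dots> = 0"
    proof -
      have "partial_derivs is (\<lambda>x. 0) = (\<lambda>x. 0)" by (induction "is") (auto simp: partial_deriv_const)
      then show ?thesis by simp
    qed
    finally show ?thesis .
  qed
  have "compact ((\<lambda>x. (1 + norm x) ^ N * norm (partial_derivs is u x)) ` cball 0 R)"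
    using smooth_on_UNIV_continuous[OF u]
    by (intro compact_continuous_image continuous_intros continuous_on_subset[OF smooth_on_UNIV_continuous[OF u]]) auto
  then obtain C where C: "\<And>x. norm x \<le> R \<Longrightarrow> (1 + norm x) ^ N * norm (partial_derivs is u x) \<le> C"
    by (auto dest!: compact_imp_bounded simp: bounded_iff abs_mult) (metis mem_cball_0)
  show "\<exists>C. \<forall>x. (1 + norm x) ^ N * norm (partial_derivs is u x) \<le> C"
  proof (intro exI allI)
    fix x show "(1 + norm x) ^ N * norm (partial_derivs is u x) \<le> max C 0"
      using C[of x] zero[of x] by (cases "norm x \<le> R") auto
  qed
qed

section \<open>Integrability from decay, and changes of variables\<close>

lemma integrable_decay_aux:
  fixes N :: nat
  assumes N: "DIM('a::euclidean_space) < N"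
  shows "integrable lborel (\<lambda>x::'a. 1 / (1 + norm x) ^ N)"
proof (rule integrableI_nonneg)
  obtain W where W: "0 \<le> W" "\<And>t. 0 < t \<Longrightarrow> (\<integral>\<^sup>+x. eta t (real N) (x::'a) \<partial>lborel) \<le> ennreal W"
    using nn_integral_eta[of "real N", where 'a='a] N by auto
  have "eta 1 (real N) x = ennreal (1 / (1 + norm x) ^ N)" for x :: 'a
  proof -
    have "(1 + norm x) powr (- real N) = 1 / (1 + norm x) ^ N"
      by (simp add: powr_minus powr_realpow add_pos_nonneg divide_inverse)
    then show ?thesis by (simp add: eta_def)
  qed
  then have "(\<integral>\<^sup>+x. ennreal (1 / (1 + norm (x::'a)) ^ N) \<partial>lborel) \<le> ennreal W" using W(2)[of 1] by simp
  then show "(\<integral>\<^sup>+x. ennreal (1 / (1 + norm (x::'a)) ^ N) \<partial>lborel) < \<infinity>" by (auto intro: le_less_trans)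
qed auto

lemma integrable_decay:
  fixes g :: "'a::euclidean_space \<Rightarrow> 'b::{banach, second_countable_topology}"
  assumes [measurable]: "g \<in> borel_measurable borel" and g: "\<And>x. (1 + norm x) ^ N * norm (g x) \<le> C" and N: "DIM('a) < N"
  shows "integrable lborel g"
proof (rule Bochner_Integration.integrable_bound)
  show "integrable lborel (\<lambda>x::'a. C * (1 / (1 + norm x) ^ N))"
    by (intro integrable_mult_right integrable_decay_aux N)
  have "norm (g x) \<le> norm (C * (1 / (1 + norm x) ^ N))" for x
  proof -
    have "norm (g x) \<le> C * (1 / (1 + norm x) ^ N)"
      using g[of x] by (simp add: pos_le_divide_eq add_pos_nonneg mult.commute)
    also have "\<dots> \<le> norm (C * (1 / (1 + norm x) ^ N))" unfolding real_norm_def by (rule abs_ge_self)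
    finally show ?thesis .
  qed
  then show "AE x in lborel. norm (g x) \<le> norm (C * (1 / (1 + norm x) ^ N))" by blast
qed simp

text \<open>Measurability and decay suffice for the integrals and for differentiating a Fourier
  transform, and they are what is shown of the kernels \<open>conv2 v g\<close>.\<close>

definition rapid :: "('a::euclidean_space \<Rightarrow> complex) \<Rightarrow> bool" where
  "rapid g \<longleftrightarrow> g \<in> borel_measurable borel \<and> (\<forall>N. \<exists>C. \<forall>x. (1 + norm x) ^ N * norm (g x) \<le> C)"

lemma rapid_measurable: "rapid g \<Longrightarrow> g \<in> borel_measurable borel"
  by (simp add: rapid_def)

lemma rapid_bound:
  assumes "rapid g"
  obtains C where "0 \<le> C" "\<And>x. (1 + norm x) ^ N * norm (g x) \<le> C"
proof -
  obtain C where C: "\<And>x. (1 + norm x) ^ N * norm (g x) \<le> C"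
    using assms unfolding rapid_def by meson
  moreover have "0 \<le> C" using C[of 0] by (auto intro: order_trans[OF norm_ge_zero])
  ultimately show thesis using that by blast
qed

lemma rapid_growth_integrable:
  fixes g :: "'a::euclidean_space \<Rightarrow> complex" and w :: "'a \<Rightarrow> complex"
  assumes g: "rapid g" and w: "w \<in> borel_measurable borel" "\<And>x. norm (w x) \<le> B * (1 + norm x) ^ M"
  shows "integrable lborel (\<lambda>x. w x * g x)"
proof -
  obtain C where C: "0 \<le> C" "\<And>x. (1 + norm x) ^ (M + Suc DIM('a)) * norm (g x) \<le> C" using rapid_bound[OF g] by blast
  have B: "0 \<le> B" using order_trans[OF norm_ge_zero w(2)[of 0]] by simp
  show ?thesis
  proof (rule integrable_decay[where N="Suc DIM('a)" and C="B * C"])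
    fix x
    have "(1 + norm x) ^ Suc DIM('a) * norm (w x * g x) \<le> (1 + norm x) ^ Suc DIM('a) * (B * (1 + norm x) ^ M * norm (g x))"
      using w(2)[of x] by (intro mult_left_mono) (auto simp: norm_mult intro: mult_right_mono)
    also have "\<dots> = B * ((1 + norm x) ^ (M + Suc DIM('a)) * norm (g x))" by (simp add: power_add mult_ac)
    also have "\<dots> \<le> B * C" using C B by (intro mult_left_mono) auto
    finally show "(1 + norm x) ^ Suc DIM('a) * norm (w x * g x) \<le> B * C" .
  qed (use w rapid_measurable[OF g] in auto)
qed

lemma rapid_integrable: "rapid g \<Longrightarrow> integrable lborel g"
  using rapid_growth_integrable[of g "\<lambda>_. 1" 1 0] by simp

lemma schwartz_continuous: "u \<in> schwartz \<Longrightarrow> continuous_on UNIV (partial_derivs is u)"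
  by (intro smooth_on_UNIV_continuous schwartz_smooth)

lemma schwartz_continuous0: "u \<in> schwartz \<Longrightarrow> continuous_on UNIV u"
  using schwartz_continuous[of u "[]"] by simp

lemma schwartz_rapid: "u \<in> schwartz \<Longrightarrow> rapid u"
  using schwartz_iff[of u] schwartz_continuous0[of u]
  by (auto simp: rapid_def intro: borel_measurable_continuous_onI) (metis partial_derivs.simps(1))

lemma one_plus_norm_le:
  fixes x y :: "'a::real_normed_vector"
  shows "1 + norm (x + y) \<le> (1 + norm x) * (1 + norm y)"
proof -
  have "norm (x + y) \<le> norm x + norm y" by (rule norm_triangle_ineq)
  also have "\<dots> \<le> norm x + norm y + norm x * norm y" by simp
  finally show ?thesis by (simp add: algebra_simps)
qed

lemma
  fixes f :: "'a::euclidean_space \<Rightarrow> 'b::{banach, second_countable_topology}"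
  assumes c: "c \<noteq> 0" and [measurable]: "f \<in> borel_measurable borel"
  shows integral_affine: "(LINT x|lborel. f x) = \<bar>c\<bar> ^ DIM('a) *\<^sub>R (LINT x|lborel. f (t + c *\<^sub>R x))"
    and integrable_affine: "integrable lborel (\<lambda>x. f (t + c *\<^sub>R x)) \<longleftrightarrow> integrable lborel f"
proof -
  have eq: "lborel = density (distr lborel borel (\<lambda>x::'a. t + c *\<^sub>R x)) (\<lambda>_. ennreal (\<bar>c\<bar> ^ DIM('a)))"
    using lborel_affine[OF c, of t] by simp
  show "(LINT x|lborel. f x) = \<bar>c\<bar> ^ DIM('a) *\<^sub>R (LINT x|lborel. f (t + c *\<^sub>R x))"
    by (subst eq) (simp add: integral_density integral_distr)
  show "integrable lborel (\<lambda>x. f (t + c *\<^sub>R x)) \<longleftrightarrow> integrable lborel f"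
  proof -
    have "integrable lborel f \<longleftrightarrow> integrable lborel (\<lambda>x. \<bar>c\<bar> ^ DIM('a) *\<^sub>R f (t + c *\<^sub>R x))"
      by (subst eq) (simp add: integrable_density integrable_distr_eq)
    also have "\<dots> \<longleftrightarrow> integrable lborel (\<lambda>x. f (t + c *\<^sub>R x))"
      using integrable_scaleR_right[of "inverse (\<bar>c\<bar> ^ DIM('a))" lborel "\<lambda>x. \<bar>c\<bar> ^ DIM('a) *\<^sub>R f (t + c *\<^sub>R x)"]
        integrable_scaleR_right[of "\<bar>c\<bar> ^ DIM('a)" lborel "\<lambda>x. f (t + c *\<^sub>R x)"] c by auto
    finally show ?thesis ..
  qed
qed

lemma nn_integral_affine:
  fixes f :: "'a::euclidean_space \<Rightarrow> ennreal"
  assumes c: "c \<noteq> 0" and [measurable]: "f \<in> borel_measurable borel"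
  shows "(\<integral>\<^sup>+x. f x \<partial>lborel) = ennreal (\<bar>c\<bar> ^ DIM('a)) * (\<integral>\<^sup>+x. f (t + c *\<^sub>R x) \<partial>lborel)"
proof -
  have eq: "lborel = density (distr lborel borel (\<lambda>x::'a. t + c *\<^sub>R x)) (\<lambda>_. ennreal (\<bar>c\<bar> ^ DIM('a)))"
    using lborel_affine[OF c, of t] by simp
  show ?thesis
    by (subst eq) (simp add: nn_integral_density nn_integral_distr nn_integral_cmult)
qed

lemma integral_reflect:
  fixes f :: "'a::euclidean_space \<Rightarrow> 'b::{banach, second_countable_topology}"
  assumes "f \<in> borel_measurable borel"
  shows "(LINT y|lborel. f (x - y)) = (LINT y|lborel. f y)"
    and "integrable lborel (\<lambda>y. f (x - y)) \<longleftrightarrow> integrable lborel f"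
  using integral_affine[of "-1" f x] integrable_affine[of "-1" f x] assms by simp_all

section \<open>Taylor expansion and vanishing moments\<close>

lemma frechet_derivative_axis_sum:
  fixes f :: "real^'n::finite \<Rightarrow> complex"
  assumes "f differentiable (at x)"
  shows "frechet_derivative f (at x) v = (\<Sum>i\<in>UNIV. of_real (v $ i) * partial_deriv i f x)"
proof -
  have lin: "linear (frechet_derivative f (at x))"
    using assms by (intro linear_frechet_derivative)
  have "v = (\<Sum>i\<in>UNIV. v $ i *\<^sub>R axis i 1)"
    using basis_expansion[of v] by (simp add: scalar_mult_eq_scaleR)
  then have "frechet_derivative f (at x) v = frechet_derivative f (at x) (\<Sum>i\<in>UNIV. v $ i *\<^sub>R axis i 1)" by simp
  also have "\<dots> = (\<Sum>i\<in>UNIV. v $ i *\<^sub>R frechet_derivative f (at x) (axis i 1))"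
    using lin by (simp add: linear_sum linear_cmul)
  finally show ?thesis by (simp add: partial_deriv_def scaleR_conv_of_real)
qed

text \<open>Monomials are indexed by lists, like \<open>partial_derivs\<close>, so that sums over
  all lists of a given length replace multinomial coefficients.\<close>

definition mon :: "'n::finite list \<Rightarrow> real^'n \<Rightarrow> real" where
  "mon is y = (\<Prod>i\<leftarrow>is. y $ i)"

lemma mon_Nil [simp]: "mon [] y = 1"
  and mon_Cons [simp]: "mon (i # is) y = y $ i * mon is y"
  by (simp_all add: mon_def)

lemma mon_scaleR: "mon is (c *\<^sub>R y) = c ^ length is * mon is y"
  by (induction "is") auto

lemma abs_mon_le: "\<bar>mon is y\<bar> \<le> norm y ^ length is"
  by (induction "is") (auto simp: abs_mult intro!: mult_mono component_le_norm_cart)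

lemma borel_measurable_mon [measurable]: "mon is \<in> borel_measurable borel"
  by (induction "is") (auto simp: mon_def[abs_def])

text \<open>The \<open>j\<close>-th derivative of \<open>g\<close> at \<open>x\<close> along
  \<open>v\<close>, so that \<open>taylor g j v x / fact j\<close> is the term of degree
  \<open>j\<close> in the Taylor expansion.\<close>

definition taylor :: "(real^'n::finite \<Rightarrow> complex) \<Rightarrow> nat \<Rightarrow> real^'n \<Rightarrow> real^'n \<Rightarrow> complex" where
  "taylor g j v x = (\<Sum>is | length is = j. of_real (mon is v) * partial_derivs is g x)"

lemma taylor_0 [simp]: "taylor g 0 v x = g x"
  by (simp add: taylor_def)

lemma taylor_scaleR: "taylor g j (c *\<^sub>R v) x = of_real (c ^ j) * taylor g j v x"
  unfolding taylor_def sum_distrib_left by (intro sum.cong) (auto simp: mon_scaleR)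

lemma sum_length_Suc:
  "(\<Sum>is | length is = Suc j. f is) = (\<Sum>is | length is = j. \<Sum>i\<in>(UNIV :: 'n::finite set). f (i # is))"
proof -
  have "(\<Sum>is | length is = j. \<Sum>i\<in>(UNIV :: 'n set). f (i # is)) = (\<Sum>(is, i)\<in>{is. length is = j} \<times> UNIV. f (i # is))"
    by (rule sum.cartesian_product)
  also have "\<dots> = (\<Sum>is | length is = Suc j. f is)"
    by (rule sum.reindex_bij_witness[of _ "\<lambda>is. (tl is, hd is)" "\<lambda>(is, i). i # is"])
      (auto simp: length_Suc_conv)
  finally show ?thesis ..
qed

lemma taylor_has_derivative:
  assumes g: "smooth_on UNIV g"
  shows "((\<lambda>\<theta>. taylor g j v (x + \<theta> *\<^sub>R v)) has_vector_derivative taylor g (Suc j) v (x + \<theta> *\<^sub>R v)) (at \<theta>)"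
proof -
  have "((\<lambda>\<theta>. partial_derivs is g (x + \<theta> *\<^sub>R v)) has_vector_derivative
      (\<Sum>i\<in>UNIV. of_real (v $ i) * partial_derivs (i # is) g (x + \<theta> *\<^sub>R v))) (at \<theta>)" for "is"
  proof -
    have d: "partial_derivs is g differentiable (at (x + \<theta> *\<^sub>R v))" using smooth_on_D[OF g] by auto
    have "((\<lambda>\<theta>. x + \<theta> *\<^sub>R v) has_derivative (\<lambda>h. h *\<^sub>R v)) (at \<theta>)" by (auto intro!: derivative_eq_intros)
    from diff_chain_at[OF this] d
    have "((\<lambda>\<theta>. partial_derivs is g (x + \<theta> *\<^sub>R v)) has_derivative
        (\<lambda>h. frechet_derivative (partial_derivs is g) (at (x + \<theta> *\<^sub>R v)) (h *\<^sub>R v))) (at \<theta>)"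
      by (auto simp: o_def frechet_derivative_works)
    moreover have "frechet_derivative (partial_derivs is g) (at (x + \<theta> *\<^sub>R v)) (h *\<^sub>R v) =
        h *\<^sub>R (\<Sum>i\<in>UNIV. of_real (v $ i) * partial_derivs (i # is) g (x + \<theta> *\<^sub>R v))" for h
      using linear_cmul[OF linear_frechet_derivative[OF d], of h v] by (simp add: frechet_derivative_axis_sum[OF d])
    ultimately show ?thesis by (simp add: has_vector_derivative_def)
  qed
  then have "((\<lambda>\<theta>. taylor g j v (x + \<theta> *\<^sub>R v)) has_vector_derivative
      (\<Sum>is | length is = j. of_real (mon is v) * (\<Sum>i\<in>UNIV. of_real (v $ i) * partial_derivs (i # is) g (x + \<theta> *\<^sub>R v)))) (at \<theta>)"
    unfolding taylor_def by (intro has_vector_derivative_sum has_vector_derivative_mult_right)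
  also have "(\<Sum>is | length is = j. of_real (mon is v) * (\<Sum>i\<in>UNIV. of_real (v $ i) * partial_derivs (i # is) g (x + \<theta> *\<^sub>R v)))
      = taylor g (Suc j) v (x + \<theta> *\<^sub>R v)"
    unfolding taylor_def sum_length_Suc by (simp add: sum_distrib_left mult_ac)
  finally show ?thesis .
qed

text \<open>A complex function has no mean value form of the remainder. A factor \<open>c\<close> of
  modulus at most 1 turns the remainder \<open>R\<close> into its norm, and the real Maclaurin
  formula applies to the real part of \<open>c * g\<close> along the segment.\<close>

lemma taylor_remainder:
  assumes g: "smooth_on UNIV g"
  obtains \<theta> where "\<bar>\<theta>\<bar> \<le> 1" "norm (g (x + v) - (\<Sum>j<L. taylor g j v x / fact j)) \<le> norm (taylor g L v (x + \<theta> *\<^sub>R v))"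
proof -
  define R where "R = g (x + v) - (\<Sum>j<L. taylor g j v x / fact j)"
  define c where "c = (if R = 0 then 0 else cnj R / norm R)"
  have cR: "c * R = norm R"
    using complex_norm_square[of R] by (auto simp: c_def power2_eq_square mult.commute[of "cnj R"] nonzero_divide_eq_eq)
  have c: "norm c \<le> 1" by (simp add: c_def norm_divide)
  define d where "d j \<theta> = Re (c * taylor g j v (x + \<theta> *\<^sub>R v))" for j \<theta>
  have "\<exists>t. \<bar>t\<bar> \<le> \<bar>1::real\<bar> \<and> d 0 1 = (\<Sum>m<L. d m 0 / fact m * 1 ^ m) + d L t / fact L * 1 ^ L"
  proof (rule Maclaurin_all_le)
    have "(d m has_real_derivative d (Suc m) \<theta>) (at \<theta>)" for m \<theta>
      unfolding d_def has_real_derivative_iff_has_vector_derivative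
      using bounded_linear.has_vector_derivative[OF bounded_linear_Re has_vector_derivative_mult_right[OF taylor_has_derivative[OF g]], of c m v x \<theta>]
      by (simp add: has_vector_derivative_def)
    then show "\<forall>m x. (d m has_real_derivative d (Suc m) x) (at x)" by blast
  qed simp
  then obtain \<theta> where \<theta>: "\<bar>\<theta>\<bar> \<le> 1" "d 0 1 = (\<Sum>m<L. d m 0 / fact m) + d L \<theta> / fact L" by auto
  have "norm R = Re (c * R)" using cR by simp
  also have "\<dots> = d 0 1 - (\<Sum>m<L. d m 0 / fact m)"
  proof -
    have "c * R = c * g (x + v) - (\<Sum>m<L. (c * taylor g m v x) / fact m)"
      by (simp add: R_def right_diff_distrib sum_distrib_left)
    moreover have "Re (z / fact m) = Re z / fact m" for z m
      by (metis Re_divide_of_real of_real_fact)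
    ultimately show ?thesis by (simp add: d_def Re_sum)
  qed
  also have "\<dots> = d L \<theta> / fact L" using \<theta> by simp
  also have "\<dots> \<le> \<bar>d L \<theta>\<bar> / 1"
    by (rule frac_le) (auto simp: fact_ge_1)
  also have "\<dots> \<le> norm c * norm (taylor g L v (x + \<theta> *\<^sub>R v))"
    using abs_Re_le_cmod[of "c * taylor g L v (x + \<theta> *\<^sub>R v)"] by (simp add: d_def norm_mult)
  also have "\<dots> \<le> 1 * norm (taylor g L v (x + \<theta> *\<^sub>R v))" using c by (intro mult_right_mono) auto
  finally show thesis using that[of \<theta>] \<theta> by (simp add: R_def)
qed

lemma taylor_bound:
  fixes g :: "real^'n::finite \<Rightarrow> complex" and L m :: nat
  assumes g: "g \<in> schwartz"
  obtains A where "0 \<le> A" "\<And>v z. (1 + norm z) ^ m * norm (taylor g L v z) \<le> A * norm v ^ L"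
proof -
  obtain B where B: "\<And>is x. length is = L \<Longrightarrow> (1 + norm x) ^ m * norm (partial_derivs is g x) \<le> B is" "\<And>is. 0 \<le> B is"
  proof -
    have "\<forall>is. \<exists>B. 0 \<le> B \<and> (\<forall>x. (1 + norm x) ^ m * norm (partial_derivs is g x) \<le> B)"
      using schwartz_bound[OF g, of m] by blast
    then show thesis using that by metis
  qed
  define A where "A = (\<Sum>is | length (is::'n list) = L. B is)"
  have A: "0 \<le> A" using B by (auto simp: A_def intro: sum_nonneg)
  have "(1 + norm z) ^ m * norm (taylor g L v z) \<le> A * norm v ^ L" for v z
  proof -
    have "(1 + norm z) ^ m * norm (taylor g L v z) \<le> (1 + norm z) ^ m * (\<Sum>is | length is = L. \<bar>mon is v\<bar> * norm (partial_derivs is g z))"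
      unfolding taylor_def by (intro mult_left_mono order_trans[OF norm_sum]) (auto simp: norm_mult)
    also have "\<dots> = (\<Sum>is | length is = L. \<bar>mon is v\<bar> * ((1 + norm z) ^ m * norm (partial_derivs is g z)))"
      by (simp add: sum_distrib_left mult_ac)
    also have "\<dots> \<le> (\<Sum>is | length (is::'n list) = L. norm v ^ L * B is)"
    proof (intro sum_mono mult_mono)
      fix "is" :: "'n list" assume "is \<in> {is. length is = L}"
      then show "\<bar>mon is v\<bar> \<le> norm v ^ L" "(1 + norm z) ^ m * norm (partial_derivs is g z) \<le> B is"
        using abs_mon_le[of "is" v] B(1) by auto
    qed auto
    finally show ?thesis by (simp add: A_def sum_distrib_left mult.commute)
  qed
  with A show thesis using that by blast
qed

text \<open>The weight is moved from the intermediate point to \<open>x\<close> at the price of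
  \<open>(1 + norm v) ^ m\<close>.\<close>

lemma taylor_remainder_bound:
  fixes g :: "real^'n::finite \<Rightarrow> complex" and L m :: nat
  assumes g: "g \<in> schwartz"
  obtains A where "0 \<le> A" "\<And>v x. (1 + norm x) ^ m * norm (g (x + v) - (\<Sum>j<L. taylor g j v x / fact j)) \<le> A * norm v ^ L * (1 + norm v) ^ m"
proof -
  obtain A where A: "0 \<le> A" "\<And>v z. (1 + norm z) ^ m * norm (taylor g L v z) \<le> A * norm v ^ L"
    using taylor_bound[OF g] by blast
  have "(1 + norm x) ^ m * norm (g (x + v) - (\<Sum>j<L. taylor g j v x / fact j)) \<le> A * norm v ^ L * (1 + norm v) ^ m" for x v
  proof -
    obtain \<theta> where \<theta>: "\<bar>\<theta>\<bar> \<le> 1" "norm (g (x + v) - (\<Sum>j<L. taylor g j v x / fact j)) \<le> norm (taylor g L v (x + \<theta> *\<^sub>R v))"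
      using taylor_remainder[OF schwartz_smooth[OF g]] by blast
    define z where "z = x + \<theta> *\<^sub>R v"
    have "1 + norm (z + (- \<theta>) *\<^sub>R v) \<le> (1 + norm z) * (1 + norm ((- \<theta>) *\<^sub>R v))" by (rule one_plus_norm_le)
    also have "\<dots> \<le> (1 + norm z) * (1 + norm v)"
      using \<theta> by (intro mult_left_mono) (auto simp: mult_left_le_one_le)
    finally have xz: "1 + norm x \<le> (1 + norm z) * (1 + norm v)" by (simp add: z_def)
    have "(1 + norm x) ^ m * norm (g (x + v) - (\<Sum>j<L. taylor g j v x / fact j)) \<le> ((1 + norm z) * (1 + norm v)) ^ m * norm (taylor g L v z)"
      using \<theta>(2) xz unfolding z_def by (intro mult_mono power_mono) auto
    also have "\<dots> = ((1 + norm z) ^ m * norm (taylor g L v z)) * (1 + norm v) ^ m"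
      by (simp add: power_mult_distrib)
    also have "\<dots> \<le> (A * norm v ^ L) * (1 + norm v) ^ m"
      by (intro mult_right_mono A) auto
    finally show ?thesis .
  qed
  with A(1) show thesis using that by blast
qed

text \<open>The moments of \<open>h\<close> annihilate the Taylor polynomial of \<open>g\<close> of
  degree below \<open>L\<close>, so \<open>g\<close> may be replaced by its remainder, which
  contributes \<open>\<tau> ^ L\<close>. With \<open>L = 0\<close> this is the plain decay of a
  convolution, uniform in the dilation.\<close>

lemma conv_moment_bound:
  fixes g h :: "real^'n::finite \<Rightarrow> complex" and L m :: nat
  assumes g: "g \<in> schwartz" and h: "rapid h"
    and mom: "\<And>is :: 'n list. length is < L \<Longrightarrow> (LINT y|lborel. of_real (mon is y) * h y) = 0"
  obtains C where "0 \<le> C" "\<And>\<tau> x. 0 \<le> \<tau> \<Longrightarrow> \<tau> \<le> 1 \<Longrightarrow>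
    (1 + norm x) ^ m * norm (LINT y|lborel. g (x - \<tau> *\<^sub>R y) * h y) \<le> C * \<tau> ^ L"
proof -
  note [measurable] = rapid_measurable[OF h]
  have gm [measurable]: "g \<in> borel_measurable borel" by (rule rapid_measurable[OF schwartz_rapid[OF g]])
  obtain A where A: "0 \<le> A" "\<And>v x. (1 + norm x) ^ m * norm (g (x + v) - (\<Sum>j<L. taylor g j v x / fact j)) \<le> A * norm v ^ L * (1 + norm v) ^ m"
    using taylor_remainder_bound[OF g] by blast
  have gb: "integrable lborel (\<lambda>y. g (x - \<tau> *\<^sub>R y) * h y)" for x \<tau>
  proof -
    obtain D where D: "\<And>x. (1 + norm x) ^ 0 * norm (partial_derivs [] g x) \<le> D" using schwartz_bound[OF g] by blast
    show ?thesis by (rule rapid_growth_integrable[OF h, where B=D and M=0]) (use D in auto)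
  qed
  have mi: "integrable lborel (\<lambda>y. of_real (mon is y) * h y)" for "is" :: "'n list"
  proof (rule rapid_growth_integrable[OF h, where B=1 and M="length is"])
    fix y :: "real^'n"
    show "norm (complex_of_real (mon is y)) \<le> 1 * (1 + norm y) ^ length is"
      using abs_mon_le[of "is" y] power_mono[of "norm y" "1 + norm y" "length is"] by simp
  qed simp
  define I where "I = (LINT y|lborel. (norm y ^ L * (1 + norm y) ^ m) * norm (h y))"
  have Ii: "integrable lborel (\<lambda>y. (norm y ^ L * (1 + norm y) ^ m) * norm (h y))"
  proof -
    have "integrable lborel (\<lambda>y. complex_of_real (norm y ^ L * (1 + norm y) ^ m) * h y)"
    proof (rule rapid_growth_integrable[OF h, where B=1 and M="L + m"])
      fix y :: "real^'n"
      show "norm (complex_of_real (norm y ^ L * (1 + norm y) ^ m)) \<le> 1 * (1 + norm y) ^ (L + m)"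
        unfolding power_add norm_of_real by (auto simp: abs_mult intro!: mult_right_mono power_mono)
    qed simp
    moreover have "norm (complex_of_real (norm y ^ L * (1 + norm y) ^ m) * h y) = (norm y ^ L * (1 + norm y) ^ m) * norm (h y)" for y
      unfolding norm_mult[of "complex_of_real _"] norm_of_real by (simp add: abs_mult)
    ultimately show ?thesis using integrable_norm by fastforce
  qed
  show thesis
  proof
    show "0 \<le> A * I" using A by (auto simp: I_def intro!: mult_nonneg_nonneg Bochner_Integration.integral_nonneg)
    fix \<tau> :: real and x :: "real^'n" assume \<tau>: "0 \<le> \<tau>" "\<tau> \<le> 1"
    define P where "P y = (\<Sum>j<L. taylor g j ((- \<tau>) *\<^sub>R y) x / fact j)" for y
    have Ph: "P y * h y = (\<Sum>j<L. \<Sum>is | length is = j. of_real ((- \<tau>) ^ j / fact j) * partial_derivs is g x * (of_real (mon is y) * h y))" for y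
      unfolding P_def taylor_scaleR unfolding taylor_def
      by (simp add: sum_distrib_left sum_distrib_right sum_divide_distrib mult_ac)
    have Pint: "integrable lborel (\<lambda>y. P y * h y)" unfolding Ph
      by (intro Bochner_Integration.integrable_sum integrable_mult_right mi)
    have P0: "(LINT y|lborel. P y * h y) = 0" unfolding Ph
      using mi mom by (subst Bochner_Integration.integral_sum) (auto intro!: Bochner_Integration.integrable_sum integrable_mult_right sum.neutral simp: Bochner_Integration.integral_sum)
    have "(LINT y|lborel. g (x - \<tau> *\<^sub>R y) * h y) = (LINT y|lborel. (g (x - \<tau> *\<^sub>R y) - P y) * h y)"
      using gb Pint P0 by (simp add: left_diff_distrib)
    then have "(1 + norm x) ^ m * norm (LINT y|lborel. g (x - \<tau> *\<^sub>R y) * h y)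
        \<le> (1 + norm x) ^ m * (LINT y|lborel. norm ((g (x - \<tau> *\<^sub>R y) - P y) * h y))"
      by (simp add: mult_left_mono)
    also have "\<dots> = (LINT y|lborel. (1 + norm x) ^ m * norm ((g (x - \<tau> *\<^sub>R y) - P y) * h y))" by simp
    also have "\<dots> \<le> (LINT y|lborel. A * \<tau> ^ L * ((norm y ^ L * (1 + norm y) ^ m) * norm (h y)))"
    proof (rule integral_mono)
      have "integrable lborel (\<lambda>y. (g (x - \<tau> *\<^sub>R y) - P y) * h y)"
        using gb Pint by (simp add: left_diff_distrib)
      then show "integrable lborel (\<lambda>y. (1 + norm x) ^ m * norm ((g (x - \<tau> *\<^sub>R y) - P y) * h y))"
        by (intro integrable_mult_right integrable_norm)
      show "integrable lborel (\<lambda>y. A * \<tau> ^ L * ((norm y ^ L * (1 + norm y) ^ m) * norm (h y)))"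
        by (intro integrable_mult_right Ii)
      fix y
      have "(1 + norm x) ^ m * norm (g (x + (- \<tau>) *\<^sub>R y) - P y) \<le> A * norm ((- \<tau>) *\<^sub>R y) ^ L * (1 + norm ((- \<tau>) *\<^sub>R y)) ^ m"
        unfolding P_def by (rule A)
      also have "\<dots> \<le> A * norm ((- \<tau>) *\<^sub>R y) ^ L * (1 + norm y) ^ m"
        using A \<tau> by (intro mult_left_mono power_mono) (auto simp: mult_left_le_one_le)
      also have "\<dots> = A * \<tau> ^ L * (norm y ^ L * (1 + norm y) ^ m)"
        using \<tau> by (simp add: power_mult_distrib)
      finally have "(1 + norm x) ^ m * norm (g (x - \<tau> *\<^sub>R y) - P y) \<le> A * \<tau> ^ L * (norm y ^ L * (1 + norm y) ^ m)" by simp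
      then have "(1 + norm x) ^ m * norm (g (x - \<tau> *\<^sub>R y) - P y) * norm (h y) \<le> A * \<tau> ^ L * (norm y ^ L * (1 + norm y) ^ m) * norm (h y)"
        by (intro mult_right_mono) auto
      then show "(1 + norm x) ^ m * norm ((g (x - \<tau> *\<^sub>R y) - P y) * h y) \<le> A * \<tau> ^ L * ((norm y ^ L * (1 + norm y) ^ m) * norm (h y))"
        by (simp add: norm_mult mult.assoc)
    qed
    also have "\<dots> = A * I * \<tau> ^ L" by (simp add: I_def)
    finally show "(1 + norm x) ^ m * norm (LINT y|lborel. g (x - \<tau> *\<^sub>R y) * h y) \<le> A * I * \<tau> ^ L" .
  qed
qed

lemma mon_eq_prod_count: "mon is y = (\<Prod>i\<in>UNIV. (y $ i) ^ count_list is i)"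
proof (induction "is")
  case (Cons j "is")
  have "(\<Prod>i\<in>UNIV. (y $ i) ^ count_list (j # is) i) = (\<Prod>i\<in>UNIV. (if i = j then y $ i else 1) * (y $ i) ^ count_list is i)"
    by (intro prod.cong) auto
  then show ?case using Cons by (simp add: prod.distrib)
qed auto

text \<open>The multi-index of a list is its \<open>count_list\<close>; this translates the moment
  condition of the theorem into the language of \<open>mon\<close>.\<close>

lemma moment_mon:
  assumes "\<And>\<beta> :: 'n::finite \<Rightarrow> nat. int (\<Sum>i\<in>UNIV. \<beta> i) \<le> S \<Longrightarrow> moment \<beta> k = 0" "int (length is) \<le> S"
  shows "(LINT y|lborel. of_real (mon is y) * k y) = 0"
proof -
  have "(\<Sum>i\<in>UNIV. count_list is i) = length is"
    by (rule sum_count_set) auto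
  then show ?thesis using assms(1)[of "count_list is"] assms(2)
    by (simp add: moment_def mon_eq_prod_count scaleR_conv_of_real)
qed

section \<open>The Fourier transform\<close>

definition chi :: "real \<Rightarrow> complex" where
  "chi r = exp (- \<i> * complex_of_real r)"

lemma fourier_chi: "fourier g \<xi> = (LINT x|lborel. chi (x \<bullet> \<xi>) * g x)"
  by (simp add: fourier_def chi_def)

lemma norm_chi [simp]: "norm (chi r) = 1"
  by (simp add: chi_def)

lemma chi_0 [simp]: "chi 0 = 1"
  by (simp add: chi_def)

lemma chi_add: "chi (a + b) = chi a * chi b"
  by (simp add: chi_def exp_add[symmetric] algebra_simps)

lemma continuous_on_chi [continuous_intros]: "continuous_on A f \<Longrightarrow> continuous_on A (\<lambda>x. chi (f x))"
  unfolding chi_def by (intro continuous_intros)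

lemma borel_measurable_chi [measurable]: "chi \<in> borel_measurable borel"
  by (intro borel_measurable_continuous_onI continuous_intros)

lemma chi_approx: "norm (chi r - 1 + \<i> * r) \<le> r\<^sup>2"
proof -
  have "norm (exp (\<i> * complex_of_real (- r)) - (\<Sum>k\<le>1. (\<i> * complex_of_real (- r)) ^ k / fact k)) \<le> \<bar>- r\<bar> ^ Suc 1 / fact (Suc 1)"
    by (rule iexp_approx1)
  then have "norm (chi r - 1 + \<i> * r) \<le> r\<^sup>2 / 2"
    by (simp add: chi_def power2_eq_square algebra_simps)
  also have "\<dots> \<le> r\<^sup>2" by simp
  finally show ?thesis .
qed

lemma integrable_chi_mult:
  assumes "integrable lborel g" "f \<in> borel_measurable borel"
  shows "integrable lborel (\<lambda>x. chi (f x) * g x)"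
proof (rule Bochner_Integration.integrable_bound[OF assms(1)])
  note [measurable] = assms(2)
  have [measurable]: "g \<in> borel_measurable borel" using assms(1) by (auto dest: borel_measurable_integrable)
  show "(\<lambda>x. chi (f x) * g x) \<in> borel_measurable lborel" by measurable
qed (simp add: norm_mult)

lemma norm_fourier_le: "norm (fourier g \<xi>) \<le> (LINT x|lborel. norm (g x))"
  unfolding fourier_chi by (rule order_trans[OF integral_norm_bound]) (simp add: norm_mult)

lemma rapid_coord:
  fixes g :: "real^'n::finite \<Rightarrow> complex"
  assumes g: "rapid g" shows "rapid (\<lambda>x. c * of_real (x $ i) * g x)"
  unfolding rapid_def
proof (intro conjI allI)
  show "(\<lambda>x. c * of_real (x $ i) * g x) \<in> borel_measurable borel"
    using rapid_measurable[OF g] by measurable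
  fix N
  obtain C where C: "\<And>x. (1 + norm x) ^ Suc N * norm (g x) \<le> C" using rapid_bound[OF g] by blast
  show "\<exists>C. \<forall>x. (1 + norm x) ^ N * norm (c * of_real (x $ i) * g x) \<le> C"
  proof (intro exI allI)
    fix x :: "real^'n"
    have "\<bar>x $ i\<bar> \<le> 1 + norm x" using component_le_norm_cart[of x i] by simp
    then have "(1 + norm x) ^ N * norm (c * of_real (x $ i) * g x) \<le> (1 + norm x) ^ N * (norm c * (1 + norm x) * norm (g x))"
      by (intro mult_left_mono) (auto simp: norm_mult intro!: mult_left_mono mult_right_mono)
    also have "\<dots> = norm c * ((1 + norm x) ^ Suc N * norm (g x))" by (simp add: mult_ac)
    also have "\<dots> \<le> norm c * C" using C by (intro mult_left_mono) auto
    finally show "(1 + norm x) ^ N * norm (c * of_real (x $ i) * g x) \<le> norm c * C" .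
  qed
qed

text \<open>The quadratic error of the linear approximation to \<open>chi\<close>, integrated
  against \<open>norm (g x)\<close>, is controlled by the second moment of \<open>g\<close>.\<close>

lemma fourier_has_derivative:
  fixes g :: "real^'n::finite \<Rightarrow> complex"
  assumes g: "rapid g"
  shows "(fourier g has_derivative (\<lambda>h. \<Sum>i\<in>UNIV. of_real (h $ i) * fourier (\<lambda>x. - \<i> * of_real (x $ i) * g x) \<xi>)) (at \<xi>)"
proof -
  note [measurable] = rapid_measurable[OF g]
  let ?L = "\<lambda>h. \<Sum>i\<in>UNIV. of_real (h $ i) * fourier (\<lambda>x. - \<i> * of_real (x $ i) * g x) \<xi>"
  have gi: "integrable lborel g" by (rule rapid_integrable[OF g])
  have ci: "integrable lborel (\<lambda>x. chi (x \<bullet> \<xi>) * g x)" for \<xi> :: "real^'n"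
    by (intro integrable_chi_mult gi) auto
  have xi: "integrable lborel (\<lambda>x. chi (x \<bullet> \<xi>) * (- \<i> * of_real (x $ i) * g x))" for i
    by (intro integrable_chi_mult rapid_integrable rapid_coord g) auto
  define K where "K = (LINT x|lborel. (norm x)\<^sup>2 * norm (g x))"
  have Ki: "integrable lborel (\<lambda>x. (norm x)\<^sup>2 * norm (g x))"
  proof -
    have "integrable lborel (\<lambda>x. complex_of_real ((norm x)\<^sup>2) * g x)"
    proof (rule rapid_growth_integrable[OF g, where B=1 and M=2])
      fix x :: "real^'n" show "norm (complex_of_real ((norm x)\<^sup>2)) \<le> 1 * (1 + norm x)\<^sup>2"
        using power_mono[of "norm x" "1 + norm x" 2] by (simp del: of_real_power)
    qed simp
    from integrable_norm[OF this] show ?thesis by (simp add: norm_mult norm_power)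
  qed
  have bl: "bounded_linear ?L"
    by (intro bounded_linear_sum bounded_linear_mult_left[THEN bounded_linear_compose] bounded_linear_compose[OF bounded_linear_of_real bounded_linear_vec_nth])
  have L: "?L h = (LINT x|lborel. chi (x \<bullet> \<xi>) * (- \<i> * of_real (x \<bullet> h) * g x))" for h
  proof -
    have "?L h = (\<Sum>i\<in>UNIV. LINT x|lborel. of_real (h $ i) * (chi (x \<bullet> \<xi>) * (- \<i> * of_real (x $ i) * g x)))"
      by (simp add: fourier_chi)
    also have "\<dots> = (LINT x|lborel. (\<Sum>i\<in>UNIV. of_real (h $ i) * (chi (x \<bullet> \<xi>) * (- \<i> * of_real (x $ i) * g x))))"
      using xi by (intro Bochner_Integration.integral_sum[symmetric] integrable_mult_right) auto
    also have "\<dots> = (LINT x|lborel. chi (x \<bullet> \<xi>) * (- \<i> * of_real (x \<bullet> h) * g x))"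
      by (intro Bochner_Integration.integral_cong) (auto simp: inner_vec_def sum_distrib_left sum_distrib_right mult_ac sum_negf[symmetric])
    finally show ?thesis .
  qed
  have Li: "integrable lborel (\<lambda>x. chi (x \<bullet> \<xi>) * (- \<i> * of_real (x \<bullet> h) * g x))" for h
  proof -
    have "(\<lambda>x. chi (x \<bullet> \<xi>) * (- \<i> * of_real (x \<bullet> h) * g x)) = (\<lambda>x. \<Sum>i\<in>UNIV. of_real (h $ i) * (chi (x \<bullet> \<xi>) * (- \<i> * of_real (x $ i) * g x)))"
      by (auto simp: inner_vec_def sum_distrib_left sum_distrib_right mult_ac sum_negf[symmetric])
    then show ?thesis using xi by (auto intro!: Bochner_Integration.integrable_sum integrable_mult_right)
  qed
  have key: "norm (fourier g (\<xi> + h) - fourier g \<xi> - ?L h) \<le> (norm h)\<^sup>2 * K" for h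
  proof -
    have "fourier g (\<xi> + h) - fourier g \<xi> - ?L h =
        (LINT x|lborel. chi (x \<bullet> (\<xi> + h)) * g x - chi (x \<bullet> \<xi>) * g x - chi (x \<bullet> \<xi>) * (- \<i> * of_real (x \<bullet> h) * g x))"
      unfolding L unfolding fourier_chi
      by (simp only: Bochner_Integration.integral_diff Bochner_Integration.integrable_diff ci Li)
    also have "\<dots> = (LINT x|lborel. chi (x \<bullet> \<xi>) * (chi (x \<bullet> h) - 1 + \<i> * of_real (x \<bullet> h)) * g x)"
      by (intro Bochner_Integration.integral_cong) (auto simp: inner_add_right chi_add algebra_simps)
    also have "norm \<dots> \<le> (LINT x|lborel. (norm h)\<^sup>2 * ((norm x)\<^sup>2 * norm (g x)))"
    proof (rule order_trans[OF integral_norm_bound integral_mono'])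
      show "integrable lborel (\<lambda>x. (norm h)\<^sup>2 * ((norm x)\<^sup>2 * norm (g x)))" by (intro integrable_mult_right Ki)
      fix x
      have "norm (chi (x \<bullet> h) - 1 + \<i> * of_real (x \<bullet> h)) \<le> (x \<bullet> h)\<^sup>2" by (rule chi_approx)
      also have "\<dots> \<le> (norm x * norm h)\<^sup>2"
        using Cauchy_Schwarz_ineq2[of x h] by (metis abs_le_square_iff abs_mult abs_norm_cancel)
      finally show "norm (chi (x \<bullet> \<xi>) * (chi (x \<bullet> h) - 1 + \<i> * of_real (x \<bullet> h)) * g x) \<le> (norm h)\<^sup>2 * ((norm x)\<^sup>2 * norm (g x))"
        by (simp add: norm_mult power_mult_distrib mult.assoc[symmetric] mult.commute[of "(norm h)\<^sup>2"] mult_right_mono)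
    qed auto
    also have "\<dots> = (norm h)\<^sup>2 * K" by (simp add: K_def)
    finally show ?thesis .
  qed
  show ?thesis
    unfolding has_derivative_iff_norm
  proof (intro conjI bl)
    show "((\<lambda>y. norm (fourier g y - fourier g \<xi> - ?L (y - \<xi>)) / norm (y - \<xi>)) \<longlongrightarrow> 0) (at \<xi>)"
    proof (rule tendsto_sandwich[of "\<lambda>_. 0" _ _ "\<lambda>y. norm (y - \<xi>) * K"])
      show "\<forall>\<^sub>F y in at \<xi>. norm (fourier g y - fourier g \<xi> - ?L (y - \<xi>)) / norm (y - \<xi>) \<le> norm (y - \<xi>) * K"
      proof (rule eventually_at_topological[THEN iffD2], intro exI[of _ UNIV] conjI ballI impI)
        fix y :: "real^'n" assume "y \<noteq> \<xi>"
        then show "norm (fourier g y - fourier g \<xi> - ?L (y - \<xi>)) / norm (y - \<xi>) \<le> norm (y - \<xi>) * K"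
          using key[of "y - \<xi>"] by (simp add: divide_le_eq power2_eq_square mult_ac)
      qed auto
      show "((\<lambda>y. norm (y - \<xi>) * K) \<longlongrightarrow> 0) (at \<xi>)"
        by (auto intro!: tendsto_eq_intros)
    qed auto
  qed
qed

lemma partial_deriv_fourier:
  assumes "rapid g"
  shows "partial_deriv i (fourier g) = fourier (\<lambda>x. - \<i> * of_real (x $ i) * g x)"
proof
  fix \<xi>
  have "partial_deriv i (fourier g) \<xi> = (\<Sum>j\<in>UNIV. of_real (axis i 1 $ j) * fourier (\<lambda>x. - \<i> * of_real (x $ j) * g x) \<xi>)"
    by (rule partial_deriv_eqI[OF fourier_has_derivative[OF assms]])
  also have "\<dots> = (\<Sum>j\<in>UNIV. if j = i then fourier (\<lambda>x. - \<i> * of_real (x $ j) * g x) \<xi> else 0)"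
    by (intro sum.cong) (auto simp: axis_def)
  finally show "partial_deriv i (fourier g) \<xi> = fourier (\<lambda>x. - \<i> * of_real (x $ i) * g x) \<xi>" by simp
qed

lemma smooth_fourier:
  assumes "rapid g" shows "smooth_on UNIV (fourier g)"
proof (rule smooth_on_coinduct[where P="\<lambda>F. \<exists>g. rapid g \<and> F = fourier g"])
  show "f differentiable (at x)" if "\<exists>g. rapid g \<and> f = fourier g" for f x
    using that fourier_has_derivative unfolding differentiable_def by blast
  show "\<exists>g. (\<exists>h. rapid h \<and> g = fourier h) \<and> (\<forall>x\<in>UNIV. partial_deriv i f x = g x)" if "\<exists>g. rapid g \<and> f = fourier g" for f i
    using that partial_deriv_fourier rapid_coord by blast
qed (use assms in auto)

lemma partial_derivs_fourier:
  "rapid g \<Longrightarrow> partial_derivs is (fourier g) = fourier (\<lambda>x. (- \<i>) ^ length is * of_real (mon is x) * g x)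
    \<and> rapid (\<lambda>x. (- \<i>) ^ length is * of_real (mon is x) * g x)"
proof (induction "is")
  case (Cons i "is")
  then have IH: "partial_derivs is (fourier g) = fourier (\<lambda>x. (- \<i>) ^ length is * of_real (mon is x) * g x)"
    "rapid (\<lambda>x. (- \<i>) ^ length is * of_real (mon is x) * g x)" by auto
  have eq: "(\<lambda>x. (- \<i>) ^ length (i # is) * of_real (mon (i # is) x) * g x) = (\<lambda>x. - \<i> * of_real (x $ i) * ((- \<i>) ^ length is * of_real (mon is x) * g x))"
    by (auto simp: mult_ac)
  show ?case unfolding eq partial_derivs.simps IH(1)
    using partial_deriv_fourier[OF IH(2)] rapid_coord[OF IH(2), of "- \<i>" i] by auto
qed simp

lemma schwartz_mon_mult:
  "g \<in> schwartz \<Longrightarrow> (\<lambda>x. c * of_real (mon is x) * g x) \<in> schwartz"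
proof (induction "is")
  case (Cons i "is")
  have "(\<lambda>x. c * of_real (mon (i # is) x) * g x) = (\<lambda>x. of_real (x $ i) * (c * of_real (mon is x) * g x))"
    by (auto simp: mult_ac)
  then show ?case using schwartz_coord_mult[OF Cons.IH[OF Cons.prems]] by simp
qed (auto intro: schwartz_cmult)

lemma fourier_translate:
  fixes g :: "real^'n::finite \<Rightarrow> complex"
  assumes "g \<in> borel_measurable borel"
  shows "fourier (\<lambda>x. g (x + v)) \<xi> = chi (- (v \<bullet> \<xi>)) * fourier g \<xi>"
proof -
  note [measurable] = assms
  have "fourier g \<xi> = (LINT x|lborel. chi ((v + 1 *\<^sub>R x) \<bullet> \<xi>) * g (v + 1 *\<^sub>R x))"
    unfolding fourier_chi by (subst integral_affine[where c=1 and t=v]) auto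
  then have "chi (- (v \<bullet> \<xi>)) * fourier g \<xi> = (LINT x|lborel. chi (- (v \<bullet> \<xi>)) * (chi ((v + 1 *\<^sub>R x) \<bullet> \<xi>) * g (v + 1 *\<^sub>R x)))"
    by simp
  also have "\<dots> = fourier (\<lambda>x. g (x + v)) \<xi>"
    unfolding fourier_chi
  proof (intro Bochner_Integration.integral_cong refl)
    fix x
    have "chi (- (v \<bullet> \<xi>)) * chi ((v + x) \<bullet> \<xi>) = chi (x \<bullet> \<xi>)"
      by (simp add: chi_add[symmetric] inner_add_left)
    then show "chi (- (v \<bullet> \<xi>)) * (chi ((v + 1 *\<^sub>R x) \<bullet> \<xi>) * g (v + 1 *\<^sub>R x)) = chi (x \<bullet> \<xi>) * g (x + v)"
      by (simp add: add.commute mult.assoc[symmetric])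
  qed
  finally show ?thesis ..
qed

lemma taylor_1_axis: "taylor g 1 (h *\<^sub>R axis i 1) x = of_real h * partial_deriv i g x"
proof -
  have "taylor g 1 (h *\<^sub>R axis i 1) x = (\<Sum>j\<in>UNIV. of_real (h * axis i 1 $ j) * partial_deriv j g x)"
    using sum_length_Suc[of "\<lambda>is. of_real (mon is (h *\<^sub>R axis i 1)) * partial_derivs is g x" 0]
    by (simp add: taylor_def)
  also have "\<dots> = (\<Sum>j\<in>UNIV. if j = i then of_real h * partial_deriv j g x else 0)"
    by (intro sum.cong) (auto simp: axis_def)
  finally show ?thesis by simp
qed

text \<open>The difference quotient of \<open>g\<close> in direction \<open>i\<close> converges in \<open>L\<^sup>1\<close>, and translations become
  multiplications.\<close>
lemma fourier_partial_deriv: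
  fixes g :: "real^'n::finite \<Rightarrow> complex"
  assumes g: "g \<in> schwartz"
  shows "fourier (partial_deriv i g) \<xi> = \<i> * of_real (\<xi> $ i) * fourier g \<xi>"
proof -
  let ?n = "Suc (DIM(real^'n))"
  let ?D = "fourier (partial_deriv i g) \<xi> - \<i> * of_real (\<xi> $ i) * fourier g \<xi>"
  have gm [measurable]: "g \<in> borel_measurable borel" by (rule rapid_measurable[OF schwartz_rapid[OF g]])
  have Dm [measurable]: "partial_deriv i g \<in> borel_measurable borel"
    by (rule rapid_measurable[OF schwartz_rapid[OF schwartz_partial_deriv[OF g]]])
  obtain A where A: "0 \<le> A" "\<And>v x. (1 + norm x) ^ ?n * norm (g (x + v) - (\<Sum>j<2. taylor g j v x / fact j)) \<le> A * norm v ^ 2 * (1 + norm v) ^ ?n"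
    using taylor_remainder_bound[OF g] by blast
  define J where "J = (LINT x|lborel. 1 / (1 + norm (x::real^'n)) ^ ?n)"
  have Ji: "integrable lborel (\<lambda>x::real^'n. 1 / (1 + norm x) ^ ?n)" by (intro integrable_decay_aux) simp
  define B where "B = A * 2 ^ ?n * J + (\<xi> $ i)\<^sup>2 * norm (fourier g \<xi>)"
  \<comment> \<open>Both errors, that of Taylor's formula and that of \<open>chi\<close>, are
    quadratic in \<open>h\<close>; dividing by \<open>h\<close> and letting it tend to 0 forces
    \<open>?D\<close> to vanish.\<close>
  have main: "h * norm ?D \<le> h\<^sup>2 * B" if h: "0 < h" "h \<le> 1" for h
  proof -
    let ?v = "h *\<^sub>R axis i (1::real)"
    have nv: "norm ?v = h" using h by simp
    define r where "r x = g (x + ?v) - g x - of_real h * partial_deriv i g x" for x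
    have [measurable]: "r \<in> borel_measurable borel" unfolding r_def by measurable
    have r: "(1 + norm x) ^ ?n * norm (r x) \<le> A * 2 ^ ?n * h\<^sup>2" for x
    proof -
      have "(1 + norm x) ^ ?n * norm (r x) \<le> A * norm ?v ^ 2 * (1 + norm ?v) ^ ?n"
        using A(2)[of x ?v] by (simp add: r_def taylor_1_axis[unfolded One_nat_def] numeral_2_eq_2 diff_diff_add del: norm_scaleR power_Suc)
      also have "\<dots> \<le> A * h ^ 2 * 2 ^ ?n"
        unfolding nv using A h by (intro mult_left_mono power_mono) auto
      finally show ?thesis by (simp add: mult_ac)
    qed
    have "integrable lborel r" by (rule integrable_decay[OF _ r]) auto
    have ig: "integrable lborel (\<lambda>x. chi (x \<bullet> \<xi>) * g x)" "integrable lborel (\<lambda>x. chi (x \<bullet> \<xi>) * partial_deriv i g x)"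
      by (intro integrable_chi_mult rapid_integrable schwartz_rapid schwartz_partial_deriv g; simp)+
    have "(\<lambda>x. g (x + ?v)) \<in> schwartz" using schwartz_affine[OF g, of 1 ?v] by simp
    then have ig': "integrable lborel (\<lambda>x. chi (x \<bullet> \<xi>) * g (x + ?v))"
      by (intro integrable_chi_mult rapid_integrable schwartz_rapid) auto
    have "fourier r \<xi> = (LINT x|lborel. chi (x \<bullet> \<xi>) * g (x + ?v) - chi (x \<bullet> \<xi>) * g x - of_real h * (chi (x \<bullet> \<xi>) * partial_deriv i g x))"
      unfolding fourier_chi r_def by (intro Bochner_Integration.integral_cong) (auto simp: algebra_simps)
    also have "\<dots> = fourier (\<lambda>x. g (x + ?v)) \<xi> - fourier g \<xi> - of_real h * fourier (partial_deriv i g) \<xi>"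
      unfolding fourier_chi using ig ig' by simp
    also have "fourier (\<lambda>x. g (x + ?v)) \<xi> = chi (- (h * \<xi> $ i)) * fourier g \<xi>"
      by (simp add: fourier_translate inner_axis')
    finally have "of_real h * ?D = (chi (- (h * \<xi> $ i)) - 1 + \<i> * of_real (- (h * \<xi> $ i))) * fourier g \<xi> - fourier r \<xi>"
      by (simp add: algebra_simps)
    then have "h * norm ?D = norm ((chi (- (h * \<xi> $ i)) - 1 + \<i> * of_real (- (h * \<xi> $ i))) * fourier g \<xi> - fourier r \<xi>)"
      using h by (metis abs_of_pos norm_mult norm_of_real)
    also have "\<dots> \<le> (h * \<xi> $ i)\<^sup>2 * norm (fourier g \<xi>) + A * 2 ^ ?n * h\<^sup>2 * J"
    proof (rule order_trans[OF norm_triangle_ineq4 add_mono])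
      show "norm ((chi (- (h * \<xi> $ i)) - 1 + \<i> * of_real (- (h * \<xi> $ i))) * fourier g \<xi>) \<le> (h * \<xi> $ i)\<^sup>2 * norm (fourier g \<xi>)"
        unfolding norm_mult using chi_approx[of "- (h * \<xi> $ i)"] by (intro mult_right_mono) auto
      have "norm (fourier r \<xi>) \<le> (LINT x|lborel. norm (r x))" by (rule norm_fourier_le)
      also have "\<dots> \<le> (LINT x|lborel. (A * 2 ^ ?n * h\<^sup>2) * (1 / (1 + norm (x::real^'n)) ^ ?n))"
      proof (rule integral_mono)
        show "integrable lborel (\<lambda>x::real^'n. (A * 2 ^ ?n * h\<^sup>2) * (1 / (1 + norm x) ^ ?n))"
          by (rule integrable_mult_right[OF Ji])
        show "norm (r x) \<le> (A * 2 ^ ?n * h\<^sup>2) * (1 / (1 + norm x) ^ ?n)" for x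
          using r[of x] by (simp add: pos_le_divide_eq add_pos_nonneg mult.commute del: power_Suc)
      qed (use \<open>integrable lborel r\<close> in auto)
      finally show "norm (fourier r \<xi>) \<le> A * 2 ^ ?n * h\<^sup>2 * J" by (simp only: J_def integral_mult_right_zero)
    qed
    also have "\<dots> = h\<^sup>2 * B" by (simp add: B_def power_mult_distrib algebra_simps)
    finally show ?thesis .
  qed
  have "norm ?D \<le> e" if e: "0 < e" for e
  proof -
    define h where "h = min 1 (e / (\<bar>B\<bar> + 1))"
    have h: "0 < h" "h \<le> 1" using e by (auto simp: h_def)
    have "h \<le> e / (\<bar>B\<bar> + 1)" by (simp add: h_def)
    then have he: "h * (\<bar>B\<bar> + 1) \<le> e" by (subst (asm) pos_le_divide_eq) auto
    have "norm ?D \<le> h * B" using main[OF h(1,2)] h(1) by (simp add: power2_eq_square mult.assoc)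
    also have "\<dots> \<le> h * (\<bar>B\<bar> + 1)" using h by (intro mult_left_mono) auto
    finally show ?thesis using he by simp
  qed
  then have "norm ?D \<le> 0" by (rule field_le_epsilon) simp
  then show ?thesis by simp
qed

lemma fourier_partial_derivs:
  "g \<in> schwartz \<Longrightarrow> fourier (partial_derivs is g) \<xi> = \<i> ^ length is * of_real (mon is \<xi>) * fourier g \<xi>"
  by (induction "is") (auto simp: fourier_partial_deriv[OF schwartz_partial_derivs] mult_ac)

text \<open>A factor \<open>1 + norm \<xi>\<close> is at most 1 plus the sum of the absolute values
  of the coordinates, and a coordinate times the transform is, up to a factor of modulus 1, the
  transform of a partial derivative.\<close>

lemma fourier_decay:
  fixes g :: "real^'n::finite \<Rightarrow> complex"
  assumes "g \<in> schwartz"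
  shows "\<exists>C. \<forall>\<xi>. (1 + norm \<xi>) ^ N * norm (fourier g \<xi>) \<le> C"
  using assms
proof (induction N arbitrary: g)
  case (Suc N)
  obtain C where C: "\<And>\<xi>. (1 + norm \<xi>) ^ N * norm (fourier g \<xi>) \<le> C" using Suc by blast
  have "\<forall>i. \<exists>C. \<forall>\<xi>. (1 + norm \<xi>) ^ N * norm (fourier (partial_deriv i g) \<xi>) \<le> C"
    using Suc.IH schwartz_partial_deriv[OF Suc.prems] by blast
  then obtain D where D: "\<And>i \<xi>. (1 + norm \<xi>) ^ N * norm (fourier (partial_deriv i g) \<xi>) \<le> D i" by metis
  show ?case
  proof (intro exI allI)
    fix \<xi> :: "real^'n"
    have "(1 + norm \<xi>) * norm (fourier g \<xi>) \<le> (1 + (\<Sum>i\<in>UNIV. \<bar>\<xi> $ i\<bar>)) * norm (fourier g \<xi>)"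
      using norm_le_l1_cart[of \<xi>] by (intro mult_right_mono) auto
    also have "\<dots> = norm (fourier g \<xi>) + (\<Sum>i\<in>UNIV. norm (fourier (partial_deriv i g) \<xi>))"
      by (simp add: fourier_partial_deriv[OF Suc.prems] norm_mult algebra_simps sum_distrib_left)
    finally have "(1 + norm \<xi>) ^ N * ((1 + norm \<xi>) * norm (fourier g \<xi>)) \<le> (1 + norm \<xi>) ^ N * (norm (fourier g \<xi>) + (\<Sum>i\<in>UNIV. norm (fourier (partial_deriv i g) \<xi>)))"
      by (intro mult_left_mono) auto
    also have "\<dots> \<le> C + (\<Sum>i\<in>UNIV. D i)"
      unfolding distrib_left sum_distrib_left by (intro add_mono sum_mono C D)
    finally show "(1 + norm \<xi>) ^ Suc N * norm (fourier g \<xi>) \<le> C + (\<Sum>i\<in>UNIV. D i)" by (simp add: mult_ac)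
  qed
qed (use norm_fourier_le in auto)

lemma schwartz_fourier:
  assumes g: "g \<in> schwartz" shows "fourier g \<in> schwartz"
  unfolding schwartz_iff
proof (intro conjI allI)
  show "smooth_on UNIV (fourier g)" by (intro smooth_fourier schwartz_rapid g)
  fix "is" N
  show "\<exists>C. \<forall>x. (1 + norm x) ^ N * norm (partial_derivs is (fourier g) x) \<le> C"
    using partial_derivs_fourier[OF schwartz_rapid[OF g], of "is"] fourier_decay[OF schwartz_mon_mult[OF g]] by auto
qed

section \<open>The Gaussian and Fourier inversion\<close>

definition gauss :: "real^'n::finite \<Rightarrow> complex" where
  "gauss x = of_real (exp (- (x \<bullet> x) / 2))"

text \<open>Polynomials times the Gaussian. The class is closed under partial derivatives and its
  members decay rapidly, whence the Gaussian is a Schwartz function.\<close>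

inductive gauss_poly :: "(real^'n::finite \<Rightarrow> complex) \<Rightarrow> bool" where
  base: "gauss_poly gauss"
| coord: "gauss_poly f \<Longrightarrow> gauss_poly (\<lambda>x. of_real (x $ i) * f x)"
| lin: "gauss_poly f \<Longrightarrow> gauss_poly g \<Longrightarrow> gauss_poly (\<lambda>x. a * f x + b * g x)"

lemma gauss_has_derivative:
  "((gauss :: real^'n::finite \<Rightarrow> complex) has_derivative (\<lambda>h. - of_real (x \<bullet> h) * gauss x)) (at x)"
proof -
  have "((\<lambda>x::real^'n. exp (- (x \<bullet> x) / 2)) has_derivative (\<lambda>h. - (x \<bullet> h) * exp (- (x \<bullet> x) / 2))) (at x)"
    by (auto intro!: derivative_eq_intros simp: inner_commute)
  from has_derivative_of_real[OF this] show ?thesis by (simp add: gauss_def[abs_def])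
qed

lemma rapid_gauss: "rapid gauss"
  unfolding rapid_def
proof (intro conjI allI)
  show "gauss \<in> borel_measurable borel"
    using gauss_has_derivative by (intro borel_measurable_continuous_onI continuous_at_imp_continuous_on) (auto intro: has_derivative_continuous)
  fix N
  have "((\<lambda>r::real. (1 + r) ^ N * exp (- (r * r) / 2)) \<longlongrightarrow> 0) at_top"
    by real_asymp
  then have "\<forall>\<^sub>F r in at_top. (1 + r) ^ N * exp (- (r * r) / 2) < (1::real)"
    by (rule order_tendstoD) simp
  then obtain R where R: "\<And>r. R \<le> r \<Longrightarrow> (1 + r) ^ N * exp (- (r * r) / 2) < (1::real)"
    by (auto simp: eventually_at_top_linorder)
  show "\<exists>C. \<forall>x::real^'n. (1 + norm x) ^ N * norm (gauss x) \<le> C"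
  proof (intro exI allI)
    fix x :: "real^'n"
    have ng: "norm (gauss x) = exp (- (norm x * norm x) / 2)"
      by (simp add: gauss_def dot_square_norm power2_eq_square)
    show "(1 + norm x) ^ N * norm (gauss x) \<le> max 1 ((1 + \<bar>R\<bar>) ^ N)"
    proof (cases "R \<le> norm x")
      case True
      show ?thesis using R[OF True] unfolding ng by (intro max.coboundedI1) auto
    next
      case False
      have "(1 + norm x) ^ N * norm (gauss x) \<le> (1 + \<bar>R\<bar>) ^ N * 1"
        unfolding ng using False by (intro mult_mono power_mono) auto
      then show ?thesis by simp
    qed
  qed
qed

lemma gauss_poly_props:
  fixes f :: "real^'n::finite \<Rightarrow> complex"
  shows "gauss_poly f \<Longrightarrow> rapid f \<and> (\<forall>x. f differentiable (at x)) \<and> (\<forall>i. gauss_poly (partial_deriv i f))"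
proof (induction rule: gauss_poly.induct)
  case base
  have "partial_deriv i gauss = (\<lambda>x. (-1) * (of_real (x $ i) * gauss x) + 0 * gauss x)" for i :: 'n
    by (rule ext, subst partial_deriv_eqI[OF gauss_has_derivative]) (simp add: inner_axis)
  moreover have "gauss_poly (\<lambda>x. (-1) * (of_real (x $ i) * gauss x) + 0 * gauss x)" for i :: 'n
    by (intro gauss_poly.intros)
  ultimately show ?case using rapid_gauss gauss_has_derivative by (auto simp: differentiable_def)
next
  case (coord f i)
  have der: "((\<lambda>x. complex_of_real (x $ i) * f x) has_derivative
      (\<lambda>h. of_real (x $ i) * frechet_derivative f (at x) h + of_real (h $ i) * f x)) (at x)" for x
  proof -
    have "((\<lambda>x. complex_of_real (x $ i)) has_derivative (\<lambda>h. complex_of_real (h $ i))) (at x)"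
      by (intro bounded_linear_imp_has_derivative bounded_linear_compose[OF bounded_linear_of_real bounded_linear_vec_nth])
    then show ?thesis using coord.IH by (intro has_derivative_mult) (auto simp: frechet_derivative_works)
  qed
  have "partial_deriv j (\<lambda>x. of_real (x $ i) * f x) = (\<lambda>x. 1 * (of_real (x $ i) * partial_deriv j f x) + (if i = j then 1 else 0) * f x)" for j
    by (rule ext, subst partial_deriv_eqI[OF der]) (auto simp: axis_def partial_deriv_def)
  moreover have "gauss_poly (\<lambda>x. 1 * (of_real (x $ i) * partial_deriv j f x) + (if i = j then 1 else 0) * f x)" for j
    using coord by (intro gauss_poly.intros) auto
  moreover have "rapid (\<lambda>x. of_real (x $ i) * f x)" using rapid_coord[of f 1 i] coord.IH by simp
  ultimately show ?case using der by (auto simp: differentiable_def)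
next
  case (lin f g a b)
  have der: "((\<lambda>x. a * f x + b * g x) has_derivative
      (\<lambda>h. a * frechet_derivative f (at x) h + b * frechet_derivative g (at x) h)) (at x)" for x
    using lin.IH by (intro has_derivative_add has_derivative_mult_right) (auto simp: frechet_derivative_works)
  have "partial_deriv j (\<lambda>x. a * f x + b * g x) = (\<lambda>x. a * partial_deriv j f x + b * partial_deriv j g x)" for j
    by (rule ext, subst partial_deriv_eqI[OF der]) (auto simp: partial_deriv_def)
  moreover have "gauss_poly (\<lambda>x. a * partial_deriv j f x + b * partial_deriv j g x)" for j
    using lin by (intro gauss_poly.intros) auto
  moreover have "rapid (\<lambda>x. a * f x + b * g x)" unfolding rapid_def
  proof (intro conjI allI)
    have "f \<in> borel_measurable borel" "g \<in> borel_measurable borel" using lin.IH by (auto intro: rapid_measurable)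
    then show "(\<lambda>x. a * f x + b * g x) \<in> borel_measurable borel" by measurable
    fix N
    obtain C where C: "0 \<le> C" "\<And>x. (1 + norm x) ^ N * norm (f x) \<le> C" using rapid_bound lin.IH by metis
    obtain D where D: "0 \<le> D" "\<And>x. (1 + norm x) ^ N * norm (g x) \<le> D" using rapid_bound lin.IH by metis
    show "\<exists>C. \<forall>x. (1 + norm x) ^ N * norm (a * f x + b * g x) \<le> C"
    proof (intro exI allI)
      fix x
      have "(1 + norm x) ^ N * norm (a * f x + b * g x) \<le> (1 + norm x) ^ N * (norm a * norm (f x) + norm b * norm (g x))"
        by (intro mult_left_mono norm_triangle_le) (auto simp: norm_mult)
      also have "\<dots> = norm a * ((1 + norm x) ^ N * norm (f x)) + norm b * ((1 + norm x) ^ N * norm (g x))"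
        by (simp add: algebra_simps)
      also have "\<dots> \<le> norm a * C + norm b * D" by (intro add_mono mult_left_mono C D) auto
      finally show "(1 + norm x) ^ N * norm (a * f x + b * g x) \<le> norm a * C + norm b * D" .
    qed
  qed
  ultimately show ?case using der by (auto simp: differentiable_def)
qed

lemma schwartz_gauss: "(gauss :: real^'n::finite \<Rightarrow> complex) \<in> schwartz"
proof -
  have gp: "gauss_poly (partial_derivs is gauss)" for "is" :: "'n list"
    by (induction "is") (use gauss_poly.base gauss_poly_props in auto)
  then show ?thesis
    unfolding schwartz_iff smooth_on_def using gauss_poly_props by (auto simp: rapid_def)
qed

text \<open>The Fourier transform of the Gaussian solves the differential equation that characterises
  the Gaussian up to a factor.\<close>
lemma fourier_gauss:
  fixes \<xi> :: "real^'n::finite"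
  shows "fourier gauss \<xi> = fourier (gauss :: real^'n \<Rightarrow> complex) 0 * gauss \<xi>"
proof -
  let ?F = "fourier (gauss :: real^'n \<Rightarrow> complex)"
  have coord: "fourier (\<lambda>x. - \<i> * of_real (x $ i) * gauss x) \<xi> = - of_real (\<xi> $ i) * ?F \<xi>" for i :: 'n and \<xi>
  proof -
    have "(\<lambda>x. - \<i> * of_real (x $ i) * gauss x) = (\<lambda>x. \<i> * partial_deriv i gauss x)"
      by (rule ext, subst partial_deriv_eqI[OF gauss_has_derivative]) (simp add: inner_axis)
    then have "fourier (\<lambda>x. - \<i> * of_real (x $ i) * gauss x) \<xi> = \<i> * fourier (partial_deriv i gauss) \<xi>"
      by (simp add: fourier_chi mult.left_commute)
    then show ?thesis by (simp add: fourier_partial_deriv[OF schwartz_gauss] mult.assoc[symmetric])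
  qed
  \<comment> \<open>The quotient of the transform by the Gaussian; both satisfy the same first-order
    equation, so its derivative vanishes.\<close>
  define D where "D \<xi> = ?F \<xi> * of_real (exp ((\<xi> \<bullet> \<xi>) / 2))" for \<xi> :: "real^'n"
  have "(D has_derivative (\<lambda>h. 0)) (at \<xi>)" for \<xi>
  proof -
    have e: "((\<lambda>x::real^'n. exp ((x \<bullet> x) / 2)) has_derivative (\<lambda>h. (\<xi> \<bullet> h) * exp ((\<xi> \<bullet> \<xi>) / 2))) (at \<xi>)"
      by (auto intro!: derivative_eq_intros simp: inner_commute)
    have "(\<Sum>i\<in>UNIV. of_real (h $ i) * fourier (\<lambda>x. - \<i> * of_real (x $ i) * gauss x) \<xi>) = - of_real (\<xi> \<bullet> h) * ?F \<xi>" for h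
      unfolding coord by (simp add: inner_vec_def sum_distrib_left sum_negf mult_ac)
    with fourier_has_derivative[OF rapid_gauss, of \<xi>]
    have "(?F has_derivative (\<lambda>h. - of_real (\<xi> \<bullet> h) * ?F \<xi>)) (at \<xi>)" by simp
    from has_derivative_mult[OF this has_derivative_of_real[OF e]]
    show ?thesis unfolding D_def by (simp add: algebra_simps)
  qed
  then obtain c where "\<And>\<xi>. D \<xi> = c"
    using has_derivative_zero_constant[of UNIV D] by auto
  then have "D \<xi> = D 0" by metis
  then have "?F \<xi> * of_real (exp ((\<xi> \<bullet> \<xi>) / 2)) * gauss \<xi> = ?F 0 * gauss \<xi>" by (simp add: D_def)
  moreover have "of_real (exp ((\<xi> \<bullet> \<xi>) / 2)) * gauss \<xi> = 1"
    by (simp add: gauss_def exp_add[symmetric] flip: of_real_mult)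
  ultimately show ?thesis by (simp add: mult.assoc)
qed

lemma fourier_gauss_0: "fourier (gauss :: real^'n::finite \<Rightarrow> complex) 0 \<noteq> 0"
proof
  assume "fourier (gauss :: real^'n \<Rightarrow> complex) 0 = 0"
  moreover have int: "integrable lborel (\<lambda>x::real^'n. exp (- (x \<bullet> x) / 2))"
    using integrable_norm[OF rapid_integrable[OF rapid_gauss]] by (simp add: gauss_def)
  moreover have "fourier (gauss :: real^'n \<Rightarrow> complex) 0 = of_real (LINT x|lborel. exp (- ((x::real^'n) \<bullet> x) / 2))"
    unfolding fourier_chi by (simp add: gauss_def integral_complex_of_real)
  ultimately have "(LINT x|lborel. exp (- ((x::real^'n) \<bullet> x) / 2)) = 0" by simp
  then have "AE x::real^'n in lborel. exp (- (x \<bullet> x) / 2) = (0::real)"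
    using int by (subst (asm) integral_nonneg_eq_0_iff_AE) auto
  then have "AE x::real^'n in lborel. False" by simp
  then show False by (simp add: eventually_False ae_filter_eq_bot_iff)
qed

lemma pair_integrable_mult:
  fixes f :: "'a::euclidean_space \<Rightarrow> complex" and g :: "'b::euclidean_space \<Rightarrow> complex"
  assumes f: "integrable lborel f" and g: "integrable lborel g"
    and [measurable]: "(\<lambda>(x, y). h x y) \<in> borel_measurable (borel \<Otimes>\<^sub>M borel)"
    and h: "\<And>x y. norm (h x y) \<le> norm (f x) * norm (g y)"
  shows "integrable (lborel \<Otimes>\<^sub>M lborel) (\<lambda>(x, y). h x y :: complex)"
proof (rule Bochner_Integration.integrable_bound)
  show "integrable (lborel \<Otimes>\<^sub>M lborel) (\<lambda>(x, y). f x * g y)"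
  proof (rule lborel_pair.Fubini_integrable)
    have [measurable]: "f \<in> borel_measurable borel" "g \<in> borel_measurable borel"
      using f g by (auto dest: borel_measurable_integrable)
    show "(\<lambda>(x, y). f x * g y) \<in> borel_measurable (lborel \<Otimes>\<^sub>M lborel)" by measurable
  qed (use f g in \<open>auto simp: norm_mult\<close>)
  show "(\<lambda>(x, y). h x y) \<in> borel_measurable (lborel \<Otimes>\<^sub>M lborel)" by measurable
  show "AE z in lborel \<Otimes>\<^sub>M lborel. norm (case z of (x, y) \<Rightarrow> h x y) \<le> norm (case z of (x, y) \<Rightarrow> f x * g y)"
    using h by (auto simp: norm_mult)
qed

lemma fourier_fubini:
  fixes f g :: "real^'n::finite \<Rightarrow> complex"
  assumes f: "integrable lborel f" and g: "integrable lborel g"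
  shows "(LINT \<xi>|lborel. f \<xi> * fourier g \<xi>) = (LINT x|lborel. fourier f x * g x)"
proof -
  have [measurable]: "f \<in> borel_measurable borel" "g \<in> borel_measurable borel"
    using f g by (auto dest: borel_measurable_integrable)
  have int: "integrable (lborel \<Otimes>\<^sub>M lborel) (\<lambda>(\<xi>, x). f \<xi> * (chi (x \<bullet> \<xi>) * g x))"
    by (rule pair_integrable_mult[OF f g]) (auto simp: norm_mult)
  have "(LINT \<xi>|lborel. f \<xi> * fourier g \<xi>) = (LINT \<xi>|lborel. LINT x|lborel. f \<xi> * (chi (x \<bullet> \<xi>) * g x))"
    unfolding fourier_chi by simp
  also have "\<dots> = (LINT x|lborel. LINT \<xi>|lborel. f \<xi> * (chi (x \<bullet> \<xi>) * g x))"
    using lborel_pair.Fubini_integral[OF int] by simp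
  also have "\<dots> = (LINT x|lborel. (LINT \<xi>|lborel. chi (\<xi> \<bullet> x) * f \<xi>) * g x)"
    by (intro Bochner_Integration.integral_cong refl) (simp add: inner_commute mult_ac flip: integral_mult_left_zero integral_mult_right_zero)
  finally show ?thesis by (simp add: fourier_chi)
qed

text \<open>Equal to \<open>(2 \<pi>)\<^sup>n\<close>, but only its not vanishing matters.\<close>
definition fconst :: "'n::finite itself \<Rightarrow> complex" where
  "fconst _ = (fourier (gauss :: real^'n \<Rightarrow> complex) 0)\<^sup>2"

lemma fconst_nonzero: "fconst T \<noteq> 0"
  using fourier_gauss_0 by (simp add: fconst_def)

text \<open>Inserting the factor \<open>gauss (\<delta> \<xi>)\<close> makes the double integral absolutely convergent;
  then \<open>\<delta>\<close> tends to 0.\<close>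
lemma fourier_inversion:
  fixes g :: "real^'n::finite \<Rightarrow> complex"
  assumes g: "g \<in> schwartz"
  shows "fourier (fourier g) (- x) = fconst TYPE('n) * g x"
proof -
  let ?k = "fourier (gauss :: real^'n \<Rightarrow> complex) 0"
  have gi: "integrable lborel g" by (intro rapid_integrable schwartz_rapid g)
  have Fi: "integrable lborel (fourier g)" by (intro rapid_integrable schwartz_rapid schwartz_fourier g)
  have [measurable]: "g \<in> borel_measurable borel" "fourier g \<in> borel_measurable borel"
    "(gauss :: real^'n \<Rightarrow> complex) \<in> borel_measurable borel"
    using gi Fi rapid_measurable[OF rapid_gauss] by (auto dest: borel_measurable_integrable)
  have E1: "norm (gauss y) \<le> 1" for y :: "real^'n" by (simp add: gauss_def)
  have Ei: "integrable lborel (gauss :: real^'n \<Rightarrow> complex)" by (rule rapid_integrable[OF rapid_gauss])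
  have contE: "isCont gauss (y::real^'n)" for y using gauss_has_derivative by (auto intro: has_derivative_continuous)
  have contg: "isCont g y" for y using schwartz_continuous0[OF g] by (simp add: continuous_on_eq_continuous_at)
  obtain G where G: "\<And>x. norm (g x) \<le> G" using rapid_bound[OF schwartz_rapid[OF g], of 0] by auto
  \<comment> \<open>As \<open>\<delta>\<close> tends to 0, \<open>I\<close> tends to the integral in
    the inversion formula and \<open>J\<close> to \<open>g x\<close> times the square of
    \<open>?k\<close>. The multiplication formula \<open>fourier_fubini\<close> and a change of
    variables identify the two for positive \<open>\<delta>\<close>.\<close>
  define I where "I \<delta> = (LINT \<xi>|lborel. (chi (- (x \<bullet> \<xi>)) * gauss (\<delta> *\<^sub>R \<xi>)) * fourier g \<xi>)" for \<delta>
  define J where "J \<delta> = ?k * (LINT z|lborel. g (x + \<delta> *\<^sub>R z) * gauss z)" for \<delta>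
  have IJ: "I \<delta> = J \<delta>" if \<delta>: "0 < \<delta>" for \<delta>
  proof -
    let ?f = "\<lambda>\<xi>. chi (- (x \<bullet> \<xi>)) * gauss (\<delta> *\<^sub>R \<xi>)"
    have ci: "integrable lborel (\<lambda>\<xi>::real^'n. gauss (\<delta> *\<^sub>R \<xi>))"
      using integrable_affine[of \<delta> "gauss :: real^'n \<Rightarrow> complex" 0] Ei \<delta> by simp
    have fi: "integrable lborel ?f" by (intro integrable_chi_mult ci) auto
    have Ff: "fourier ?f y = of_real (1 / \<delta> ^ CARD('n)) * (?k * gauss ((y - x) /\<^sub>R \<delta>))" for y
    proof -
      have "?k * gauss ((y - x) /\<^sub>R \<delta>) = fourier gauss ((y - x) /\<^sub>R \<delta>)" by (rule fourier_gauss[symmetric])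
      also have "\<dots> = of_real (\<delta> ^ CARD('n)) * (LINT \<xi>|lborel. chi ((\<delta> *\<^sub>R \<xi>) \<bullet> ((y - x) /\<^sub>R \<delta>)) * gauss (\<delta> *\<^sub>R \<xi>))"
        unfolding fourier_chi using \<delta> by (subst integral_affine[where c=\<delta> and t=0]) (auto simp: scaleR_conv_of_real[where 'a=complex])
      also have "(LINT \<xi>|lborel. chi ((\<delta> *\<^sub>R \<xi>) \<bullet> ((y - x) /\<^sub>R \<delta>)) * gauss (\<delta> *\<^sub>R \<xi>)) = fourier ?f y"
        unfolding fourier_chi using \<delta>
        by (intro Bochner_Integration.integral_cong) (auto simp: mult.assoc[symmetric] chi_add[symmetric] inner_diff_right inner_commute)
      finally show ?thesis using \<delta> by simp
    qed
    have "I \<delta> = (LINT y|lborel. fourier ?f y * g y)"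
      unfolding I_def by (rule fourier_fubini[OF fi gi])
    also have "\<dots> = of_real (\<delta> ^ CARD('n)) * (LINT z|lborel. fourier ?f (x + \<delta> *\<^sub>R z) * g (x + \<delta> *\<^sub>R z))"
      using \<delta> unfolding Ff by (subst integral_affine[where c=\<delta> and t=x]) (auto simp: scaleR_conv_of_real[where 'a=complex])
    also have "\<dots> = (LINT z|lborel. ?k * (g (x + \<delta> *\<^sub>R z) * gauss z))"
      unfolding Ff using \<delta> by (subst integral_mult_right_zero[symmetric]) (auto simp: mult_ac intro!: Bochner_Integration.integral_cong)
    finally show ?thesis by (simp add: J_def)
  qed
  define d where "d j = 1 / real (Suc j)" for j
  have d: "d \<longlonglongrightarrow> 0" "\<And>j. 0 < d j" unfolding d_def by (rule LIMSEQ_Suc[OF lim_1_over_n]) simp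
  have "(\<lambda>j. I (d j)) \<longlonglongrightarrow> (LINT \<xi>|lborel. (chi (- (x \<bullet> \<xi>)) * 1) * fourier g \<xi>)"
    unfolding I_def
  proof (rule integral_dominated_convergence[where w="\<lambda>\<xi>. norm (fourier g \<xi>)"])
    show "AE \<xi> in lborel. (\<lambda>j. (chi (- (x \<bullet> \<xi>)) * gauss (d j *\<^sub>R \<xi>)) * fourier g \<xi>) \<longlonglongrightarrow> (chi (- (x \<bullet> \<xi>)) * 1) * fourier g \<xi>"
    proof (intro AE_I2 tendsto_mult tendsto_const)
      fix \<xi> :: "real^'n"
      have "(\<lambda>j. gauss (d j *\<^sub>R \<xi>)) \<longlonglongrightarrow> gauss (0 *\<^sub>R \<xi>)"
        by (intro isCont_tendsto_compose[OF contE] tendsto_scaleR d tendsto_const)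
      then show "(\<lambda>j. gauss (d j *\<^sub>R \<xi>)) \<longlonglongrightarrow> 1" by (simp add: gauss_def)
    qed
    show "AE \<xi> in lborel. norm ((chi (- (x \<bullet> \<xi>)) * gauss (d j *\<^sub>R \<xi>)) * fourier g \<xi>) \<le> norm (fourier g \<xi>)" for j
      using E1 by (auto simp: norm_mult intro!: mult_left_le_one_le)
  qed (use Fi in auto)
  moreover have "(\<lambda>j. LINT z|lborel. g (x + d j *\<^sub>R z) * gauss z) \<longlonglongrightarrow> (LINT z|lborel. g x * gauss (z::real^'n))"
  proof (rule integral_dominated_convergence[where w="\<lambda>z::real^'n. G * norm (gauss z)"])
    show "AE z in lborel. (\<lambda>j. g (x + d j *\<^sub>R z) * gauss z) \<longlonglongrightarrow> g x * gauss z"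
    proof (intro AE_I2 tendsto_mult tendsto_const)
      fix z
      have "(\<lambda>j. g (x + d j *\<^sub>R z)) \<longlonglongrightarrow> g (x + 0 *\<^sub>R z)"
        by (intro isCont_tendsto_compose[OF contg] tendsto_add tendsto_scaleR d tendsto_const)
      then show "(\<lambda>j. g (x + d j *\<^sub>R z)) \<longlonglongrightarrow> g x" by simp
    qed
    show "AE z in lborel. norm (g (x + d j *\<^sub>R z) * gauss z) \<le> G * norm (gauss z)" for j
      using G by (auto simp: norm_mult intro!: mult_right_mono)
  qed (use Ei in auto)
  then have "(\<lambda>j. J (d j)) \<longlonglongrightarrow> ?k * (LINT z|lborel. g x * gauss (z::real^'n))"
    unfolding J_def by (intro tendsto_mult tendsto_const)
  moreover have "(\<lambda>j. I (d j)) = (\<lambda>j. J (d j))" using IJ d by auto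
  ultimately have "(LINT \<xi>|lborel. (chi (- (x \<bullet> \<xi>)) * 1) * fourier g \<xi>) = ?k * (LINT z|lborel. g x * gauss (z::real^'n))"
    using LIMSEQ_unique by metis
  moreover have "(LINT z|lborel. gauss (z::real^'n)) = ?k" by (simp add: fourier_chi)
  ultimately show ?thesis
    by (simp add: fourier_chi[of "fourier g"] fconst_def power2_eq_square inner_commute mult_ac)
qed

section \<open>Convolution of functions under the Fourier transform\<close>

definition conv2 :: "(real^'n::finite \<Rightarrow> complex) \<Rightarrow> (real^'n \<Rightarrow> complex) \<Rightarrow> real^'n \<Rightarrow> complex" where
  "conv2 a b x = (LINT y|lborel. a (x - y) * b y)"

text \<open>Inversion is applied to the Schwartz factor \<open>b\<close> only, and the
  multiplication formula moves one transform onto a translate of \<open>a\<close>. In this way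
  \<open>conv2 a b\<close> is recovered from its transform although it is not known to be a Schwartz
  function.\<close>

lemma conv2_inversion:
  fixes a b :: "real^'n::finite \<Rightarrow> complex"
  assumes a: "integrable lborel a" and b: "b \<in> schwartz"
  shows "fconst TYPE('n) * conv2 a b x = fourier (\<lambda>\<xi>. fourier a \<xi> * fourier b \<xi>) (- x)"
proof -
  have am [measurable]: "a \<in> borel_measurable borel" using a by (auto dest: borel_measurable_integrable)
  have Fb: "integrable lborel (fourier b)" by (intro rapid_integrable schwartz_rapid schwartz_fourier b)
  have ai: "integrable lborel (\<lambda>y. a (x - y))" using integral_reflect(2)[OF am] a by simp
  have "fconst TYPE('n) * conv2 a b x = (LINT y|lborel. a (x - y) * fourier (fourier b) (- y))"
    unfolding conv2_def fourier_inversion[OF b] by (subst integral_mult_right_zero[symmetric]) (simp add: mult_ac)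
  also have "\<dots> = (LINT y|lborel. a (x + y) * fourier (fourier b) y)"
  proof -
    have [measurable]: "fourier (fourier b) \<in> borel_measurable borel"
      by (intro rapid_measurable schwartz_rapid schwartz_fourier b)
    show ?thesis by (subst integral_reflect(1)[where x=0, symmetric]) auto
  qed
  also have "\<dots> = (LINT \<xi>|lborel. fourier (\<lambda>y. a (x + y)) \<xi> * fourier b \<xi>)"
  proof (rule fourier_fubini[OF _ Fb])
    show "integrable lborel (\<lambda>y. a (x + y))" using integrable_affine[of 1 a x] a by simp
  qed
  also have "\<dots> = fourier (\<lambda>\<xi>. fourier a \<xi> * fourier b \<xi>) (- x)"
    unfolding fourier_chi[of "\<lambda>\<xi>. fourier a \<xi> * fourier b \<xi>"]
    using fourier_translate[OF am, of x] by (simp add: add.commute inner_commute mult.assoc)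
  finally show ?thesis .
qed

lemma fourier_conv2:
  fixes a b :: "real^'n::finite \<Rightarrow> complex"
  assumes a: "integrable lborel a" and b: "integrable lborel b"
  shows "fourier (conv2 a b) \<xi> = fourier a \<xi> * fourier b \<xi>" and "integrable lborel (conv2 a b)"
proof -
  have [measurable]: "a \<in> borel_measurable borel" "b \<in> borel_measurable borel"
    using a b by (auto dest: borel_measurable_integrable)
  have ay: "integrable lborel (\<lambda>x. a (x - y))" "(LINT x|lborel. norm (a (x - y))) = (LINT x|lborel. norm (a x))" for y
    using integrable_affine[of 1 a "- y"] integral_affine[of 1 "\<lambda>x. norm (a x)" "- y"] a by simp_all
  have int: "integrable (lborel \<Otimes>\<^sub>M lborel) (\<lambda>(y, x). a (x - y) * b y)"
    by (rule lborel_pair.Fubini_integrable) (use ay b in \<open>auto simp: norm_mult\<close>)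
  then have int': "integrable (lborel \<Otimes>\<^sub>M lborel) (\<lambda>(x, y). a (x - y) * b y)"
    using lborel_pair.integrable_product_swap[OF int] by (simp add: split_beta')
  show "integrable lborel (conv2 a b)"
    using lborel_pair.integrable_fst'[OF int'] by (simp add: conv2_def[abs_def])
  have int2: "integrable (lborel \<Otimes>\<^sub>M lborel) (\<lambda>(y, x). chi (x \<bullet> \<xi>) * (a (x - y) * b y))"
    by (rule Bochner_Integration.integrable_bound[OF int]) (auto simp: norm_mult split_beta')
  have "fourier (conv2 a b) \<xi> = (LINT x|lborel. LINT y|lborel. chi (x \<bullet> \<xi>) * (a (x - y) * b y))"
    unfolding fourier_chi conv2_def by simp
  also have "\<dots> = (LINT y|lborel. LINT x|lborel. chi (x \<bullet> \<xi>) * (a (x - y) * b y))"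
    using lborel_pair.Fubini_integral[OF int2] by simp
  also have "\<dots> = (LINT y|lborel. fourier a \<xi> * (chi (y \<bullet> \<xi>) * b y))"
  proof (intro Bochner_Integration.integral_cong refl)
    fix y
    have "(LINT x|lborel. chi (x \<bullet> \<xi>) * (a (x - y) * b y)) = fourier (\<lambda>x. a (x + (- y))) \<xi> * b y"
      unfolding fourier_chi by (subst integral_mult_left_zero[symmetric]) (simp add: mult.assoc)
    then show "(LINT x|lborel. chi (x \<bullet> \<xi>) * (a (x - y) * b y)) = fourier a \<xi> * (chi (y \<bullet> \<xi>) * b y)"
      using fourier_translate[of a "- y" \<xi>] by simp
  qed
  finally show "fourier (conv2 a b) \<xi> = fourier a \<xi> * fourier b \<xi>" by (simp add: fourier_chi)
qed

text \<open>The inversion formula exhibits the preimage: the reflected transform of \<open>l\<close>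
  divided by \<open>fconst\<close>. The functions \<open>L0\<close> and \<open>L\<close> are later
  prescribed through their transforms.\<close>

lemma fourier_surj:
  fixes l :: "real^'n::finite \<Rightarrow> complex"
  assumes l: "l \<in> schwartz"
  obtains L where "L \<in> schwartz" "fourier L = l"
proof
  define L where "L x = inverse (fconst TYPE('n)) * fourier l ((-1) *\<^sub>R x + 0)" for x
  show "L \<in> schwartz" unfolding L_def by (intro schwartz_cmult schwartz_affine schwartz_fourier l) auto
  show "fourier L = l"
  proof
    fix \<xi>
    have [measurable]: "fourier l \<in> borel_measurable borel"
      by (intro rapid_measurable schwartz_rapid schwartz_fourier l)
    have "fourier L \<xi> = inverse (fconst TYPE('n)) * (LINT x|lborel. chi (x \<bullet> \<xi>) * fourier l (- x))"
      unfolding fourier_chi[of L] L_def by (subst integral_mult_right_zero[symmetric]) (simp add: mult_ac)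
    also have "(LINT x|lborel. chi (x \<bullet> \<xi>) * fourier l (- x)) = fourier (fourier l) (- \<xi>)"
      unfolding fourier_chi[of "fourier l"] by (subst integral_reflect(1)[where x=0, symmetric]) auto
    finally show "fourier L \<xi> = l \<xi>" using fconst_nonzero[of "TYPE('n)"] by (simp add: fourier_inversion[OF l] mult.assoc[symmetric])
  qed
qed

lemma fourier_dilate:
  fixes g :: "real^'n::finite \<Rightarrow> complex"
  assumes t: "0 < t" and [measurable]: "g \<in> borel_measurable borel"
  shows "fourier (dilate t g) \<xi> = fourier g (t *\<^sub>R \<xi>)"
proof -
  have "fourier (dilate t g) \<xi> = of_real (t ^ CARD('n)) * (LINT x|lborel. chi ((t *\<^sub>R x) \<bullet> \<xi>) * dilate t g (t *\<^sub>R x))"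
    unfolding fourier_chi dilate_def using t by (subst integral_affine[where c=t and t=0]) (auto simp: scaleR_conv_of_real[where 'a=complex])
  also have "\<dots> = (LINT x|lborel. chi (x \<bullet> (t *\<^sub>R \<xi>)) * g x)"
    using t by (subst integral_mult_right_zero[symmetric]) (auto simp: dilate_def scaleR_conv_of_real[where 'a=complex] intro!: Bochner_Integration.integral_cong)
  finally show ?thesis by (simp add: fourier_chi)
qed

lemma schwartz_dilate: "g \<in> schwartz \<Longrightarrow> t \<noteq> 0 \<Longrightarrow> dilate t g \<in> schwartz"
  using schwartz_cmult[OF schwartz_affine[of g "inverse t" 0], of "of_real (1 / t ^ CARD('n))" for g :: "real^'n::finite \<Rightarrow> complex"]
  by (simp add: dilate_def[abs_def] scaleR_conv_of_real[where 'a=complex])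

section \<open>Tempered distributions under the integral sign\<close>

lemma tempered_lincomb:
  assumes "f \<in> tempered" "u \<in> schwartz" "v \<in> schwartz"
  shows "f (\<lambda>x. a * u x + b * v x) = a * f u + b * f v"
  using assms schwartz_cmult[of u a] schwartz_cmult[of v b] unfolding tempered_def by simp

text \<open>Continuity is expressed through an arbitrary common bound \<open>B\<close> of the
  weighted derivatives, which spares the handling of suprema and their finiteness at each
  use.\<close>

definition dominated :: "((real^'n::finite \<Rightarrow> complex) \<Rightarrow> complex) \<Rightarrow> nat \<Rightarrow> real \<Rightarrow> bool" where
  "dominated f N C \<longleftrightarrow> 0 \<le> C \<and> (\<forall>u\<in>schwartz. \<forall>B.
    (\<forall>is x. length is \<le> N \<longrightarrow> (1 + norm x) ^ N * norm (partial_derivs is u x) \<le> B) \<longrightarrow> norm (f u) \<le> C * B)"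

lemma dominatedD:
  assumes "dominated f N C"
  shows "0 \<le> C" and "u \<in> schwartz \<Longrightarrow>
    (\<And>is x. length is \<le> N \<Longrightarrow> (1 + norm x) ^ N * norm (partial_derivs is u x) \<le> B) \<Longrightarrow> norm (f u) \<le> C * B"
  using assms by (auto simp: dominated_def)

lemma tempered_dominated:
  fixes f :: "(real^'n::finite \<Rightarrow> complex) \<Rightarrow> complex"
  assumes f: "f \<in> tempered"
  obtains C N where "dominated f N C"
proof -
  obtain N C where NC: "\<And>u. u \<in> schwartz \<Longrightarrow> norm (f u) \<le> C * schwartz_seminorm N u"
    using f unfolding tempered_def by blast
  have "norm (f u) \<le> \<bar>C\<bar> * B" if u: "u \<in> schwartz"
    and B: "\<And>is x. length is \<le> N \<Longrightarrow> (1 + norm x) ^ N * norm (partial_derivs is u x) \<le> B" for u B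
  proof -
    let ?g = "\<lambda>(is, x). (1 + norm x) ^ N * norm (partial_derivs is u x)"
    let ?A = "{is. length is \<le> N} \<times> (UNIV :: (real^'n) set)"
    have "bdd_above (?g ` ?A)" using B by (intro bdd_aboveI2[where M=B]) auto
    \<comment> \<open>One value of the weighted function shows that the seminorm is nonnegative,
      which allows \<open>C\<close> to be replaced by its absolute value.\<close>
    then have "?g ([], 0) \<le> schwartz_seminorm N u"
      unfolding schwartz_seminorm_def by (intro cSUP_upper) auto
    moreover have "0 \<le> ?g ([], 0)" by simp
    ultimately have 0: "0 \<le> schwartz_seminorm N u" by linarith
    have B': "schwartz_seminorm N u \<le> B"
      unfolding schwartz_seminorm_def using B by (intro cSUP_least) (auto intro: exI[of _ "[]"])
    have "norm (f u) \<le> C * schwartz_seminorm N u" by (rule NC[OF u])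
    also have "\<dots> \<le> \<bar>C\<bar> * schwartz_seminorm N u" using 0 by (intro mult_right_mono) auto
    also have "\<dots> \<le> \<bar>C\<bar> * B" using B' by (intro mult_left_mono) auto
    finally show ?thesis .
  qed
  then show thesis using that[of N "\<bar>C\<bar>"] by (simp add: dominated_def)
qed

lemma partial_derivs_diff:
  assumes "u \<in> schwartz" "v \<in> schwartz"
  shows "partial_derivs is (\<lambda>x. u x - v x) x = partial_derivs is u x - partial_derivs is v x"
    and "(\<lambda>x. u x - v x) \<in> schwartz"
  using partial_derivs_lincomb[OF assms[THEN schwartz_smooth], of "is" 1 "-1"] schwartz_lincomb[OF assms, of 1 "-1"] by simp_all

text \<open>The assumptions make \<open>\<integral> w b U b db\<close> converge in the Schwartz space, so that a tempered
  distribution may be applied under the integral sign.\<close>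
locale schwartz_family =
  fixes B :: "'b::euclidean_space set" and U :: "'b \<Rightarrow> real^'n::finite \<Rightarrow> complex" and w :: "'b \<Rightarrow> complex"
  assumes open_B: "open B"
    and schwartz_U: "\<And>b. b \<in> B \<Longrightarrow> U b \<in> schwartz"
    and cont_U: "\<And>is. continuous_on (B \<times> UNIV) (\<lambda>(b, x). partial_derivs is (U b) x)"
    and w_meas: "w \<in> borel_measurable borel"
    and w_out: "\<And>b. b \<notin> B \<Longrightarrow> w b = 0"
    and bound_U: "\<And>N. \<exists>W. continuous_on B W \<and> (\<forall>b\<in>B. 1 \<le> W b) \<and>
      (\<forall>b\<in>B. \<forall>x is. length is \<le> N \<longrightarrow> (1 + norm x) ^ N * norm (partial_derivs is (U b) x) \<le> W b) \<and>
      integrable lborel (\<lambda>b. norm (w b) * W b)"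
begin

text \<open>Uniformity in \<open>x\<close> comes from two regions: on a ball the derivatives are
  uniformly continuous, and outside it the bound with the weight of order \<open>Suc N\<close> is
  one power better than required.\<close>

lemma seminorm_continuous:
  assumes b0: "b0 \<in> B" and e: "0 < e"
  shows "\<forall>\<^sub>F b in nhds b0. \<forall>is\<in>{is. length is \<le> N}. \<forall>x.
    (1 + norm x) ^ N * norm (partial_derivs is (U b) x - partial_derivs is (U b0) x) \<le> e"
proof -
  have fin: "finite {is :: 'n list. length is \<le> N}"
    using finite_lists_length_le[of "UNIV :: 'n set" N] by simp
  obtain W where W: "continuous_on B W" "\<And>b. b \<in> B \<Longrightarrow> 1 \<le> W b"
    "\<And>b x is. b \<in> B \<Longrightarrow> length is \<le> Suc N \<Longrightarrow> (1 + norm x) ^ Suc N * norm (partial_derivs is (U b) x) \<le> W b"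
    using bound_U[of "Suc N"] by blast
  obtain d0 where d0: "0 < d0" "cball b0 d0 \<subseteq> B"
    using open_B b0 open_contains_cball by blast
  \<comment> \<open>Continuity of \<open>W\<close> is used here, to bound it near
    \<open>b0\<close>.\<close>
  have "compact (W ` cball b0 d0)"
    by (intro compact_continuous_image continuous_on_subset[OF W(1) d0(2)] compact_cball)
  then obtain M where M: "\<And>b. b \<in> cball b0 d0 \<Longrightarrow> W b \<le> M"
  proof -
    obtain M where "\<forall>y\<in>W ` cball b0 d0. norm y \<le> M"
      using \<open>compact (W ` cball b0 d0)\<close> compact_imp_bounded bounded_iff by metis
    then have "\<bar>W b\<bar> \<le> M" if "b \<in> cball b0 d0" for b using that by simp
    then have "W b \<le> M" if "b \<in> cball b0 d0" for b using that by (meson abs_le_D1)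
    then show thesis using that by blast
  qed
  have M0: "0 \<le> M" using M[of b0] W(2)[OF b0] d0 by auto
  define R where "R = 2 * M / e"
  have R: "0 \<le> R" "2 * M \<le> e * (1 + R)" using M0 e by (auto simp: R_def field_simps)
  have "\<forall>\<^sub>F b in nhds b0. \<forall>x. (1 + norm x) ^ N * norm (partial_derivs is (U b) x - partial_derivs is (U b0) x) \<le> e"
    if "is": "length is \<le> N" for "is"
  proof -
    let ?A = "\<lambda>(b, x). partial_derivs is (U b) x"
    have "uniformly_continuous_on (cball b0 d0 \<times> cball 0 R) ?A"
      using d0 by (intro compact_uniformly_continuous continuous_on_subset[OF cont_U] compact_Times) auto
    then obtain d where d: "0 < d" "\<And>z z'. z \<in> cball b0 d0 \<times> cball 0 R \<Longrightarrow> z' \<in> cball b0 d0 \<times> cball 0 R \<Longrightarrow>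
        dist z' z < d \<Longrightarrow> dist (?A z') (?A z) < e / (1 + R) ^ N"
      using e R unfolding uniformly_continuous_on_def by (metis add_pos_nonneg divide_pos_pos zero_less_one zero_less_power)
    have "\<forall>\<^sub>F b in nhds b0. dist b b0 < min d d0"
      using d d0 by (intro eventually_nhds_metric[THEN iffD2]) (auto intro!: exI[of _ "min d d0"])
    then show ?thesis
    proof (eventually_elim, intro allI)
      fix b x assume b: "dist b b0 < min d d0"
      then have bB: "b \<in> cball b0 d0" "b0 \<in> cball b0 d0" using d0 by (auto simp: dist_commute)
      show "(1 + norm x) ^ N * norm (partial_derivs is (U b) x - partial_derivs is (U b0) x) \<le> e"
      proof (cases "norm x \<le> R")
        case True
        then have "norm (partial_derivs is (U b) x - partial_derivs is (U b0) x) \<le> e / (1 + R) ^ N"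
          using d(2)[of "(b0, x)" "(b, x)"] b bB by (auto simp: dist_Pair_Pair dist_norm)
        then have "(1 + norm x) ^ N * norm (partial_derivs is (U b) x - partial_derivs is (U b0) x) \<le> (1 + R) ^ N * (e / (1 + R) ^ N)"
          using True R by (intro mult_mono power_mono) auto
        also have "\<dots> = e" using R by simp
        finally show ?thesis .
      next
        case False
        have "(1 + norm x) * ((1 + norm x) ^ N * norm (partial_derivs is (U b) x - partial_derivs is (U b0) x))
            \<le> (1 + norm x) ^ Suc N * (norm (partial_derivs is (U b) x) + norm (partial_derivs is (U b0) x))"
          unfolding power_Suc mult.assoc by (intro mult_left_mono norm_triangle_ineq4) auto
        also have "\<dots> \<le> W b + W b0"
          unfolding distrib_left using W(3)[of b "is" x] W(3)[of b0 "is" x] "is" bB d0(2) b0 by (intro add_mono) auto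
        also have "\<dots> \<le> e * (1 + R)" using M[OF bB(1)] M[OF bB(2)] R by linarith
        also have "\<dots> \<le> e * (1 + norm x)" using False e by (intro mult_left_mono) auto
        finally show ?thesis by (simp add: mult.commute[of e] add_pos_nonneg del: power_Suc)
      qed
    qed
  qed
  then show ?thesis using fin by (intro eventually_ball_finite) auto
qed

lemma tempered_continuous:
  assumes f: "f \<in> tempered"
  shows "continuous_on B (\<lambda>b. f (U b))"
proof -
  obtain N C where dom: "dominated f N C" by (rule tempered_dominated[OF f])
  note NC = dominatedD[OF dom]
  show ?thesis
  proof (intro continuous_at_imp_continuous_on ballI)
    fix b0 assume b0: "b0 \<in> B"
    show "isCont (\<lambda>b. f (U b)) b0"
      unfolding isCont_def
    proof (rule tendstoI)
      fix e :: real assume e: "0 < e"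
      define e' where "e' = e / (2 * (C + 1))"
      have e': "0 < e'" "C * e' < e"
      proof -
        show "0 < e'" using e NC(1) by (simp add: e'_def)
        have "C * e' \<le> (C + 1) * e'" using \<open>0 < e'\<close> by (intro mult_right_mono) auto
        also have "\<dots> = e / 2" using NC(1) by (simp add: e'_def field_simps)
        finally show "C * e' < e" using e by simp
      qed
      have "\<forall>\<^sub>F b in nhds b0. b \<in> B" using open_B b0 by (rule eventually_nhds_in_open)
      with seminorm_continuous[OF b0 e'(1), of N]
      have "\<forall>\<^sub>F b in nhds b0. dist (f (U b)) (f (U b0)) < e"
      proof eventually_elim
        case (elim b)
        have "norm (f (\<lambda>x. U b x - U b0 x)) \<le> C * e'"
          using elim b0 schwartz_U by (intro NC(2)) (auto simp: partial_derivs_diff)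
        moreover have "f (\<lambda>x. U b x - U b0 x) = f (U b) - f (U b0)"
          using tempered_lincomb[OF f schwartz_U schwartz_U, of b b0 1 "-1"] elim b0 by simp
        ultimately show ?case using e' by (simp add: dist_norm)
      qed
      then show "\<forall>\<^sub>F b in at b0. dist (f (U b)) (f (U b0)) < e"
        unfolding eventually_at_filter by (rule eventually_mono) simp
    qed
  qed
qed

lemma w_mult_measurable:
  assumes "continuous_on B F"
  shows "(\<lambda>b. w b * F b :: complex) \<in> borel_measurable borel"
proof -
  have [measurable]: "(\<lambda>b. indicator B b *\<^sub>R F b) \<in> borel_measurable borel"
    using assms open_B by (intro borel_measurable_continuous_on_indicator) auto
  have eq: "(\<lambda>b. w b * F b) = (\<lambda>b. w b * (indicator B b *\<^sub>R F b))"
    using w_out by (auto simp: indicator_def)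
  note [measurable] = w_meas
  show ?thesis unfolding eq by measurable
qed

lemma partial_derivs_U_continuous: "continuous_on B (\<lambda>b. partial_derivs is (U b) x)"
proof -
  have "continuous_on B (\<lambda>b. (\<lambda>(b, x). partial_derivs is (U b) x) (b, x))"
    by (rule continuous_on_compose2[OF cont_U[of "is"]]) (auto intro!: continuous_intros)
  then show ?thesis by simp
qed

lemma integrable_partial_derivs_U: "integrable lborel (\<lambda>b. w b * partial_derivs is (U b) x)"
proof -
  obtain W where W: "\<And>b. b \<in> B \<Longrightarrow> norm (partial_derivs is (U b) x) \<le> W b"
    and Wi: "integrable lborel (\<lambda>b. norm (w b) * W b)"
  proof -
    obtain W where W: "\<And>b x js. b \<in> B \<Longrightarrow> length (js :: 'n list) \<le> length is \<Longrightarrow> (1 + norm x) ^ length is * norm (partial_derivs js (U b) x) \<le> W b"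
      and Wi: "integrable lborel (\<lambda>b. norm (w b) * W b)"
      using bound_U[of "length is"] by blast
    have "norm (partial_derivs is (U b) x) \<le> W b" if "b \<in> B" for b
    proof -
      have "1 * norm (partial_derivs is (U b) x) \<le> (1 + norm x) ^ length is * norm (partial_derivs is (U b) x)"
        by (intro mult_right_mono one_le_power) auto
      also have "\<dots> \<le> W b" using W[OF that] by simp
      finally show ?thesis by simp
    qed
    with Wi show thesis using that by blast
  qed
  show ?thesis
  proof (rule Bochner_Integration.integrable_bound[OF Wi])
    show "(\<lambda>b. w b * partial_derivs is (U b) x) \<in> borel_measurable lborel"
      using w_mult_measurable[OF partial_derivs_U_continuous] by simp
    have "norm (w b * partial_derivs is (U b) x) \<le> norm (w b) * W b" for b
      using W[of b] w_out[of b] by (cases "b \<in> B") (auto simp: norm_mult mult_left_mono)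
    then show "AE b in lborel. norm (w b * partial_derivs is (U b) x) \<le> norm (norm (w b) * W b)"
      by (auto intro: order_trans[OF _ abs_ge_self])
  qed
qed

text \<open>\<open>v\<close> is a Riemann sum: a compact part of the parameter set is cut into small
  pieces and the mass of \<open>w\<close> on each piece is placed at one point \<open>c\<close>. As
  the sum is finite, \<open>f\<close> commutes with it, and the same sum approximates both the
  integral in the \<open>N\<close>-th seminorm and the integral of
  \<open>w b * f (U b)\<close>.\<close>

lemma approximation:
  assumes f: "f \<in> tempered" and dom: "dominated f N C"
    and e: "0 < e"
  shows "\<exists>v\<in>schwartz. (\<forall>is x. length is \<le> N \<longrightarrow>
      (1 + norm x) ^ N * norm (partial_derivs is v x - (LINT b|lborel. w b * partial_derivs is (U b) x)) \<le> e) \<and>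
    norm (f v - (LINT b|lborel. w b * f (U b))) \<le> e"
    and integrable_tempered: "integrable lborel (\<lambda>b. w b * f (U b))"
proof -
  obtain W where W: "continuous_on B W" "\<And>b. b \<in> B \<Longrightarrow> 1 \<le> W b"
    "\<And>b x is. b \<in> B \<Longrightarrow> length is \<le> N \<Longrightarrow> (1 + norm x) ^ N * norm (partial_derivs is (U b) x) \<le> W b"
    and Wi: "integrable lborel (\<lambda>b. norm (w b) * W b)"
    using bound_U[of N] by blast
  note [measurable] = w_meas
  note NC = dominatedD[OF dom]
  have fU: "norm (f (U b)) \<le> C * W b" if "b \<in> B" for b
    using that W(3) schwartz_U by (intro NC(2)) auto
  have wW: "norm (w b) \<le> norm (w b) * W b" for b
    using mult_left_mono[OF W(2)[of b], of "norm (w b)"] w_out[of b] by (cases "b \<in> B") auto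
  have wi: "integrable lborel w"
    by (rule Bochner_Integration.integrable_bound[OF Wi]) (use wW in \<open>auto intro: order_trans[OF _ abs_ge_self]\<close>)
  note Ui = integrable_partial_derivs_U
  have fi: "integrable lborel (\<lambda>b. w b * f (U b))"
  proof (rule Bochner_Integration.integrable_bound)
    show "integrable lborel (\<lambda>b. C * (norm (w b) * W b))" using Wi by (rule integrable_mult_right)
    show "(\<lambda>b. w b * f (U b)) \<in> borel_measurable lborel"
      using w_mult_measurable[OF tempered_continuous[OF f]] by simp
    have "norm (w b * f (U b)) \<le> C * (norm (w b) * W b)" for b
      using fU[of b] w_out[of b] mult_left_mono[of "norm (f (U b))" "C * W b" "norm (w b)"]
      by (cases "b \<in> B") (auto simp: norm_mult mult_ac)
    then show "AE b in lborel. norm (w b * f (U b)) \<le> norm (C * (norm (w b) * W b))"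
      by (auto intro: order_trans[OF _ abs_ge_self])
  qed
  then show "integrable lborel (\<lambda>b. w b * f (U b))" .
  define T where "T = (LINT b|lborel. norm (w b))"
  have T0: "0 \<le> T" by (simp add: T_def)
  \<comment> \<open>\<open>e1\<close> is the allowance for the part outside a compact set, and
    \<open>e2\<close> the oscillation allowed on a piece, scaled by the mass \<open>T\<close> of
    \<open>w\<close>. The denominator \<open>C + 1\<close> covers the loss under
    \<open>f\<close>.\<close>
  define e1 where "e1 = e / 2 / (C + 1)"
  define e2 where "e2 = e1 / (T + 1)"
  have e1: "0 < e1" "e1 \<le> e / 2" "C * e1 \<le> e / 2"
  proof -
    show "0 < e1" using e NC(1) by (simp add: e1_def)
    have "C + 1 \<noteq> 0" using NC(1) by linarith
    then have "(C + 1) * e1 = e / 2" 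

      unfolding e1_def times_divide_eq_right[of "C + 1" "e / 2" "C + 1"] by (rule nonzero_mult_div_cancel_left)
    moreover have "0 \<le> C * e1" using \<open>0 < e1\<close> NC by simp
    ultimately show "e1 \<le> e / 2" "C * e1 \<le> e / 2" using \<open>0 < e1\<close> by (auto simp: algebra_simps)
  qed
  have e2: "0 < e2" "e2 * T \<le> e1"
  proof -
    show "0 < e2" using e1 T0 by (simp add: e2_def)
    then have "e2 * T \<le> e2 * (T + 1)" by (intro mult_left_mono) auto
    also have "\<dots> = e1" using T0 by (simp add: e2_def)
    finally show "e2 * T \<le> e1" .
  qed
  define O' where "O' b0 = {b \<in> B. \<forall>is\<in>{is. length is \<le> N}. \<forall>x.
    (1 + norm x) ^ N * norm (partial_derivs is (U b) x - partial_derivs is (U b0) x) \<le> e2}" for b0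
  have nb: "\<exists>V. open V \<and> b0 \<in> V \<and> V \<subseteq> O' b0" if "b0 \<in> B" for b0
  proof -
    have "\<forall>\<^sub>F b in nhds b0. b \<in> B" using open_B that by (rule eventually_nhds_in_open)
    with seminorm_continuous[OF that e2(1), of N] have "\<forall>\<^sub>F b in nhds b0. b \<in> O' b0"
      by eventually_elim (auto simp: O'_def)
    then show ?thesis unfolding eventually_nhds by auto
  qed
  then obtain V where V: "\<And>b0. b0 \<in> B \<Longrightarrow> open (V b0)" "\<And>b0. b0 \<in> B \<Longrightarrow> b0 \<in> V b0" "\<And>b0. b0 \<in> B \<Longrightarrow> V b0 \<subseteq> O' b0"
    by metis
  \<comment> \<open>The error is proportional to the mass on \<open>A\<close>, hence additive when
    the part of \<open>A\<close> inside one more neighbourhood is split off; this carries the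
    induction over the finite cover.\<close>
  have step: "\<exists>v\<in>schwartz. (\<forall>is x. length is \<le> N \<longrightarrow>
      (1 + norm x) ^ N * norm (partial_derivs is v x - (LINT b|lborel. indicator A b *\<^sub>R (w b * partial_derivs is (U b) x)))
        \<le> e2 * (LINT b|lborel. indicator A b *\<^sub>R norm (w b))) \<and>
    norm (f v - (LINT b|lborel. indicator A b *\<^sub>R (w b * f (U b)))) \<le> C * e2 * (LINT b|lborel. indicator A b *\<^sub>R norm (w b))"
    if "finite D" "D \<subseteq> B" "A \<in> sets borel" "A \<subseteq> (\<Union>b\<in>D. V b)" for D A
    using that
  proof (induction D arbitrary: A rule: finite_induct)
    case empty
    have "(\<lambda>x. 0 * gauss x) \<in> schwartz" by (intro schwartz_cmult schwartz_gauss)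
    then have z: "(\<lambda>x. 0) \<in> schwartz" by simp
    have "f (\<lambda>x. 0) = 0" using tempered_lincomb[OF f z z, of 0 0] by simp
    moreover have "partial_derivs is (\<lambda>x. 0) = (\<lambda>x. 0)" for "is" :: "'n list" by (induction "is") (auto simp: partial_deriv_const)
    ultimately show ?case using empty z by (intro bexI[of _ "\<lambda>x. 0"]) auto
  next
    case (insert c D)
    have cB: "c \<in> B" using insert.prems by auto
    define A1 where "A1 = A \<inter> V c"
    define A2 where "A2 = A - V c"
    have [measurable]: "A1 \<in> sets borel" "A2 \<in> sets borel" "A \<in> sets borel"
      using insert.prems V(1)[OF cB] by (auto simp: A1_def A2_def)
    obtain v where v: "v \<in> schwartz" "\<And>is x. length is \<le> N \<Longrightarrow>
        (1 + norm x) ^ N * norm (partial_derivs is v x - (LINT b|lborel. indicator A2 b *\<^sub>R (w b * partial_derivs is (U b) x)))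
          \<le> e2 * (LINT b|lborel. indicator A2 b *\<^sub>R norm (w b))"
      "norm (f v - (LINT b|lborel. indicator A2 b *\<^sub>R (w b * f (U b)))) \<le> C * e2 * (LINT b|lborel. indicator A2 b *\<^sub>R norm (w b))"
    proof -
      have "D \<subseteq> B" "A2 \<subseteq> (\<Union>b\<in>D. V b)" using insert.prems by (auto simp: A2_def)
      from insert.IH[OF this(1) _ this(2)] show thesis using that by auto
    qed
    have ind: "indicator A b *\<^sub>R z = indicator A1 b *\<^sub>R z + indicator A2 b *\<^sub>R z" for b and z :: "'z::real_vector"
      by (auto simp: A1_def A2_def indicator_def)
    have add: "(LINT b|lborel. indicator A b *\<^sub>R F b) = (LINT b|lborel. indicator A1 b *\<^sub>R F b) + (LINT b|lborel. indicator A2 b *\<^sub>R F b)"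
      if "integrable lborel F" for F :: "'b \<Rightarrow> 'z::{banach, second_countable_topology}"
      unfolding ind using that by (intro Bochner_Integration.integral_add integrable_mult_indicator) auto
    define k where "k = (LINT b|lborel. indicator A1 b *\<^sub>R w b)"
    define v' where "v' x = 1 * v x + k * U c x" for x
    have v': "v' \<in> schwartz" unfolding v'_def by (intro schwartz_lincomb v schwartz_U cB)
    have kF: "norm (k * z - (LINT b|lborel. indicator A1 b *\<^sub>R (w b * F b))) \<le> E * (LINT b|lborel. indicator A1 b *\<^sub>R norm (w b))"
      if F: "\<And>b. b \<in> A1 \<Longrightarrow> norm (z - F b) \<le> E" and Fi: "integrable lborel (\<lambda>b. w b * F b)" for z F E
    proof -
      have "k * z - (LINT b|lborel. indicator A1 b *\<^sub>R (w b * F b)) = (LINT b|lborel. indicator A1 b *\<^sub>R (w b * z)) - (LINT b|lborel. indicator A1 b *\<^sub>R (w b * F b))"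
        unfolding k_def by (subst integral_mult_left_zero[symmetric]) simp
      also have "\<dots> = (LINT b|lborel. indicator A1 b *\<^sub>R (w b * z) - indicator A1 b *\<^sub>R (w b * F b))"
        using wi Fi by (intro Bochner_Integration.integral_diff[symmetric] integrable_mult_indicator integrable_mult_left) auto
      also have "norm \<dots> \<le> (LINT b|lborel. E * (indicator A1 b *\<^sub>R norm (w b)))"
      proof (rule order_trans[OF integral_norm_bound integral_mono'])
        show "integrable lborel (\<lambda>b. E * (indicator A1 b *\<^sub>R norm (w b)))"
          using wi by (intro integrable_mult_right integrable_mult_indicator integrable_norm) auto
        show bd: "norm (indicator A1 b *\<^sub>R (w b * z) - indicator A1 b *\<^sub>R (w b * F b)) \<le> E * (indicator A1 b *\<^sub>R norm (w b))" for b
          using F[of b] by (auto simp: indicator_def right_diff_distrib[symmetric] norm_mult mult.commute[of E] intro!: mult_left_mono)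
        show "0 \<le> E * (indicator A1 b *\<^sub>R norm (w b))" for b
          by (rule order_trans[OF norm_ge_zero bd])
      qed
      finally show ?thesis by simp
    qed
    have V': "b \<in> O' c" if "b \<in> A1" for b using V(3)[OF cB] that by (auto simp: A1_def)
    show ?case
    proof (intro bexI[of _ v'] v' conjI allI impI)
      fix "is" x assume l: "length (is :: 'n list) \<le> N"
      let ?F = "\<lambda>b. partial_derivs is (U b) x"
      have eq: "partial_derivs is v' x - (LINT b|lborel. indicator A b *\<^sub>R (w b * ?F b)) =
          (partial_derivs is v x - (LINT b|lborel. indicator A2 b *\<^sub>R (w b * ?F b))) + (k * ?F c - (LINT b|lborel. indicator A1 b *\<^sub>R (w b * ?F b)))"
        unfolding v'_def partial_derivs_lincomb[OF schwartz_smooth[OF v(1)] schwartz_smooth[OF schwartz_U[OF cB]]] add[OF Ui] by simp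
      have p: "0 < (1 + norm x) ^ N" by (simp add: add_pos_nonneg)
      have "norm (?F c - ?F b) \<le> e2 / (1 + norm x) ^ N" if "b \<in> A1" for b
        using V'[OF that] l p by (auto simp: O'_def pos_le_divide_eq norm_minus_commute mult.commute)
      from kF[OF this Ui] have "(1 + norm x) ^ N * norm (k * ?F c - (LINT b|lborel. indicator A1 b *\<^sub>R (w b * ?F b))) \<le> e2 * (LINT b|lborel. indicator A1 b *\<^sub>R norm (w b))"
        using p by (simp add: pos_le_divide_eq mult.commute)
      with v(2)[OF l, of x]
      have "(1 + norm x) ^ N * (norm (partial_derivs is v x - (LINT b|lborel. indicator A2 b *\<^sub>R (w b * ?F b))) + norm (k * ?F c - (LINT b|lborel. indicator A1 b *\<^sub>R (w b * ?F b))))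
          \<le> e2 * ((LINT b|lborel. indicator A1 b *\<^sub>R norm (w b)) + (LINT b|lborel. indicator A2 b *\<^sub>R norm (w b)))"
        by (simp add: distrib_left)
      then show "(1 + norm x) ^ N * norm (partial_derivs is v' x - (LINT b|lborel. indicator A b *\<^sub>R (w b * ?F b)))
          \<le> e2 * (LINT b|lborel. indicator A b *\<^sub>R norm (w b))"
        unfolding eq add[OF integrable_norm[OF wi]]
        by (rule order_trans[rotated]) (intro mult_left_mono norm_triangle_ineq, auto)
    next
      have eq: "f v' - (LINT b|lborel. indicator A b *\<^sub>R (w b * f (U b))) =
          (f v - (LINT b|lborel. indicator A2 b *\<^sub>R (w b * f (U b)))) + (k * f (U c) - (LINT b|lborel. indicator A1 b *\<^sub>R (w b * f (U b))))"
        unfolding v'_def tempered_lincomb[OF f v(1) schwartz_U[OF cB]] add[OF fi] by simp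
      have "norm (f (U c) - f (U b)) \<le> C * e2" if "b \<in> A1" for b
      proof -
        have b: "b \<in> B" "b \<in> O' c" using V'[OF that] by (auto simp: O'_def)
        have "norm (f (\<lambda>x. U b x - U c x)) \<le> C * e2"
          using b cB schwartz_U by (intro NC(2)) (auto simp: partial_derivs_diff O'_def)
        moreover have "f (\<lambda>x. U b x - U c x) = f (U b) - f (U c)"
          using tempered_lincomb[OF f schwartz_U schwartz_U, of b c 1 "-1"] b cB by simp
        ultimately show ?thesis by (simp add: norm_minus_commute)
      qed
      from kF[OF this fi] v(3)
      show "norm (f v' - (LINT b|lborel. indicator A b *\<^sub>R (w b * f (U b)))) \<le> C * e2 * (LINT b|lborel. indicator A b *\<^sub>R norm (w b))"
        unfolding eq add[OF integrable_norm[OF wi]] distrib_left by (intro norm_triangle_le) linarith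
    qed
  qed
  obtain K :: "nat \<Rightarrow> 'b set" where K: "\<And>j. compact (K j)" "\<And>j. K j \<subseteq> B" "\<And>x. x \<in> B \<Longrightarrow> \<exists>j. x \<in> K j" "\<And>j. K j \<subseteq> K (Suc j)"
  proof (rule open_Union_compact_subsets[OF open_B])
    fix K :: "nat \<Rightarrow> 'b set"
    assume *: "\<And>n. compact (K n)" "\<And>n. K n \<subseteq> B" "\<And>n. K n \<subseteq> interior (K (Suc n))" "\<Union> (range K) = B"
    have "K j \<subseteq> K (Suc j)" for j using *(3)[of j] interior_subset by blast
    then show thesis using that[of K] * by blast
  qed
  have Km: "K i \<subseteq> K j" if "i \<le> j" for i j using K(4) that by (rule lift_Suc_mono_le)
  have [measurable]: "K j \<in> sets borel" for j using K(1) by (intro borel_compact)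
  \<comment> \<open>The mass outside the exhausting compact sets tends to 0, measured with the
    factor \<open>W\<close> that controls both the derivatives and \<open>f (U b)\<close>.\<close>
  have "(\<lambda>j. LINT b|lborel. indicator (- K j) b *\<^sub>R (norm (w b) * W b)) \<longlonglongrightarrow> (LINT (b::'b)|lborel. 0)"
  proof (rule integral_dominated_convergence[where w="\<lambda>b. norm (norm (w b) * W b)"])
    show "AE b in lborel. (\<lambda>j. indicator (- K j) b *\<^sub>R (norm (w b) * W b)) \<longlonglongrightarrow> 0"
    proof (rule AE_I2)
      fix b
      show "(\<lambda>j. indicator (- K j) b *\<^sub>R (norm (w b) * W b)) \<longlonglongrightarrow> 0"
      proof (cases "b \<in> B")
        case True
        then obtain i where i: "b \<in> K i" using K(3) by blast
        have "\<forall>\<^sub>F j in sequentially. indicator (- K j) b *\<^sub>R (norm (w b) * W b) = 0"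
          using eventually_ge_at_top[of i] by eventually_elim (use Km i in \<open>auto simp: indicator_def\<close>)
        then show ?thesis by (rule tendsto_eventually)
      qed (simp add: w_out)
    qed
    have [measurable]: "(\<lambda>b. norm (w b) * W b) \<in> borel_measurable lborel" using Wi by (rule borel_measurable_integrable)
    show "(\<lambda>b. indicator (- K j) b *\<^sub>R (norm (w b) * W b)) \<in> borel_measurable lborel" for j
      by measurable
    show "integrable lborel (\<lambda>b. norm (norm (w b) * W b))" using Wi by (rule integrable_norm)
  qed (auto simp: indicator_def)
  then have "(\<lambda>j. LINT b|lborel. indicator (- K j) b *\<^sub>R (norm (w b) * W b)) \<longlonglongrightarrow> 0" by simp
  then have "\<forall>\<^sub>F j in sequentially. (LINT b|lborel. indicator (- K j) b *\<^sub>R (norm (w b) * W b)) < e1"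
    using e1(1) by (rule order_tendstoD)
  then obtain j where j: "(LINT b|lborel. indicator (- K j) b *\<^sub>R (norm (w b) * W b)) < e1"
    by (meson eventually_happens sequentially_bot)
  obtain D where D: "D \<subseteq> K j" "finite D" "K j \<subseteq> (\<Union>b\<in>D. V b)"
  proof (rule compactE_image[OF K(1)[of j], of "K j" V])
    show "open (V b)" if "b \<in> K j" for b using that K(2) by (intro V(1)) auto
    show "K j \<subseteq> (\<Union>b\<in>K j. V b)"
    proof
      fix b assume b: "b \<in> K j"
      then have "b \<in> V b" using K(2) by (intro V(2)) auto
      with b show "b \<in> (\<Union>b\<in>K j. V b)" by (rule UN_I)
    qed
  qed
  obtain v where v: "v \<in> schwartz" "\<And>is x. length is \<le> N \<Longrightarrow>
      (1 + norm x) ^ N * norm (partial_derivs is v x - (LINT b|lborel. indicator (K j) b *\<^sub>R (w b * partial_derivs is (U b) x)))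
        \<le> e2 * (LINT b|lborel. indicator (K j) b *\<^sub>R norm (w b))"
    "norm (f v - (LINT b|lborel. indicator (K j) b *\<^sub>R (w b * f (U b)))) \<le> C * e2 * (LINT b|lborel. indicator (K j) b *\<^sub>R norm (w b))"
  proof -
    have "D \<subseteq> B" using D(1) K(2)[of j] by blast
    from step[OF D(2) this _ D(3)] show thesis using that by auto
  qed
  have TK: "(LINT b|lborel. indicator (K j) b *\<^sub>R norm (w b)) \<le> T"
    unfolding T_def using wi by (intro integral_mono integrable_mult_indicator integrable_norm) (auto simp: indicator_def)
  have split: "(LINT b|lborel. F b) = (LINT b|lborel. indicator (K j) b *\<^sub>R F b) + (LINT b|lborel. indicator (- K j) b *\<^sub>R F b)"
    if "integrable lborel F" for F :: "'b \<Rightarrow> complex"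
  proof -
    have "(LINT b|lborel. F b) = (LINT b|lborel. indicator (K j) b *\<^sub>R F b + indicator (- K j) b *\<^sub>R F b)"
      by (intro Bochner_Integration.integral_cong) (auto simp: indicator_def)
    also have "\<dots> = (LINT b|lborel. indicator (K j) b *\<^sub>R F b) + (LINT b|lborel. indicator (- K j) b *\<^sub>R F b)"
      using that by (intro Bochner_Integration.integral_add integrable_mult_indicator) auto
    finally show ?thesis .
  qed
  have tail: "norm (LINT b|lborel. indicator (- K j) b *\<^sub>R (w b * F b)) \<le> E * e1"
    if "\<And>b. b \<in> B \<Longrightarrow> norm (F b) \<le> E * W b" "0 \<le> E" for F E
  proof -
    have "norm (LINT b|lborel. indicator (- K j) b *\<^sub>R (w b * F b)) \<le> (LINT b|lborel. E * (indicator (- K j) b *\<^sub>R (norm (w b) * W b)))"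
    proof (rule order_trans[OF integral_norm_bound integral_mono'])
      show "integrable lborel (\<lambda>b. E * (indicator (- K j) b *\<^sub>R (norm (w b) * W b)))"
        using Wi by (intro integrable_mult_right integrable_mult_indicator) auto
      show bd: "norm (indicator (- K j) b *\<^sub>R (w b * F b)) \<le> E * (indicator (- K j) b *\<^sub>R (norm (w b) * W b))" for b
        using that(1)[of b] w_out[of b] mult_left_mono[of "norm (F b)" "E * W b" "norm (w b)"]
        by (cases "b \<in> B") (auto simp: indicator_def norm_mult mult_ac)
      show "0 \<le> E * (indicator (- K j) b *\<^sub>R (norm (w b) * W b))" for b
        by (rule order_trans[OF norm_ge_zero bd])
    qed
    also have "\<dots> \<le> E * e1" using j that(2) by (simp add: mult_left_mono)
    finally show ?thesis .
  qed
  show "\<exists>v\<in>schwartz. (\<forall>is x. length is \<le> N \<longrightarrow>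
      (1 + norm x) ^ N * norm (partial_derivs is v x - (LINT b|lborel. w b * partial_derivs is (U b) x)) \<le> e) \<and>
    norm (f v - (LINT b|lborel. w b * f (U b))) \<le> e"
  proof (intro bexI[of _ v] v conjI allI impI)
    fix "is" x assume l: "length (is :: 'n list) \<le> N"
    let ?F = "\<lambda>b. partial_derivs is (U b) x"
    have p: "0 < (1 + norm x) ^ N" by (simp add: add_pos_nonneg)
    have "norm (?F b) \<le> (1 / (1 + norm x) ^ N) * W b" if "b \<in> B" for b
      using W(3)[OF that l, of x] p by (simp add: pos_le_divide_eq mult.commute)
    then have "norm (LINT b|lborel. indicator (- K j) b *\<^sub>R (w b * ?F b)) \<le> (1 / (1 + norm x) ^ N) * e1"
      using p by (intro tail) auto
    then have t: "(1 + norm x) ^ N * norm (LINT b|lborel. indicator (- K j) b *\<^sub>R (w b * ?F b)) \<le> e1"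
      using p by (simp add: pos_le_divide_eq mult.commute)
    have "norm (partial_derivs is v x - (LINT b|lborel. w b * ?F b)) \<le>
        norm (partial_derivs is v x - (LINT b|lborel. indicator (K j) b *\<^sub>R (w b * ?F b))) + norm (LINT b|lborel. indicator (- K j) b *\<^sub>R (w b * ?F b))"
      unfolding split[OF Ui] diff_diff_add[symmetric] by (rule norm_triangle_ineq4)
    then have "(1 + norm x) ^ N * norm (partial_derivs is v x - (LINT b|lborel. w b * ?F b)) \<le>
        (1 + norm x) ^ N * (norm (partial_derivs is v x - (LINT b|lborel. indicator (K j) b *\<^sub>R (w b * ?F b))) + norm (LINT b|lborel. indicator (- K j) b *\<^sub>R (w b * ?F b)))"
      using p by (intro mult_left_mono) auto
    also have "\<dots> \<le> e2 * T + e1"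
      unfolding distrib_left using v(2)[OF l, of x] t mult_left_mono[OF TK, of e2] e2(1) by linarith
    also have "\<dots> \<le> e" using e1 e2 by linarith
    finally show "(1 + norm x) ^ N * norm (partial_derivs is v x - (LINT b|lborel. w b * ?F b)) \<le> e" .
  next
    have t: "norm (LINT b|lborel. indicator (- K j) b *\<^sub>R (w b * f (U b))) \<le> C * e1"
      using fU NC(1) by (intro tail)
    have "norm (f v - (LINT b|lborel. w b * f (U b))) \<le>
        norm (f v - (LINT b|lborel. indicator (K j) b *\<^sub>R (w b * f (U b)))) + norm (LINT b|lborel. indicator (- K j) b *\<^sub>R (w b * f (U b)))"
      unfolding split[OF fi] diff_diff_add[symmetric] by (rule norm_triangle_ineq4)
    also have "\<dots> \<le> C * (e2 * T) + C * e1"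
      using v(3) t mult_left_mono[OF TK, of "C * e2"] e2(1) NC(1) by (simp add: mult.assoc)
    also have "\<dots> \<le> e" using mult_left_mono[OF e2(2) NC(1)] e1 by linarith
    finally show "norm (f v - (LINT b|lborel. w b * f (U b))) \<le> e" .
  qed
qed

end

text \<open>Two families serve the two terms of the reproducing formula. The sum of their Riemann
  sums is close to \<open>u\<close> in the seminorm that dominates \<open>f\<close>, and its image
  under \<open>f\<close> is close to the sum of the two integrals.\<close>

lemma tempered_exchange:
  fixes u :: "real^'n::finite \<Rightarrow> complex"
  assumes f: "f \<in> tempered" and u: "u \<in> schwartz"
    and 1: "schwartz_family B1 U1 w1" and 2: "schwartz_family B2 U2 w2"
    and eq: "\<And>is x. partial_derivs is u x =
      (LINT b|lborel. w1 b * partial_derivs is (U1 b) x) + (LINT b|lborel. w2 b * partial_derivs is (U2 b) x)"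
  shows "f u = (LINT b|lborel. w1 b * f (U1 b)) + (LINT b|lborel. w2 b * f (U2 b))"
proof -
  obtain N C where dom: "dominated f N C" by (rule tempered_dominated[OF f])
  note NC = dominatedD[OF dom]
  let ?I1 = "LINT b|lborel. w1 b * f (U1 b)" and ?I2 = "LINT b|lborel. w2 b * f (U2 b)"
  have "norm (f u - (?I1 + ?I2)) \<le> e" if e: "0 < e" for e
  proof -
    \<comment> \<open>The approximation of \<open>u\<close> costs \<open>C * (2 * e')\<close> and
      the two integrals cost \<open>2 * e'\<close>; this choice makes the total
      \<open>e\<close>.\<close>
    define e' where "e' = e / (2 * C + 2)"
    have e': "0 < e'" "C * (2 * e') + 2 * e' = e"
    proof -
      show "0 < e'" using e NC(1) by (simp add: e'_def add_nonneg_pos)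
      have "2 * C + 2 \<noteq> 0" using NC(1) by linarith
      then have "e' * (2 * C + 2) = e" by (simp add: e'_def)
      then show "C * (2 * e') + 2 * e' = e" by (simp add: algebra_simps)
    qed
    obtain v1 where v1: "v1 \<in> schwartz" "\<And>is x. length is \<le> N \<Longrightarrow>
      (1 + norm x) ^ N * norm (partial_derivs is v1 x - (LINT b|lborel. w1 b * partial_derivs is (U1 b) x)) \<le> e'"
      "norm (f v1 - ?I1) \<le> e'"
      using schwartz_family.approximation(1)[OF 1 f dom e'(1)] by blast
    obtain v2 where v2: "v2 \<in> schwartz" "\<And>is x. length is \<le> N \<Longrightarrow>
      (1 + norm x) ^ N * norm (partial_derivs is v2 x - (LINT b|lborel. w2 b * partial_derivs is (U2 b) x)) \<le> e'"
      "norm (f v2 - ?I2) \<le> e'"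
      using schwartz_family.approximation(1)[OF 2 f dom e'(1)] by blast
    define v where "v x = 1 * v1 x + 1 * v2 x" for x
    have v: "v \<in> schwartz" unfolding v_def by (intro schwartz_lincomb v1 v2)
    have fv: "f v = f v1 + f v2" using tempered_lincomb[OF f v1(1) v2(1), of 1 1] by (simp add: v_def[abs_def])
    have "norm (f (\<lambda>x. u x - v x)) \<le> C * (2 * e')"
    proof (rule NC(2))
      show "(\<lambda>x. u x - v x) \<in> schwartz" by (rule partial_derivs_diff(2)[OF u v])
      fix "is" x assume l: "length (is :: 'n list) \<le> N"
      have "partial_derivs is (\<lambda>x. u x - v x) x =
          ((LINT b|lborel. w1 b * partial_derivs is (U1 b) x) - partial_derivs is v1 x) + ((LINT b|lborel. w2 b * partial_derivs is (U2 b) x) - partial_derivs is v2 x)"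
      proof -
        have "partial_derivs is v x = partial_derivs is v1 x + partial_derivs is v2 x"
          using partial_derivs_lincomb[OF v1(1)[THEN schwartz_smooth] v2(1)[THEN schwartz_smooth], of "is" 1 1]
          by (simp add: v_def[abs_def])
        then show ?thesis by (simp add: partial_derivs_diff(1)[OF u v] eq)
      qed
      then have "(1 + norm x) ^ N * norm (partial_derivs is (\<lambda>x. u x - v x) x) \<le> (1 + norm x) ^ N *
          (norm (partial_derivs is v1 x - (LINT b|lborel. w1 b * partial_derivs is (U1 b) x)) + norm (partial_derivs is v2 x - (LINT b|lborel. w2 b * partial_derivs is (U2 b) x)))"
        by (intro mult_left_mono) (auto intro: norm_triangle_le simp: norm_minus_commute)
      also have "\<dots> \<le> e' + e'" unfolding distrib_left by (intro add_mono v1 v2 l)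
      finally show "(1 + norm x) ^ N * norm (partial_derivs is (\<lambda>x. u x - v x) x) \<le> 2 * e'" by simp
    qed
    moreover have "f (\<lambda>x. u x - v x) = f u - f v" using tempered_lincomb[OF f u v, of 1 "-1"] by simp
    ultimately have 1: "norm (f u - f v) \<le> C * (2 * e')" by simp
    have "f u - (?I1 + ?I2) = (f u - f v) + ((f v1 - ?I1) + (f v2 - ?I2))" unfolding fv by simp
    then have "norm (f u - (?I1 + ?I2)) \<le> norm (f u - f v) + (norm (f v1 - ?I1) + norm (f v2 - ?I2))"
      using norm_triangle_ineq[of "f u - f v" "(f v1 - ?I1) + (f v2 - ?I2)"] norm_triangle_ineq[of "f v1 - ?I1" "f v2 - ?I2"]
      by (simp only:)
    then have "norm (f u - (?I1 + ?I2)) \<le> C * (2 * e') + 2 * e'" using 1 v1(3) v2(3) by linarith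
    then show ?thesis using e' by simp
  qed
  then have "norm (f u - (?I1 + ?I2)) \<le> 0" by (rule field_le_epsilon) simp
  then show ?thesis by simp
qed

section \<open>Families of translated and dilated test functions\<close>

lemma partial_derivs_reflect:
  assumes "u \<in> schwartz"
  shows "partial_derivs is (\<lambda>x. u (z - x)) x = (- 1) ^ length is * partial_derivs is u (z - x)"
  using partial_derivs_affine(1)[OF schwartz_smooth[OF assms], of "is" "-1" z]
  by (simp add: scaleR_conv_of_real)

lemma schwartz_reflect: "u \<in> schwartz \<Longrightarrow> (\<lambda>x. u (z - x)) \<in> schwartz"
  using schwartz_affine[of u "-1" z] by simp

lemma partial_derivs_dilate:
  fixes h :: "real^'n::finite \<Rightarrow> complex"
  assumes h: "h \<in> schwartz"
  shows "partial_derivs is (dilate s h) x = ((1 / s) ^ length is * (1 / s) ^ CARD('n)) *\<^sub>R partial_derivs is h (x /\<^sub>R s)"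
proof -
  let ?u = "\<lambda>y. of_real (1 / s ^ CARD('n)) * h y"
  have u: "?u \<in> schwartz" using h by (rule schwartz_cmult)
  have "dilate s h = (\<lambda>x. ?u ((1 / s) *\<^sub>R x + 0))"
    by (simp add: dilate_def[abs_def] scaleR_conv_of_real[where 'a=complex] divide_inverse)
  then have "partial_derivs is (dilate s h) x = (1 / s) ^ length is *\<^sub>R partial_derivs is ?u ((1 / s) *\<^sub>R x + 0)"
    using partial_derivs_affine(1)[OF schwartz_smooth[OF u], of "is" "1 / s" 0] by simp
  also have "partial_derivs is ?u = (\<lambda>y. of_real (1 / s ^ CARD('n)) * partial_derivs is h y)"
    using partial_derivs_lincomb[OF schwartz_smooth[OF h] schwartz_smooth[OF h], of "is" "of_real (1 / s ^ CARD('n))" 0] by simp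
  finally show ?thesis by (simp add: scaleR_conv_of_real[where 'a=complex] power_divide divide_inverse power_inverse)
qed

lemma schwartz_bound_all:
  fixes h :: "real^'n::finite \<Rightarrow> complex"
  assumes h: "h \<in> schwartz"
  obtains C where "0 \<le> C" "\<And>is x. length is \<le> N \<Longrightarrow> (1 + norm x) ^ N * norm (partial_derivs is h x) \<le> C"
proof -
  have fin: "finite {is :: 'n list. length is \<le> N}"
    using finite_lists_length_le[of "UNIV :: 'n set" N] by simp
  have "\<forall>is. \<exists>B. 0 \<le> B \<and> (\<forall>x. (1 + norm x) ^ N * norm (partial_derivs is h x) \<le> B)"
    using schwartz_bound[OF h, of N] by blast
  then obtain B where B: "\<And>is. 0 \<le> B is" "\<And>is x. (1 + norm x) ^ N * norm (partial_derivs is h x) \<le> B is" by metis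
  show thesis
  proof (rule that[of "\<Sum>is | length is \<le> N. B is"])
    show "0 \<le> (\<Sum>is | length is \<le> N. B is)" using B by (intro sum_nonneg) auto
    fix "is" :: "'n list" and x assume l: "length is \<le> N"
    have "(1 + norm x) ^ N * norm (partial_derivs is h x) \<le> B is" by (rule B)
    also have "\<dots> \<le> (\<Sum>is | length is \<le> N. B is)"
      using l fin B by (intro member_le_sum) auto
    finally show "(1 + norm x) ^ N * norm (partial_derivs is h x) \<le> (\<Sum>is | length is \<le> N. B is)" .
  qed
qed

text \<open>The seminorms of a dilate grow at most like a power of \<open>1 / s\<close> for small
  \<open>s\<close>; kernels that vanish to all orders at \<open>s = 0\<close> compensate for
  this.\<close>

lemma reflect_dilate_bound:
  fixes h :: "real^'n::finite \<Rightarrow> complex"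
  assumes h: "h \<in> schwartz"
  obtains C where "0 \<le> C" "\<And>is s z x. 0 < s \<Longrightarrow> length is \<le> N \<Longrightarrow>
    (1 + norm x) ^ N * norm (partial_derivs is (\<lambda>x. dilate s h (z - x)) x) \<le> C * (1 + 1 / s) ^ (CARD('n) + N) * (1 + s) ^ N * (1 + norm z) ^ N"
proof -
  obtain C where C: "0 \<le> C" "\<And>is x. length is \<le> N \<Longrightarrow> (1 + norm x) ^ N * norm (partial_derivs is h x) \<le> C"
    using schwartz_bound_all[OF h, of N] by blast
  have "(1 + norm x) ^ N * norm (partial_derivs is (\<lambda>x. dilate s h (z - x)) x) \<le> C * (1 + 1 / s) ^ (CARD('n) + N) * (1 + s) ^ N * (1 + norm z) ^ N"
    if s: "0 < s" and l: "length is \<le> N" for "is" s z x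
  proof -
    define y where "y = (z - x) /\<^sub>R s"
    have "1 + norm x \<le> (1 + norm z) * (1 + norm (x - z))"
      using one_plus_norm_le[of z "x - z"] by simp
    also have "\<dots> = (1 + norm z) * (1 + s * norm y)"
      using s by (simp add: y_def norm_minus_commute)
    also have "\<dots> \<le> (1 + norm z) * ((1 + s) * (1 + norm y))"
      using s by (intro mult_left_mono) (auto simp: algebra_simps)
    finally have xz: "1 + norm x \<le> (1 + norm z) * (1 + s) * (1 + norm y)" by (simp add: mult.assoc)
    have "(1 / s) ^ length is * (1 / s) ^ CARD('n) \<le> (1 + 1 / s) ^ length is * (1 + 1 / s) ^ CARD('n)"
      using s by (intro mult_mono power_mono) auto
    also have "\<dots> \<le> (1 + 1 / s) ^ N * (1 + 1 / s) ^ CARD('n)"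
      using s l by (intro mult_right_mono power_increasing) auto
    finally have ss: "(1 / s) ^ length is * (1 / s) ^ CARD('n) \<le> (1 + 1 / s) ^ (CARD('n) + N)"
      by (simp add: power_add mult.commute)
    have "norm (partial_derivs is (\<lambda>x. dilate s h (z - x)) x) = ((1 / s) ^ length is * (1 / s) ^ CARD('n)) * norm (partial_derivs is h y)"
      using s schwartz_dilate[OF h, of s]
      by (subst partial_derivs_reflect) (auto simp: norm_mult norm_power partial_derivs_dilate[OF h] y_def)
    then have "(1 + norm x) ^ N * norm (partial_derivs is (\<lambda>x. dilate s h (z - x)) x) \<le>
        ((1 + norm z) * (1 + s) * (1 + norm y)) ^ N * ((1 + 1 / s) ^ (CARD('n) + N) * norm (partial_derivs is h y))"
      using xz ss s by (auto intro!: mult_mono power_mono mult_nonneg_nonneg)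
    also have "\<dots> = (1 + 1 / s) ^ (CARD('n) + N) * (1 + s) ^ N * (1 + norm z) ^ N * ((1 + norm y) ^ N * norm (partial_derivs is h y))"
      by (simp add: power_mult_distrib mult_ac)
    also have "\<dots> \<le> (1 + 1 / s) ^ (CARD('n) + N) * (1 + s) ^ N * (1 + norm z) ^ N * C"
      using s l by (intro mult_left_mono C) auto
    finally show ?thesis by (simp add: mult_ac)
  qed
  with C(1) show thesis using that by blast
qed

lemma dilate_1 [simp]: "dilate 1 h = h"
  by (simp add: dilate_def[abs_def])

lemma power_norm_shift:
  "(1 + norm (z :: 'a::real_normed_vector)) ^ N \<le> (1 + norm y) ^ N * (1 + norm (y - z)) ^ N"
  using one_plus_norm_le[of y "z - y"] unfolding power_mult_distrib[symmetric]
  by (intro power_mono) (auto simp: norm_minus_commute)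

lemma schwartz_family_translates:
  fixes h :: "real^'n::finite \<Rightarrow> complex"
  assumes h: "h \<in> schwartz" and k: "rapid k"
  shows "schwartz_family UNIV (\<lambda>z x. h (z - x)) (\<lambda>z. k (y - z))"
proof
  show "open (UNIV :: (real^'n) set)" by simp
  show "(\<lambda>x. h (z - x)) \<in> schwartz" for z using h by (rule schwartz_reflect)
  show "continuous_on (UNIV \<times> UNIV) (\<lambda>(z, x). partial_derivs is (\<lambda>x. h (z - x)) x)" for "is"
  proof -
    have "continuous_on UNIV (\<lambda>p. (-1) ^ length is * partial_derivs is h (fst p - snd p))"
      by (intro continuous_intros continuous_on_compose2[OF schwartz_continuous[OF h]]) auto
    then show ?thesis by (simp add: partial_derivs_reflect[OF h] split_beta')
  qed
  note [measurable] = rapid_measurable[OF k]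
  show "(\<lambda>z. k (y - z)) \<in> borel_measurable borel" by measurable
  fix N
  obtain C where C: "0 \<le> C" "\<And>is s z x. 0 < s \<Longrightarrow> length is \<le> N \<Longrightarrow>
    (1 + norm x) ^ N * norm (partial_derivs is (\<lambda>x. dilate s h (z - x)) x) \<le> C * (1 + 1 / s) ^ (CARD('n) + N) * (1 + s) ^ N * (1 + norm z) ^ N"
    using reflect_dilate_bound[OF h, of N] by blast
  define D where "D = C * 2 ^ (CARD('n) + N) * 2 ^ N"
  have D: "0 \<le> D" using C by (simp add: D_def)
  define W where "W z = 1 + D * (1 + norm z) ^ N" for z :: "real^'n"
  have Wi: "integrable lborel (\<lambda>z. norm (k (y - z)) * W z)"
  proof -
    have "integrable lborel (\<lambda>t. complex_of_real (1 + D * ((1 + norm y) ^ N * (1 + norm t) ^ N)) * k t)"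
    proof (rule rapid_growth_integrable[OF k, where B="1 + D * (1 + norm y) ^ N" and M=N])
      fix t :: "real^'n"
      have "1 \<le> (1 + norm t) ^ N" by (intro one_le_power) simp
      then show "norm (complex_of_real (1 + D * ((1 + norm y) ^ N * (1 + norm t) ^ N))) \<le> (1 + D * (1 + norm y) ^ N) * (1 + norm t) ^ N"
        using D unfolding norm_of_real by (subst abs_of_nonneg) (auto simp: distrib_right mult.assoc add_nonneg_nonneg)
    qed measurable
    from integrable_norm[OF this] have "integrable lborel (\<lambda>t. (1 + D * ((1 + norm y) ^ N * (1 + norm t) ^ N)) * norm (k t))"
      using D unfolding norm_mult norm_of_real by (subst (asm) abs_of_nonneg) (auto intro!: add_nonneg_nonneg mult_nonneg_nonneg)
    then have "integrable lborel (\<lambda>z. (1 + D * ((1 + norm y) ^ N * (1 + norm (y - z)) ^ N)) * norm (k (y - z)))"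
      by (subst integral_reflect(2)[of "\<lambda>t. (1 + D * ((1 + norm y) ^ N * (1 + norm t) ^ N)) * norm (k t)"]) auto
    then show ?thesis
    proof (rule Bochner_Integration.integrable_bound)
      show "(\<lambda>z. norm (k (y - z)) * W z) \<in> borel_measurable lborel" unfolding W_def by measurable
      show "AE z in lborel. norm (norm (k (y - z)) * W z) \<le> norm ((1 + D * ((1 + norm y) ^ N * (1 + norm (y - z)) ^ N)) * norm (k (y - z)))"
      proof (rule AE_I2)
        fix z
        have "W z \<le> 1 + D * ((1 + norm y) ^ N * (1 + norm (y - z)) ^ N)"
          unfolding W_def using D by (intro add_left_mono mult_left_mono power_norm_shift)
        moreover have "0 \<le> W z" using D by (simp add: W_def)
        ultimately show "norm (norm (k (y - z)) * W z) \<le> norm ((1 + D * ((1 + norm y) ^ N * (1 + norm (y - z)) ^ N)) * norm (k (y - z)))"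
          unfolding norm_mult by (subst mult.commute) (auto intro!: mult_right_mono)
      qed
    qed
  qed
  show "\<exists>W. continuous_on UNIV W \<and> (\<forall>b\<in>UNIV. 1 \<le> W b) \<and>
      (\<forall>b\<in>UNIV. \<forall>x is. length is \<le> N \<longrightarrow> (1 + norm x) ^ N * norm (partial_derivs is (\<lambda>x. h (b - x)) x) \<le> W b) \<and>
      integrable lborel (\<lambda>b. norm (k (y - b)) * W b)"
  proof (intro exI[of _ W] conjI ballI allI impI Wi)
    show "continuous_on UNIV W" unfolding W_def by (intro continuous_intros)
    show "1 \<le> W b" for b using D by (simp add: W_def)
    show "(1 + norm x) ^ N * norm (partial_derivs is (\<lambda>x. h (b - x)) x) \<le> W b" if "length is \<le> N" for b x "is"
      using C(2)[of 1 "is" x b] that by (simp add: W_def D_def)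
  qed
qed auto

text \<open>Every power of \<open>s\<close> is available in the bound on \<open>k\<close>, and
  finitely many of them offset the growth of the dilates together with the factor
  \<open>1 / s\<close>.\<close>

lemma schwartz_family_dilates:
  fixes h :: "real^'n::finite \<Rightarrow> complex" and k :: "real \<Rightarrow> real^'n \<Rightarrow> complex"
  assumes h: "h \<in> schwartz" and km [measurable]: "(\<lambda>(s, x). k s x) \<in> borel_measurable (borel \<Otimes>\<^sub>M borel)"
    and kb: "\<And>M. \<exists>C. \<forall>s x. 0 < s \<longrightarrow> s \<le> 1 \<longrightarrow> (1 + norm x) ^ M * norm (k s x) \<le> C * s ^ M"
  shows "schwartz_family ({0<..} \<times> UNIV) (\<lambda>(s, z) x. dilate s h (z - x)) (\<lambda>(s, z). (indicator {0<..1} s / s) *\<^sub>R k s (y - z))"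
proof
  show "open ({0<..} \<times> UNIV :: (real \<times> (real^'n)) set)" by (intro open_Times) auto
  show "(case b of (s, z) \<Rightarrow> \<lambda>x. dilate s h (z - x)) \<in> schwartz" if "b \<in> {0<..} \<times> UNIV" for b
    using that by (auto intro!: schwartz_reflect schwartz_dilate h)
  show "(case b of (s, z) \<Rightarrow> (indicator {0<..1} s / s) *\<^sub>R k s (y - z)) = 0" if "b \<notin> {0<..} \<times> UNIV" for b
    using that by (cases b) (auto simp: indicator_def)
  have "(\<lambda>(s, z). (indicator {0<..1} s / s) *\<^sub>R k s (y - z)) \<in> borel_measurable (borel \<Otimes>\<^sub>M borel)" by measurable
  then show wm: "(\<lambda>(s, z). (indicator {0<..1} s / s) *\<^sub>R k s (y - z)) \<in> borel_measurable borel" by (simp add: borel_prod)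
  show "continuous_on (({0<..} \<times> UNIV) \<times> UNIV) (\<lambda>(b, x). partial_derivs is (case b of (s, z) \<Rightarrow> \<lambda>x. dilate s h (z - x)) x)" for "is"
  proof -
    have "continuous_on (({0<..} \<times> UNIV) \<times> UNIV) (\<lambda>p. (-1) ^ length is *
        (((1 / fst (fst p)) ^ length is * (1 / fst (fst p)) ^ CARD('n)) *\<^sub>R partial_derivs is h ((snd (fst p) - snd p) /\<^sub>R fst (fst p))))"
      by (intro continuous_intros continuous_on_compose2[OF schwartz_continuous[OF h]]) auto
    then show ?thesis
      by (rule continuous_on_eq) (auto simp: partial_derivs_reflect[OF schwartz_dilate[OF h]] partial_derivs_dilate[OF h])
  qed
  fix N
  obtain C where C: "0 \<le> C" "\<And>is s z x. 0 < s \<Longrightarrow> length is \<le> N \<Longrightarrow>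
    (1 + norm x) ^ N * norm (partial_derivs is (\<lambda>x. dilate s h (z - x)) x) \<le> C * (1 + 1 / s) ^ (CARD('n) + N) * (1 + s) ^ N * (1 + norm z) ^ N"
    using reflect_dilate_bound[OF h, of N] by blast
  define W where "W b = (case b of (s, z) \<Rightarrow> 1 + C * (1 + 1 / s) ^ (CARD('n) + N) * (1 + s) ^ N * (1 + norm z) ^ N)" for b :: "real \<times> (real^'n)"
  \<comment> \<open>Of these powers of \<open>s\<close>, \<open>CARD('n) + N\<close> offset the
    dilate and one offsets \<open>1 / s\<close>. Of the powers of \<open>1 + norm (y - z)\<close>,
    \<open>N\<close> offset the translation and \<open>Suc CARD('n)\<close> remain for
    integrability.\<close>
  let ?M = "Suc (CARD('n) + N)"
  obtain C' where C': "\<And>s x. 0 < s \<Longrightarrow> s \<le> 1 \<Longrightarrow> (1 + norm x) ^ ?M * norm (k s x) \<le> C' * s ^ ?M"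
    using kb by blast
  have C'0: "0 \<le> C'" using C'[of 1 0] by (auto intro: order_trans[OF norm_ge_zero])
  define D where "D = 1 + C * 2 ^ (CARD('n) + N) * 2 ^ N"
  have D: "0 \<le> D" using C by (simp add: D_def)
  define G where "G = C' * D * (1 + norm y) ^ N"
  have bd: "norm ((indicator {0<..1} s / s) *\<^sub>R k s (y - z)) * \<bar>W (s, z)\<bar> \<le> indicator {0<..1} s * (G * (1 / (1 + norm (y - z)) ^ Suc CARD('n)))" for s z
  proof (cases "0 < s \<and> s \<le> 1")
    case True
    then have s: "0 < s" "s \<le> 1" by auto
    define t where "t = 1 + norm (y - z)"
    have t: "0 < t" by (simp add: t_def add_pos_nonneg)
    have s1: "1 + 1 / s \<le> 2 * (1 / s)" using s by (simp add: field_simps)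
    have W0: "0 \<le> W (s, z)" using C s by (auto simp: W_def intro!: add_nonneg_nonneg mult_nonneg_nonneg)
    have "1 * 1 \<le> (1 / s) ^ (CARD('n) + N) * (1 + norm z) ^ N" using s by (intro mult_mono one_le_power) auto
    then have P1: "1 \<le> (1 / s) ^ (CARD('n) + N) * (1 + norm z) ^ N" by simp
    have "C * (1 + 1 / s) ^ (CARD('n) + N) * (1 + s) ^ N * (1 + norm z) ^ N \<le> C * (2 * (1 / s)) ^ (CARD('n) + N) * 2 ^ N * (1 + norm z) ^ N"
      using s s1 C by (intro mult_mono mult_nonneg_nonneg power_mono order_refl) auto
    also have "\<dots> = (C * 2 ^ (CARD('n) + N) * 2 ^ N) * ((1 / s) ^ (CARD('n) + N) * (1 + norm z) ^ N)"
      unfolding power_mult_distrib by (simp only: mult_ac)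
    finally have "W (s, z) \<le> D * ((1 / s) ^ (CARD('n) + N) * (1 + norm z) ^ N)"
      unfolding W_def D_def prod.case distrib_right[of 1] using P1 by linarith
    also have "\<dots> \<le> D * ((1 / s) ^ (CARD('n) + N) * ((1 + norm y) ^ N * t ^ N))"
      using s D by (intro mult_left_mono power_norm_shift[of z N y, folded t_def]) auto
    finally have W1: "W (s, z) \<le> D * ((1 / s) ^ (CARD('n) + N) * ((1 + norm y) ^ N * t ^ N))" .
    have k1: "norm (k s (y - z)) \<le> C' * s ^ ?M / t ^ ?M"
      using C'[OF s, of "y - z", folded t_def] t by (simp add: pos_le_divide_eq mult.commute del: power_Suc)
    have "norm ((indicator {0<..1} s / s) *\<^sub>R k s (y - z)) * \<bar>W (s, z)\<bar> = 1 / s * norm (k s (y - z)) * W (s, z)"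
      using True W0 by simp
    also have "\<dots> \<le> 1 / s * (C' * s ^ ?M / t ^ ?M) * (D * ((1 / s) ^ (CARD('n) + N) * ((1 + norm y) ^ N * t ^ N)))"
      using s W0 k1 W1 C'0 t by (intro mult_mono mult_nonneg_nonneg) auto
    also have "\<dots> = G * (1 / t ^ Suc CARD('n))"
      using s t by (simp add: G_def power_add power_divide field_simps)
    finally show ?thesis using True by (simp add: t_def)
  qed auto
  have Wi: "integrable lborel (\<lambda>b. norm (case b of (s, z) \<Rightarrow> (indicator {0<..1} s / s) *\<^sub>R k s (y - z)) * W b)"
  proof -
    have "integrable lborel (\<lambda>z::real^'n. G * (1 / (1 + norm (y - z)) ^ Suc CARD('n)))"
      using integral_reflect(2)[of "\<lambda>z::real^'n. 1 / (1 + norm z) ^ Suc CARD('n)" y] integrable_decay_aux[of "Suc CARD('n)", where 'a="real^'n"]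
      by (intro integrable_mult_right) auto
    then have i2: "integrable lborel (\<lambda>z::real^'n. complex_of_real (G * (1 / (1 + norm (y - z)) ^ Suc CARD('n))))"
      by (rule integrable_of_real)
    have i1: "integrable lborel (\<lambda>s::real. complex_of_real (indicator {0<..1} s))" by simp
    have G0: "0 \<le> G" using C'0 D by (simp add: G_def)
    have "integrable (lborel \<Otimes>\<^sub>M lborel) (\<lambda>(s, z). complex_of_real (norm ((indicator {0<..1} s / s) *\<^sub>R k s (y - z)) * W (s, z)))"
    proof (rule pair_integrable_mult[OF i1 i2])
      show "norm (complex_of_real (norm ((indicator {0<..1} s / s) *\<^sub>R k s (y - z)) * W (s, z)))
          \<le> norm (complex_of_real (indicator {0<..1} s)) * norm (complex_of_real (G * (1 / (1 + norm (y - z)) ^ Suc CARD('n))))" for s z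
        using bd[of s z] G0 unfolding norm_of_real abs_mult by simp
    qed (unfold W_def, simp, measurable)
    then have "integrable (lborel \<Otimes>\<^sub>M lborel) (\<lambda>p. Re (case p of (s, z) \<Rightarrow> complex_of_real (norm ((indicator {0<..1} s / s) *\<^sub>R k s (y - z)) * W (s, z))))"
      by (rule integrable_Re)
    then show ?thesis unfolding lborel_prod by (simp add: split_beta')
  qed
  show "\<exists>W. continuous_on ({0<..} \<times> UNIV) W \<and> (\<forall>b\<in>{0<..} \<times> UNIV. 1 \<le> W b) \<and>
      (\<forall>b\<in>{0<..} \<times> UNIV. \<forall>x is. length is \<le> N \<longrightarrow> (1 + norm x) ^ N * norm (partial_derivs is (case b of (s, z) \<Rightarrow> \<lambda>x. dilate s h (z - x)) x) \<le> W b) \<and>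
      integrable lborel (\<lambda>b. norm (case b of (s, z) \<Rightarrow> (indicator {0<..1} s / s) *\<^sub>R k s (y - z)) * W b)"
  proof (intro exI[of _ W] conjI ballI allI impI Wi)
    show "continuous_on ({0<..} \<times> UNIV) W" unfolding W_def split_beta' by (intro continuous_intros) auto
    show "1 \<le> W b" if "b \<in> {0<..} \<times> UNIV" for b using that C by (auto simp: W_def)
    show "(1 + norm x) ^ N * norm (partial_derivs is (case b of (s, z) \<Rightarrow> \<lambda>x. dilate s h (z - x)) x) \<le> W b"
      if "b \<in> {0<..} \<times> UNIV" "length is \<le> N" for b x "is"
      using C(2)[of "fst b" "is" x "snd b"] that by (auto simp: W_def)
  qed
qed

lemma continuous_on_conv_dilate:
  fixes h :: "real^'n::finite \<Rightarrow> complex"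
  assumes h: "h \<in> schwartz" and f: "f \<in> tempered"
  shows "continuous_on ({0<..} \<times> UNIV) (\<lambda>(s, z). conv (dilate s h) f z)"
proof -
  \<comment> \<open>Zero weights satisfy the integrability conditions trivially, so the locale
    yields joint continuity in scale and position.\<close>
  interpret schwartz_family "{0<..} \<times> UNIV" "\<lambda>(s, z) x. dilate s h (z - x)" "\<lambda>(s, z). (indicator {0<..1} s / s) *\<^sub>R (0::complex)"
    by (rule schwartz_family_dilates[OF h]) (auto intro: exI[of _ 0])
  show ?thesis using tempered_continuous[OF f] by (simp add: conv_def split_beta')
qed

lemma continuous_on_conv:
  fixes h :: "real^'n::finite \<Rightarrow> complex"
  assumes "h \<in> schwartz" "f \<in> tempered"
  shows "continuous_on UNIV (conv h f)"
  using continuous_on_compose2[OF continuous_on_conv_dilate[OF assms], of UNIV "\<lambda>z. (1, z)"]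
  by (simp add: continuous_intros image_subset_iff)

section \<open>A reproducing formula\<close>

lemma dilate_measurable:
  fixes g :: "real^'n::finite \<Rightarrow> complex"
  assumes [measurable]: "g \<in> borel_measurable borel"
  shows "(\<lambda>(s, x). dilate s g x) \<in> borel_measurable (borel \<Otimes>\<^sub>M borel)"
  unfolding dilate_def by measurable

lemma conv2_dilate:
  fixes v g :: "real^'n::finite \<Rightarrow> complex"
  assumes [measurable]: "v \<in> borel_measurable borel" "g \<in> borel_measurable borel" and s: "0 < s"
  shows "conv2 v (dilate s g) x = (LINT y|lborel. v (x - s *\<^sub>R y) * g y)"
proof -
  have "conv2 v (dilate s g) x = s ^ CARD('n) *\<^sub>R (LINT y|lborel. v (x - s *\<^sub>R y) * dilate s g (s *\<^sub>R y))"
    unfolding conv2_def dilate_def using s by (subst integral_affine[where c=s and t=0]) auto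
  also have "\<dots> = (LINT y|lborel. v (x - s *\<^sub>R y) * g y)"
    using s by (subst integral_scaleR_right[symmetric]) (auto simp: dilate_def intro!: Bochner_Integration.integral_cong)
  finally show ?thesis .
qed

lemma conv2_commute:
  fixes a b :: "real^'n::finite \<Rightarrow> complex"
  assumes [measurable]: "a \<in> borel_measurable borel" "b \<in> borel_measurable borel"
  shows "conv2 a b x = conv2 b a x"
proof -
  have "conv2 b a x = (LINT y|lborel. b (x - (x - y)) * a (x - y))"
    unfolding conv2_def by (rule integral_reflect(1)[symmetric]) measurable
  then show ?thesis by (simp add: conv2_def mult.commute)
qed

lemma conv2_dilate_both:
  fixes v g :: "real^'n::finite \<Rightarrow> complex"
  assumes [measurable]: "v \<in> borel_measurable borel" "g \<in> borel_measurable borel" and t: "0 < t"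
  shows "conv2 (dilate t v) (dilate s g) x = (1 / t ^ CARD('n)) *\<^sub>R conv2 v (dilate (s / t) g) (x /\<^sub>R t)"
proof -
  have "conv2 (dilate t v) (dilate s g) x = t ^ CARD('n) *\<^sub>R (LINT y|lborel. dilate t v (x - t *\<^sub>R y) * dilate s g (t *\<^sub>R y))"
    unfolding conv2_def dilate_def using t by (subst integral_affine[where c=t and t=0]) auto
  also have "\<dots> = (LINT y|lborel. (1 / t ^ CARD('n)) *\<^sub>R (v (x /\<^sub>R t - y) * dilate (s / t) g y))"
    using t by (subst integral_scaleR_right[symmetric])
      (auto simp: dilate_def scaleR_diff_right power_mult_distrib power_inverse divide_inverse mult.commute intro!: Bochner_Integration.integral_cong)
  finally show ?thesis by (simp add: conv2_def)
qed

lemma conv2_measurable: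
  fixes v g :: "real^'n::finite \<Rightarrow> complex"
  assumes [measurable]: "v \<in> borel_measurable borel" "g \<in> borel_measurable borel"
  shows "(\<lambda>(s, x). conv2 v (dilate s g) x) \<in> borel_measurable (borel \<Otimes>\<^sub>M borel)"
    and "conv2 v g \<in> borel_measurable borel"
proof -
  note [measurable] = dilate_measurable[OF assms(2)]
  show "(\<lambda>(s, x). conv2 v (dilate s g) x) \<in> borel_measurable (borel \<Otimes>\<^sub>M borel)"
    unfolding conv2_def dilate_def split_beta' by measurable
  show "conv2 v g \<in> borel_measurable borel" unfolding conv2_def[abs_def] by measurable
qed

lemma rapid_conv2:
  fixes v g :: "real^'n::finite \<Rightarrow> complex"
  assumes v: "v \<in> schwartz" and g: "rapid g"
  shows "rapid (conv2 v g)"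
  unfolding rapid_def
proof (intro conjI allI)
  show "conv2 v g \<in> borel_measurable borel"
    by (intro conv2_measurable rapid_measurable g schwartz_rapid v)
  fix N
  obtain C where C: "0 \<le> C" "\<And>\<tau> x. 0 \<le> \<tau> \<Longrightarrow> \<tau> \<le> 1 \<Longrightarrow>
    (1 + norm x) ^ N * norm (LINT y|lborel. v (x - \<tau> *\<^sub>R y) * g y) \<le> C * \<tau> ^ 0"
    using conv_moment_bound[OF v g, of 0 N] by auto
  then show "\<exists>C. \<forall>x. (1 + norm x) ^ N * norm (conv2 v g x) \<le> C"
    using C(2)[of 1] by (auto simp: conv2_def)
qed

lemma conv2_translate_integral:
  fixes a b :: "real^'n::finite \<Rightarrow> complex"
  assumes [measurable]: "a \<in> borel_measurable borel" "b \<in> borel_measurable borel"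
  shows "(LINT z|lborel. a (y - z) * b (z - x)) = conv2 a b (y - x)"
  unfolding conv2_def using integral_affine[of 1 "\<lambda>z. a (y - x - z) * b z" "- x"]
  by (simp add: algebra_simps)

text \<open>Up to powers of \<open>- \<i>\<close> the moments are the derivatives of the Fourier
  transform at 0, near which the transform vanishes.\<close>

lemma vanishing_moments:
  fixes g :: "real^'n::finite \<Rightarrow> complex"
  assumes g: "g \<in> schwartz" and r: "0 < r" and vanish: "\<And>\<xi>. norm \<xi> < r \<Longrightarrow> fourier g \<xi> = 0"
  shows "(LINT y|lborel. of_real (mon is y) * g y) = 0"
proof -
  have "partial_derivs is (fourier g) 0 = partial_derivs is (\<lambda>x. 0) (0::real^'n)"
    by (rule partial_derivs_cong[of "ball 0 r"]) (use vanish r in auto)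
  also have "partial_derivs is (\<lambda>x. 0) = (\<lambda>x::real^'n. 0)"
    by (induction "is") (auto simp: partial_deriv_const)
  finally have "fourier (\<lambda>x. (- \<i>) ^ length is * of_real (mon is x) * g x) 0 = 0"
    using partial_derivs_fourier[OF schwartz_rapid[OF g], of "is"] by simp
  then have "(- \<i>) ^ length is * (LINT y|lborel. of_real (mon is y) * g y) = 0"
    unfolding fourier_chi by (subst integral_mult_right_zero[symmetric]) (simp add: mult.assoc)
  then show ?thesis by simp
qed

text \<open>On the Fourier side this is the reproducing formula
  \<open>f = L0 * h0 * f + \<integral>\<^sub>0\<^sup>1 L\<^sub>s * h\<^sub>s * f ds / s\<close>, where the subscript denotes \<open>dilate s\<close>.\<close>
locale calderon =
  fixes h0 h L0 L :: "real^'n::finite \<Rightarrow> complex" and r :: real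
  assumes h0: "h0 \<in> schwartz" and h: "h \<in> schwartz" and L0: "L0 \<in> schwartz" and L: "L \<in> schwartz"
    and r: "0 < r" and vanish: "\<And>\<xi>. norm \<xi> < r \<Longrightarrow> fourier L \<xi> = 0"
    and resolution: "\<And>\<xi>. fourier L0 \<xi> * fourier h0 \<xi> +
      (LINT s|lborel. (indicator {0<..1} s / s) *\<^sub>R (fourier L (s *\<^sub>R \<xi>) * fourier h (s *\<^sub>R \<xi>))) = 1"
begin

lemma meas [measurable]: "h0 \<in> borel_measurable borel" "h \<in> borel_measurable borel"
    "L0 \<in> borel_measurable borel" "L \<in> borel_measurable borel"
  by (intro rapid_measurable schwartz_rapid h0 h L0 L)+

lemma moments_L: "(LINT y|lborel. of_real (mon is y) * L y) = 0"
  by (rule vanishing_moments[OF L r vanish])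

text \<open>All moments of \<open>L\<close> vanish, so the order \<open>M\<close> of vanishing at
  \<open>s = 0\<close> can be chosen at will.\<close>

lemma kernel_bound:
  assumes v: "v \<in> schwartz"
  obtains C where "0 \<le> C" "\<And>s x. 0 < s \<Longrightarrow> s \<le> 1 \<Longrightarrow> (1 + norm x) ^ m * norm (conv2 v (dilate s L) x) \<le> C * s ^ M"
proof -
  obtain C where C: "0 \<le> C" "\<And>\<tau> x. 0 \<le> \<tau> \<Longrightarrow> \<tau> \<le> 1 \<Longrightarrow>
    (1 + norm x) ^ m * norm (LINT y|lborel. v (x - \<tau> *\<^sub>R y) * L y) \<le> C * \<tau> ^ M"
  proof (rule conv_moment_bound[OF v schwartz_rapid[OF L], of M m])
    show "(LINT y|lborel. of_real (mon is y) * L y) = 0" for "is" by (rule moments_L)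
  qed (rule that)
  have [measurable]: "v \<in> borel_measurable borel" by (intro rapid_measurable schwartz_rapid v)
  show thesis using that[OF C(1)] C(2) by (simp add: conv2_dilate)
qed

text \<open>At the point \<open>s *\<^sub>R \<xi>\<close> a bound linear in the norm cancels the
  singular factor \<open>1 / s\<close> and makes Fubini's theorem applicable. It holds because
  \<open>fourier L\<close> vanishes near 0 and both transforms are bounded.\<close>

lemma fourier_product_linear_bound: "\<exists>C. \<forall>\<xi>. norm (fourier L \<xi> * fourier h \<xi>) \<le> C * norm \<xi>"
proof -
  obtain A where A: "\<And>\<xi>. norm (fourier L \<xi>) \<le> A" using norm_fourier_le by blast
  obtain B where B: "\<And>\<xi>. norm (fourier h \<xi>) \<le> B" using norm_fourier_le by blast
  have A0: "0 \<le> A" using A[of 0] norm_ge_zero order_trans by blast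
  have B0: "0 \<le> B" using B[of 0] norm_ge_zero order_trans by blast
  have "norm (fourier L \<xi> * fourier h \<xi>) \<le> (A * B / r) * norm \<xi>" for \<xi>
  proof (cases "norm \<xi> < r")
    case False
    have "norm (fourier L \<xi> * fourier h \<xi>) \<le> A * B"
      unfolding norm_mult by (intro mult_mono A B A0) auto
    also have "\<dots> \<le> A * B * (norm \<xi> / r)"
      using False r A0 B0 mult_left_mono[of 1 "norm \<xi> / r" "A * B"] by simp
    finally show ?thesis by simp
  qed (use vanish A0 B0 r in auto)
  then show ?thesis by blast
qed

text \<open>The resolution identity multiplied by the transform \<open>q\<close> of the derivative
  and transformed back. Derivatives are included because a distribution can be applied only when the
  formula holds in the Schwartz space.\<close>

lemma reproducing_derivs:
  assumes v: "v \<in> schwartz"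
  shows "partial_derivs is v x = conv2 (conv2 v L0) (partial_derivs is h0) x +
    (LINT s|lborel. (indicator {0<..1} s / s) *\<^sub>R conv2 (conv2 v (dilate s L)) (partial_derivs is (dilate s h)) x)"
proof -
  let ?k = "fconst TYPE('n)"
  define q where "q = fourier (partial_derivs is v)"
  have q: "q \<xi> = \<i> ^ length is * of_real (mon is \<xi>) * fourier v \<xi>" for \<xi>
    unfolding q_def by (rule fourier_partial_derivs[OF v])
  have qs: "q \<in> schwartz" unfolding q_def by (intro schwartz_fourier schwartz_partial_derivs v)
  have vi: "integrable lborel v" "integrable lborel L0" "integrable lborel L" by (intro rapid_integrable schwartz_rapid v L0 L)+
  have [measurable]: "q \<in> borel_measurable borel" by (intro rapid_measurable schwartz_rapid qs)
  have [measurable]: "fourier L \<in> borel_measurable borel" "fourier h \<in> borel_measurable borel"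
    by (intro rapid_measurable schwartz_rapid schwartz_fourier L h)+
  have fx: "fourier w (- x) = (LINT \<xi>|lborel. chi (- (x \<bullet> \<xi>)) * w \<xi>)" for w
    by (simp add: fourier_chi inner_commute)
  have 0: "?k * conv2 (conv2 v L0) (partial_derivs is h0) x = (LINT \<xi>|lborel. chi (- (x \<bullet> \<xi>)) * q \<xi> * (fourier L0 \<xi> * fourier h0 \<xi>))"
    using conv2_inversion[OF fourier_conv2(2)[OF vi(1,2)] schwartz_partial_derivs[OF h0, of "is"], of x]
    by (simp add: fx fourier_conv2(1)[OF vi(1,2)] fourier_partial_derivs[OF h0] q mult_ac)
  have s: "?k * conv2 (conv2 v (dilate s L)) (partial_derivs is (dilate s h)) x =
      (LINT \<xi>|lborel. chi (- (x \<bullet> \<xi>)) * q \<xi> * (fourier L (s *\<^sub>R \<xi>) * fourier h (s *\<^sub>R \<xi>)))" if "0 < s" for s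
  proof -
    have Ls: "integrable lborel (dilate s L)" using that by (intro rapid_integrable schwartz_rapid schwartz_dilate L) auto
    have hs: "dilate s h \<in> schwartz" using that by (intro schwartz_dilate h) auto
    show ?thesis
      using conv2_inversion[OF fourier_conv2(2)[OF vi(1) Ls] schwartz_partial_derivs[OF hs, of "is"], of x] that
      by (simp add: fx fourier_conv2(1)[OF vi(1) Ls] fourier_partial_derivs[OF hs] fourier_dilate q mult_ac)
  qed
  obtain C where C: "\<And>\<xi>. norm (fourier L \<xi> * fourier h \<xi>) \<le> C * norm \<xi>" using fourier_product_linear_bound by blast
  define F where "F s \<xi> = (indicator {0<..1} s / s) *\<^sub>R (chi (- (x \<bullet> \<xi>)) * q \<xi> * (fourier L (s *\<^sub>R \<xi>) * fourier h (s *\<^sub>R \<xi>)))" for s \<xi>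
  have Fi: "integrable (lborel \<Otimes>\<^sub>M lborel) (\<lambda>(s, \<xi>). F s \<xi>)"
  proof (rule pair_integrable_mult)
    show "integrable lborel (\<lambda>s::real. complex_of_real (indicator {0<..1} s))" by simp
    show "integrable lborel (\<lambda>\<xi>. complex_of_real (C * norm \<xi>) * q \<xi>)"
    proof (rule rapid_growth_integrable[OF schwartz_rapid[OF qs], where B="\<bar>C\<bar>" and M=1])
      show "norm (complex_of_real (C * norm \<xi>)) \<le> \<bar>C\<bar> * (1 + norm \<xi>) ^ 1" for \<xi> :: "real^'n"
        unfolding norm_of_real abs_mult by (intro mult_mono) auto
    qed simp
    show "(\<lambda>(s, \<xi>). F s \<xi>) \<in> borel_measurable (borel \<Otimes>\<^sub>M borel)" unfolding F_def by measurable
    fix s :: real and \<xi> :: "real^'n"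
    show "norm (F s \<xi>) \<le> norm (complex_of_real (indicator {0<..1} s)) * norm (complex_of_real (C * norm \<xi>) * q \<xi>)"
    proof (cases "0 < s \<and> s \<le> 1")
      case True
      have "norm (F s \<xi>) = 1 / s * norm (q \<xi>) * norm (fourier L (s *\<^sub>R \<xi>) * fourier h (s *\<^sub>R \<xi>))"
        using True by (simp add: F_def norm_mult)
      also have "\<dots> \<le> 1 / s * norm (q \<xi>) * (C * norm (s *\<^sub>R \<xi>))"
        using True by (intro mult_left_mono C) auto
      also have "\<dots> = C * norm \<xi> * norm (q \<xi>)" using True by simp
      also have "\<dots> \<le> \<bar>C * norm \<xi>\<bar> * norm (q \<xi>)" by (intro mult_right_mono) auto
      finally show ?thesis using True by (simp add: norm_mult abs_mult)
    qed (simp add: F_def)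
  qed
  have Fsw: "integrable (lborel \<Otimes>\<^sub>M lborel) (\<lambda>(\<xi>, s). F s \<xi>)"
    using lborel_pair.integrable_product_swap[OF Fi] by (simp add: split_beta')
  have Fint: "integrable lborel (\<lambda>\<xi>. LINT s|lborel. F s \<xi>)"
    using lborel_pair.integrable_fst'[OF Fsw] by simp
  have F2: "(LINT s|lborel. F s \<xi>) = chi (- (x \<bullet> \<xi>)) * q \<xi> * (LINT s|lborel. (indicator {0<..1} s / s) *\<^sub>R (fourier L (s *\<^sub>R \<xi>) * fourier h (s *\<^sub>R \<xi>)))" for \<xi>
    unfolding F_def by (subst integral_mult_right_zero[symmetric]) (simp add: mult_ac)
  have F0: "integrable lborel (\<lambda>\<xi>. chi (- (x \<bullet> \<xi>)) * q \<xi> * (fourier L0 \<xi> * fourier h0 \<xi>))"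
  proof -
    obtain A where A: "\<And>\<xi>. norm (fourier L0 \<xi>) \<le> A" using norm_fourier_le by blast
    obtain B where B: "\<And>\<xi>. norm (fourier h0 \<xi>) \<le> B" using norm_fourier_le by blast
    have A0: "0 \<le> A" using A[of 0] norm_ge_zero order_trans by blast
    have [measurable]: "fourier L0 \<in> borel_measurable borel" "fourier h0 \<in> borel_measurable borel"
      by (intro rapid_measurable schwartz_rapid schwartz_fourier L0 h0)+
    have "integrable lborel (\<lambda>\<xi>. (chi (- (x \<bullet> \<xi>)) * (fourier L0 \<xi> * fourier h0 \<xi>)) * q \<xi>)"
    proof (rule rapid_growth_integrable[OF schwartz_rapid[OF qs], where B="A * B" and M=0])
      show "norm (chi (- (x \<bullet> \<xi>)) * (fourier L0 \<xi> * fourier h0 \<xi>)) \<le> A * B * (1 + norm \<xi>) ^ 0" for \<xi>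
        using mult_mono[OF A[of \<xi>] B[of \<xi>] A0] by (simp add: norm_mult)
    qed measurable
    then show ?thesis by (simp add: mult_ac)
  qed
  have "?k * (LINT s|lborel. (indicator {0<..1} s / s) *\<^sub>R conv2 (conv2 v (dilate s L)) (partial_derivs is (dilate s h)) x)
      = (LINT s|lborel. (indicator {0<..1} s / s) *\<^sub>R (?k * conv2 (conv2 v (dilate s L)) (partial_derivs is (dilate s h)) x))"
    by (subst integral_mult_right_zero[symmetric]) simp
  also have "\<dots> = (LINT s|lborel. LINT \<xi>|lborel. F s \<xi>)"
    unfolding F_def using s by (intro Bochner_Integration.integral_cong) (auto simp: indicator_def)
  also have "\<dots> = (LINT \<xi>|lborel. LINT s|lborel. F s \<xi>)"
    using lborel_pair.Fubini_integral[OF Fsw] by simp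
  finally have "?k * (conv2 (conv2 v L0) (partial_derivs is h0) x +
      (LINT s|lborel. (indicator {0<..1} s / s) *\<^sub>R conv2 (conv2 v (dilate s L)) (partial_derivs is (dilate s h)) x))
    = (LINT \<xi>|lborel. chi (- (x \<bullet> \<xi>)) * q \<xi> * (fourier L0 \<xi> * fourier h0 \<xi>)) + (LINT \<xi>|lborel. LINT s|lborel. F s \<xi>)"
    by (simp add: distrib_left 0)
  also have "\<dots> = (LINT \<xi>|lborel. chi (- (x \<bullet> \<xi>)) * q \<xi> * (fourier L0 \<xi> * fourier h0 \<xi>) + (LINT s|lborel. F s \<xi>))"
    using F0 Fint by simp
  also have "\<dots> = (LINT \<xi>|lborel. chi (- (x \<bullet> \<xi>)) * q \<xi>)"
    unfolding F2 distrib_left[symmetric] resolution by simp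
  also have "\<dots> = fourier q (- x)" by (simp add: fourier_chi inner_commute)
  also have "\<dots> = ?k * partial_derivs is v x"
    unfolding q_def by (rule fourier_inversion[OF schwartz_partial_derivs[OF v]])
  finally show ?thesis using fconst_nonzero[of "TYPE('n)"] by simp
qed

text \<open>The reflected test function \<open>\<lambda>x. v (y - x)\<close> is an integral of the
  test functions that define \<open>conv h0 f\<close> and \<open>conv (dilate s h) f\<close>.
  Applying \<open>f\<close> under the integral gives an identity, of which the norm estimate is
  kept.\<close>

theorem reproducing_formula:
  assumes v: "v \<in> schwartz" and f: "f \<in> tempered"
  shows "ennreal (norm (conv v f y)) \<le>
    (\<integral>\<^sup>+z. ennreal (norm (conv2 v L0 (y - z)) * norm (conv h0 f z)) \<partial>lborel) +
    (\<integral>\<^sup>+s. (\<integral>\<^sup>+z. indicator {0<..1} s * ennreal (1 / s) * ennreal (norm (conv2 v (dilate s L) (y - z)) * norm (conv (dilate s h) f z)) \<partial>lborel) \<partial>lborel)"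
proof -
  have vm [measurable]: "v \<in> borel_measurable borel" by (intro rapid_measurable schwartz_rapid v)
  have k0: "rapid (conv2 v L0)" by (intro rapid_conv2 v schwartz_rapid L0)
  note [measurable] = rapid_measurable[OF k0] conv2_measurable(1)[OF vm meas(4)]
  let ?U1 = "\<lambda>z x. h0 (z - x)" and ?w1 = "\<lambda>z. conv2 v L0 (y - z)"
  let ?U2 = "\<lambda>(s, z) x. dilate s h (z - x)" and ?w2 = "\<lambda>(s, z). (indicator {0<..1} s / s) *\<^sub>R conv2 v (dilate s L) (y - z)"
  have f1: "schwartz_family UNIV ?U1 ?w1" by (rule schwartz_family_translates[OF h0 k0])
  have f2: "schwartz_family ({0<..} \<times> UNIV) ?U2 ?w2"
  proof (rule schwartz_family_dilates[OF h conv2_measurable(1)[OF vm meas(4)]])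
    fix M
    show "\<exists>C. \<forall>s x. 0 < s \<longrightarrow> s \<le> 1 \<longrightarrow> (1 + norm x) ^ M * norm (conv2 v (dilate s L) x) \<le> C * s ^ M"
      using kernel_bound[OF v, of M M] by metis
  qed
  interpret F1: schwartz_family UNIV ?U1 ?w1 by (rule f1)
  interpret F2: schwartz_family "{0<..} \<times> UNIV" ?U2 ?w2 by (rule f2)
  obtain C N where dom: "dominated f N C" by (rule tempered_dominated[OF f])
  \<comment> \<open>Only integrability is extracted here; the accuracy 1 is arbitrary.\<close>
  have i1: "integrable lborel (\<lambda>z. ?w1 z * conv h0 f z)"
    using F1.approximation(2)[OF f dom, of 1] by (simp add: conv_def)
  have i2: "integrable lborel (\<lambda>b. ?w2 b * f (?U2 b))"
    using F2.approximation(2)[OF f dom, of 1] by simp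
  have i2': "integrable (lborel \<Otimes>\<^sub>M lborel) (\<lambda>(s, z). ?w2 (s, z) * conv (dilate s h) f z)"
    using i2 unfolding lborel_prod[symmetric] by (simp add: conv_def split_beta')
  have eq: "partial_derivs is (\<lambda>x. v (y - x)) x =
      (LINT b|lborel. ?w1 b * partial_derivs is (?U1 b) x) + (LINT b|lborel. ?w2 b * partial_derivs is (?U2 b) x)" for "is" x
  proof -
    have [measurable]: "partial_derivs is h0 \<in> borel_measurable borel"
      by (intro rapid_measurable schwartz_rapid schwartz_partial_derivs h0)
    have 1: "(LINT b|lborel. ?w1 b * partial_derivs is (?U1 b) x) = (-1) ^ length is * conv2 (conv2 v L0) (partial_derivs is h0) (y - x)"
      unfolding partial_derivs_reflect[OF h0]
      by (subst conv2_translate_integral[symmetric]) (auto simp: mult.left_commute simp flip: integral_mult_right_zero)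
    have int: "integrable (lborel \<Otimes>\<^sub>M lborel) (\<lambda>(s, z). ?w2 (s, z) * partial_derivs is (?U2 (s, z)) x)"
      using F2.integrable_partial_derivs_U[of "is" x] unfolding lborel_prod[symmetric] by (simp add: split_beta')
    have "(LINT b|lborel. ?w2 b * partial_derivs is (?U2 b) x) = (LINT s|lborel. LINT z|lborel. ?w2 (s, z) * partial_derivs is (?U2 (s, z)) x)"
      using lborel_pair.integral_fst'[OF int] unfolding lborel_prod[symmetric] by (simp add: split_beta')
    also have "\<dots> = (LINT s|lborel. (-1) ^ length is * ((indicator {0<..1} s / s) *\<^sub>R conv2 (conv2 v (dilate s L)) (partial_derivs is (dilate s h)) (y - x)))"
    proof (intro Bochner_Integration.integral_cong refl)
      fix s :: real
      show "(LINT z|lborel. ?w2 (s, z) * partial_derivs is (?U2 (s, z)) x) =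
          (-1) ^ length is * ((indicator {0<..1} s / s) *\<^sub>R conv2 (conv2 v (dilate s L)) (partial_derivs is (dilate s h)) (y - x))"
      proof (cases "0 < s \<and> s \<le> 1")
        case True
        then have hs: "dilate s h \<in> schwartz" by (intro schwartz_dilate h) auto
        have [measurable]: "partial_derivs is (dilate s h) \<in> borel_measurable borel"
          by (intro rapid_measurable schwartz_rapid schwartz_partial_derivs hs)
        have [measurable]: "conv2 v (dilate s L) \<in> borel_measurable borel"
          using True by (intro conv2_measurable(2) vm rapid_measurable schwartz_rapid schwartz_dilate L) auto
        show ?thesis
          unfolding prod.case partial_derivs_reflect[OF hs]
          by (subst conv2_translate_integral[symmetric]) (auto simp: mult_ac simp flip: integral_mult_right_zero integral_scaleR_right)
      qed auto
    qed
    also have "\<dots> = (-1) ^ length is * (LINT s|lborel. (indicator {0<..1} s / s) *\<^sub>R conv2 (conv2 v (dilate s L)) (partial_derivs is (dilate s h)) (y - x))"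
      by (rule integral_mult_right_zero)
    finally show ?thesis
      unfolding 1 partial_derivs_reflect[OF v] reproducing_derivs[OF v, of "is" "y - x"] by (simp add: distrib_left)
  qed
  have "conv v f y = (LINT b|lborel. ?w1 b * f (?U1 b)) + (LINT b|lborel. ?w2 b * f (?U2 b))"
    unfolding conv_def by (rule tempered_exchange[OF f schwartz_reflect[OF v] f1 f2 eq])
  also have "(LINT b|lborel. ?w1 b * f (?U1 b)) = (LINT z|lborel. ?w1 z * conv h0 f z)" by (simp add: conv_def)
  also have "(LINT b|lborel. ?w2 b * f (?U2 b)) = (LINT b|(lborel \<Otimes>\<^sub>M lborel). (\<lambda>(s, z). ?w2 (s, z) * conv (dilate s h) f z) b)"
    unfolding lborel_prod by (simp add: conv_def split_beta')
  finally have "norm (conv v f y) \<le> norm (LINT z|lborel. ?w1 z * conv h0 f z) + norm (LINT b|(lborel \<Otimes>\<^sub>M lborel). (\<lambda>(s, z). ?w2 (s, z) * conv (dilate s h) f z) b)"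
    by (simp add: norm_triangle_ineq)
  then have "ennreal (norm (conv v f y)) \<le> ennreal (norm (LINT z|lborel. ?w1 z * conv h0 f z)) + ennreal (norm (LINT b|(lborel \<Otimes>\<^sub>M lborel). (\<lambda>(s, z). ?w2 (s, z) * conv (dilate s h) f z) b))"
    by (simp add: ennreal_leI flip: ennreal_plus)
  also have "\<dots> \<le> (\<integral>\<^sup>+z. ennreal (norm (?w1 z * conv h0 f z)) \<partial>lborel) + (\<integral>\<^sup>+b. ennreal (norm ((\<lambda>(s, z). ?w2 (s, z) * conv (dilate s h) f z) b)) \<partial>(lborel \<Otimes>\<^sub>M lborel))"
    by (intro add_mono integral_norm_bound_ennreal i1 i2')
  also have "(\<integral>\<^sup>+b. ennreal (norm ((\<lambda>(s, z). ?w2 (s, z) * conv (dilate s h) f z) b)) \<partial>(lborel \<Otimes>\<^sub>M lborel)) =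
      (\<integral>\<^sup>+s. (\<integral>\<^sup>+z. ennreal (norm (?w2 (s, z) * conv (dilate s h) f z)) \<partial>lborel) \<partial>lborel)"
  proof -
    have [measurable]: "(\<lambda>(s, z). ?w2 (s, z) * conv (dilate s h) f z) \<in> borel_measurable (lborel \<Otimes>\<^sub>M lborel)"
      using i2' by (rule borel_measurable_integrable)
    have "(\<lambda>b. ennreal (norm ((\<lambda>(s, z). ?w2 (s, z) * conv (dilate s h) f z) b))) \<in> borel_measurable (lborel \<Otimes>\<^sub>M lborel)"
      by measurable
    from lborel.nn_integral_fst[OF this] show ?thesis by simp
  qed
  also have "\<dots> = (\<integral>\<^sup>+s. (\<integral>\<^sup>+z. indicator {0<..1} s * ennreal (1 / s) * ennreal (norm (conv2 v (dilate s L) (y - z)) * norm (conv (dilate s h) f z)) \<partial>lborel) \<partial>lborel)"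
    by (intro nn_integral_cong) (auto simp: indicator_def norm_mult ennreal_mult[symmetric])
  finally show ?thesis by (simp add: norm_mult)
qed

end

section \<open>Kernel estimates\<close>

text \<open>With \<open>d\<close> the distance, \<open>1 / \<rho>\<close> is at most
  \<open>(1 + d / \<rho>) * (exp 1 + 1 / d)\<close>. Raised to the oscillation of
  \<open>\<alpha>\<close>, the second factor is at most \<open>exp c\<close> by log-Hoelder
  continuity, and the first is at most its power \<open>c\<close>.\<close>

lemma log_holder_weight:
  fixes \<alpha> :: "'a::real_normed_vector \<Rightarrow> real"
  assumes c: "0 < c" "\<And>x y. \<bar>\<alpha> x - \<alpha> y\<bar> \<le> c / ln (exp 1 + 1 / norm (x - y))" and \<rho>: "0 < \<rho>" "\<rho> \<le> 1"
  shows "\<rho> powr (- \<alpha> y + \<alpha> z) \<le> exp c * (1 + norm (y - z) / \<rho>) powr c"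
proof (cases "y = z")
  case True
  then show ?thesis using c \<rho> by simp
next
  case False
  define d where "d = norm (y - z)"
  have d: "0 < d" using False by (simp add: d_def)
  define \<beta> where "\<beta> = \<bar>\<alpha> y - \<alpha> z\<bar>"
  have e: "exp 1 \<le> exp 1 + 1 / d" using d by simp
  have ln1: "1 \<le> ln (exp 1 + 1 / d)"
    using d by (subst ln_ge_iff) (auto intro!: add_pos_nonneg)
  have "\<beta> \<le> c / ln (exp 1 + 1 / d)" using c(2)[of y z] by (simp add: \<beta>_def d_def)
  then have \<beta>1: "\<beta> * ln (exp 1 + 1 / d) \<le> c" using ln1 by (simp add: field_simps)
  have \<beta>0: "0 \<le> \<beta>" by (simp add: \<beta>_def)
  have \<beta>c: "\<beta> \<le> c" using mult_left_mono[OF ln1 \<beta>0] \<beta>1 by linarith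
  have "\<rho> powr (- \<alpha> y + \<alpha> z) \<le> \<rho> powr (- \<beta>)"
    using \<rho> by (intro powr_mono') (auto simp: \<beta>_def)
  also have "\<dots> = (1 / \<rho>) powr \<beta>" using \<rho> by (simp add: powr_minus inverse_powr divide_inverse)
  also have "\<dots> \<le> ((1 + d / \<rho>) * (exp 1 + 1 / d)) powr \<beta>"
  proof (intro powr_mono2 \<beta>0)
    have "1 / \<rho> = (d / \<rho>) * (1 / d)" using d by simp
    also have "\<dots> \<le> (1 + d / \<rho>) * (exp 1 + 1 / d)" using d \<rho> by (intro mult_mono) auto
    finally show "1 / \<rho> \<le> (1 + d / \<rho>) * (exp 1 + 1 / d)" .
  qed (use \<rho> in auto)
  also have "\<dots> = (1 + d / \<rho>) powr \<beta> * (exp 1 + 1 / d) powr \<beta>"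
    using d \<rho> by (simp add: powr_mult)
  also have "\<dots> \<le> (1 + d / \<rho>) powr c * exp c"
  proof (intro mult_mono)
    show "(1 + d / \<rho>) powr \<beta> \<le> (1 + d / \<rho>) powr c" using d \<rho> \<beta>c by (intro powr_mono) auto
    have "exp 1 + 1 / d \<noteq> 0" using d by (smt (verit) divide_pos_pos exp_gt_zero)
    then show "(exp 1 + 1 / d) powr \<beta> \<le> exp c" using \<beta>1 by (simp add: powr_def)
  qed auto
  finally show ?thesis by (simp add: d_def mult.commute)
qed

lemma decay_powr_le:
  fixes w :: "'a::real_normed_vector"
  assumes "(1 + norm w) ^ m * N \<le> B" "b \<le> real m" "0 \<le> N"
  shows "N \<le> B * (1 + norm w) powr (- b)"
proof -
  have "(1 + norm w) powr b * N \<le> (1 + norm w) powr real m * N"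
    using assms by (intro mult_right_mono powr_mono) auto
  also have "\<dots> \<le> B" using assms by (simp add: powr_realpow add_pos_nonneg)
  finally have "N * (1 + norm w) powr b \<le> B" by (simp add: mult.commute)
  moreover have "0 < 1 + norm w" by (simp add: add_pos_nonneg)
  then have "0 < (1 + norm w) powr b" by (metis less_irrefl powr_gt_zero)
  ultimately show ?thesis by (simp add: powr_minus pos_le_divide_eq divide_inverse[symmetric])
qed

text \<open>Two ways of exchanging the weight at scale \<open>t\<close> for that at scale
  \<open>s\<close> when the exponent changes as well. The change is charged to \<open>t\<close> in
  the first identity and to \<open>s\<close> in the second; in use, this is the larger of the two
  scales.\<close>

lemma powr_shuffle:
  fixes s t a b :: real
  assumes "0 < s" "0 < t"
  shows "t powr (- a) = s powr (- b) * t powr (- a + b) * (s / t) powr b"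
    and "t powr (- a) = s powr (- b) * s powr (- a + b) * (t / s) powr (- a)"
proof -
  have "(s / t) powr b = s powr b * t powr (- b)" using assms by (simp add: divide_inverse powr_mult inverse_powr powr_minus)
  then have "s powr (- b) * t powr (- a + b) * (s / t) powr b = (s powr (- b) * s powr b) * (t powr (- a + b) * t powr (- b))"
    by (simp only: mult_ac)
  also have "\<dots> = t powr (- a)" using assms by (simp add: powr_add[symmetric])
  finally show "t powr (- a) = s powr (- b) * t powr (- a + b) * (s / t) powr b" ..
  have "(t / s) powr (- a) = t powr (- a) * s powr a" using assms by (simp add: divide_inverse powr_mult inverse_powr powr_minus)
  then have "s powr (- b) * s powr (- a + b) * (t / s) powr (- a) = (s powr (- b) * s powr (- a + b) * s powr a) * t powr (- a)"
    by (simp only: mult_ac)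
  also have "\<dots> = t powr (- a)" using assms by (simp add: powr_add[symmetric])
  finally show "t powr (- a) = s powr (- b) * s powr (- a + b) * (t / s) powr (- a)" ..
qed

lemma eta_shift_le:
  fixes x y z :: "'a::euclidean_space"
  assumes "0 < \<rho>" "0 \<le> b"
  shows "eta \<rho> b (y - z) \<le> ennreal ((1 + norm (x - y) / \<rho>) powr b) * eta \<rho> b (x - z)"
proof -
  have "1 + norm ((x - z) /\<^sub>R \<rho>) \<le> (1 + norm ((x - y) /\<^sub>R \<rho>)) * (1 + norm ((y - z) /\<^sub>R \<rho>))"
    using one_plus_norm_le[of "(x - y) /\<^sub>R \<rho>" "(y - z) /\<^sub>R \<rho>"] by (simp add: scaleR_add_right[symmetric])
  then have le: "1 + norm (x - z) / \<rho> \<le> (1 + norm (x - y) / \<rho>) * (1 + norm (y - z) / \<rho>)"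
    using assms by (simp add: divide_inverse mult.commute)
  have pos: "0 < 1 + norm v / \<rho>" for v :: 'a using assms by (simp add: add_pos_nonneg)
  have "(1 + norm (y - z) / \<rho>) powr (- b) = (1 + norm (x - y) / \<rho>) powr b * ((1 + norm (x - y) / \<rho>) * (1 + norm (y - z) / \<rho>)) powr (- b)"
  proof -
    have "A powr b * (A * D) powr (- b) = D powr (- b)" if "0 < A" "0 < D" for A D :: real
    proof -
      have "A powr b * (A * D) powr (- b) = (A powr b * A powr (- b)) * D powr (- b)"
        using that by (simp add: powr_mult)
      then show ?thesis using that by (simp add: powr_add[symmetric])
    qed
    then show ?thesis using pos by simp
  qed
  also have "\<dots> \<le> (1 + norm (x - y) / \<rho>) powr b * (1 + norm (x - z) / \<rho>) powr (- b)"
    using le pos assms by (intro mult_left_mono powr_mono2') auto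
  finally have "\<rho> powr (- real DIM('a)) * (1 + norm (y - z) / \<rho>) powr (- b) \<le>
      (1 + norm (x - y) / \<rho>) powr b * (\<rho> powr (- real DIM('a)) * (1 + norm (x - z) / \<rho>) powr (- b))"
    using mult_left_mono by (fastforce simp: mult_ac)
  then show ?thesis unfolding eta_def by (simp add: ennreal_leI flip: ennreal_mult)
qed

definition eta_root :: "real \<Rightarrow> real \<Rightarrow> real \<Rightarrow> ('a::euclidean_space \<Rightarrow> ennreal) \<Rightarrow> 'a \<Rightarrow> ennreal" where
  "eta_root r m \<rho> F x = epowr (\<integral>\<^sup>+z. eta \<rho> m (x - z) * epowr (F z) r \<partial>lborel) (1 / r)"

text \<open>Jensen's inequality for the normalised bump centred at \<open>y\<close>, followed by a
  shift of the centre to \<open>x\<close>. With decay rate \<open>a * r\<close> the shift costs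
  exactly the Peetre weight with exponent \<open>a\<close> after the \<open>r\<close>-th
  root.\<close>

lemma eta_conv_le_root:
  fixes F :: "'a::euclidean_space \<Rightarrow> ennreal"
  assumes [measurable]: "F \<in> borel_measurable borel" and \<rho>: "0 < \<rho>" and r: "1 \<le> r" and a: "0 \<le> a"
    and W: "1 \<le> W" "(\<integral>\<^sup>+x. eta \<rho> (a * r) (x::'a) \<partial>lborel) \<le> ennreal W"
  shows "(\<integral>\<^sup>+z. eta \<rho> (a * r) (y - z) * F z \<partial>lborel) \<le>
    ennreal W * (ennreal ((1 + norm (x - y) / \<rho>) powr a) * eta_root r (a * r) \<rho> F x)"
proof -
  define k where "k z = eta \<rho> (a * r) (y - z) / ennreal W" for z
  have [measurable]: "k \<in> borel_measurable borel" unfolding k_def by measurable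
  have k1: "(\<integral>\<^sup>+z. k z \<partial>lborel) \<le> 1"
  proof -
    have "(\<integral>\<^sup>+z. eta \<rho> (a * r) (y - z) \<partial>lborel) = (\<integral>\<^sup>+x. eta \<rho> (a * r) (x::'a) \<partial>lborel)"
      using nn_integral_affine[of "-1" "eta \<rho> (a * r) :: 'a \<Rightarrow> ennreal" y] by simp
    then show ?thesis using W unfolding k_def by (subst nn_integral_divide) (auto intro!: divide_le_posI_ennreal)
  qed
  have "epowr (\<integral>\<^sup>+z. k z * F z \<partial>lborel) r \<le> (\<integral>\<^sup>+z. k z * epowr (F z) r \<partial>lborel)"
    using k1 r by (intro epowr_Jensen) auto
  also have "\<dots> \<le> (\<integral>\<^sup>+z. ennreal ((1 + norm (x - y) / \<rho>) powr (a * r)) * (eta \<rho> (a * r) (x - z) * epowr (F z) r) \<partial>lborel)"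
  proof (intro nn_integral_mono)
    fix z
    have "k z \<le> eta \<rho> (a * r) (y - z)"
      unfolding k_def using W mult_right_mono[of 1 "ennreal W" "eta \<rho> (a * r) (y - z)"]
      by (intro divide_le_posI_ennreal) auto
    also have "\<dots> \<le> ennreal ((1 + norm (x - y) / \<rho>) powr (a * r)) * eta \<rho> (a * r) (x - z)"
      using \<rho> a r by (intro eta_shift_le) auto
    finally show "k z * epowr (F z) r \<le> ennreal ((1 + norm (x - y) / \<rho>) powr (a * r)) * (eta \<rho> (a * r) (x - z) * epowr (F z) r)"
      unfolding mult.assoc[symmetric] by (intro mult_right_mono) auto
  qed
  also have "\<dots> = ennreal ((1 + norm (x - y) / \<rho>) powr (a * r)) * (\<integral>\<^sup>+z. eta \<rho> (a * r) (x - z) * epowr (F z) r \<partial>lborel)"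
    by (rule nn_integral_cmult) measurable
  also have "\<dots> = epowr (ennreal ((1 + norm (x - y) / \<rho>) powr a) * eta_root r (a * r) \<rho> F x) r"
    using r by (simp add: epowr_mult eta_root_def epowr_epowr epowr_ennreal powr_powr)
  finally have "(\<integral>\<^sup>+z. k z * F z \<partial>lborel) \<le> ennreal ((1 + norm (x - y) / \<rho>) powr a) * eta_root r (a * r) \<rho> F x"
    using r by (simp add: epowr_le_iff)
  then have "ennreal W * (\<integral>\<^sup>+z. k z * F z \<partial>lborel) \<le> ennreal W * (ennreal ((1 + norm (x - y) / \<rho>) powr a) * eta_root r (a * r) \<rho> F x)"
    by (rule mult_left_mono) auto
  moreover have "ennreal W * (\<integral>\<^sup>+z. k z * F z \<partial>lborel) = (\<integral>\<^sup>+z. eta \<rho> (a * r) (y - z) * F z \<partial>lborel)"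
  proof -
    have "ennreal W * k z = eta \<rho> (a * r) (y - z)" for z
      using W unfolding k_def by (simp add: ennreal_times_divide mult.commute[of "ennreal W"] ennreal_mult_divide_eq)
    then show ?thesis by (subst nn_integral_cmult[symmetric]) (auto simp: mult.assoc[symmetric])
  qed
  ultimately show ?thesis by simp
qed

text \<open>Unlike \<open>lux_cmult_le\<close> this admits the factor 0; it is Minkowski's
  inequality over a one-point space.\<close>

lemma lux_cmult_finite_le:
  assumes "sigma_finite_measure M" and [measurable]: "g \<in> borel_measurable M" "p \<in> borel_measurable M"
    and p: "\<And>x. 1 \<le> p x" and c: "c < top"
  shows "lux M p (\<lambda>x. c * g x) \<le> c * lux M p g"
proof -
  have "lux M p (\<lambda>x. \<integral>\<^sup>+s. c * g x \<partial>count_space (UNIV :: unit set)) \<le> (\<integral>\<^sup>+s. c * lux M p g \<partial>count_space (UNIV :: unit set))"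
    by (rule lux_nn_integral_le[OF assms(1)])
      (use p c in \<open>auto simp: nn_integral_count_space_finite UNIV_unit intro!: sigma_finite_measure_count_space_countable measurable_pair_measure_countable1\<close>)
  then show ?thesis by (simp add: nn_integral_count_space_finite UNIV_unit)
qed

text \<open>The logarithm in the denominator is at least 1, so \<open>\<alpha>\<close> differs from
  \<open>\<alpha> 0\<close> by at most \<open>c\<close>. Hence some number \<open>M\<close> of
  vanishing moments outweighs any negative smoothness.\<close>

lemma log_holder_lower_bound:
  fixes \<alpha> :: "'a::real_normed_vector \<Rightarrow> real"
  assumes c: "0 < c" "\<And>x y. \<bar>\<alpha> x - \<alpha> y\<bar> \<le> c / ln (exp 1 + 1 / norm (x - y))"
  obtains M :: nat where "\<And>z. \<delta> \<le> \<alpha> z + real M"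
proof -
  obtain M :: nat where M: "c + \<bar>\<alpha> 0\<bar> + \<delta> \<le> real M" using real_arch_simple by blast
  have "\<delta> \<le> \<alpha> z + real M" for z
  proof -
    have "1 \<le> ln (exp 1 + 1 / norm z)" by (subst ln_ge_iff) (auto intro!: add_pos_nonneg)
    then have "c / ln (exp 1 + 1 / norm z) \<le> c / 1" using c(1) by (intro frac_le) auto
    with c(2)[of z 0] M show ?thesis by simp
  qed
  then show thesis by (rule that)
qed

text \<open>For \<open>t \<le> \<rho>\<close> the Peetre weight at scale \<open>t\<close> is at
  least the one at scale \<open>\<rho>\<close>, so it pays for the shift of the centre.\<close>

lemma eta_conv_shrink:
  fixes F :: "'a::euclidean_space \<Rightarrow> ennreal"
  assumes F: "F \<in> borel_measurable borel" and t: "0 < t" "t \<le> \<rho>" and r: "1 \<le> r" and a: "0 \<le> a"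
    and W: "1 \<le> W" "(\<integral>\<^sup>+x. eta \<rho> (a * r) (x::'a) \<partial>lborel) \<le> ennreal W"
  shows "ennreal ((1 + norm (x - y) / t) powr (- a)) * (\<integral>\<^sup>+z. eta \<rho> (a * r) (y - z) * F z \<partial>lborel) \<le>
    ennreal W * eta_root r (a * r) \<rho> F x"
proof -
  have \<rho>: "0 < \<rho>" using t by linarith
  let ?c = "(1 + norm (x - y) / t) powr (- a)" and ?d = "(1 + norm (x - y) / \<rho>) powr a"
  have "?c * ?d \<le> ?c * (1 + norm (x - y) / t) powr a"
    using t \<rho> a by (intro mult_left_mono powr_mono2 add_left_mono divide_left_mono) auto
  also have "\<dots> = 1"
  proof -
    have "0 < 1 + norm (x - y) / t" using t by (simp add: add_pos_nonneg)
    then show ?thesis by (simp add: powr_add[symmetric])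
  qed
  finally have cd: "ennreal ?c * ennreal ?d \<le> 1" by (simp add: ennreal_mult[symmetric] ennreal_le_1)
  have "ennreal ?c * (\<integral>\<^sup>+z. eta \<rho> (a * r) (y - z) * F z \<partial>lborel) \<le> ennreal ?c * (ennreal W * (ennreal ?d * eta_root r (a * r) \<rho> F x))"
    by (intro mult_left_mono eta_conv_le_root F \<rho> r a W) auto
  also have "\<dots> = (ennreal ?c * ennreal ?d) * (ennreal W * eta_root r (a * r) \<rho> F x)" by (simp only: mult_ac)
  also have "\<dots> \<le> 1 * (ennreal W * eta_root r (a * r) \<rho> F x)" by (intro mult_right_mono cd) auto
  finally show ?thesis by simp
qed

lemma borel_measurable_conv_dilate:
  fixes h :: "real^'n::finite \<Rightarrow> complex"
  assumes "h \<in> schwartz" "f \<in> tempered"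
  shows "(\<lambda>(s, z). indicator {0<..1} s *\<^sub>R conv (dilate s h) f z) \<in> borel_measurable (borel \<Otimes>\<^sub>M borel)"
proof -
  have "continuous_on ({0<..1} \<times> UNIV) (\<lambda>(s, z). conv (dilate s h) f z)"
    by (rule continuous_on_subset[OF continuous_on_conv_dilate[OF assms]]) auto
  moreover have "{0<..1::real} \<times> (UNIV :: (real^'n) set) \<in> sets borel"
    unfolding borel_prod[symmetric] by measurable
  ultimately have "(\<lambda>b. indicator ({0<..1::real} \<times> UNIV) b *\<^sub>R (\<lambda>(s, z). conv (dilate s h) f z) b) \<in> borel_measurable borel"
    by (intro borel_measurable_continuous_on_indicator)
  also have "(\<lambda>b. indicator ({0<..1::real} \<times> UNIV) b *\<^sub>R (\<lambda>(s, z). conv (dilate s h) f z) b) = (\<lambda>(s, z). indicator {0<..1} s *\<^sub>R conv (dilate s h) f z)"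
    by (auto simp: fun_eq_iff indicator_def)
  finally show ?thesis by (simp add: borel_prod)
qed

context calderon
begin

text \<open>For \<open>s \<le> t\<close> the moments of \<open>L\<close> give powers of
  \<open>s / t\<close>, as many as the lower bound on \<open>\<alpha>\<close> demands. For
  \<open>t < s\<close> the moments of \<open>u\<close> give \<open>M0\<close> powers of
  \<open>t / s\<close>, of which the weight consumes at most \<open>\<alpha>1\<close>. In both cases
  at least \<open>\<delta>\<close> powers remain.\<close>

lemma rescaled_kernel_bound:
  assumes u: "u \<in> schwartz" and mom: "\<And>is :: 'n list. length is < M0 \<Longrightarrow> (LINT y|lborel. of_real (mon is y) * u y) = 0"
    and c: "0 < c" "\<And>x y. \<bar>\<alpha> x - \<alpha> y\<bar> \<le> c / ln (exp 1 + 1 / norm (x - y))"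
    and \<alpha>: "\<And>x. \<alpha> x \<le> \<alpha>1" and \<delta>: "0 < \<delta>" "\<delta> + \<alpha>1 \<le> real M0"
  obtains C where "0 \<le> C" "\<And>s t y z. 0 < s \<Longrightarrow> s \<le> 1 \<Longrightarrow> 0 < t \<Longrightarrow> t \<le> 1 \<Longrightarrow>
      ennreal (t powr (- \<alpha> y) * norm (conv2 (dilate t u) (dilate s L) (y - z))) \<le>
      ennreal C * ennreal (min (s / t) (t / s) powr \<delta>) * eta (max s t) b (y - z) * ennreal (s powr (- \<alpha> z))"
proof -
  have um [measurable]: "u \<in> borel_measurable borel" by (intro rapid_measurable schwartz_rapid u)
  let ?n = "real CARD('n)"
  \<comment> \<open>\<open>b\<close> powers of decay are kept, and \<open>c\<close> are spent on
    moving the weight from \<open>y\<close> to \<open>z\<close>.\<close>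
  obtain m :: nat where m: "b + c \<le> real m" using real_arch_simple by blast
  obtain M :: nat where \<alpha>M: "\<And>z. \<delta> \<le> \<alpha> z + real M" using log_holder_lower_bound[OF c, of \<delta>] by blast
  obtain C1 where C1: "0 \<le> C1" "\<And>s x. 0 < s \<Longrightarrow> s \<le> 1 \<Longrightarrow> (1 + norm x) ^ m * norm (conv2 u (dilate s L) x) \<le> C1 * s ^ M"
    using kernel_bound[OF u, of m M] by blast
  obtain C2 where C2: "0 \<le> C2" "\<And>\<tau> x. 0 \<le> \<tau> \<Longrightarrow> \<tau> \<le> 1 \<Longrightarrow>
    (1 + norm x) ^ m * norm (LINT y|lborel. L (x - \<tau> *\<^sub>R y) * u y) \<le> C2 * \<tau> ^ M0"
  proof (rule conv_moment_bound[OF L schwartz_rapid[OF u], of M0 m])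
    show "(LINT y|lborel. of_real (mon is y) * u y) = 0" if "length is < M0" for "is" using that by (rule mom)
  qed (rule that)
  define C where "C = (C1 + C2) * exp c"
  have C: "0 \<le> C" "C1 * exp c \<le> C" "C2 * exp c \<le> C" using C1 C2 by (auto simp: C_def)
  have main: "t powr (- \<alpha> y) * norm (conv2 (dilate t u) (dilate s L) (y - z)) \<le>
      C * min (s / t) (t / s) powr \<delta> * (max s t powr (- ?n) * (1 + norm (y - z) / max s t) powr (- b)) * s powr (- \<alpha> z)"
    if s: "0 < s" "s \<le> 1" and t: "0 < t" "t \<le> 1" for s t y z
  proof (cases "s \<le> t")
    case True
    define w where "w = (y - z) /\<^sub>R t"
    have nw: "norm w = norm (y - z) / t" using t by (simp add: w_def divide_inverse mult.commute)
    have \<sigma>: "0 < s / t" "s / t \<le> 1" using True s t by auto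
    have "norm (conv2 u (dilate (s / t) L) w) \<le> C1 * (s / t) ^ M * (1 + norm w) powr (- (b + c))"
      using C1(2)[OF \<sigma>] m by (intro decay_powr_le[where m=m]) auto
    then have k: "norm (conv2 (dilate t u) (dilate s L) (y - z)) \<le> t powr (- ?n) * (C1 * (s / t) powr real M * (1 + norm w) powr (- (b + c)))"
      using t \<sigma> by (simp add: conv2_dilate_both w_def powr_minus powr_realpow divide_inverse mult_left_mono)
    have "t powr (- \<alpha> y) = s powr (- \<alpha> z) * t powr (- \<alpha> y + \<alpha> z) * (s / t) powr \<alpha> z"
      using s t by (intro powr_shuffle) auto
    also have "\<dots> \<le> s powr (- \<alpha> z) * (exp c * (1 + norm w) powr c) * (s / t) powr \<alpha> z"
      using log_holder_weight[OF c t, of y z] unfolding nw by (intro mult_right_mono mult_left_mono) auto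
    finally have t1: "t powr (- \<alpha> y) \<le> s powr (- \<alpha> z) * (exp c * (1 + norm w) powr c) * (s / t) powr \<alpha> z" .
    have "t powr (- \<alpha> y) * norm (conv2 (dilate t u) (dilate s L) (y - z)) \<le>
        (s powr (- \<alpha> z) * (exp c * (1 + norm w) powr c) * (s / t) powr \<alpha> z) * (t powr (- ?n) * (C1 * (s / t) powr real M * (1 + norm w) powr (- (b + c))))"
      by (intro mult_mono t1 k) auto
    also have "\<dots> = (C1 * exp c) * ((s / t) powr \<alpha> z * (s / t) powr real M) * (t powr (- ?n) * ((1 + norm w) powr c * (1 + norm w) powr (- (b + c)))) * s powr (- \<alpha> z)"
      by (simp only: mult_ac)
    also have "\<dots> = (C1 * exp c) * (s / t) powr (\<alpha> z + real M) * (t powr (- ?n) * (1 + norm w) powr (- b)) * s powr (- \<alpha> z)"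
      by (simp add: powr_add[symmetric])
    also have "\<dots> \<le> C * (s / t) powr \<delta> * (t powr (- ?n) * (1 + norm w) powr (- b)) * s powr (- \<alpha> z)"
      using C \<sigma> \<alpha>M C1 by (intro mult_right_mono mult_mono powr_mono') auto
    also have "s / t = min (s / t) (t / s)"
    proof -
      have "1 \<le> t / s" using True s by simp
      then show ?thesis using \<sigma> by linarith
    qed
    finally show ?thesis using True by (simp add: nw max_def)
  next
    case False
    then have ts: "t \<le> s" "max s t = s" by auto
    define w where "w = (y - z) /\<^sub>R s"
    have nw: "norm w = norm (y - z) / s" using s by (simp add: w_def divide_inverse mult.commute)
    have \<sigma>: "0 < t / s" "t / s \<le> 1" using ts s t by auto
    have "conv2 (dilate t u) (dilate s L) (y - z) = conv2 (dilate s L) (dilate t u) (y - z)"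
      using s t by (intro conv2_commute rapid_measurable schwartz_rapid schwartz_dilate u L) auto
    also have "\<dots> = (1 / s ^ CARD('n)) *\<^sub>R conv2 L (dilate (t / s) u) w"
      using s by (simp add: conv2_dilate_both w_def)
    also have "conv2 L (dilate (t / s) u) w = (LINT y|lborel. L (w - (t / s) *\<^sub>R y) * u y)"
      using \<sigma> by (intro conv2_dilate) auto
    finally have eq: "norm (conv2 (dilate t u) (dilate s L) (y - z)) = s powr (- ?n) * norm (LINT y|lborel. L (w - (t / s) *\<^sub>R y) * u y)"
      using s by (simp add: powr_minus powr_realpow divide_inverse)
    have "norm (LINT y|lborel. L (w - (t / s) *\<^sub>R y) * u y) \<le> C2 * (t / s) ^ M0 * (1 + norm w) powr (- (b + c))"
      using C2(2)[of "t / s" w] \<sigma> m by (intro decay_powr_le[where m=m]) auto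
    then have k: "norm (conv2 (dilate t u) (dilate s L) (y - z)) \<le> s powr (- ?n) * (C2 * (t / s) powr real M0 * (1 + norm w) powr (- (b + c)))"
      unfolding eq using \<sigma> by (simp add: powr_realpow mult_left_mono)
    have "t powr (- \<alpha> y) = s powr (- \<alpha> z) * s powr (- \<alpha> y + \<alpha> z) * (t / s) powr (- \<alpha> y)"
      using s t by (intro powr_shuffle) auto
    also have "\<dots> \<le> s powr (- \<alpha> z) * (exp c * (1 + norm w) powr c) * (t / s) powr (- \<alpha>1)"
      using log_holder_weight[OF c s, of y z] \<alpha>[of y] \<sigma> s unfolding nw by (intro mult_mono powr_mono') auto
    finally have t1: "t powr (- \<alpha> y) \<le> s powr (- \<alpha> z) * (exp c * (1 + norm w) powr c) * (t / s) powr (- \<alpha>1)" .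
    have "t powr (- \<alpha> y) * norm (conv2 (dilate t u) (dilate s L) (y - z)) \<le>
        (s powr (- \<alpha> z) * (exp c * (1 + norm w) powr c) * (t / s) powr (- \<alpha>1)) * (s powr (- ?n) * (C2 * (t / s) powr real M0 * (1 + norm w) powr (- (b + c))))"
      by (intro mult_mono t1 k) auto
    also have "\<dots> = (C2 * exp c) * ((t / s) powr (- \<alpha>1) * (t / s) powr real M0) * (s powr (- ?n) * ((1 + norm w) powr c * (1 + norm w) powr (- (b + c)))) * s powr (- \<alpha> z)"
      by (simp only: mult_ac)
    also have "\<dots> = (C2 * exp c) * (t / s) powr (- \<alpha>1 + real M0) * (s powr (- ?n) * (1 + norm w) powr (- b)) * s powr (- \<alpha> z)"
      by (simp add: powr_add[symmetric])
    also have "\<dots> \<le> C * (t / s) powr \<delta> * (s powr (- ?n) * (1 + norm w) powr (- b)) * s powr (- \<alpha> z)"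
      using C \<sigma> \<delta> C2 by (intro mult_right_mono mult_mono powr_mono') auto
    also have "t / s = min (s / t) (t / s)"
    proof -
      have "1 \<le> s / t" using ts t by simp
      then show ?thesis using \<sigma> by linarith
    qed
    finally show ?thesis using ts by (simp add: nw)
  qed
  show thesis
  proof (rule that[OF C(1)])
    fix s t :: real and y z :: "real^'n" assume st: "0 < s" "s \<le> 1" "0 < t" "t \<le> 1"
    show "ennreal (t powr (- \<alpha> y) * norm (conv2 (dilate t u) (dilate s L) (y - z))) \<le>
      ennreal C * ennreal (min (s / t) (t / s) powr \<delta>) * eta (max s t) b (y - z) * ennreal (s powr (- \<alpha> z))"
      using ennreal_leI[OF main[OF st, of y z]] C(1) by (simp add: eta_def ennreal_mult)
  qed
qed

text \<open>The indicator makes the function measurable jointly in scale and position on the whole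
  line, while continuity of the convolution is available for positive scales.\<close>

definition wmean :: "(real^'n \<Rightarrow> real) \<Rightarrow> ((real^'n \<Rightarrow> complex) \<Rightarrow> complex) \<Rightarrow> real \<Rightarrow> real^'n \<Rightarrow> ennreal" where
  "wmean \<alpha> f s z = ennreal (s powr (- \<alpha> z) * norm (indicator {0<..1} s *\<^sub>R conv (dilate s h) f z))"

definition mean0 :: "((real^'n \<Rightarrow> complex) \<Rightarrow> complex) \<Rightarrow> real^'n \<Rightarrow> ennreal" where
  "mean0 f z = ennreal (norm (conv h0 f z))"

lemma wmean_eq: "0 < s \<Longrightarrow> s \<le> 1 \<Longrightarrow> wmean \<alpha> f s z = ennreal (s powr (- \<alpha> z) * norm (conv (dilate s h) f z))"
  by (simp add: wmean_def)

lemma means_measurable: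
  assumes [measurable]: "\<alpha> \<in> borel_measurable borel" and f: "f \<in> tempered"
  shows "(\<lambda>(s, z). wmean \<alpha> f s z) \<in> borel_measurable (borel \<Otimes>\<^sub>M borel)"
    and "wmean \<alpha> f s \<in> borel_measurable borel"
    and "mean0 f \<in> borel_measurable borel"
proof -
  note [measurable] = borel_measurable_conv_dilate[OF h f]
  show m [measurable]: "(\<lambda>(s, z). wmean \<alpha> f s z) \<in> borel_measurable (borel \<Otimes>\<^sub>M borel)"
    unfolding wmean_def split_beta' by measurable
  show "wmean \<alpha> f s \<in> borel_measurable borel"
    using measurable_compose[OF measurable_Pair1' m, of s] by simp
  have [measurable]: "conv h0 f \<in> borel_measurable borel"
    by (intro borel_measurable_continuous_onI continuous_on_conv h0 f)
  show "mean0 f \<in> borel_measurable borel" unfolding mean0_def[abs_def] by measurable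
qed

text \<open>\<open>B\<close> is the value at \<open>y\<close> of the weight,
  \<open>t powr (- \<alpha> y)\<close> or 1, so that both maximal functions are covered. The kernel
  bounds are put into the reproducing formula, and the Peetre weight recentres each average at
  \<open>x\<close>.\<close>

lemma weighted_conv_le:
  assumes v: "v \<in> schwartz" and f: "f \<in> tempered" and \<alpha>m: "\<alpha> \<in> borel_measurable borel"
    and t: "0 < t" "t \<le> 1" and e: "1 \<le> e" and a: "0 \<le> a" and W: "1 \<le> W"
    "\<And>\<rho>. 0 < \<rho> \<Longrightarrow> (\<integral>\<^sup>+x. eta \<rho> (a * e) (x::real^'n) \<partial>lborel) \<le> ennreal W"
    and B: "0 \<le> B"
    and K0: "\<And>z. ennreal (B * norm (conv2 v L0 (y - z))) \<le> ennreal A0 * eta 1 (a * e) (y - z)"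
    and K: "\<And>s z. 0 < s \<Longrightarrow> s \<le> 1 \<Longrightarrow>
      ennreal (B * norm (conv2 v (dilate s L) (y - z))) \<le> ennreal (A s) * eta (max s t) (a * e) (y - z) * ennreal (s powr (- \<alpha> z))"
  shows "ennreal (B * norm (conv v f y) / (1 + norm (x - y) / t) powr a) \<le>
    ennreal A0 * (ennreal W * eta_root e (a * e) 1 (mean0 f) x) +
    (\<integral>\<^sup>+s\<in>{0<..1}. ennreal (A s) * (ennreal W * eta_root e (a * e) (max s t) (wmean \<alpha> f s) x) * ennreal (1 / s) \<partial>lborel)"
proof -
  note mm [measurable] = means_measurable[OF \<alpha>m f]
  have vm [measurable]: "v \<in> borel_measurable borel" by (intro rapid_measurable schwartz_rapid v)
  have L0m [measurable]: "L0 \<in> borel_measurable borel" by (rule meas)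
  note [measurable] = conv2_measurable(1)[OF vm meas(4)] conv2_measurable(2)[OF vm L0m] borel_measurable_conv_dilate[OF h f]
  have [measurable]: "conv h0 f \<in> borel_measurable borel"
    by (intro borel_measurable_continuous_onI continuous_on_conv h0 f)
  let ?c = "ennreal ((1 + norm (x - y) / t) powr (- a))"
  define J where "J s z = ennreal (1 / s) * ennreal (norm (conv2 v (dilate s L) (y - z)) * norm (indicator {0<..1} s *\<^sub>R conv (dilate s h) f z))" for s z
  have Jm [measurable]: "(\<lambda>(s, z). J s z) \<in> borel_measurable (borel \<Otimes>\<^sub>M borel)"
    unfolding J_def by measurable
  have Jm' [measurable]: "J s \<in> borel_measurable borel" for s
    using measurable_compose[OF measurable_Pair1' Jm, of s] by simp
  define I0 where "I0 = (\<integral>\<^sup>+z. ennreal (norm (conv2 v L0 (y - z)) * norm (conv h0 f z)) \<partial>lborel)"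
  have "ennreal (norm (conv v f y)) \<le> I0 +
    (\<integral>\<^sup>+s. (\<integral>\<^sup>+z. indicator {0<..1} s * ennreal (1 / s) * ennreal (norm (conv2 v (dilate s L) (y - z)) * norm (conv (dilate s h) f z)) \<partial>lborel) \<partial>lborel)"
    unfolding I0_def by (rule reproducing_formula[OF v f])
  also have "(\<integral>\<^sup>+s. (\<integral>\<^sup>+z. indicator {0<..1} s * ennreal (1 / s) * ennreal (norm (conv2 v (dilate s L) (y - z)) * norm (conv (dilate s h) f z)) \<partial>lborel) \<partial>lborel) =
      (\<integral>\<^sup>+s. (\<integral>\<^sup>+z. J s z \<partial>lborel) \<partial>lborel)"
    by (intro nn_integral_cong) (auto simp: J_def indicator_def)
  finally have rep: "ennreal (norm (conv v f y)) \<le> I0 + (\<integral>\<^sup>+s. (\<integral>\<^sup>+z. J s z \<partial>lborel) \<partial>lborel)" .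
  have i0: "?c * (ennreal B * I0) \<le> ennreal A0 * (ennreal W * eta_root e (a * e) 1 (mean0 f) x)"
  proof -
    have "ennreal B * I0 = (\<integral>\<^sup>+z. ennreal B * ennreal (norm (conv2 v L0 (y - z)) * norm (conv h0 f z)) \<partial>lborel)"
      unfolding I0_def by (rule nn_integral_cmult[symmetric]) measurable
    also have "\<dots> \<le> (\<integral>\<^sup>+z. ennreal A0 * (eta 1 (a * e) (y - z) * mean0 f z) \<partial>lborel)"
    proof (intro nn_integral_mono)
      fix z
      show "ennreal B * ennreal (norm (conv2 v L0 (y - z)) * norm (conv h0 f z)) \<le> ennreal A0 * (eta 1 (a * e) (y - z) * mean0 f z)"
        using mult_right_mono[OF K0[of z], of "mean0 f z"] B
        by (simp add: mean0_def ennreal_mult mult.assoc)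
    qed
    also have "\<dots> = ennreal A0 * (\<integral>\<^sup>+z. eta 1 (a * e) (y - z) * mean0 f z \<partial>lborel)"
      by (rule nn_integral_cmult) measurable
    finally have "?c * (ennreal B * I0) \<le> ?c * (ennreal A0 * (\<integral>\<^sup>+z. eta 1 (a * e) (y - z) * mean0 f z \<partial>lborel))"
      by (rule mult_left_mono) simp
    also have "\<dots> = ennreal A0 * (?c * (\<integral>\<^sup>+z. eta 1 (a * e) (y - z) * mean0 f z \<partial>lborel))" by (simp only: mult_ac)
    also have "\<dots> \<le> ennreal A0 * (ennreal W * eta_root e (a * e) 1 (mean0 f) x)"
      by (intro mult_left_mono eta_conv_shrink mm t e a W) auto
    finally show ?thesis .
  qed
  have i1: "?c * (ennreal B * (\<integral>\<^sup>+s. (\<integral>\<^sup>+z. J s z \<partial>lborel) \<partial>lborel)) \<le>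
      (\<integral>\<^sup>+s\<in>{0<..1}. ennreal (A s) * (ennreal W * eta_root e (a * e) (max s t) (wmean \<alpha> f s) x) * ennreal (1 / s) \<partial>lborel)"
  proof -
    have "?c * (ennreal B * (\<integral>\<^sup>+s. (\<integral>\<^sup>+z. J s z \<partial>lborel) \<partial>lborel)) = (\<integral>\<^sup>+s. ?c * ennreal B * (\<integral>\<^sup>+z. J s z \<partial>lborel) \<partial>lborel)"
      unfolding mult.assoc[symmetric] by (rule nn_integral_cmult[symmetric]) measurable
    also have "\<dots> \<le> (\<integral>\<^sup>+s\<in>{0<..1}. ennreal (A s) * (ennreal W * eta_root e (a * e) (max s t) (wmean \<alpha> f s) x) * ennreal (1 / s) \<partial>lborel)"
    proof (intro nn_integral_mono)
      fix s :: real
      show "?c * ennreal B * (\<integral>\<^sup>+z. J s z \<partial>lborel) \<le>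
          ennreal (A s) * (ennreal W * eta_root e (a * e) (max s t) (wmean \<alpha> f s) x) * ennreal (1 / s) * indicator {0<..1} s"
      proof (cases "0 < s \<and> s \<le> 1")
        case True
        then have s: "0 < s" "s \<le> 1" by auto
        have "ennreal B * (\<integral>\<^sup>+z. J s z \<partial>lborel) = (\<integral>\<^sup>+z. ennreal B * J s z \<partial>lborel)"
          by (rule nn_integral_cmult[symmetric]) measurable
        also have "\<dots> \<le> (\<integral>\<^sup>+z. (ennreal (A s) * ennreal (1 / s)) * (eta (max s t) (a * e) (y - z) * wmean \<alpha> f s z) \<partial>lborel)"
        proof (intro nn_integral_mono)
          fix z
          have "ennreal B * J s z = ennreal (B * norm (conv2 v (dilate s L) (y - z))) * (ennreal (1 / s) * ennreal (norm (conv (dilate s h) f z)))"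
            using B s by (simp add: J_def ennreal_mult mult_ac)
          also have "\<dots> \<le> (ennreal (A s) * eta (max s t) (a * e) (y - z) * ennreal (s powr (- \<alpha> z))) * (ennreal (1 / s) * ennreal (norm (conv (dilate s h) f z)))"
            by (intro mult_right_mono K s) auto
          also have "\<dots> = (ennreal (A s) * ennreal (1 / s)) * (eta (max s t) (a * e) (y - z) * wmean \<alpha> f s z)"
            using s by (simp add: wmean_eq ennreal_mult mult_ac)
          finally show "ennreal B * J s z \<le> (ennreal (A s) * ennreal (1 / s)) * (eta (max s t) (a * e) (y - z) * wmean \<alpha> f s z)" .
        qed
        also have "\<dots> = (ennreal (A s) * ennreal (1 / s)) * (\<integral>\<^sup>+z. eta (max s t) (a * e) (y - z) * wmean \<alpha> f s z \<partial>lborel)"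
          by (rule nn_integral_cmult) measurable
        finally have "?c * (ennreal B * (\<integral>\<^sup>+z. J s z \<partial>lborel)) \<le>
            ?c * ((ennreal (A s) * ennreal (1 / s)) * (\<integral>\<^sup>+z. eta (max s t) (a * e) (y - z) * wmean \<alpha> f s z \<partial>lborel))"
          by (rule mult_left_mono) simp
        also have "\<dots> = (ennreal (A s) * ennreal (1 / s)) * (?c * (\<integral>\<^sup>+z. eta (max s t) (a * e) (y - z) * wmean \<alpha> f s z \<partial>lborel))"
          by (simp only: mult_ac)
        also have "\<dots> \<le> (ennreal (A s) * ennreal (1 / s)) * (ennreal W * eta_root e (a * e) (max s t) (wmean \<alpha> f s) x)"
          using s by (intro mult_left_mono eta_conv_shrink mm t e a W) auto
        finally show ?thesis using s by (simp add: mult_ac)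
      qed (auto simp: J_def)
    qed
    finally show ?thesis .
  qed
  have "ennreal (B * norm (conv v f y) / (1 + norm (x - y) / t) powr a) = ?c * (ennreal B * ennreal (norm (conv v f y)))"
    using B by (simp add: ennreal_mult[symmetric] powr_minus divide_inverse mult_ac)
  also have "\<dots> \<le> ?c * (ennreal B * (I0 + (\<integral>\<^sup>+s. (\<integral>\<^sup>+z. J s z \<partial>lborel) \<partial>lborel)))"
    by (intro mult_left_mono rep) auto
  also have "\<dots> = ?c * (ennreal B * I0) + ?c * (ennreal B * (\<integral>\<^sup>+s. (\<integral>\<^sup>+z. J s z \<partial>lborel) \<partial>lborel))"
    by (simp add: distrib_left)
  also have "\<dots> \<le> ennreal A0 * (ennreal W * eta_root e (a * e) 1 (mean0 f) x) +
    (\<integral>\<^sup>+s\<in>{0<..1}. ennreal (A s) * (ennreal W * eta_root e (a * e) (max s t) (wmean \<alpha> f s) x) * ennreal (1 / s) \<partial>lborel)"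
    by (intro add_mono i0 i1)
  finally show ?thesis .
qed

text \<open>The pointwise bound has a right side free of \<open>y\<close> and so survives the
  supremum; Minkowski's inequality in \<open>s\<close> and the boundedness of the averages then give
  the norm.\<close>

lemma lux_weighted_sup_le:
  assumes v: "v \<in> schwartz" and f: "f \<in> tempered" and \<alpha>m: "\<alpha> \<in> borel_measurable borel"
    and t: "0 < t" "t \<le> 1" and e: "1 \<le> e" and a: "0 \<le> a" and W: "1 \<le> W"
    "\<And>\<rho>. 0 < \<rho> \<Longrightarrow> (\<integral>\<^sup>+x. eta \<rho> (a * e) (x::real^'n) \<partial>lborel) \<le> ennreal W"
    and p: "\<And>x. 1 \<le> p x" and pm: "p \<in> borel_measurable borel"
    and D: "\<And>\<rho> g. 0 < \<rho> \<Longrightarrow> g \<in> borel_measurable borel \<Longrightarrow> lux lborel p (eta_root e (a * e) \<rho> g) \<le> ennreal D * lux lborel p g"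
    and \<beta>: "\<And>y. 0 \<le> \<beta> y" and A [measurable]: "A \<in> borel_measurable borel"
    and Afin: "(\<integral>\<^sup>+s\<in>{0<..1}. ennreal (A s) * ennreal (1 / s) \<partial>lborel) < \<infinity>"
    and K0: "\<And>y z. ennreal (\<beta> y * norm (conv2 v L0 (y - z))) \<le> ennreal A0 * eta 1 (a * e) (y - z)"
    and K: "\<And>s y z. 0 < s \<Longrightarrow> s \<le> 1 \<Longrightarrow>
      ennreal (\<beta> y * norm (conv2 v (dilate s L) (y - z))) \<le> ennreal (A s) * eta (max s t) (a * e) (y - z) * ennreal (s powr (- \<alpha> z))"
  shows "lux lborel p (\<lambda>x. SUP y. ennreal (\<beta> y * norm (conv v f y) / (1 + norm (x - y) / t) powr a)) \<le>
    ennreal W * ennreal D * (ennreal A0 * lux lborel p (mean0 f) +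
      (\<integral>\<^sup>+s\<in>{0<..1}. ennreal (A s) * lux lborel p (wmean \<alpha> f s) * ennreal (1 / s) \<partial>lborel))"
proof -
  note mm [measurable] = means_measurable[OF \<alpha>m f]
  note [measurable] = pm
  have p0: "0 \<le> p x" for x using p[of x] by simp
  note sf = lborel.sigma_finite_measure_axioms
  have [measurable]: "(\<lambda>x. eta_root e (a * e) 1 (mean0 f) x) \<in> borel_measurable borel"
    unfolding eta_root_def by measurable
  define h1 where "h1 s x = ennreal W * eta_root e (a * e) (max s t) (wmean \<alpha> f s) x" for s x
  have h1m [measurable]: "(\<lambda>(s, x). h1 s x) \<in> borel_measurable (borel \<Otimes>\<^sub>M borel)"
    unfolding h1_def eta_root_def eta_def by measurable
  have h1m' [measurable]: "h1 s \<in> borel_measurable borel" for s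
    using measurable_compose[OF measurable_Pair1' h1m, of s] by simp
  define w where "w s = ennreal (A s) * ennreal (1 / s) * indicator {0<..1} s" for s
  have [measurable]: "w \<in> borel_measurable borel" unfolding w_def by measurable
  have wfin: "(\<integral>\<^sup>+s. w s \<partial>lborel) < \<infinity>" using Afin by (simp add: w_def)
  have [measurable]: "(\<lambda>s. lux lborel p (wmean \<alpha> f s)) \<in> borel_measurable borel"
    using p0 mm by (intro borel_measurable_lux sf) (auto cong: measurable_cong_sets)
  have "lux lborel p (\<lambda>x. SUP y. ennreal (\<beta> y * norm (conv v f y) / (1 + norm (x - y) / t) powr a)) \<le>
      lux lborel p (\<lambda>x. ennreal A0 * (ennreal W * eta_root e (a * e) 1 (mean0 f) x) + (\<integral>\<^sup>+s. w s * h1 s x \<partial>lborel))"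
  proof (intro lux_mono p0 SUP_least)
    fix x y
    have "ennreal (\<beta> y * norm (conv v f y) / (1 + norm (x - y) / t) powr a) \<le>
      ennreal A0 * (ennreal W * eta_root e (a * e) 1 (mean0 f) x) +
      (\<integral>\<^sup>+s\<in>{0<..1}. ennreal (A s) * (ennreal W * eta_root e (a * e) (max s t) (wmean \<alpha> f s) x) * ennreal (1 / s) \<partial>lborel)"
      by (intro weighted_conv_le v f \<alpha>m t e a W \<beta> K0 K)
    then show "ennreal (\<beta> y * norm (conv v f y) / (1 + norm (x - y) / t) powr a) \<le>
        ennreal A0 * (ennreal W * eta_root e (a * e) 1 (mean0 f) x) + (\<integral>\<^sup>+s. w s * h1 s x \<partial>lborel)"
      by (simp add: w_def h1_def mult_ac)
  qed
  also have "\<dots> \<le> lux lborel p (\<lambda>x. ennreal A0 * (ennreal W * eta_root e (a * e) 1 (mean0 f) x)) + lux lborel p (\<lambda>x. \<integral>\<^sup>+s. w s * h1 s x \<partial>lborel)"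
    using p by (intro lux_add_le sf) auto
  also have "\<dots> \<le> ennreal A0 * (ennreal W * (ennreal D * lux lborel p (mean0 f))) + (\<integral>\<^sup>+s. w s * (ennreal W * (ennreal D * lux lborel p (wmean \<alpha> f s))) \<partial>lborel)"
  proof (intro add_mono)
    have "lux lborel p (\<lambda>x. ennreal A0 * (ennreal W * eta_root e (a * e) 1 (mean0 f) x)) \<le> ennreal A0 * lux lborel p (\<lambda>x. ennreal W * eta_root e (a * e) 1 (mean0 f) x)"
      using p by (intro lux_cmult_finite_le sf) auto
    also have "\<dots> \<le> ennreal A0 * (ennreal W * lux lborel p (eta_root e (a * e) 1 (mean0 f)))"
      using p by (intro lux_cmult_finite_le sf mult_left_mono) auto
    also have "\<dots> \<le> ennreal A0 * (ennreal W * (ennreal D * lux lborel p (mean0 f)))"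
      by (intro mult_left_mono D mm) auto
    finally show "lux lborel p (\<lambda>x. ennreal A0 * (ennreal W * eta_root e (a * e) 1 (mean0 f) x)) \<le> ennreal A0 * (ennreal W * (ennreal D * lux lborel p (mean0 f)))" .
    have "lux lborel p (\<lambda>x. \<integral>\<^sup>+s. w s * h1 s x \<partial>lborel) \<le> (\<integral>\<^sup>+s. w s * lux lborel p (h1 s) \<partial>lborel)"
      using p wfin by (intro lux_nn_integral_le sf) auto
    also have "\<dots> \<le> (\<integral>\<^sup>+s. w s * (ennreal W * (ennreal D * lux lborel p (wmean \<alpha> f s))) \<partial>lborel)"
    proof (intro nn_integral_mono mult_left_mono)
      fix s
      have [measurable]: "eta_root e (a * e) (max s t) (wmean \<alpha> f s) \<in> borel_measurable borel"
        unfolding eta_root_def[abs_def] by measurable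
      have "lux lborel p (h1 s) \<le> ennreal W * lux lborel p (eta_root e (a * e) (max s t) (wmean \<alpha> f s))"
        unfolding h1_def using p by (intro lux_cmult_finite_le sf) auto
      also have "\<dots> \<le> ennreal W * (ennreal D * lux lborel p (wmean \<alpha> f s))"
        using t by (intro mult_left_mono D mm) auto
      finally show "lux lborel p (h1 s) \<le> ennreal W * (ennreal D * lux lborel p (wmean \<alpha> f s))" .
    qed auto
    finally show "lux lborel p (\<lambda>x. \<integral>\<^sup>+s. w s * h1 s x \<partial>lborel) \<le> (\<integral>\<^sup>+s. w s * (ennreal W * (ennreal D * lux lborel p (wmean \<alpha> f s))) \<partial>lborel)" .
  qed
  also have "(\<integral>\<^sup>+s. w s * (ennreal W * (ennreal D * lux lborel p (wmean \<alpha> f s))) \<partial>lborel) = (\<integral>\<^sup>+s. ennreal W * ennreal D * (w s * lux lborel p (wmean \<alpha> f s)) \<partial>lborel)"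
    by (simp only: mult_ac)
  also have "\<dots> = ennreal W * ennreal D * (\<integral>\<^sup>+s. w s * lux lborel p (wmean \<alpha> f s) \<partial>lborel)"
    by (rule nn_integral_cmult) measurable
  also have "(\<integral>\<^sup>+s. w s * lux lborel p (wmean \<alpha> f s) \<partial>lborel) = (\<integral>\<^sup>+s\<in>{0<..1}. ennreal (A s) * lux lborel p (wmean \<alpha> f s) * ennreal (1 / s) \<partial>lborel)"
    by (simp add: w_def mult_ac)
  finally show ?thesis by (simp add: distrib_left mult_ac)
qed

text \<open>\<open>L0\<close> has unit scale, so the gain comes from the moments of
  \<open>u\<close>: \<open>t ^ M0\<close> against a loss of at most
  \<open>t powr (- \<alpha>1)\<close> from the weight.\<close>

lemma coarse_kernel_bound:
  assumes u: "u \<in> schwartz" and mom: "\<And>is :: 'n list. length is < M0 \<Longrightarrow> (LINT y|lborel. of_real (mon is y) * u y) = 0"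
    and \<alpha>: "\<And>x. \<alpha> x \<le> \<alpha>1" and \<delta>: "\<delta> + \<alpha>1 \<le> real M0"
  obtains C where "0 \<le> C" "\<And>t y z. 0 < t \<Longrightarrow> t \<le> 1 \<Longrightarrow>
      ennreal (t powr (- \<alpha> y) * norm (conv2 (dilate t u) L0 (y - z))) \<le> ennreal (C * t powr \<delta>) * eta 1 b (y - z)"
proof -
  have um [measurable]: "u \<in> borel_measurable borel" by (intro rapid_measurable schwartz_rapid u)
  obtain m :: nat where m: "b \<le> real m" using real_arch_simple by blast
  obtain C where C: "0 \<le> C" "\<And>\<tau> x. 0 \<le> \<tau> \<Longrightarrow> \<tau> \<le> 1 \<Longrightarrow>
    (1 + norm x) ^ m * norm (LINT y|lborel. L0 (x - \<tau> *\<^sub>R y) * u y) \<le> C * \<tau> ^ M0"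
  proof (rule conv_moment_bound[OF L0 schwartz_rapid[OF u], of M0 m])
    show "(LINT y|lborel. of_real (mon is y) * u y) = 0" if "length is < M0" for "is" using that by (rule mom)
  qed (rule that)
  show thesis
  proof (rule that[OF C(1)])
    fix t :: real and y z :: "real^'n" assume t: "0 < t" "t \<le> 1"
    have "conv2 (dilate t u) L0 (y - z) = conv2 L0 (dilate t u) (y - z)"
      using t by (intro conv2_commute rapid_measurable schwartz_rapid schwartz_dilate u L0) auto
    also have "\<dots> = (LINT x|lborel. L0 (y - z - t *\<^sub>R x) * u x)" using t by (intro conv2_dilate) auto
    finally have "norm (conv2 (dilate t u) L0 (y - z)) \<le> C * t ^ M0 * (1 + norm (y - z)) powr (- b)"
      using C(2)[of t "y - z"] t m by (intro decay_powr_le[where m=m]) auto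
    then have "t powr (- \<alpha> y) * norm (conv2 (dilate t u) L0 (y - z)) \<le> t powr (- \<alpha>1) * (C * t powr real M0 * (1 + norm (y - z)) powr (- b))"
      using t \<alpha>[of y] by (intro mult_mono powr_mono') (auto simp: powr_realpow)
    also have "\<dots> = C * t powr (- \<alpha>1 + real M0) * (1 + norm (y - z)) powr (- b)"
      by (simp add: powr_add[symmetric])
    also have "\<dots> \<le> C * t powr \<delta> * (1 + norm (y - z)) powr (- b)"
      using t \<delta> C(1) by (intro mult_right_mono mult_left_mono powr_mono') auto
    finally show "ennreal (t powr (- \<alpha> y) * norm (conv2 (dilate t u) L0 (y - z))) \<le> ennreal (C * t powr \<delta>) * eta 1 b (y - z)"
      using C(1) by (simp add: eta_def ennreal_mult[symmetric] ennreal_leI)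
  qed
qed

text \<open>The test function has unit scale, so the gain comes from \<open>L\<close>: enough powers
  of \<open>s\<close> are taken that \<open>\<delta>\<close> of them remain once the weight
  \<open>s powr (- \<alpha> z)\<close> is split off.\<close>

lemma fine_kernel_bound:
  assumes v: "v \<in> schwartz"
    and c: "0 < c" "\<And>x y. \<bar>\<alpha> x - \<alpha> y\<bar> \<le> c / ln (exp 1 + 1 / norm (x - y))"
  obtains C where "0 \<le> C"
    "\<And>s y z. 0 < s \<Longrightarrow> s \<le> 1 \<Longrightarrow> ennreal (norm (conv2 v (dilate s L) (y - z))) \<le>
      ennreal (C * s powr \<delta>) * eta (max s 1) b (y - z) * ennreal (s powr (- \<alpha> z))"
    "\<And>y z. ennreal (norm (conv2 v L0 (y - z))) \<le> ennreal C * eta 1 b (y - z)"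
proof -
  obtain m :: nat where m: "b \<le> real m" using real_arch_simple by blast
  obtain M :: nat where M: "\<And>z. \<delta> \<le> \<alpha> z + real M" using log_holder_lower_bound[OF c, of \<delta>] by blast
  obtain C1 where C1: "0 \<le> C1" "\<And>s x. 0 < s \<Longrightarrow> s \<le> 1 \<Longrightarrow> (1 + norm x) ^ m * norm (conv2 v (dilate s L) x) \<le> C1 * s ^ M"
    using kernel_bound[OF v, of m M] by blast
  obtain C2 where C2: "\<And>x. (1 + norm x) ^ m * norm (conv2 v L0 x) \<le> C2"
    using rapid_conv2[OF v schwartz_rapid[OF L0]] unfolding rapid_def by metis
  have C20: "0 \<le> C2" using C2[of 0] by (simp add: order_trans[OF norm_ge_zero])
  show thesis
  proof (rule that)
    show "0 \<le> C1 + C2" using C1 C20 by simp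
    fix y z :: "real^'n"
    have "norm (conv2 v L0 (y - z)) \<le> C2 * (1 + norm (y - z)) powr (- b)"
      using C2 m by (intro decay_powr_le[where m=m]) auto
    also have "\<dots> \<le> (C1 + C2) * (1 + norm (y - z)) powr (- b)" using C1 by (intro mult_right_mono) auto
    finally show "ennreal (norm (conv2 v L0 (y - z))) \<le> ennreal (C1 + C2) * eta 1 b (y - z)"
      using C1 C20 by (simp add: eta_def ennreal_mult[symmetric] ennreal_leI del: ennreal_plus)
    fix s :: real assume s: "0 < s" "s \<le> 1"
    have "norm (conv2 v (dilate s L) (y - z)) \<le> C1 * s ^ M * (1 + norm (y - z)) powr (- b)"
      using C1 s m by (intro decay_powr_le[where m=m]) auto
    also have "s ^ M = s powr (\<alpha> z + real M) * s powr (- \<alpha> z)"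
      using s by (simp add: powr_add[symmetric] powr_realpow)
    also have "C1 * (s powr (\<alpha> z + real M) * s powr (- \<alpha> z)) * (1 + norm (y - z)) powr (- b) \<le>
        (C1 + C2) * (s powr \<delta> * s powr (- \<alpha> z)) * (1 + norm (y - z)) powr (- b)"
      using s M C1 C20 by (intro mult_right_mono mult_mono powr_mono') auto
    also have "\<dots> = (C1 + C2) * s powr \<delta> * (1 + norm (y - z)) powr (- b) * s powr (- \<alpha> z)" by (simp add: mult_ac)
    finally show "ennreal (norm (conv2 v (dilate s L) (y - z))) \<le>
      ennreal ((C1 + C2) * s powr \<delta>) * eta (max s 1) b (y - z) * ennreal (s powr (- \<alpha> z))"
      using C1 C20 s by (simp add: max_absorb2 eta_def ennreal_mult[symmetric] ennreal_leI del: ennreal_plus)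
  qed
qed

text \<open>At scale \<open>t\<close> the norm of the maximal function is bounded by
  \<open>t powr \<delta>\<close> times the norm of the coarse mean plus the Hardy operator applied
  to the norms of the other means. For the coarse maximal function a linear functional of these
  norms appears instead of the operator.\<close>

theorem maximal_norm_le:
  assumes u0: "u0 \<in> schwartz" and u: "u \<in> schwartz"
    and mom: "\<And>is :: 'n list. length is < M0 \<Longrightarrow> (LINT y|lborel. of_real (mon is y) * u y) = 0"
    and \<alpha>: "log_holder_loc \<alpha>" "\<And>x. \<alpha> x \<le> \<alpha>1" "\<alpha>1 < real M0"
    and e: "1 \<le> e" "\<And>x. e \<le> p x" "real CARD('n) < a * e" and lp: "log_holder (\<lambda>x. 1 / p x)"
    and q: "\<And>t. 1 \<le> q t" "q \<in> borel_measurable lebesgue" "log_holder_origin q"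
  obtains C where "0 < C" "\<And>f. f \<in> tempered \<Longrightarrow> maximal_norm u0 u a \<alpha> p q f \<le> ennreal C * local_means_norm h0 h \<alpha> p q f"
proof -
  have p: "1 \<le> p x" for x using e(1) e(2)[of x] by linarith
  have p0: "0 \<le> p x" for x using p[of x] by simp
  have q0: "0 \<le> q t" for t using q(1)[of t] by simp
  have pm [measurable]: "p \<in> borel_measurable borel" by (rule log_holder_exponent_measurable(2)[OF p lp])
  have \<alpha>m [measurable]: "\<alpha> \<in> borel_measurable borel"
    by (intro borel_measurable_continuous_onI log_holder_loc_continuous \<alpha>)
  have a: "0 < a"
  proof -
    have "0 < a * e" using e(3) by (simp add: le_less_trans[OF of_nat_0_le_iff])
    then show ?thesis using e(1) by (simp add: zero_less_mult_iff)
  qed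
  obtain c where c: "0 < c" "\<And>x y. \<bar>\<alpha> x - \<alpha> y\<bar> \<le> c / ln (exp 1 + 1 / norm (x - y))"
    using \<alpha>(1) by (auto simp: log_holder_loc_def)
  \<comment> \<open>The smoothness bound \<open>\<alpha>1 < real M0\<close> leaves a positive
    margin; it is capped at 1 for the sake of \<open>hardy_lux\<close>.\<close>
  define \<delta> where "\<delta> = min 1 (real M0 - \<alpha>1)"
  have \<delta>: "0 < \<delta>" "\<delta> \<le> 1" "\<delta> + \<alpha>1 \<le> real M0" using \<alpha>(3) by (auto simp: \<delta>_def)
  obtain W0 where W0: "\<And>\<rho>. 0 < \<rho> \<Longrightarrow> (\<integral>\<^sup>+x. eta \<rho> (a * e) (x::real^'n) \<partial>lborel) \<le> ennreal W0"
    using nn_integral_eta[of "a * e", where 'a="real^'n"] e(3) by auto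
  define W where "W = max 1 W0"
  have W: "1 \<le> W" "\<And>\<rho>. 0 < \<rho> \<Longrightarrow> (\<integral>\<^sup>+x. eta \<rho> (a * e) (x::real^'n) \<partial>lborel) \<le> ennreal W"
  proof -
    show "1 \<le> W" by (simp add: W_def)
    show "(\<integral>\<^sup>+x. eta \<rho> (a * e) (x::real^'n) \<partial>lborel) \<le> ennreal W" if "0 < \<rho>" for \<rho>
      using W0[OF that] by (rule order_trans) (simp add: W_def ennreal_leI)
  qed
  obtain D where D: "0 < D" "\<And>\<rho> g. 0 < \<rho> \<Longrightarrow> g \<in> borel_measurable borel \<Longrightarrow>
      lux lborel p (eta_root e (a * e) \<rho> g) \<le> ennreal D * lux lborel p (g :: real^'n \<Rightarrow> ennreal)"
    using eta_lux_root[OF e(1,2) lp, of "a * e"] e(3) unfolding eta_root_def[abs_def] by auto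
  obtain Dh where Dh: "0 < Dh" "\<And>g. g \<in> borel_measurable borel \<Longrightarrow> lux dtt q (hardy \<delta> g) \<le> ennreal Dh * lux dtt q g"
    using hardy_lux[OF q \<delta>(1,2)] by blast
  obtain C1 where C1: "0 \<le> C1" "\<And>s t y z. 0 < s \<Longrightarrow> s \<le> 1 \<Longrightarrow> 0 < t \<Longrightarrow> t \<le> 1 \<Longrightarrow>
      ennreal (t powr (- \<alpha> y) * norm (conv2 (dilate t u) (dilate s L) (y - z))) \<le>
      ennreal C1 * ennreal (min (s / t) (t / s) powr \<delta>) * eta (max s t) (a * e) (y - z) * ennreal (s powr (- \<alpha> z))"
  proof (rule rescaled_kernel_bound[OF u _ c \<alpha>(2) \<delta>(1,3)])
    show "(LINT y|lborel. of_real (mon is y) * u y) = 0" if "length is < M0" for "is" using that by (rule mom)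
  qed (rule that)
  obtain C2 where C2: "0 \<le> C2" "\<And>t y z. 0 < t \<Longrightarrow> t \<le> 1 \<Longrightarrow>
      ennreal (t powr (- \<alpha> y) * norm (conv2 (dilate t u) L0 (y - z))) \<le> ennreal (C2 * t powr \<delta>) * eta 1 (a * e) (y - z)"
  proof (rule coarse_kernel_bound[OF u _ \<alpha>(2) \<delta>(3)])
    show "(LINT y|lborel. of_real (mon is y) * u y) = 0" if "length is < M0" for "is" using that by (rule mom)
  qed (rule that)
  obtain C3 where C3: "0 \<le> C3"
    "\<And>s y z. 0 < s \<Longrightarrow> s \<le> 1 \<Longrightarrow> ennreal (norm (conv2 u0 (dilate s L) (y - z))) \<le>
      ennreal (C3 * s powr \<delta>) * eta (max s 1) (a * e) (y - z) * ennreal (s powr (- \<alpha> z))"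
    "\<And>y z. ennreal (norm (conv2 u0 L0 (y - z))) \<le> ennreal C3 * eta 1 (a * e) (y - z)"
    using fine_kernel_bound[OF u0 c, of \<delta> "a * e"] by blast
  \<comment> \<open>One constant for all three kernel bounds; the summand 1 keeps it
    positive.\<close>
  define Q where "Q = W * D * (C1 + C2 + C3 + 1)"
  have Q: "0 < Q" using W D C1 C2 C3 by (simp add: Q_def add_nonneg_pos)
  have QC: "ennreal W * ennreal D * (ennreal A * X) \<le> ennreal Q * X" if "A \<le> C1 + C2 + C3 + 1" "0 \<le> A" for A X
  proof -
    have "ennreal W * ennreal D * ennreal A \<le> ennreal Q"
      using that W D by (auto simp: Q_def ennreal_mult[symmetric] intro!: ennreal_leI mult_left_mono)
    then show ?thesis unfolding mult.assoc[symmetric] by (rule mult_right_mono) simp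
  qed
  define m1 where "m1 = max 1 (1 / \<delta>)"
  define C where "C = Q * (1 + m1) + Q * (1 / \<delta> + 1 + Dh)"
  have m1: "1 \<le> m1" by (simp add: m1_def)
  have "0 < C" using Q m1 \<delta> Dh by (auto simp: C_def intro!: add_pos_pos mult_pos_pos)
  moreover have "maximal_norm u0 u a \<alpha> p q f \<le> ennreal C * local_means_norm h0 h \<alpha> p q f" if f: "f \<in> tempered" for f
  proof -
    define g0 where "g0 = lux lborel p (mean0 f)"
    define g where "g s = lux lborel p (wmean \<alpha> f s)" for s
    define G where "G = lux_norm_dt q {0<..1} g"
    note mm = means_measurable[OF \<alpha>m f]
    have gm [measurable]: "g \<in> borel_measurable borel"
      unfolding g_def using p0 mm(1) by (intro borel_measurable_lux lborel.sigma_finite_measure_axioms) (auto cong: measurable_cong_sets)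
    have loc: "local_means_norm h0 h \<alpha> p q f = g0 + G"
    proof -
      have "lux_norm_dt q {0<..1} (\<lambda>t. lux_norm p (\<lambda>x. ennreal (t powr (- \<alpha> x) * norm (conv (dilate t h) f x)))) = G"
        unfolding G_def g_def lux_norm_eq using q0 by (intro antisym lux_norm_dt_mono) (auto simp: wmean_def[abs_def])
      then show ?thesis by (simp add: local_means_norm_def lux_norm_eq g0_def mean0_def[abs_def])
    qed
    have fine: "lux lborel p (maximal0 u0 a f) \<le> ennreal Q * g0 + ennreal Q * (ennreal (1 / \<delta> + 1) * G)"
    proof -
      have "lux lborel p (\<lambda>x. SUP y. ennreal (1 * norm (conv u0 f y) / (1 + norm (x - y) / 1) powr a)) \<le>
        ennreal W * ennreal D * (ennreal C3 * lux lborel p (mean0 f) +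
          (\<integral>\<^sup>+s\<in>{0<..1}. ennreal (C3 * s powr \<delta>) * lux lborel p (wmean \<alpha> f s) * ennreal (1 / s) \<partial>lborel))"
      proof (rule lux_weighted_sup_le[OF u0 f \<alpha>m _ _ e(1) _ W p pm D(2)])
        have "(\<integral>\<^sup>+s\<in>{0<..1}. ennreal (C3 * s powr \<delta>) * ennreal (1 / s) \<partial>lborel) = ennreal C3 * (\<integral>\<^sup>+s\<in>{0<..1}. ennreal (s powr \<delta>) * ennreal (1 / s) \<partial>lborel)"
          using C3(1) by (subst nn_integral_cmult[symmetric]) (auto simp: ennreal_mult mult.assoc)
        also have "\<dots> < \<infinity>"
          using nn_integral_powr_unit[OF \<delta>(1)] by (simp add: ennreal_mult_less_top le_less_trans[OF _ ennreal_less_top])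
        finally show "(\<integral>\<^sup>+s\<in>{0<..1}. ennreal (C3 * s powr \<delta>) * ennreal (1 / s) \<partial>lborel) < \<infinity>" .
      qed (use C3 a in auto)
      also have "(\<integral>\<^sup>+s\<in>{0<..1}. ennreal (C3 * s powr \<delta>) * lux lborel p (wmean \<alpha> f s) * ennreal (1 / s) \<partial>lborel) =
          ennreal C3 * (\<integral>\<^sup>+s\<in>{0<..1}. ennreal (s powr \<delta>) * g s * ennreal (1 / s) \<partial>lborel)"
        using C3(1) by (subst nn_integral_cmult[symmetric]) (auto simp: ennreal_mult mult.assoc g_def[symmetric])
      also have "ennreal W * ennreal D * (ennreal C3 * lux lborel p (mean0 f) + \<dots>) \<le>
          ennreal Q * (g0 + (\<integral>\<^sup>+s\<in>{0<..1}. ennreal (s powr \<delta>) * g s * ennreal (1 / s) \<partial>lborel))"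
        unfolding distrib_left[symmetric] g0_def[symmetric] using C1 C2 C3 by (intro QC) auto
      also have "\<dots> \<le> ennreal Q * (g0 + ennreal (1 / \<delta> + 1) * G)"
        unfolding G_def by (intro mult_left_mono add_left_mono powr_functional_le q \<delta> gm) auto
      finally show ?thesis by (simp add: maximal0_def[abs_def] distrib_left)
    qed
    have scale: "lux lborel p (maximal u a t \<alpha> f) \<le> ennreal Q * (ennreal (t powr \<delta>) * g0 + hardy \<delta> g t)"
      if t: "0 < t" "t \<le> 1" for t
    proof -
      have "lux lborel p (\<lambda>x. SUP y. ennreal (t powr (- \<alpha> y) * norm (conv (dilate t u) f y) / (1 + norm (x - y) / t) powr a)) \<le>
        ennreal W * ennreal D * (ennreal (C2 * t powr \<delta>) * lux lborel p (mean0 f) +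
          (\<integral>\<^sup>+s\<in>{0<..1}. ennreal (C1 * min (s / t) (t / s) powr \<delta>) * lux lborel p (wmean \<alpha> f s) * ennreal (1 / s) \<partial>lborel))"
      proof (rule lux_weighted_sup_le[OF _ f \<alpha>m t e(1) _ W p pm D(2)])
        show "dilate t u \<in> schwartz" using t by (intro schwartz_dilate u) auto
        have "(\<integral>\<^sup>+s\<in>{0<..1}. ennreal (C1 * min (s / t) (t / s) powr \<delta>) * ennreal (1 / s) \<partial>lborel) =
            ennreal C1 * (\<integral>\<^sup>+s\<in>{0<..1}. ennreal (min (s / t) (t / s) powr \<delta>) * ennreal (1 / s) \<partial>lborel)"
          using C1(1) by (subst nn_integral_cmult[symmetric]) (auto simp: ennreal_mult mult.assoc)
        also have "\<dots> < \<infinity>"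
          using nn_integral_min_kernel[OF t(1) \<delta>(1)] by (simp add: ennreal_mult_less_top le_less_trans[OF _ ennreal_less_top])
        finally show "(\<integral>\<^sup>+s\<in>{0<..1}. ennreal (C1 * min (s / t) (t / s) powr \<delta>) * ennreal (1 / s) \<partial>lborel) < \<infinity>" .
        fix s y z assume "0 < s" "s \<le> (1::real)"
        then show "ennreal (t powr (- \<alpha> y) * norm (conv2 (dilate t u) (dilate s L) (y - z))) \<le>
            ennreal (C1 * min (s / t) (t / s) powr \<delta>) * eta (max s t) (a * e) (y - z) * ennreal (s powr (- \<alpha> z))"
          using C1(2)[of s t y z] C1(1) t by (simp add: ennreal_mult)
      qed (use C2 t a in auto)
      also have "(\<integral>\<^sup>+s\<in>{0<..1}. ennreal (C1 * min (s / t) (t / s) powr \<delta>) * lux lborel p (wmean \<alpha> f s) * ennreal (1 / s) \<partial>lborel) =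
          ennreal C1 * hardy \<delta> g t"
        unfolding hardy_def using C1(1) by (subst nn_integral_cmult[symmetric]) (auto simp: ennreal_mult mult.assoc g_def[symmetric])
      also have "ennreal (C2 * t powr \<delta>) * lux lborel p (mean0 f) = ennreal C2 * (ennreal (t powr \<delta>) * g0)"
        using C2(1) by (simp add: g0_def ennreal_mult mult.assoc)
      also have "ennreal W * ennreal D * (ennreal C2 * (ennreal (t powr \<delta>) * g0) + ennreal C1 * hardy \<delta> g t) \<le>
          ennreal Q * (ennreal (t powr \<delta>) * g0) + ennreal Q * hardy \<delta> g t"
        unfolding distrib_left using C1 C2 C3 by (intro add_mono QC) auto
      finally show ?thesis by (simp add: maximal_def[abs_def] distrib_left)
    qed
    show ?thesis
    \<comment> \<open>The scalar \<open>g0\<close> is pulled out of a norm by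
      \<open>lux_cmult_finite_le\<close>, which requires it to be finite; if it is infinite, so is
      the right side.\<close>
    proof (cases "g0 = top")
      case True
      then show ?thesis using \<open>0 < C\<close> by (simp add: loc ennreal_mult_top)
    next
      case False
      note [measurable] = q(2)
      have lm [measurable]: "g \<in> borel_measurable lebesgue" "hardy \<delta> g \<in> borel_measurable lebesgue"
          "(\<lambda>t. ennreal (t powr \<delta>)) \<in> borel_measurable lebesgue"
        by (intro measurable_completion; measurable)+
      have meas_dtt: "F \<in> borel_measurable dtt" if "F \<in> borel_measurable lebesgue" for F :: "real \<Rightarrow> ennreal"
        using that by (simp cong: measurable_cong_sets)
      have qd: "q \<in> borel_measurable dtt" using q(2) by (simp cong: measurable_cong_sets)
      \<comment> \<open>The passage to a measurable majorant precedes the change to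
        \<open>lux dtt q\<close>, whose rules require measurability.\<close>
      have "lux_norm_dt q {0<..1} (\<lambda>t. lux_norm p (maximal u a t \<alpha> f)) \<le>
          lux_norm_dt q {0<..1} (\<lambda>t. ennreal Q * (ennreal (t powr \<delta>) * g0 + hardy \<delta> g t))"
        unfolding lux_norm_eq using scale q0 by (intro lux_norm_dt_mono) auto
      also have "\<dots> = lux dtt q (\<lambda>t. ennreal Q * (g0 * ennreal (t powr \<delta>) + hardy \<delta> g t))"
        unfolding mult.commute[of g0] by (intro lux_norm_dt_eq q(2)) measurable
      also have "\<dots> \<le> ennreal Q * lux dtt q (\<lambda>t. g0 * ennreal (t powr \<delta>) + hardy \<delta> g t)"
        by (intro lux_cmult_finite_le sigma_finite_dtt q(1) qd meas_dtt) auto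
      also have "\<dots> \<le> ennreal Q * (lux dtt q (\<lambda>t. g0 * ennreal (t powr \<delta>)) + lux dtt q (hardy \<delta> g))"
        by (intro mult_left_mono lux_add_le sigma_finite_dtt q(1) qd meas_dtt) auto
      also have "\<dots> \<le> ennreal Q * (g0 * ennreal m1 + ennreal Dh * G)"
      proof (intro mult_left_mono add_mono)
        have "lux dtt q (\<lambda>t. g0 * ennreal (t powr \<delta>)) \<le> g0 * lux dtt q (\<lambda>t. ennreal (t powr \<delta>))"
          using False by (intro lux_cmult_finite_le sigma_finite_dtt q(1) qd meas_dtt lm(3)) (simp add: less_top)
        also have "\<dots> \<le> g0 * ennreal m1"
          unfolding m1_def by (intro mult_left_mono lux_powr_le q \<delta>) auto
        finally show "lux dtt q (\<lambda>t. g0 * ennreal (t powr \<delta>)) \<le> g0 * ennreal m1" .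
        show "lux dtt q (hardy \<delta> g) \<le> ennreal Dh * G"
          using Dh(2)[OF gm] by (simp add: G_def lux_norm_dt_eq)
      qed auto
      finally have "maximal_norm u0 u a \<alpha> p q f \<le>
          (ennreal Q * g0 + ennreal Q * (ennreal (1 / \<delta> + 1) * G)) + ennreal Q * (g0 * ennreal m1 + ennreal Dh * G)"
        unfolding maximal_norm_def lux_norm_eq using fine by (intro add_mono) auto
      also have "\<dots> = ennreal (Q * (1 + m1)) * g0 + ennreal (Q * (1 / \<delta> + 1 + Dh)) * G"
      proof -
        have "ennreal (Q * (1 + m1)) = ennreal Q + ennreal Q * ennreal m1"
          using Q m1 by (simp add: ennreal_mult[symmetric] ennreal_plus[symmetric] distrib_left del: ennreal_plus)
        moreover have "ennreal (Q * (1 / \<delta> + 1 + Dh)) = ennreal Q * ennreal (1 / \<delta> + 1) + ennreal Q * ennreal Dh"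
          using Q \<delta> Dh by (simp add: ennreal_mult[symmetric] ennreal_plus[symmetric] distrib_left del: ennreal_plus)
        ultimately show ?thesis by (simp only: distrib_left distrib_right ac_simps)
      qed
      also have "\<dots> \<le> ennreal C * g0 + ennreal C * G"
        using Q m1 \<delta> Dh by (intro add_mono mult_right_mono ennreal_leI) (auto simp: C_def)
      finally show ?thesis by (simp add: loc distrib_left)
    qed
  qed
  ultimately show thesis by (rule that)
qed

end

section \<open>The two reproducing formulas of the theorem\<close>

text \<open>For continuous \<open>g\<close> the exceptional set is open and null, hence empty. This
  makes the essential bounds on \<open>p\<close> and \<open>\<alpha>\<close> pointwise.\<close>

lemma AE_le_everywhere:
  fixes g :: "'a::euclidean_space \<Rightarrow> real"
  assumes g: "continuous_on UNIV g" and ae: "AE x in lebesgue. ereal (g x) \<le> c"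
  shows "ereal (g x) \<le> c"
proof (rule ccontr)
  let ?S = "{x. c < ereal (g x)}"
  assume "\<not> ereal (g x) \<le> c"
  then have "?S \<noteq> {}" by (auto simp: not_le)
  moreover have "open ?S" using g by (intro open_Collect_less continuous_intros continuous_on_ereal)
  ultimately have "\<not> negligible ?S" by (rule open_not_negligible[rotated])
  moreover have "?S \<in> null_sets lebesgue"
    using ae \<open>open ?S\<close> by (subst (asm) AE_iff_null) (auto simp: not_le)
  ultimately show False by (simp add: negligible_iff_null_sets)
qed

lemma le_ess_sup:
  assumes "continuous_on UNIV g"
  shows "ereal (g x) \<le> ess_sup g"
  unfolding ess_sup_def by (intro AE_le_everywhere assms esssup_AE)

lemma ess_inf_le:
  assumes "continuous_on UNIV g"
  shows "ess_inf g \<le> ereal (g x)"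
proof -
  have "ereal (- g x) \<le> esssup lebesgue (\<lambda>x. - ereal (g x))"
    using esssup_AE[of "\<lambda>x. - ereal (g x)" lebesgue] by (intro AE_le_everywhere continuous_on_minus assms) simp
  then show ?thesis unfolding ess_inf_def by (simp add: ereal_uminus_le_reorder)
qed

lemma le_ess_inf:
  assumes "g \<in> borel_measurable lebesgue" "\<And>x. c \<le> g x"
  shows "ereal c \<le> ess_inf g"
proof -
  have "esssup lebesgue (\<lambda>x. - ereal (g x)) \<le> - ereal c"
    using assms by (intro esssup_I) auto
  then show ?thesis unfolding ess_inf_def by (metis ereal_minus_le_minus ereal_uminus_uminus)
qed

text \<open>The quotient is smooth on \<open>V\<close>, where the denominator does not vanish, and
  is 0 off the support of \<open>u\<close>; these two open sets cover the space, and
  \<open>V\<close> is bounded.\<close>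

lemma quotient_schwartz:
  fixes u v :: "real^'n::finite \<Rightarrow> complex"
  assumes u: "u \<in> schwartz" and v: "v \<in> schwartz" and V: "open V" "V \<subseteq> ball 0 R" "closure {x. u x \<noteq> 0} \<subseteq> V"
    and nz: "\<And>x. x \<in> V \<Longrightarrow> v x \<noteq> 0"
  shows "(\<lambda>x. u x / v x) \<in> schwartz" and "u x / v x * v x = u x"
proof -
  have zero: "u x = 0" if "x \<notin> V" for x using V closure_subset[of "{x. u x \<noteq> 0}"] that by blast
  show "(\<lambda>x. u x / v x) \<in> schwartz"
  proof (rule compact_support_schwartz)
    have "smooth_on V (\<lambda>x. u x / v x)"
      using V nz u v by (intro smooth_on_divide) (auto intro: smooth_on_subset[OF schwartz_smooth])
    moreover have "smooth_on (- closure {x. u x \<noteq> 0}) (\<lambda>x. u x / v x)"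
    proof (rule smooth_on_cong)
      show "smooth_on (- closure {x. u x \<noteq> 0}) (\<lambda>x. 0)" by (intro smooth_on_const) auto
    qed (use closure_subset[of "{x. u x \<noteq> 0}"] in auto)
    ultimately have "smooth_on (V \<union> - closure {x. u x \<noteq> 0}) (\<lambda>x. u x / v x)" by (rule smooth_on_Un)
    moreover have "V \<union> - closure {x. u x \<noteq> 0} = UNIV" using V by auto
    ultimately show "smooth_on UNIV (\<lambda>x. u x / v x)" by simp
    show "u x / v x = 0" if "R < norm x" for x using zero[of x] subsetD[OF V(2), of x] that by auto
  qed
  show "u x / v x * v x = u x" using zero nz by (cases "x \<in> V") auto
qed

locale resolution =
  fixes \<Phi> \<phi> :: "real^'n::finite \<Rightarrow> complex"
  assumes res: "resolution_of_unity \<Phi> \<phi>"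
begin

lemma schw: "\<Phi> \<in> schwartz" "\<phi> \<in> schwartz"
  using res by (auto simp: resolution_of_unity_def)

lemma supp: "closure {\<xi>. fourier \<Phi> \<xi> \<noteq> 0} \<subseteq> {\<xi>. norm \<xi> < 2}"
    "closure {\<xi>. fourier \<phi> \<xi> \<noteq> 0} \<subseteq> {\<xi>. 1/2 < norm \<xi> \<and> norm \<xi> < 2}"
  using res by (auto simp: resolution_of_unity_def)

lemma supp_fourier: "2 \<le> norm \<xi> \<Longrightarrow> fourier \<Phi> \<xi> = 0" "2 \<le> norm \<xi> \<Longrightarrow> fourier \<phi> \<xi> = 0" "norm \<xi> \<le> 1/2 \<Longrightarrow> fourier \<phi> \<xi> = 0"
  using supp closure_subset[of "{\<xi>. fourier \<Phi> \<xi> \<noteq> 0}"] closure_subset[of "{\<xi>. fourier \<phi> \<xi> \<noteq> 0}"] by fastforce+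

lemma partition: "fourier \<Phi> \<xi> + (LINT s|lborel. (indicator {0<..1} s / s) *\<^sub>R fourier \<phi> (s *\<^sub>R \<xi>)) = 1"
proof -
  have "(LINT s|lborel. (indicator {0<..1} s / s) *\<^sub>R fourier \<phi> (s *\<^sub>R \<xi>)) = (LINT t:{0<..1}|lborel. (1 / t) *\<^sub>R fourier \<phi> (t *\<^sub>R \<xi>))"
    unfolding set_lebesgue_integral_def by simp
  then show ?thesis using res by (simp add: resolution_of_unity_def)
qed

text \<open>For \<open>s \<le> 1\<close> the point \<open>s *\<^sub>R \<xi>\<close> stays outside
  the annulus that carries \<open>fourier \<phi>\<close>, so the integral in the partition
  contributes nothing.\<close>

lemma fourier_eq_1: "norm \<xi> \<le> 1/2 \<Longrightarrow> fourier \<Phi> \<xi> = 1"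
proof -
  assume \<xi>: "norm \<xi> \<le> 1/2"
  have "(indicator {0<..1} s / s) *\<^sub>R fourier \<phi> (s *\<^sub>R \<xi>) = 0" (is "?F s = 0") for s :: real
  proof (cases "0 < s \<and> s \<le> 1")
    case True
    then have "norm (s *\<^sub>R \<xi>) \<le> 1 * (1/2)" unfolding norm_scaleR using \<xi> by (intro mult_mono) auto
    then show ?thesis by (simp add: supp_fourier)
  qed auto
  then have "(LINT s|lborel. ?F s) = 0" by (simp only: Bochner_Integration.integral_zero)
  then show "fourier \<Phi> \<xi> = 1" using partition[of \<xi>] by simp
qed

lemma moments: "(LINT y|lborel. of_real (mon is y) * \<phi> y) = 0"
  by (rule vanishing_moments[OF schw(2), of "1/2"]) (auto simp: supp_fourier)

text \<open>\<open>fourier \<Phi>\<close> is 1 up to radius 1/2 and 0 from radius 2 on. Hence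
  \<open>fourier \<Phi> ((1/4) *\<^sub>R \<xi>)\<close> is 1 up to radius 2, and subtracting
  \<open>fourier \<Phi> (4 *\<^sub>R \<xi>)\<close> keeps the value 1 on the annulus while both
  terms cancel up to radius 1/8. Multiplication by these functions leaves the resolution
  unchanged.\<close>

lemma calderon_self:
  obtains L0 L where "calderon \<Phi> \<phi> L0 L (1/8)"
proof -
  have s4: "(\<lambda>\<xi>. fourier \<Phi> ((1/4) *\<^sub>R \<xi>)) \<in> schwartz" "(\<lambda>\<xi>. fourier \<Phi> (4 *\<^sub>R \<xi>)) \<in> schwartz"
    using schwartz_affine[OF schwartz_fourier[OF schw(1)], of "1/4" 0] schwartz_affine[OF schwartz_fourier[OF schw(1)], of 4 0] by auto
  have d4: "(\<lambda>\<xi>. fourier \<Phi> ((1/4) *\<^sub>R \<xi>) - fourier \<Phi> (4 *\<^sub>R \<xi>)) \<in> schwartz"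
    using schwartz_lincomb[OF s4, of 1 "-1"] by simp
  obtain L0 where L0: "L0 \<in> schwartz" "fourier L0 = (\<lambda>\<xi>. fourier \<Phi> ((1/4) *\<^sub>R \<xi>))" by (rule fourier_surj[OF s4(1)])
  obtain L where L: "L \<in> schwartz" "fourier L = (\<lambda>\<xi>. fourier \<Phi> ((1/4) *\<^sub>R \<xi>) - fourier \<Phi> (4 *\<^sub>R \<xi>))" by (rule fourier_surj[OF d4])
  have eq0: "fourier L0 \<xi> * fourier \<Phi> \<xi> = fourier \<Phi> \<xi>" for \<xi>
    by (cases "norm \<xi> < 2") (auto simp: L0 fourier_eq_1 supp_fourier)
  have eq: "fourier L \<xi> * fourier \<phi> \<xi> = fourier \<phi> \<xi>" for \<xi>
    by (cases "1/2 < norm \<xi> \<and> norm \<xi> < 2") (auto simp: L fourier_eq_1 supp_fourier)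
  have "calderon \<Phi> \<phi> L0 L (1/8)"
  proof
    show "fourier L \<xi> = 0" if "norm \<xi> < 1/8" for \<xi> using that by (simp add: L fourier_eq_1)
    show "fourier L0 \<xi> * fourier \<Phi> \<xi> + (LINT s|lborel. (indicator {0<..1} s / s) *\<^sub>R (fourier L (s *\<^sub>R \<xi>) * fourier \<phi> (s *\<^sub>R \<xi>))) = 1" for \<xi>
      unfolding eq0 eq by (rule partition)
  qed (use schw L0(1) L(1) in simp_all)
  then show thesis by (rule that)
qed

text \<open>Scaling by \<open>\<epsilon>\<close> carries the supports of the resolution into the
  regions where the transforms of \<open>k0\<close> and \<open>k\<close> do not vanish, so division
  is possible there; the products add up to the resolution of unity at
  \<open>(1 / \<epsilon>) *\<^sub>R \<xi>\<close>.\<close>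

lemma calderon_tauberian:
  fixes k0 k :: "real^'n \<Rightarrow> complex"
  assumes k: "k0 \<in> schwartz" "k \<in> schwartz" and \<epsilon>: "0 < \<epsilon>"
    and k0: "\<And>\<xi>. norm \<xi> < 2 * \<epsilon> \<Longrightarrow> fourier k0 \<xi> \<noteq> 0"
    and k1: "\<And>\<xi>. \<epsilon> / 2 < norm \<xi> \<Longrightarrow> norm \<xi> < 2 * \<epsilon> \<Longrightarrow> fourier k \<xi> \<noteq> 0"
  obtains L0 L where "calderon k0 k L0 L (\<epsilon> / 2)"
proof -
  have scaled: "(\<lambda>\<xi>. w ((1 / \<epsilon>) *\<^sub>R \<xi>)) \<in> schwartz" if "w \<in> schwartz" for w :: "real^'n \<Rightarrow> complex"
    using schwartz_affine[OF that, of "1 / \<epsilon>" 0] \<epsilon> by auto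
  have clos: "closure {\<xi>. w ((1 / \<epsilon>) *\<^sub>R \<xi>) \<noteq> 0} \<subseteq> {\<xi>. (1 / \<epsilon>) *\<^sub>R \<xi> \<in> closure {\<xi>. w \<xi> \<noteq> 0}}" for w :: "real^'n \<Rightarrow> complex"
  proof (rule closure_minimal)
    show "{\<xi>. w ((1 / \<epsilon>) *\<^sub>R \<xi>) \<noteq> 0} \<subseteq> {\<xi>. (1 / \<epsilon>) *\<^sub>R \<xi> \<in> closure {\<xi>. w \<xi> \<noteq> 0}}"
      using closure_subset[of "{\<xi>. w \<xi> \<noteq> 0}"] by auto
    show "closed {\<xi>::real^'n. (1 / \<epsilon>) *\<^sub>R \<xi> \<in> closure {\<xi>. w \<xi> \<noteq> 0}}"
      using continuous_closed_vimage[OF closed_closure, of "\<lambda>\<xi>. (1 / \<epsilon>) *\<^sub>R \<xi>" "{\<xi>. w \<xi> \<noteq> 0}"] by (simp add: vimage_def)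
  qed
  let ?U = "ball (0::real^'n) (2 * \<epsilon>)" and ?V = "{\<xi>::real^'n. \<epsilon> / 2 < norm \<xi> \<and> norm \<xi> < 2 * \<epsilon>}"
  have V0: "closure {\<xi>. fourier \<Phi> ((1 / \<epsilon>) *\<^sub>R \<xi>) \<noteq> 0} \<subseteq> ?U"
  proof
    fix \<xi> assume "\<xi> \<in> closure {\<xi>. fourier \<Phi> ((1 / \<epsilon>) *\<^sub>R \<xi>) \<noteq> 0}"
    then have "norm ((1 / \<epsilon>) *\<^sub>R \<xi>) < 2" using clos[of "fourier \<Phi>"] supp(1) by blast
    then show "\<xi> \<in> ?U" using \<epsilon> by (simp add: pos_divide_less_eq)
  qed
  have V: "closure {\<xi>. fourier \<phi> ((1 / \<epsilon>) *\<^sub>R \<xi>) \<noteq> 0} \<subseteq> ?V"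
  proof
    fix \<xi> assume "\<xi> \<in> closure {\<xi>. fourier \<phi> ((1 / \<epsilon>) *\<^sub>R \<xi>) \<noteq> 0}"
    then have "1/2 < norm ((1 / \<epsilon>) *\<^sub>R \<xi>) \<and> norm ((1 / \<epsilon>) *\<^sub>R \<xi>) < 2" using clos[of "fourier \<phi>"] supp(2) by blast
    then have "1/2 < norm \<xi> / \<epsilon>" "norm \<xi> / \<epsilon> < 2" using \<epsilon> by simp_all
    then show "\<xi> \<in> ?V" using \<epsilon> by (simp_all add: pos_divide_less_eq pos_less_divide_eq)
  qed
  have "open ?V" by (intro open_Collect_conj open_Collect_less continuous_intros)
  have q0: "(\<lambda>\<xi>. fourier \<Phi> ((1 / \<epsilon>) *\<^sub>R \<xi>) / fourier k0 \<xi>) \<in> schwartz"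
      "fourier \<Phi> ((1 / \<epsilon>) *\<^sub>R \<xi>) / fourier k0 \<xi> * fourier k0 \<xi> = fourier \<Phi> ((1 / \<epsilon>) *\<^sub>R \<xi>)" for \<xi>
    using quotient_schwartz[OF scaled[OF schwartz_fourier[OF schw(1)]] schwartz_fourier[OF k(1)], of ?U "2 * \<epsilon>"] V0 k0
    by (simp_all add: subset_iff)
  have q1: "(\<lambda>\<xi>. fourier \<phi> ((1 / \<epsilon>) *\<^sub>R \<xi>) / fourier k \<xi>) \<in> schwartz"
      "fourier \<phi> ((1 / \<epsilon>) *\<^sub>R \<xi>) / fourier k \<xi> * fourier k \<xi> = fourier \<phi> ((1 / \<epsilon>) *\<^sub>R \<xi>)" for \<xi>
    using quotient_schwartz[OF scaled[OF schwartz_fourier[OF schw(2)]] schwartz_fourier[OF k(2)], of ?V "2 * \<epsilon>"] V \<open>open ?V\<close> k1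
    by (simp_all add: subset_iff)
  obtain L0 where L0: "L0 \<in> schwartz" "fourier L0 = (\<lambda>\<xi>. fourier \<Phi> ((1 / \<epsilon>) *\<^sub>R \<xi>) / fourier k0 \<xi>)"
    by (rule fourier_surj[OF q0(1)])
  obtain L where L: "L \<in> schwartz" "fourier L = (\<lambda>\<xi>. fourier \<phi> ((1 / \<epsilon>) *\<^sub>R \<xi>) / fourier k \<xi>)"
    by (rule fourier_surj[OF q1(1)])
  have eq0: "fourier L0 \<xi> * fourier k0 \<xi> = fourier \<Phi> ((1 / \<epsilon>) *\<^sub>R \<xi>)" for \<xi>
    unfolding L0(2) by (rule q0(2))
  have eq: "fourier L \<xi> * fourier k \<xi> = fourier \<phi> ((1 / \<epsilon>) *\<^sub>R \<xi>)" for \<xi>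
    unfolding L(2) by (rule q1(2))
  have "calderon k0 k L0 L (\<epsilon> / 2)"
  proof
    show "fourier L \<xi> = 0" if "norm \<xi> < \<epsilon> / 2" for \<xi>
      using that \<epsilon> by (simp add: L supp_fourier field_simps)
    show "fourier L0 \<xi> * fourier k0 \<xi> + (LINT s|lborel. (indicator {0<..1} s / s) *\<^sub>R (fourier L (s *\<^sub>R \<xi>) * fourier k (s *\<^sub>R \<xi>))) = 1" for \<xi>
      unfolding eq0 eq using partition[of "(1 / \<epsilon>) *\<^sub>R \<xi>"] by (simp add: mult.commute)
  qed (use k \<epsilon> L0(1) L(1) in simp_all)
  then show thesis by (rule that)
qed

end

lemma local_means_norm_le_maximal_norm:
  assumes p: "\<And>x. 0 \<le> p x" and q: "\<And>t. 0 \<le> q t"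
  shows "local_means_norm k0 k \<alpha> p q f \<le> maximal_norm k0 k a \<alpha> p q f"
  unfolding local_means_norm_def maximal_norm_def lux_norm_eq
proof (intro add_mono lux_mono lux_norm_dt_mono p q)
  fix x t
  show "ennreal (norm (conv k0 f x)) \<le> maximal0 k0 a f x"
    unfolding maximal0_def by (rule SUP_upper2[of x]) auto
  show "ennreal (t powr (- \<alpha> x) * norm (conv (dilate t k) f x)) \<le> maximal k a t \<alpha> f x"
    unfolding maximal_def by (rule SUP_upper2[of x]) auto
qed

theorem theorem4:
  fixes \<Phi> \<phi> k0 k :: "real^'n::finite \<Rightarrow> complex" and S :: int and \<epsilon> a :: real
    and \<alpha> p :: "real^'n \<Rightarrow> real" and q :: "real \<Rightarrow> real"
  assumes "resolution_of_unity \<Phi> \<phi>"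
    and "k0 \<in> schwartz" and "k \<in> schwartz" and "S \<ge> -1" and "\<epsilon> > 0"
    and "\<And>\<xi>. norm \<xi> < 2 * \<epsilon> \<Longrightarrow> norm (fourier k0 \<xi>) > 0"
    and "\<And>\<xi>. \<epsilon> / 2 < norm \<xi> \<Longrightarrow> norm \<xi> < 2 * \<epsilon> \<Longrightarrow> norm (fourier k \<xi>) > 0"
    and "\<And>\<beta> :: 'n \<Rightarrow> nat. int (\<Sum>i\<in>UNIV. \<beta> i) \<le> S \<Longrightarrow> moment \<beta> k = 0"
    and "log_holder_loc \<alpha>" and "p \<in> log_exponents"
    and "q \<in> exponents" and "log_holder_origin q"
    and "ereal a > ereal (real CARD('n)) / ess_inf p"
    and "ess_sup \<alpha> < ereal (real_of_int S + 1)"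
  shows "equivalent_on (besov \<Phi> \<phi> \<alpha> p q) (maximal_norm k0 k a \<alpha> p q) (besov_norm \<Phi> \<phi> \<alpha> p q)
       \<and> equivalent_on (besov \<Phi> \<phi> \<alpha> p q) (local_means_norm k0 k \<alpha> p q) (besov_norm \<Phi> \<phi> \<alpha> p q)"
proof -
  interpret resolution \<Phi> \<phi> by (rule resolution.intro) fact
  have p: "1 \<le> p x" "log_holder (\<lambda>x. 1 / p x)" "p \<in> borel_measurable lebesgue" for x
    using \<open>p \<in> log_exponents\<close> by (auto simp: log_exponents_def exponents_def)
  have q: "1 \<le> q t" "q \<in> borel_measurable lebesgue" for t
    using \<open>q \<in> exponents\<close> by (auto simp: exponents_def)
  have p0: "0 \<le> p x" and q0: "0 \<le> q t" for x t using p(1)[of x] q(1)[of t] by auto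
  have pc: "continuous_on UNIV p" by (rule log_holder_exponent_measurable(1)[OF p(1,2)])
  have \<alpha>c: "continuous_on UNIV \<alpha>" by (rule log_holder_loc_continuous) fact
  \<comment> \<open>The lower bound 1 and the value of \<open>p\<close> at one point show that the
    essential infimum is finite, so it can serve as the exponent of the averages.\<close>
  obtain e where e: "ess_inf p = ereal e"
    using ess_inf_le[OF pc, of 0] le_ess_inf[OF p(3,1)] by (cases "ess_inf p") auto
  have e1: "1 \<le> e" using le_ess_inf[OF p(3,1)] by (simp add: e)
  have ep: "e \<le> p x" for x using ess_inf_le[OF pc, of x] by (simp add: e)
  have "real CARD('n) / e < a"
    using \<open>ereal a > ereal (real CARD('n)) / ess_inf p\<close> e1 by (simp add: e)
  then have ae: "real CARD('n) < a * e" using e1 by (simp add: pos_divide_less_eq)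
  obtain \<alpha>1 where \<alpha>1: "ess_sup \<alpha> = ereal \<alpha>1"
    using le_ess_sup[OF \<alpha>c, of 0] \<open>ess_sup \<alpha> < ereal (real_of_int S + 1)\<close> by (cases "ess_sup \<alpha>") auto
  \<comment> \<open>Moments of order at most \<open>S\<close> are those of order below
    \<open>S + 1\<close>; for \<open>S = -1\<close> the condition is empty.\<close>
  define M0 where "M0 = nat (S + 1)"
  have M0: "real M0 = real_of_int S + 1" using \<open>S \<ge> -1\<close> by (simp add: M0_def)
  have \<alpha>M: "\<alpha> x \<le> \<alpha>1" "\<alpha>1 < real M0" for x
    using le_ess_sup[OF \<alpha>c, of x] \<open>ess_sup \<alpha> < ereal (real_of_int S + 1)\<close> by (auto simp: \<alpha>1 M0)
  have mom: "(LINT y|lborel. of_real (mon is y) * k y) = 0" if "length is < M0" for "is"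
    by (rule moment_mon[where S=S]) (use assms(8) that \<open>S \<ge> -1\<close> in \<open>auto simp: M0_def\<close>)
  obtain L0 L where "calderon \<Phi> \<phi> L0 L (1/8)" by (rule calderon_self)
  then interpret C1: calderon \<Phi> \<phi> L0 L "1/8" .
  obtain C1 where C1: "0 < C1" "\<And>f. f \<in> tempered \<Longrightarrow> maximal_norm k0 k a \<alpha> p q f \<le> ennreal C1 * local_means_norm \<Phi> \<phi> \<alpha> p q f"
    using C1.maximal_norm_le[OF \<open>k0 \<in> schwartz\<close> \<open>k \<in> schwartz\<close> mom \<open>log_holder_loc \<alpha>\<close> \<alpha>M e1 ep ae p(2) q \<open>log_holder_origin q\<close>] by blast
  obtain L0' L' where "calderon k0 k L0' L' (\<epsilon> / 2)"
  proof (rule calderon_tauberian[OF \<open>k0 \<in> schwartz\<close> \<open>k \<in> schwartz\<close> \<open>\<epsilon> > 0\<close>])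
    show "fourier k0 \<xi> \<noteq> 0" if "norm \<xi> < 2 * \<epsilon>" for \<xi> using assms(6)[OF that] by simp
    show "fourier k \<xi> \<noteq> 0" if "\<epsilon> / 2 < norm \<xi>" "norm \<xi> < 2 * \<epsilon>" for \<xi> using assms(7)[OF that] by simp
  qed
  then interpret C2: calderon k0 k L0' L' "\<epsilon> / 2" .
  obtain C2 where C2: "0 < C2" "\<And>f. f \<in> tempered \<Longrightarrow> maximal_norm \<Phi> \<phi> a \<alpha> p q f \<le> ennreal C2 * local_means_norm k0 k \<alpha> p q f"
    using C2.maximal_norm_le[OF schw moments \<open>log_holder_loc \<alpha>\<close> \<alpha>M e1 ep ae p(2) q \<open>log_holder_origin q\<close>] by blast
  \<comment> \<open>The maximal norm of the resolution lies between \<open>besov_norm\<close> and a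
    multiple of the local means norm of \<open>k0\<close> and \<open>k\<close>.\<close>
  have lower: "ennreal (1 / C2) * besov_norm \<Phi> \<phi> \<alpha> p q f \<le> local_means_norm k0 k \<alpha> p q f" if "f \<in> besov \<Phi> \<phi> \<alpha> p q" for f
  proof -
    have "besov_norm \<Phi> \<phi> \<alpha> p q f \<le> maximal_norm \<Phi> \<phi> a \<alpha> p q f"
      unfolding besov_norm_def by (intro local_means_norm_le_maximal_norm p0 q0)
    also have "\<dots> \<le> ennreal C2 * local_means_norm k0 k \<alpha> p q f" using that by (intro C2) (simp add: besov_def)
    finally have "ennreal (1 / C2) * besov_norm \<Phi> \<phi> \<alpha> p q f \<le> ennreal (1 / C2) * (ennreal C2 * local_means_norm k0 k \<alpha> p q f)"
      by (rule mult_left_mono) simp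
    also have "\<dots> = local_means_norm k0 k \<alpha> p q f"
      using C2(1) by (simp add: mult.assoc[symmetric] ennreal_mult[symmetric])
    finally show ?thesis .
  qed
  have upper: "maximal_norm k0 k a \<alpha> p q f \<le> ennreal C1 * besov_norm \<Phi> \<phi> \<alpha> p q f" if "f \<in> besov \<Phi> \<phi> \<alpha> p q" for f
    using C1(2) that by (simp add: besov_def besov_norm_def)
  have mid: "local_means_norm k0 k \<alpha> p q f \<le> maximal_norm k0 k a \<alpha> p q f" for f
    by (intro local_means_norm_le_maximal_norm p0 q0)
  \<comment> \<open>Both norms of the theorem lie between the local means norm and the maximal norm
    of \<open>k0\<close> and \<open>k\<close>, so one argument serves for both.\<close>
  have "equivalent_on (besov \<Phi> \<phi> \<alpha> p q) N (besov_norm \<Phi> \<phi> \<alpha> p q)"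
    if N: "\<And>f. local_means_norm k0 k \<alpha> p q f \<le> N f" "\<And>f. N f \<le> maximal_norm k0 k a \<alpha> p q f" for N
    unfolding equivalent_on_def
  proof (rule exI[of _ "1 / C2"], rule exI[of _ C1], intro conjI ballI)
    fix f assume f: "f \<in> besov \<Phi> \<phi> \<alpha> p q"
    show "ennreal (1 / C2) * besov_norm \<Phi> \<phi> \<alpha> p q f \<le> N f" using order_trans[OF lower[OF f] N(1)] .
    show "N f \<le> ennreal C1 * besov_norm \<Phi> \<phi> \<alpha> p q f" using order_trans[OF N(2) upper[OF f]] .
  qed (use C1(1) C2(1) in simp_all)
  then show ?thesis using mid by blast
qed

end
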